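(* Let $\Gamma$ be a finite, connected, oriented graph, let $n \geq 2$, let $m \geq 1$, and let $e_1, \dots, e_m$ be distinct edges of $\Gamma$ sharing a common vertex $v$. Write $\Gamma^\circ = \Gamma \smallsetminus (\mathring{e}_1\cup\dots\cup\mathring{e}_m)$. For each $i \in \{1,\dots,m\}$, let $\mathcal{H}_i$ be the collection of hyperplanes of $UC_n(\Gamma)$ that are dual to edges of $UC_n(\Gamma)$ labeled by $e_i$, with orientations induced by the orientation of $e_i$, and let $\mathcal{H} = \mathcal{H}_1 \cup \dots \cup \mathcal{H}_m$. Then the reduced graph braid group $RB_n(\Gamma)$ decomposes as a graph of groups $(\mathcal{G},\Lambda)$, where: (i) $V(\Lambda)$ is the collection of connected components of $UC_n(\Gamma^\circ)$; (ii) $E(\Lambda) = \mathcal{H}$, where $H \in E(\Lambda)$ has initial and terminal vertices $K \in V(\Lambda)$ and $L \in V(\Lambda)$ (not necessarily distinct) if the combinatorial hyperplanes $H^-$ and $H^+$ lie in the components $K$ and $L$ of $UC_n(\Gamma^\circ)$, respectively; (iii) for each $K \in V(\Lambda)$, the vertex group is $G_K = RB_n(\Gamma^\circ, S_K)$ for some (equivalently any) base point $S_K \in K$; (iv) for each $H_i \in \mathcal{H}_i \subseteq E(\Lambda)$, the edge group is $G_{H_i} = RB_{n-1}(\Gamma \smallsetminus e_i, S_{H_i} \cap (\Gamma \smallsetminus e_i))$, for some (equivalently any) vertex $S_{H_i}$ of one of the combinatorial hyperplanes $H^\pm_i$; (v) for each edge $H \in E(\Lambda)$ joining vertices $K,L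 \in V(\Lambda)$, the monomorphisms $\phi^\pm_{H}$ are induced by the inclusion maps of the combinatorial hyperplanes $H^\pm$ into $K$ and $L$.
   Context: Combinatorial configuration spaces. For a finite graph $\Gamma$ and $x\in\Gamma$, the carrier $c(x)$ is the lowest-dimensional closed cell (vertex or closed edge) of $\Gamma$ containing $x$. $C_n(\Gamma)$ is the cube complex of all $(x_1,\dots,x_n)\in\Gamma^n$ with $c(x_i)\cap c(x_j)=\emptyset$ for $i\ne j$; $UC_n(\Gamma)=C_n(\Gamma)/S_n$; and $RB_n(\Gamma,S)=\pi_1(UC_n(\Gamma),S)$ is the reduced graph braid group (written $RB_n(\Gamma)$ when $UC_n(\Gamma)$ is connected). Equivalently: vertices of $UC_n(\Gamma)$ are the $n$-element subsets $S\subseteq V(\Gamma)$; an edge of $UC_n(\Gamma)$ joins $S_1,S_2$ when $S_1\triangle S_2$ is the pair of endpoints of an edge $e$ of $\Gamma$, and this edge is labeled by $e$; edges with a common endpoint span a cube when their labels are pairwise disjoint closed edges. Hyperplanes. A hyperplane of a cube complex is an equivalence class of midcubes (under the transitive closure of "meeting a common edge"); equivalently, a parallelism class of edges, which are said to be dual to it. All edges dual to a given hyperplane of $UC_n(\Gamma)$ have the same label $e$. If $H$ is labeled by an oriented edge $e$, its two combinatorial hyperplanes $H^-$ and $H^+$ are the subcomplexes of $UC_n(\Gamma)$ parallel to $H$ on its two sides, with one particle fixed at the initial (for $H^-$) respectively terminal (for $H^+$) endpoint of $e$ and the other $n-1$ particles ranging over a connected component of $UC_{n-1}(\Gamma\smallsetminus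 e)$; each is a copy of $H$. Subgraphs. $\Gamma\smallsetminus\mathring e$ means remove the open edge, keeping endpoints; $\Gamma\smallsetminus e$ means the induced subgraph on the vertices that are not endpoints of $e$. For a configuration $S$, $S\cap(\Gamma\smallsetminus e)$ is the configuration of the particles of $S$ lying in $\Gamma\smallsetminus e$. Graphs of groups. A graph of groups $(\mathcal{G},\Lambda)$ is an oriented connected graph $\Lambda$, groups $G_v$ ($v\in V(\Lambda)$) and $G_e$ ($e\in E(\Lambda)$), and monomorphisms $\phi_e^-:G_e\to G_{o(e)}$, $\phi_e^+:G_e\to G_{t(e)}$ to the groups at the initial and terminal vertices. A group $G$ decomposes as $(\mathcal{G},\Lambda)$ if for some spanning tree $T$ of $\Lambda$, $G$ is isomorphic to the quotient of $(\ast_{v}G_v)\ast F(E(\Lambda))$ by the normal closure of $\{e^{-1}\phi_e^-(g)e\phi_e^+(g)^{-1}: e\in E(\Lambda), g\in G_e\}\cup E(T)$. *)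

theory Defs
  imports
    "HOL-Analysis.Analysis"
    "HOL-Algebra.Coset"
    "Graph_Theory.Digraph_Component"
begin

section \<open>Quotient topologies and the fundamental group\<close>

definition quotient_topology :: "'a topology \<Rightarrow> ('a \<Rightarrow> 'b) \<Rightarrow> 'b topology" where
  "quotient_topology X f =
     topology (\<lambda>U. U \<subseteq> f ` topspace X \<and> openin X {x \<in> topspace X. f x \<in> U})"

lemma openin_quotient_topology:
  "openin (quotient_topology X f) U \<longleftrightarrow>
     U \<subseteq> f ` topspace X \<and> openin X {x \<in> topspace X. f x \<in> U}"
proof -
  have "istopology (\<lambda>U. U \<subseteq> f ` topspace X \<and> openin X {x \<in> topspace X. f x \<in> U})"
    unfolding istopology_def
  proof (intro conjI allI impI)
    fix S T
    assume "S \<subseteq> f ` topspace X \<and> openin X {x \<in> topspace X. f x \<in> S}"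
      and "T \<subseteq> f ` topspace X \<and> openin X {x \<in> topspace X. f x \<in> T}"
    moreover have "{x \<in> topspace X. f x \<in> S \<inter> T} =
        {x \<in> topspace X. f x \<in> S} \<inter> {x \<in> topspace X. f x \<in> T}" by auto
    ultimately show "S \<inter> T \<subseteq> f ` topspace X" "openin X {x \<in> topspace X. f x \<in> S \<inter> T}"
      by auto
  next
    fix \<K> assume *: "\<forall>K\<in>\<K>. K \<subseteq> f ` topspace X \<and> openin X {x \<in> topspace X. f x \<in> K}"
    then show "\<Union>\<K> \<subseteq> f ` topspace X" by blast
    have "{x \<in> topspace X. f x \<in> \<Union>\<K>} = (\<Union>K\<in>\<K>. {x \<in> topspace X. f x \<in> K})" by auto
    then show "openin X {x \<in> topspace X. f x \<in> \<Union>\<K>}" using * by auto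
  qed
  then show ?thesis by (simp add: quotient_topology_def)
qed

lemma topspace_quotient_topology: "topspace (quotient_topology X f) = f ` topspace X"
proof
  show "topspace (quotient_topology X f) \<subseteq> f ` topspace X"
    unfolding topspace_def[of "quotient_topology X f"] by (auto simp: openin_quotient_topology)
  have "{x \<in> topspace X. f x \<in> f ` topspace X} = topspace X" by auto
  then have "openin (quotient_topology X f) (f ` topspace X)"
    by (simp add: openin_quotient_topology)
  then show "f ` topspace X \<subseteq> topspace (quotient_topology X f)" by (rule openin_subset)
qed

lemma quotient_map_quotient_topology: "quotient_map X (quotient_topology X f) f"
  by (auto simp: quotient_map_def topspace_quotient_topology openin_quotient_topology)

text \<open>
  The library's \<^const>\<open>joinpaths\<close>, \<^const>\<open>reversepath\<close> and \<^const>\<open>homotopic_paths\<close> require a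
  type of class \<^class>\<open>topological_space\<close>; the following are the same notions for an abstract
  topology.
\<close>

definition path_join :: "(real \<Rightarrow> 'a) \<Rightarrow> (real \<Rightarrow> 'a) \<Rightarrow> real \<Rightarrow> 'a" where
  "path_join p q = (\<lambda>t. if t \<le> 1/2 then p (2 * t) else q (2 * t - 1))"

definition path_rev :: "(real \<Rightarrow> 'a) \<Rightarrow> real \<Rightarrow> 'a" where
  "path_rev p = (\<lambda>t. p (1 - t))"

definition path_homotopic :: "'a topology \<Rightarrow> (real \<Rightarrow> 'a) \<Rightarrow> (real \<Rightarrow> 'a) \<Rightarrow> bool" where
  "path_homotopic X p q \<longleftrightarrow>
     homotopic_with (\<lambda>r. r 0 = p 0 \<and> r 1 = p 1) (top_of_set {0..1}) X p q"

definition path_class :: "'a topology \<Rightarrow> (real \<Rightarrow> 'a) \<Rightarrow> (real \<Rightarrow> 'a) set" where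
  "path_class X p = {q. path_homotopic X p q}"

definition loops :: "'a topology \<Rightarrow> 'a \<Rightarrow> (real \<Rightarrow> 'a) set" where
  "loops X x = {p. pathin X p \<and> p 0 = x \<and> p 1 = x}"

definition fundamental_group :: "'a topology \<Rightarrow> 'a \<Rightarrow> (real \<Rightarrow> 'a) set monoid" where
  "fundamental_group X x =
     \<lparr>carrier = path_class X ` loops X x,
      mult = (\<lambda>A B. \<Union>p\<in>A. \<Union>q\<in>B. path_class X (path_join p q)),
      one = path_class X (\<lambda>_. x)\<rparr>"

text \<open>
  \<open>\<phi>\<close> is the homomorphism from the fundamental group of \<open>X\<close> at \<open>x\<close> to that of \<open>Y\<close> at \<open>y\<close> induced
  by the map \<open>f\<close>. As \<open>f x\<close> and \<open>y\<close> may differ, \<open>\<phi>\<close> involves the change of base point along some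
  path \<open>\<delta>\<close> from \<open>y\<close> to \<open>f x\<close>.
\<close>

definition induced_by_map ::
    "'a topology \<Rightarrow> 'a \<Rightarrow> 'b topology \<Rightarrow> 'b \<Rightarrow> ('a \<Rightarrow> 'b) \<Rightarrow>
     ((real \<Rightarrow> 'a) set \<Rightarrow> (real \<Rightarrow> 'b) set) \<Rightarrow> bool" where
  "induced_by_map X x Y y f \<phi> \<longleftrightarrow>
     (\<exists>\<delta>. pathin Y \<delta> \<and> \<delta> 0 = y \<and> \<delta> 1 = f x \<and>
       (\<forall>p \<in> loops X x.
          \<phi> (path_class X p) = path_class Y (path_join \<delta> (path_join (f \<circ> p) (path_rev \<delta>)))))"


section \<open>Graphs as topological spaces and their configuration spaces\<close>

text \<open>
  An oriented graph is a \<^typ>\<open>('v, 'e) pre_digraph\<close>; loops and multiple edges are allowed, and the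
  orientation of an edge is from its tail to its head. \<open>Interior e t\<close> is the point with parameter
  \<open>t\<close>, where \<open>0 < t < 1\<close>, of the open edge \<open>e\<close>.
\<close>

datatype ('v, 'e) gpoint = Vertex 'v | Interior 'e real

definition graph_points :: "('v, 'e) pre_digraph \<Rightarrow> ('v, 'e) gpoint set" where
  "graph_points G = Vertex ` verts G \<union> {Interior e t | e t. e \<in> arcs G \<and> 0 < t \<and> t < 1}"

definition edge_point :: "('v, 'e) pre_digraph \<Rightarrow> 'e \<Rightarrow> real \<Rightarrow> ('v, 'e) gpoint" where
  "edge_point G e t =
     (if t = 0 then Vertex (tail G e) else if t = 1 then Vertex (head G e) else Interior e t)"

text \<open>
  The topology of the 1-dimensional CW complex, i.e. the quotient topology of the disjoint union
  of the discrete vertex set and one copy of the unit interval for each edge.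
\<close>

definition graph_space :: "('v, 'e) pre_digraph \<Rightarrow> ('v, 'e) gpoint topology" where
  "graph_space G =
     topology (\<lambda>U. U \<subseteq> graph_points G \<and>
       (\<forall>e \<in> arcs G. openin (top_of_set {0..1}) {t \<in> {0..1}. edge_point G e t \<in> U}))"

lemma openin_graph_space:
  "openin (graph_space G) U \<longleftrightarrow> U \<subseteq> graph_points G \<and>
     (\<forall>e \<in> arcs G. openin (top_of_set {0..1}) {t \<in> {0..1}. edge_point G e t \<in> U})"
proof -
  let ?P = "\<lambda>U. U \<subseteq> graph_points G \<and>
     (\<forall>e \<in> arcs G. openin (top_of_set {0..1}) {t \<in> {0..1}. edge_point G e t \<in> U})"
  have "?P (S \<inter> T)" if S: "?P S" and T: "?P T" for S T
  proof (intro conjI ballI)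
    show "S \<inter> T \<subseteq> graph_points G" using S by (simp add: le_infI1)
    fix e assume e: "e \<in> arcs G"
    have "{t \<in> {0..1}. edge_point G e t \<in> S \<inter> T} =
        {t \<in> {0..1}. edge_point G e t \<in> S} \<inter> {t \<in> {0..1}. edge_point G e t \<in> T}" by auto
    moreover have "openin (top_of_set {0..1})
        ({t \<in> {0..1}. edge_point G e t \<in> S} \<inter> {t \<in> {0..1}. edge_point G e t \<in> T})"
      using S T e by (intro openin_Int) simp_all
    ultimately show "openin (top_of_set {0..1}) {t \<in> {0..1}. edge_point G e t \<in> S \<inter> T}" by simp
  qed
  moreover have "?P (\<Union>\<K>)" if K: "\<forall>K\<in>\<K>. ?P K" for \<K>
  proof (intro conjI ballI)
    show "\<Union>\<K> \<subseteq> graph_points G" using K by (simp add: Sup_le_iff)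
    fix e assume e: "e \<in> arcs G"
    have "{t \<in> {0..1}. edge_point G e t \<in> \<Union>\<K>} =
        (\<Union>K\<in>\<K>. {t \<in> {0..1}. edge_point G e t \<in> K})" by auto
    moreover have "openin (top_of_set {0..1}) {t \<in> {0..1}. edge_point G e t \<in> K}" if "K \<in> \<K>" for K
      using bspec[OF K that] e by simp
    then have "openin (top_of_set {0..1}) (\<Union>K\<in>\<K>. {t \<in> {0..1}. edge_point G e t \<in> K})"
      by (intro openin_Union, elim imageE) simp
    ultimately show "openin (top_of_set {0..1}) {t \<in> {0..1}. edge_point G e t \<in> \<Union>\<K>}" by simp
  qed
  ultimately have "istopology ?P" unfolding istopology_def by blast
  then show ?thesis by (simp add: graph_space_def)
qed

lemma topspace_graph_space:
  assumes "wf_digraph G"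
  shows "topspace (graph_space G) = graph_points G"
proof
  show "topspace (graph_space G) \<subseteq> graph_points G"
    unfolding topspace_def by (auto simp: openin_graph_space)
  have "{t \<in> {0..1}. edge_point G e t \<in> graph_points G} = {0..1}" if "e \<in> arcs G" for e
    using that assms by (auto simp: edge_point_def graph_points_def wf_digraph_def)
  then have "openin (graph_space G) (graph_points G)"
    by (simp add: openin_graph_space)
  then show "graph_points G \<subseteq> topspace (graph_space G)" by (rule openin_subset)
qed

fun cell_carrier :: "('v, 'e) pre_digraph \<Rightarrow> ('v, 'e) gpoint \<Rightarrow> ('v, 'e) gpoint set" where
  "cell_carrier G (Vertex v) = {Vertex v}"
| "cell_carrier G (Interior e t) = edge_point G e ` {0..1}"

definition conf_space :: "nat \<Rightarrow> ('v, 'e) pre_digraph \<Rightarrow> (nat \<Rightarrow> ('v, 'e) gpoint) topology" where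
  "conf_space n G =
     subtopology (product_topology (\<lambda>_. graph_space G) {..<n})
       {x. \<forall>i<n. \<forall>j<n. i \<noteq> j \<longrightarrow> cell_carrier G (x i) \<inter> cell_carrier G (x j) = {}}"

text \<open>
  The coordinates of a point of \<^term>\<open>conf_space n G\<close> are distinct, so its orbit under the
  symmetric group is determined by the \<open>n\<close>-element set of its coordinates.
\<close>

definition uconf_space :: "nat \<Rightarrow> ('v, 'e) pre_digraph \<Rightarrow> ('v, 'e) gpoint set topology" where
  "uconf_space n G = quotient_topology (conf_space n G) (\<lambda>x. x ` {..<n})"

definition RB ::
    "nat \<Rightarrow> ('v, 'e) pre_digraph \<Rightarrow> ('v, 'e) gpoint set \<Rightarrow> (real \<Rightarrow> ('v, 'e) gpoint set) set monoid"
  where "RB n G S = fundamental_group (uconf_space n G) S"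

definition remove_open_edges :: "('v, 'e) pre_digraph \<Rightarrow> 'e set \<Rightarrow> ('v, 'e) pre_digraph" where
  "remove_open_edges G A = G\<lparr>arcs := arcs G - A\<rparr>"

definition remove_closed_edge :: "('v, 'e) pre_digraph \<Rightarrow> 'e \<Rightarrow> ('v, 'e) pre_digraph" where
  "remove_closed_edge G e = G \<restriction> (verts G - {tail G e, head G e})"


section \<open>Hyperplanes\<close>

text \<open>
  The pair \<open>(e, T)\<close> is the edge of the cube complex \<^term>\<open>uconf_space n G\<close> along which one particle
  traverses \<open>e\<close> while the others rest at the vertices in \<open>T\<close>. It is labelled by \<open>e\<close>, and joins
  \<open>insert (tail G e) T\<close> to \<open>insert (head G e) T\<close>.
\<close>

definition uconf_edges :: "nat \<Rightarrow> ('v, 'e) pre_digraph \<Rightarrow> ('e \<times> 'v set) set" where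
  "uconf_edges n G =
     {(e, T). e \<in> arcs G \<and> T \<subseteq> verts G - {tail G e, head G e} \<and> finite T \<and> card T + 1 = n}"

text \<open>
  A square is given by disjoint closed edges \<open>e\<close>, \<open>f\<close> and the positions \<open>T\<close> of the \<open>n - 2\<close> resting
  particles; its two sides labelled by \<open>e\<close> are opposite.
\<close>

definition opposite_edges :: "nat \<Rightarrow> ('v, 'e) pre_digraph \<Rightarrow> ('e \<times> 'v set) rel" where
  "opposite_edges n G =
     {((e, insert (tail G f) T), (e, insert (head G f) T)) | e f T.
        e \<in> arcs G \<and> f \<in> arcs G \<and> {tail G e, head G e} \<inter> {tail G f, head G f} = {} \<and>
        T \<subseteq> verts G - {tail G e, head G e, tail G f, head G f} \<and> finite T \<and> card T + 2 = n}"

definition parallelism :: "nat \<Rightarrow> ('v, 'e) pre_digraph \<Rightarrow> ('e \<times> 'v set) rel" where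
  "parallelism n G =
     {(a, b). a \<in> uconf_edges n G \<and> (a, b) \<in> (opposite_edges n G \<union> (opposite_edges n G)\<inverse>)\<^sup>*}"

definition hyperplanes :: "nat \<Rightarrow> ('v, 'e) pre_digraph \<Rightarrow> ('e \<times> 'v set) set set" where
  "hyperplanes n G = uconf_edges n G // parallelism n G"

definition hyperplanes_labelled ::
    "nat \<Rightarrow> ('v, 'e) pre_digraph \<Rightarrow> 'e \<Rightarrow> ('e \<times> 'v set) set set" where
  "hyperplanes_labelled n G e = {H \<in> hyperplanes n G. \<exists>T. (e, T) \<in> H}"

text \<open>
  For a hyperplane \<open>H\<close> labelled by \<open>e\<close>: the component of the configuration space of \<open>n - 1\<close> particles
  over which the particles not on \<open>e\<close> range.
\<close>

definition hyperplane_component ::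
    "nat \<Rightarrow> ('v, 'e) pre_digraph \<Rightarrow> 'e \<Rightarrow> ('e \<times> 'v set) set \<Rightarrow> ('v, 'e) gpoint set set" where
  "hyperplane_component n G e H =
     (THE C. C \<in> connected_components_of (uconf_space (n - 1) (remove_closed_edge G e)) \<and>
             (\<forall>T. (e, T) \<in> H \<longrightarrow> Vertex ` T \<in> C))"

definition comb_hyperplane_minus ::
    "nat \<Rightarrow> ('v, 'e) pre_digraph \<Rightarrow> 'e \<Rightarrow> ('e \<times> 'v set) set \<Rightarrow> ('v, 'e) gpoint set set" where
  "comb_hyperplane_minus n G e H = insert (Vertex (tail G e)) ` hyperplane_component n G e H"

definition comb_hyperplane_plus ::
    "nat \<Rightarrow> ('v, 'e) pre_digraph \<Rightarrow> 'e \<Rightarrow> ('e \<times> 'v set) set \<Rightarrow> ('v, 'e) gpoint set set" where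
  "comb_hyperplane_plus n G e H = insert (Vertex (head G e)) ` hyperplane_component n G e H"


section \<open>Graphs of groups\<close>

text \<open>
  \<open>Digraph_Component.forest\<close> only excludes directed cycles, so spanning trees of an oriented graph
  are defined here through cycles of the underlying undirected multigraph. A pair \<open>(a, s)\<close> is the
  arc \<open>a\<close> traversed forwards if \<open>s\<close> holds, and backwards otherwise.
\<close>

definition arc_start :: "('k, 'h) pre_digraph \<Rightarrow> 'h \<times> bool \<Rightarrow> 'k" where
  "arc_start G = (\<lambda>(a, s). if s then tail G a else head G a)"

definition arc_end :: "('k, 'h) pre_digraph \<Rightarrow> 'h \<times> bool \<Rightarrow> 'k" where
  "arc_end G = (\<lambda>(a, s). if s then head G a else tail G a)"

definition undirected_cycle :: "('k, 'h) pre_digraph \<Rightarrow> ('h \<times> bool) list \<Rightarrow> bool" where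
  "undirected_cycle G p \<longleftrightarrow>
     p \<noteq> [] \<and> fst ` set p \<subseteq> arcs G \<and>
     (\<forall>i. Suc i < length p \<longrightarrow> arc_end G (p ! i) = arc_start G (p ! Suc i)) \<and>
     arc_end G (last p) = arc_start G (hd p) \<and>
     distinct (map fst p) \<and> distinct (map (arc_start G) p)"

definition is_spanning_tree :: "('k, 'h) pre_digraph \<Rightarrow> ('k, 'h) pre_digraph \<Rightarrow> bool" where
  "is_spanning_tree T G \<longleftrightarrow>
     spanning T G \<and> Digraph_Component.connected T \<and> \<not> (\<exists>p. undirected_cycle T p)"

record ('k, 'h, 'a, 'b) graph_of_groups =
  base_graph :: "('k, 'h) pre_digraph"
  vertex_group :: "'k \<Rightarrow> 'a monoid"
  edge_group :: "'h \<Rightarrow> 'b monoid"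
  mono_minus :: "'h \<Rightarrow> 'b \<Rightarrow> 'a"
  mono_plus :: "'h \<Rightarrow> 'b \<Rightarrow> 'a"

definition is_graph_of_groups :: "('k, 'h, 'a, 'b) graph_of_groups \<Rightarrow> bool" where
  "is_graph_of_groups \<G> \<longleftrightarrow>
     wf_digraph (base_graph \<G>) \<and> Digraph_Component.connected (base_graph \<G>) \<and>
     (\<forall>k \<in> verts (base_graph \<G>). group (vertex_group \<G> k)) \<and>
     (\<forall>h \<in> arcs (base_graph \<G>). group (edge_group \<G> h) \<and>
        mono_minus \<G> h \<in> mon (edge_group \<G> h) (vertex_group \<G> (tail (base_graph \<G>) h)) \<and>
        mono_plus \<G> h \<in> mon (edge_group \<G> h) (vertex_group \<G> (head (base_graph \<G>) h)))"

text \<open>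
  The free product of the groups \<open>G k\<close>, \<open>k \<in> V\<close>, and the free group on \<open>E\<close>: words in the elements of
  the \<open>G k\<close> and the letters \<open>h\<close> (\<open>ELetter h True\<close>) and their inverses (\<open>ELetter h False\<close>), modulo the
  congruence generated by multiplication in each \<open>G k\<close> and free cancellation.
\<close>

datatype ('k, 'a, 'h) letter = VLetter 'k 'a | ELetter 'h bool

definition fp_words ::
    "'k set \<Rightarrow> ('k \<Rightarrow> 'a monoid) \<Rightarrow> 'h set \<Rightarrow> ('k, 'a, 'h) letter list set" where
  "fp_words V G E =
     lists ({VLetter k g | k g. k \<in> V \<and> g \<in> carrier (G k)} \<union> {ELetter h s | h s. h \<in> E})"

inductive fp_step ::
    "'k set \<Rightarrow> ('k \<Rightarrow> 'a monoid) \<Rightarrow> 'h set \<Rightarrow>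
     ('k, 'a, 'h) letter list \<Rightarrow> ('k, 'a, 'h) letter list \<Rightarrow> bool"
  for V G E where
  fp_mult: "\<lbrakk>k \<in> V; g \<in> carrier (G k); g' \<in> carrier (G k)\<rbrakk> \<Longrightarrow>
     fp_step V G E (xs @ [VLetter k g, VLetter k g'] @ ys) (xs @ [VLetter k (g \<otimes>\<^bsub>G k\<^esub> g')] @ ys)"
| fp_one: "k \<in> V \<Longrightarrow> fp_step V G E (xs @ [VLetter k \<one>\<^bsub>G k\<^esub>] @ ys) (xs @ ys)"
| fp_cancel: "h \<in> E \<Longrightarrow> fp_step V G E (xs @ [ELetter h s, ELetter h (\<not> s)] @ ys) (xs @ ys)"

definition fp_class ::
    "'k set \<Rightarrow> ('k \<Rightarrow> 'a monoid) \<Rightarrow> 'h set \<Rightarrow>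
     ('k, 'a, 'h) letter list \<Rightarrow> ('k, 'a, 'h) letter list set" where
  "fp_class V G E w = {w' \<in> fp_words V G E. equivclp (fp_step V G E) w w'}"

definition free_product_free ::
    "'k set \<Rightarrow> ('k \<Rightarrow> 'a monoid) \<Rightarrow> 'h set \<Rightarrow> ('k, 'a, 'h) letter list set monoid" where
  "free_product_free V G E =
     \<lparr>carrier = fp_class V G E ` fp_words V G E,
      mult = (\<lambda>A B. \<Union>u\<in>A. \<Union>w\<in>B. fp_class V G E (u @ w)),
      one = fp_class V G E []\<rparr>"

definition normal_closure :: "('a, 'c) monoid_scheme \<Rightarrow> 'a set \<Rightarrow> 'a set" where
  "normal_closure F R = \<Inter>{N. N \<lhd> F \<and> R \<subseteq> N}"

definition gog_free_product ::
    "('k, 'h, 'a, 'b) graph_of_groups \<Rightarrow> ('k, 'a, 'h) letter list set monoid" where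
  "gog_free_product \<G> =
     free_product_free (verts (base_graph \<G>)) (vertex_group \<G>) (arcs (base_graph \<G>))"

definition gog_vertex_elem ::
    "('k, 'h, 'a, 'b) graph_of_groups \<Rightarrow> 'k \<Rightarrow> 'a \<Rightarrow> ('k, 'a, 'h) letter list set" where
  "gog_vertex_elem \<G> k g =
     fp_class (verts (base_graph \<G>)) (vertex_group \<G>) (arcs (base_graph \<G>)) [VLetter k g]"

definition gog_edge_elem ::
    "('k, 'h, 'a, 'b) graph_of_groups \<Rightarrow> 'h \<Rightarrow> ('k, 'a, 'h) letter list set" where
  "gog_edge_elem \<G> h =
     fp_class (verts (base_graph \<G>)) (vertex_group \<G>) (arcs (base_graph \<G>)) [ELetter h True]"

definition gog_relators ::
    "('k, 'h, 'a, 'b) graph_of_groups \<Rightarrow> ('k, 'h) pre_digraph \<Rightarrow> ('k, 'a, 'h) letter list set set"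
  where
  "gog_relators \<G> T =
     (let F = gog_free_product \<G>; \<Lambda> = base_graph \<G> in
       {inv\<^bsub>F\<^esub> (gog_edge_elem \<G> h)
          \<otimes>\<^bsub>F\<^esub> gog_vertex_elem \<G> (tail \<Lambda> h) (mono_minus \<G> h g)
          \<otimes>\<^bsub>F\<^esub> gog_edge_elem \<G> h
          \<otimes>\<^bsub>F\<^esub> inv\<^bsub>F\<^esub> (gog_vertex_elem \<G> (head \<Lambda> h) (mono_plus \<G> h g))
        | h g. h \<in> arcs \<Lambda> \<and> g \<in> carrier (edge_group \<G> h)}
       \<union> gog_edge_elem \<G> ` arcs T)"

definition gog_fundamental_group ::
    "('k, 'h, 'a, 'b) graph_of_groups \<Rightarrow> ('k, 'h) pre_digraph \<Rightarrow>
     ('k, 'a, 'h) letter list set set monoid" where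
  "gog_fundamental_group \<G> T =
     gog_free_product \<G> Mod normal_closure (gog_free_product \<G>) (gog_relators \<G> T)"

definition decomposes_as ::
    "('g, 'c) monoid_scheme \<Rightarrow> ('k, 'h, 'a, 'b) graph_of_groups \<Rightarrow> bool" where
  "decomposes_as A \<G> \<longleftrightarrow>
     is_graph_of_groups \<G> \<and>
     (\<exists>T. is_spanning_tree T (base_graph \<G>) \<and> A \<cong> gog_fundamental_group \<G> T)"


section \<open>The graph of groups obtained by cutting along hyperplanes\<close>

text \<open>
  \<open>\<G>\<close> is a graph of groups obtained from the hyperplanes labelled by \<open>e 1, \<dots>, e m\<close>, for the base
  points \<open>sK K\<close> of the vertex groups and the vertices \<open>sH H\<close> of the combinatorial hyperplanes. It is
  not unique, since the maps induced by the inclusions depend on paths between base points.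
\<close>

definition hyperplane_splitting ::
    "('v, 'e) pre_digraph \<Rightarrow> nat \<Rightarrow> nat \<Rightarrow> (nat \<Rightarrow> 'e) \<Rightarrow>
     (('v, 'e) gpoint set set \<Rightarrow> ('v, 'e) gpoint set) \<Rightarrow>
     (('e \<times> 'v set) set \<Rightarrow> ('v, 'e) gpoint set) \<Rightarrow>
     (('v, 'e) gpoint set set, ('e \<times> 'v set) set,
      (real \<Rightarrow> ('v, 'e) gpoint set) set, (real \<Rightarrow> ('v, 'e) gpoint set) set) graph_of_groups \<Rightarrow> bool"
  where
  "hyperplane_splitting \<Gamma> n m e sK sH \<G> \<longleftrightarrow>
    (let \<Lambda> = base_graph \<G>; \<Gamma>' = remove_open_edges \<Gamma> (e ` {1..m}) in
      verts \<Lambda> = connected_components_of (uconf_space n \<Gamma>') \<and>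
      arcs \<Lambda> = (\<Union>i\<in>{1..m}. hyperplanes_labelled n \<Gamma> (e i)) \<and>
      (\<forall>i\<in>{1..m}. \<forall>H \<in> hyperplanes_labelled n \<Gamma> (e i).
         tail \<Lambda> H \<in> verts \<Lambda> \<and> comb_hyperplane_minus n \<Gamma> (e i) H \<subseteq> tail \<Lambda> H \<and>
         head \<Lambda> H \<in> verts \<Lambda> \<and> comb_hyperplane_plus n \<Gamma> (e i) H \<subseteq> head \<Lambda> H) \<and>
      (\<forall>K \<in> verts \<Lambda>. vertex_group \<G> K = RB n \<Gamma>' (sK K)) \<and>
      (\<forall>i\<in>{1..m}. \<forall>H \<in> hyperplanes_labelled n \<Gamma> (e i).
         let \<Delta> = remove_closed_edge \<Gamma> (e i); S = sH H \<inter> graph_points \<Delta> in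
           edge_group \<G> H = RB (n - 1) \<Delta> S \<and>
           induced_by_map (uconf_space (n - 1) \<Delta>) S (uconf_space n \<Gamma>') (sK (tail \<Lambda> H))
             (insert (Vertex (tail \<Gamma> (e i)))) (mono_minus \<G> H) \<and>
           induced_by_map (uconf_space (n - 1) \<Delta>) S (uconf_space n \<Gamma>') (sK (head \<Lambda> H))
             (insert (Vertex (head \<Gamma> (e i)))) (mono_plus \<G> H)))"

end

theory Submission
  imports Defs
begin

text \<open>
  Record the edges of \<open>\<Gamma>\<close> that the particles cross along a path of configurations, as an element of
  the right-angled Artin group on the edges of \<open>\<Gamma>\<close> in which disjoint edges commute. This holonomy is
  a parallel transport, hence invariant under homotopy. It is faithful on the fundamental groupoid:
  every path is homotopic to an edge path, and an edge path whose word is trivial in the Artin group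
  can be contracted by swaps and cancellations of letters, which are realised by squares and
  backtracks of the cube complex. So all groups in sight become subgroups of one Artin group, and
  the maps induced by inclusions become conjugations; in particular they are injective.

  A word in the vertex groups and stable letters has a value in the Artin group, once paths from \<open>S\<close>
  to the components are chosen that agree along a spanning tree. This gives a homomorphism onto the
  group at \<open>S\<close> that kills the relators. Conversely an edge path traces out a word, with a stable
  letter for each cut edge it crosses, and every word arises in this way modulo the relators.
  Homotopic edge paths give the same word modulo the relators: as the cut edges share a vertex, a
  swap involves at most one of them, and is then an instance of the edge relation. Hence the
  kernel is the normal closure of the relators.
\<close>

section \<open>Right-angled Artin groups\<close>

text \<open>Cutting a complex along hyperplanes classically needs them two-sided and injective on
  fundamental groups. Here injectivity is read off from a faithful invariant, which calls for a
  target group in which equalities can be turned back into moves of words, and for a notion of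
  crossing an edge that makes sense for continuous paths. For the first, letters act as permutations
  on reduced words up to commutation; the image of the empty word is then a normal form. For the
  second, passages through midpoints of edges are counted locally, in charts indexed by sets of
  edges. The potentials of two charts differ by a locally constant left summand, which cancels in
  transports even though the group is not abelian. The delicate topological point is that the
  retractions inside a chart be continuous jointly in configuration and time, although the graph and
  the unordered configuration space are quotients; the product of a quotient map with the compact
  interval is again one. A given splitting only says that its maps are induced along some paths, so
  holonomies of such paths are chosen once and occur in all later formulas.\<close>

typedef 'a bijection = "{f :: 'a \<Rightarrow> 'a. bij f}"
  morphisms apply_bijection Bijection
  by (rule exI[of _ id]) simp

setup_lifting type_definition_bijection

text \<open>Composition is written additively because \<open>group_add\<close> does not assume
  commutativity, yet supplies differences, cancellation and sums over lists.\<close>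

instantiation bijection :: (type) group_add
begin

lift_definition zero_bijection :: "'a bijection" is "\<lambda>x. x" by (simp add: bij_def)
lift_definition plus_bijection :: "'a bijection \<Rightarrow> 'a bijection \<Rightarrow> 'a bijection" is "\<lambda>f g. f \<circ> g"
  by (rule bij_comp)
lift_definition uminus_bijection :: "'a bijection \<Rightarrow> 'a bijection" is "\<lambda>f. inv_into UNIV f"
  by (rule bij_imp_bij_inv)
definition minus_bijection :: "'a bijection \<Rightarrow> 'a bijection \<Rightarrow> 'a bijection" where
  "minus_bijection f g = f + - g"

instance
proof
  fix a b c :: "'a bijection"
  show "a + b + c = a + (b + c)" by transfer (simp add: comp_assoc)
  show "0 + a = a" by transfer (simp add: fun_eq_iff)
  show "a + 0 = a" by transfer (simp add: fun_eq_iff)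
  show "- a + a = 0" by transfer (simp add: fun_eq_iff bij_is_inj)
  show "a + - b = a - b" by (simp add: minus_bijection_def)
qed

end

text \<open>The formal inverse of a letter: the same edge traversed in the opposite
  direction.\<close>

definition flip :: "'e \<times> bool \<Rightarrow> 'e \<times> bool" where
  "flip a = (fst a, \<not> snd a)"

lemma flip_simps [simp]: "fst (flip a) = fst a" "snd (flip a) = (\<not> snd a)" "flip (flip a) = a"
  by (auto simp: flip_def)

section \<open>Words up to commutation, and reduced words\<close>

locale raag =
  fixes c :: "'e \<Rightarrow> 'e \<Rightarrow> bool"
  assumes c_sym: "c x y \<Longrightarrow> c y x" and c_irrefl: "\<not> c x x"
begin

text \<open>Equality in the trace monoid: commuting letters may be swapped, but nothing cancels.
  Cancellation is left to \<open>rem\<close>, so that shuffling preserves length.\<close>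

inductive shuffle :: "('e \<times> bool) list \<Rightarrow> ('e \<times> bool) list \<Rightarrow> bool" where
  shuffle_refl: "shuffle w w"
| shuffle_Cons: "shuffle w w' \<Longrightarrow> shuffle (a # w) (a # w')"
| shuffle_swap: "c (fst a) (fst b) \<Longrightarrow> shuffle (a # b # w) (b # a # w)"
| shuffle_trans: "shuffle u w \<Longrightarrow> shuffle w v \<Longrightarrow> shuffle u v"

lemma shuffle_sym: "shuffle u w \<Longrightarrow> shuffle w u"
  by (induction rule: shuffle.induct) (blast intro: shuffle.intros c_sym)+

lemma shuffle_length: "shuffle u w \<Longrightarrow> length u = length w"
  by (induction rule: shuffle.induct) auto

lemma shuffle_Nil [simp]: "shuffle w [] \<longleftrightarrow> w = []"
  using shuffle_length[of w "[]"] by (auto intro: shuffle_refl)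

text \<open>Deletes the first \<open>flip a\<close> that can be carried to the front past letters
  commuting with \<open>a\<close>; \<open>None\<close> says that prefixing \<open>a\<close> causes
  no cancellation.\<close>

fun rem :: "'e \<times> bool \<Rightarrow> ('e \<times> bool) list \<Rightarrow> ('e \<times> bool) list option" where
  "rem a [] = None"
| "rem a (b # w) = (if b = flip a then Some w
     else if c (fst a) (fst b) then map_option ((#) b) (rem a w) else None)"

lemma rel_shuffle_trans:
  "rel_option shuffle x y \<Longrightarrow> rel_option shuffle y z \<Longrightarrow> rel_option shuffle x z"
  by (cases x; cases y; cases z) (auto intro: shuffle_trans)

lemma rel_shuffle_refl: "rel_option shuffle x x"
  by (cases x) (auto intro: shuffle_refl)

lemma rem_shuffle: "shuffle w w' \<Longrightarrow> rel_option shuffle (rem a w) (rem a w')"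
proof (induction rule: shuffle.induct)
  case (shuffle_Cons w w' b)
  then show ?case by (cases "rem a w"; cases "rem a w'") (auto intro: shuffle_refl shuffle.shuffle_Cons)
next
  case (shuffle_swap x y w)
  \<comment> \<open>Since \<open>c\<close> is irreflexive, two commuting letters cannot both be the
    inverse of \<open>a\<close>, so the swapped pair never offers two candidates for
    deletion.\<close>
  have "x \<noteq> flip a \<or> y \<noteq> flip a" using shuffle_swap c_irrefl by auto
  then show ?case using shuffle_swap c_sym
    by (cases "rem a w") (auto intro: shuffle_refl shuffle.shuffle_swap)
next
  case (shuffle_trans u w v)
  then show ?case using rel_shuffle_trans by blast
qed (rule rel_shuffle_refl)

lemma rem_Some_shuffle: "rem a w = Some w' \<Longrightarrow> shuffle w (flip a # w')"
proof (induction w arbitrary: w')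
  case (Cons b w)
  show ?case
  proof (cases "b = flip a")
    case True then show ?thesis using Cons.prems by (auto intro: shuffle_refl)
  next
    case False
    then obtain u where u: "c (fst a) (fst b)" "rem a w = Some u" "w' = b # u"
      using Cons.prems by (auto split: if_splits)
    have "shuffle (b # w) (b # flip a # u)" by (rule shuffle_Cons) (rule Cons.IH[OF u(2)])
    moreover have "shuffle (b # flip a # u) (flip a # b # u)"
      by (rule shuffle_swap) (simp add: u(1) c_sym)
    ultimately show ?thesis using u(3) by (blast intro: shuffle_trans)
  qed
qed simp

text \<open>No letter can meet its inverse by passing over commuting letters; by
  \<open>reduced_shuffle\<close> this depends only on the class up to shuffling.\<close>

fun reduced :: "('e \<times> bool) list \<Rightarrow> bool" where
  "reduced [] \<longleftrightarrow> True"
| "reduced (a # w) \<longleftrightarrow> rem a w = None \<and> reduced w"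

lemma rem_Cons_comm: "c (fst a) (fst b) \<Longrightarrow> rem a (b # w) = map_option ((#) b) (rem a w)"
  using c_irrefl by auto

lemma reduced_shuffle: "shuffle w w' \<Longrightarrow> reduced w \<longleftrightarrow> reduced w'"
proof (induction rule: shuffle.induct)
  case (shuffle_Cons w w' a)
  then show ?case using rem_shuffle[of w w' a] by (cases "rem a w"; cases "rem a w'") auto
next
  case (shuffle_swap a b w)
  then show ?case using rem_Cons_comm[of a b w] rem_Cons_comm[of b a w] c_sym by auto
qed auto

text \<open>Left multiplication by a letter on reduced words, up to shuffling.\<close>

definition act :: "'e \<times> bool \<Rightarrow> ('e \<times> bool) list \<Rightarrow> ('e \<times> bool) list" where
  "act a w = (case rem a w of None \<Rightarrow> a # w | Some w' \<Rightarrow> w')"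

lemma act_shuffle: "shuffle w w' \<Longrightarrow> shuffle (act a w) (act a w')"
  using rem_shuffle[of w w' a]
  by (cases "rem a w"; cases "rem a w'") (auto simp: act_def intro: shuffle_Cons)

lemma reduced_act: "reduced w \<Longrightarrow> reduced (act a w)"
  using rem_Some_shuffle[of a w] reduced_shuffle
  by (cases "rem a w") (auto simp: act_def)

text \<open>A prefixed \<open>a\<close> is deleted again at once. If \<open>a\<close> was absorbed
  instead, \<open>w\<close> shuffles to \<open>flip a # w'\<close>, and reducedness of this word
  forbids \<open>flip a\<close> to be absorbed in its turn, so it is put back.\<close>

lemma act_flip_act:
  assumes "reduced w" shows "shuffle (act (flip a) (act a w)) w"
proof (cases "rem a w")
  case None then show ?thesis by (simp add: act_def shuffle_refl)
next
  case (Some w')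
  have "shuffle w (flip a # w')" using rem_Some_shuffle[OF Some] .
  moreover from this have "reduced (flip a # w')" using assms reduced_shuffle by blast
  ultimately show ?thesis using Some by (simp add: act_def shuffle_sym)
qed

lemma act_act_commute:
  assumes "c (fst a) (fst b)"
  shows "shuffle (act a (act b w)) (act b (act a w))"
proof -
  note ba = c_sym[OF assms]
  \<comment> \<open>Deletion for \<open>x\<close> can be compared with deletion after
    \<open>flip y\<close> has been brought to the front; as \<open>x\<close> commutes with
    \<open>y\<close>, the front letter does not interfere.\<close>
  have inner: "shuffle w (flip y # u) \<and> rel_option shuffle (rem x w) (map_option ((#) (flip y)) (rem x u))"
    if "rem y w = Some u" "c (fst x) (fst y)" for x y u
    using rem_Some_shuffle[OF that(1)] rem_shuffle[OF rem_Some_shuffle[OF that(1)], of x]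
      rem_Cons_comm[of x "flip y" u] that(2) by simp
  show ?thesis
  proof (cases "rem a w"; cases "rem b w")
    assume 1: "rem a w = None" "rem b w = None"
    then show ?thesis using assms ba
      by (auto simp: act_def rem_Cons_comm simp del: rem.simps intro: shuffle_swap)
  next
    fix u assume 1: "rem a w = None" "rem b w = Some u"
    then have "rem a u = None" using inner[OF 1(2) assms] by (cases "rem a u") auto
    then show ?thesis using 1 assms ba
      by (auto simp: act_def rem_Cons_comm shuffle_refl simp del: rem.simps)
  next
    fix u assume 1: "rem a w = Some u" "rem b w = None"
    then have "rem b u = None" using inner[OF 1(1) ba] by (cases "rem b u") auto
    then show ?thesis using 1 assms ba
      by (auto simp: act_def rem_Cons_comm shuffle_refl simp del: rem.simps)
  next
    fix u u' assume 1: "rem a w = Some u" "rem b w = Some u'"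
    obtain x where x: "rem a u' = Some x" "shuffle u (flip b # x)"
      using inner[OF 1(2) assms] 1 by (cases "rem a u'") auto
    have "rel_option shuffle (rem b u) (rem b (flip b # x))" by (rule rem_shuffle[OF x(2)])
    then obtain y where "rem b u = Some y" "shuffle y x" by (cases "rem b u") auto
    then show ?thesis using 1 x by (simp add: act_def shuffle_sym)
  qed
qed

section \<open>The permutation action on classes of reduced words\<close>

definition shuffle_class :: "('e \<times> bool) list \<Rightarrow> ('e \<times> bool) list set" where
  "shuffle_class w = {w'. shuffle w w'}"

lemma shuffle_class_eq_iff: "shuffle_class u = shuffle_class w \<longleftrightarrow> shuffle u w"
proof
  assume "shuffle_class u = shuffle_class w"
  then have "w \<in> shuffle_class u" by (simp add: shuffle_class_def shuffle_refl)
  then show "shuffle u w" by (simp add: shuffle_class_def)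
next
  assume "shuffle u w"
  then show "shuffle_class u = shuffle_class w"
    unfolding shuffle_class_def using shuffle_sym[of u w] shuffle_trans by blast
qed

text \<open>Off the classes of reduced words the action is the identity, so that it is a bijection
  of the whole type; the choice of a representative is harmless by
  \<open>act_shuffle\<close>.\<close>

definition class_act :: "'e \<times> bool \<Rightarrow> ('e \<times> bool) list set \<Rightarrow> ('e \<times> bool) list set" where
  "class_act a C = (if C \<in> shuffle_class ` Collect reduced
     then shuffle_class (act a (SOME w. w \<in> C)) else C)"

lemma class_act_reduced:
  assumes "reduced w" shows "class_act a (shuffle_class w) = shuffle_class (act a w)"
proof -
  have "(SOME u. u \<in> shuffle_class w) \<in> shuffle_class w"
    by (rule someI[of _ w]) (simp add: shuffle_class_def shuffle_refl)
  then have "shuffle w (SOME u. u \<in> shuffle_class w)"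
    by (simp add: shuffle_class_def[of w])
  then have "shuffle (act a (SOME u. u \<in> shuffle_class w)) (act a w)"
    by (rule act_shuffle[OF shuffle_sym])
  then show ?thesis using assms by (auto simp: class_act_def shuffle_class_eq_iff)
qed

lemma class_act_flip: "class_act (flip a) (class_act a C) = C"
proof (cases "C \<in> shuffle_class ` Collect reduced")
  case True
  then obtain w where "C = shuffle_class w" "reduced w" by auto
  then show ?thesis
    by (simp add: class_act_reduced reduced_act shuffle_class_eq_iff act_flip_act)
qed (simp add: class_act_def)

lemma bij_class_act: "bij (class_act a)"
  by (rule bij_betw_byWitness[where f' = "class_act (flip a)"])
    (use class_act_flip[of a] class_act_flip[of "flip a"] in auto)

text \<open>The Artin group is realised as a group of permutations, following van der Waerden: the
  defining relations hold by \<open>gen_flip\<close> and \<open>gen_commute\<close>, and no normal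
  form theorem has to be proved beforehand.\<close>

definition gen :: "'e \<times> bool \<Rightarrow> ('e \<times> bool) list set bijection" where
  "gen a = Bijection (class_act a)"

lemma apply_gen: "apply_bijection (gen a) = class_act a"
  by (simp add: gen_def Bijection_inverse bij_class_act)

lemma gen_flip: "gen (flip a) = - gen a"
proof -
  have "gen (flip a) + gen a = 0"
    by (rule apply_bijection_inject[THEN iffD1])
      (auto simp: plus_bijection.rep_eq zero_bijection.rep_eq apply_gen class_act_flip)
  then show ?thesis by (simp add: eq_neg_iff_add_eq_0)
qed

lemma gen_commute:
  assumes "c (fst a) (fst b)" shows "gen a + gen b = gen b + gen a"
proof -
  have "class_act a (class_act b C) = class_act b (class_act a C)" for C
  proof (cases "C \<in> shuffle_class ` Collect reduced")
    case True
    then obtain w where "C = shuffle_class w" "reduced w" by auto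
    then show ?thesis using act_act_commute[OF assms]
      by (simp add: class_act_reduced reduced_act shuffle_class_eq_iff)
  qed (simp add: class_act_def)
  then show ?thesis
    by (intro apply_bijection_inject[THEN iffD1])
      (auto simp: plus_bijection.rep_eq apply_gen)
qed

definition word_eval :: "('e \<times> bool) list \<Rightarrow> ('e \<times> bool) list set bijection" where
  "word_eval w = sum_list (map gen w)"

lemma word_eval_simps [simp]:
  "word_eval [] = 0" "word_eval (a # w) = gen a + word_eval w"
  "word_eval (u @ w) = word_eval u + word_eval w"
  by (simp_all add: word_eval_def)

definition normal_form :: "('e \<times> bool) list \<Rightarrow> ('e \<times> bool) list" where
  "normal_form w = foldr act w []"

lemma normal_form_simps [simp]:
  "normal_form [] = []" "normal_form (a # w) = act a (normal_form w)"
  by (simp_all add: normal_form_def)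

text \<open>The value of \<open>w\<close> sends the class of the empty word to the class of the
  normal form of \<open>w\<close>, so the value determines the normal form up to shuffling.\<close>

lemma word_eval_eqD:
  assumes "word_eval u = word_eval w" shows "shuffle (normal_form u) (normal_form w)"
proof -
  have "reduced (normal_form w) \<and>
      apply_bijection (word_eval w) (shuffle_class []) = shuffle_class (normal_form w)" for w
    by (induction w)
      (auto simp: zero_bijection.rep_eq plus_bijection.rep_eq apply_gen class_act_reduced reduced_act)
  then show ?thesis using assms by (metis shuffle_class_eq_iff)
qed

text \<open>Sums over finite sets of pairwise commuting generators; the ambient group is not abelian.\<close>

definition commuting :: "'e set \<Rightarrow> bool" where
  "commuting P \<longleftrightarrow> finite P \<and> (\<forall>x\<in>P. \<forall>y\<in>P. x \<noteq> y \<longrightarrow> c x y)"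

text \<open>The order of summation is an arbitrary choice; \<open>word_eval_distinct_cong\<close>
  makes it irrelevant for commuting sets.\<close>

definition commuting_sum :: "'e set \<Rightarrow> ('e \<times> bool) list set bijection" where
  "commuting_sum P = word_eval (map (\<lambda>x. (x, True)) (SOME xs. distinct xs \<and> set xs = P))"

lemma commuting_subset: "commuting P \<Longrightarrow> Q \<subseteq> P \<Longrightarrow> commuting Q"
  unfolding commuting_def by (meson finite_subset subset_iff)

lemma word_eval_move_front:
  assumes "commuting (insert x (set ys))" "x \<notin> set ys"
  shows "word_eval (map (\<lambda>x. (x, True)) ys) + gen (x, True)
       = gen (x, True) + word_eval (map (\<lambda>x. (x, True)) ys)"
  using assms
proof (induction ys)
  case (Cons y ys)
  have "c x y" using Cons.prems by (auto simp: commuting_def)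
  then have 1: "gen (x, True) + gen (y, True) = gen (y, True) + gen (x, True)"
    by (intro gen_commute) simp
  have "commuting (insert x (set ys))" using Cons.prems by (auto intro: commuting_subset)
  then have 2: "word_eval (map (\<lambda>x. (x, True)) ys) + gen (x, True)
       = gen (x, True) + word_eval (map (\<lambda>x. (x, True)) ys)" using Cons by auto
  let ?y = "gen (y, True)" and ?w = "word_eval (map (\<lambda>x. (x, True)) ys)" and ?x = "gen (x, True)"
  have "?y + ?w + ?x = ?y + ?x + ?w" by (simp only: add.assoc 2)
  also have "\<dots> = ?x + (?y + ?w)" by (simp only: 1[symmetric] add.assoc)
  finally show ?case by simp
qed simp

lemma word_eval_distinct_cong:
  assumes "commuting (set xs)" "distinct xs" "distinct ys" "set xs = set ys"
  shows "word_eval (map (\<lambda>x. (x, True)) xs) = word_eval (map (\<lambda>x. (x, True)) ys)"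
  using assms
proof (induction xs arbitrary: ys)
  case (Cons x xs)
  then have "x \<in> set ys" by auto
  then obtain us vs where ys: "ys = us @ x # vs" by (auto dest: split_list)
  have d: "x \<notin> set us" "x \<notin> set vs" "set xs = set (us @ vs)" "distinct (us @ vs)"
    using Cons.prems ys by auto
  have "commuting (set xs)" using Cons.prems by (auto intro: commuting_subset)
  then have "word_eval (map (\<lambda>x. (x, True)) xs) = word_eval (map (\<lambda>x. (x, True)) (us @ vs))"
    using Cons.IH[of "us @ vs"] Cons.prems d by auto
  moreover have "commuting (insert x (set us))"
    using Cons.prems(1) by (rule commuting_subset) (use Cons.prems(4) ys in auto)
  ultimately show ?case using word_eval_move_front[of x us] d
    by (simp add: ys add.assoc[symmetric])
qed simp

lemma commuting_sum_eq:
  assumes "commuting (set xs)" "distinct xs"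
  shows "commuting_sum (set xs) = word_eval (map (\<lambda>x. (x, True)) xs)"
proof -
  have "distinct (SOME ys. distinct ys \<and> set ys = set xs) \<and> set (SOME ys. distinct ys \<and> set ys = set xs) = set xs"
    by (rule someI[of _ xs]) (simp add: assms)
  then show ?thesis unfolding commuting_sum_def
    by (intro word_eval_distinct_cong[symmetric]) (simp_all add: assms)
qed

lemma commuting_sum_empty [simp]: "commuting_sum {} = 0"
  using commuting_sum_eq[of "[]"] by (simp add: commuting_def)

lemma commuting_sum_singleton [simp]: "commuting_sum {x} = gen (x, True)"
  using commuting_sum_eq[of "[x]"] by (simp add: commuting_def)

lemma commuting_sum_Un:
  assumes "commuting (P \<union> Q)" "P \<inter> Q = {}"
  shows "commuting_sum (P \<union> Q) = commuting_sum P + commuting_sum Q"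
proof -
  have "finite P" "finite Q" using assms(1) by (auto simp: commuting_def)
  then obtain xs ys where xs: "set xs = P" "distinct xs" "set ys = Q" "distinct ys"
    using finite_distinct_list by metis
  then have "commuting_sum (set (xs @ ys)) = word_eval (map (\<lambda>x. (x, True)) (xs @ ys))"
    using assms by (intro commuting_sum_eq) auto
  moreover have "commuting (set xs)" "commuting (set ys)"
    using assms(1) xs by (auto elim: commuting_subset)
  ultimately show ?thesis using xs commuting_sum_eq[of xs] commuting_sum_eq[of ys] by simp
qed

end

text \<open>The condition for the labels of two edges to span a square. It is irreflexive, since an
  edge meets itself.\<close>

definition disjoint_arcs :: "('v, 'e) pre_digraph \<Rightarrow> 'e \<Rightarrow> 'e \<Rightarrow> bool" where
  "disjoint_arcs G a b \<longleftrightarrow> {tail G a, head G a} \<inter> {tail G b, head G b} = {}"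

interpretation raag_arcs: raag "disjoint_arcs G" for G
  by unfold_locales (auto simp: disjoint_arcs_def)

abbreviation arc_gen :: "('v, 'e) pre_digraph \<Rightarrow> 'e \<times> bool \<Rightarrow> ('e \<times> bool) list set bijection" where
  "arc_gen G \<equiv> raag.gen (disjoint_arcs G)"

abbreviation arc_eval :: "('v, 'e) pre_digraph \<Rightarrow> ('e \<times> bool) list \<Rightarrow> ('e \<times> bool) list set bijection" where
  "arc_eval G \<equiv> raag.word_eval (disjoint_arcs G)"

section \<open>Legal moves of particles\<close>

text \<open>The target has to be free only after the particle has left, so a particle may run around
  a loop edge.\<close>

definition can_move :: "('v, 'e) pre_digraph \<Rightarrow> 'v set \<Rightarrow> 'e \<times> bool \<Rightarrow> bool" where
  "can_move G S a \<longleftrightarrow> fst a \<in> arcs G \<and> arc_start G a \<in> S \<and> arc_end G a \<notin> S - {arc_start G a}"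

definition move :: "('v, 'e) pre_digraph \<Rightarrow> 'v set \<Rightarrow> 'e \<times> bool \<Rightarrow> 'v set" where
  "move G S a = insert (arc_end G a) (S - {arc_start G a})"

fun legal :: "('v, 'e) pre_digraph \<Rightarrow> 'v set \<Rightarrow> ('e \<times> bool) list \<Rightarrow> bool" where
  "legal G S [] \<longleftrightarrow> True"
| "legal G S (a # w) \<longleftrightarrow> can_move G S a \<and> legal G (move G S a) w"

definition dest :: "('v, 'e) pre_digraph \<Rightarrow> 'v set \<Rightarrow> ('e \<times> bool) list \<Rightarrow> 'v set" where
  "dest G S w = foldl (move G) S w"

lemma dest_simps [simp]:
  "dest G S [] = S" "dest G S (a # w) = dest G (move G S a) w"
  "dest G S (u @ w) = dest G (dest G S u) w"
  by (simp_all add: dest_def)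

lemma legal_append [simp]: "legal G S (u @ w) \<longleftrightarrow> legal G S u \<and> legal G (dest G S u) w"
  by (induction u arbitrary: S) auto

lemma arc_start_flip [simp]: "arc_start G (flip a) = arc_end G a"
  and arc_end_flip [simp]: "arc_end G (flip a) = arc_start G a"
  by (auto simp: arc_start_def arc_end_def flip_def split: prod.splits)

lemma move_flip:
  assumes "can_move G S a"
  shows "can_move G (move G S a) (flip a)" "move G (move G S a) (flip a) = S"
  using assms by (auto simp: can_move_def move_def)

definition rev_word :: "('e \<times> bool) list \<Rightarrow> ('e \<times> bool) list" where
  "rev_word w = rev (map flip w)"

lemma rev_word_simps [simp]:
  "rev_word [] = []" "rev_word (a # w) = rev_word w @ [flip a]"
  by (simp_all add: rev_word_def)

lemma legal_rev_word:
  assumes "legal G S w"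
  shows "legal G (dest G S w) (rev_word w) \<and> dest G (dest G S w) (rev_word w) = S"
  using assms by (induction w arbitrary: S) (auto simp: move_flip)

lemma arc_eval_rev_word: "arc_eval G (rev_word w) = - arc_eval G w"
  by (induction w) (simp_all add: raag_arcs.gen_flip minus_add)

lemma ends_disjoint:
  "disjoint_arcs G (fst a) (fst b) \<Longrightarrow>
     {arc_start G a, arc_end G a} \<inter> {arc_start G b, arc_end G b} = {}"
  by (auto simp: disjoint_arcs_def arc_start_def arc_end_def split: prod.splits if_splits)

text \<open>The hypothesis on \<open>b\<close> concerns the configuration after \<open>a\<close>; as
  the edges are disjoint, \<open>a\<close> neither frees nor occupies an endpoint of
  \<open>b\<close>.\<close>

lemma move_commute:
  assumes "disjoint_arcs G (fst a) (fst b)" "can_move G S a" "can_move G (move G S a) b"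
  shows "can_move G S b" "can_move G (move G S b) a"
    "move G (move G S a) b = move G (move G S b) a"
  using assms ends_disjoint[OF assms(1)] unfolding can_move_def move_def by auto

text \<open>
  The normal form of a legal word is reached by legal swaps and cancellations only. Hence any
  equivalence \<open>Q\<close> compatible with these identifies legal words with the same value in the
  right-angled Artin group.
\<close>

context
  fixes G :: "('v, 'e) pre_digraph" and P :: "'v set \<Rightarrow> bool"
    and Q :: "'v set \<Rightarrow> ('e \<times> bool) list \<Rightarrow> ('e \<times> bool) list \<Rightarrow> bool"
  assumes P_move: "\<And>S a. P S \<Longrightarrow> can_move G S a \<Longrightarrow> P (move G S a)"
    and Q_refl: "\<And>S w. P S \<Longrightarrow> legal G S w \<Longrightarrow> Q S w w"
    and Q_sym: "\<And>S u w. Q S u w \<Longrightarrow> Q S w u"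
    and Q_trans: "\<And>S u v w. Q S u v \<Longrightarrow> Q S v w \<Longrightarrow> Q S u w"
    and Q_Cons: "\<And>S a u w. P S \<Longrightarrow> can_move G S a \<Longrightarrow> legal G (move G S a) u \<Longrightarrow>
       legal G (move G S a) w \<Longrightarrow> dest G (move G S a) u = dest G (move G S a) w \<Longrightarrow>
       Q (move G S a) u w \<Longrightarrow> Q S (a # u) (a # w)"
    and Q_swap: "\<And>S a b w. P S \<Longrightarrow> disjoint_arcs G (fst a) (fst b) \<Longrightarrow> legal G S (a # b # w) \<Longrightarrow>
       Q S (a # b # w) (b # a # w)"
    and Q_cancel: "\<And>S a w. P S \<Longrightarrow> can_move G S a \<Longrightarrow> legal G S w \<Longrightarrow> Q S (a # flip a # w) w"
begin

lemma shuffle_imp_Q: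
  "raag.shuffle (disjoint_arcs G) u w \<Longrightarrow> P S \<Longrightarrow> legal G S u \<Longrightarrow>
     legal G S w \<and> dest G S u = dest G S w \<and> Q S u w"
proof (induction arbitrary: S rule: raag_arcs.shuffle.induct)
  case (shuffle_refl w)
  then show ?case by (auto intro: Q_refl)
next
  case (shuffle_Cons w w' a)
  then have "legal G (move G S a) w' \<and> dest G (move G S a) w = dest G (move G S a) w' \<and> Q (move G S a) w w'"
    by (intro shuffle_Cons.IH) (auto intro: P_move)
  then show ?case using shuffle_Cons.prems by (auto intro: Q_Cons)
next
  case (shuffle_swap a b w)
  then show ?case using move_commute[OF shuffle_swap(1)] by (auto intro: Q_swap)
next
  case (shuffle_trans u w v)
  then show ?case by (metis Q_trans)
qed

lemma normal_form_Q:
  "P S \<Longrightarrow> legal G S w \<Longrightarrow> legal G S (raag.normal_form (disjoint_arcs G) w) \<and>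
     dest G S w = dest G S (raag.normal_form (disjoint_arcs G) w) \<and>
     Q S w (raag.normal_form (disjoint_arcs G) w)"
proof (induction w arbitrary: S)
  case Nil
  then show ?case by (auto intro: Q_refl)
next
  case (Cons a w)
  let ?n = "raag.normal_form (disjoint_arcs G) w"
  have P: "P (move G S a)" and a: "can_move G S a" using Cons.prems by (auto intro: P_move)
  have IH: "legal G (move G S a) ?n" "dest G (move G S a) w = dest G (move G S a) ?n" "Q (move G S a) w ?n"
    using Cons.IH[OF P] Cons.prems by auto
  have 1: "Q S (a # w) (a # ?n)" using IH Cons.prems by (auto intro: Q_Cons)
  show ?case
  proof (cases "raag.rem (disjoint_arcs G) a ?n")
    case None
    then show ?thesis using IH 1 Cons.prems by (simp add: raag_arcs.act_def)
  next
    case (Some u)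
    have "raag.shuffle (disjoint_arcs G) ?n (flip a # u)" by (rule raag_arcs.rem_Some_shuffle[OF Some])
    then have *: "legal G (move G S a) (flip a # u) \<and> dest G (move G S a) ?n = dest G (move G S a) (flip a # u)
        \<and> Q (move G S a) ?n (flip a # u)"
      by (rule shuffle_imp_Q[OF _ P IH(1)])
    \<comment> \<open>The normal form absorbs \<open>a\<close>: after \<open>a\<close>, the rest can
      be shuffled so that it begins by moving back, and this backtrack is removed.\<close>
    have "Q S (a # ?n) (a # flip a # u)" using * IH Cons.prems a by (intro Q_Cons) auto
    moreover have "legal G S u" using * move_flip[OF a] by simp
    then have "Q S (a # flip a # u) u" using Cons.prems a by (intro Q_cancel) auto
    ultimately have "Q S (a # w) u" using 1 Q_trans by blast
    then show ?thesis using * IH move_flip[OF a] Some by (simp add: raag_arcs.act_def)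
  qed
qed

text \<open>Used for two equivalences: homotopy of edge paths, and congruence modulo the relators of
  the words that edge paths trace out.\<close>

lemma arc_eval_eq_imp_Q:
  assumes "P S" "legal G S u" "legal G S w" "arc_eval G u = arc_eval G w"
  shows "dest G S u = dest G S w" "Q S u w"
proof -
  have "raag.shuffle (disjoint_arcs G) (raag.normal_form (disjoint_arcs G) u) (raag.normal_form (disjoint_arcs G) w)"
    by (rule raag_arcs.word_eval_eqD[OF assms(4)])
  then have "dest G S (raag.normal_form (disjoint_arcs G) u) = dest G S (raag.normal_form (disjoint_arcs G) w) \<and>
     Q S (raag.normal_form (disjoint_arcs G) u) (raag.normal_form (disjoint_arcs G) w)"
    using shuffle_imp_Q normal_form_Q assms by blast
  then show "dest G S u = dest G S w" "Q S u w"
    using normal_form_Q[OF assms(1,2)] normal_form_Q[OF assms(1,3)] by (metis, metis Q_sym Q_trans)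
qed

end

section \<open>The fundamental groupoid of an abstract topological space\<close>

abbreviation unit_interval :: "real topology" where
  "unit_interval \<equiv> top_of_set {0..1}"

text \<open>In \<open>h (s, t)\<close> the first coordinate is the time of the homotopy and the
  second the parameter of the path; all later squares follow this convention.\<close>

lemma path_homotopic_iff:
  "path_homotopic X p q \<longleftrightarrow>
    (\<exists>h. continuous_map (prod_topology unit_interval unit_interval) X h \<and>
       (\<forall>t\<in>{0..1}. h (0, t) = p t \<and> h (1, t) = q t) \<and>
       (\<forall>s\<in>{0..1}. h (s, 0) = p 0 \<and> h (s, 1) = p 1))"
  unfolding path_homotopic_def by (subst homotopic_with) auto

lemma path_homotopic_imp_pathin:
  assumes "path_homotopic X p q"
  shows "pathin X p" "pathin X q"
  using homotopic_with_imp_continuous_maps assms unfolding path_homotopic_def pathin_def by blast+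

lemma path_homotopic_ends:
  assumes "path_homotopic X p q"
  shows "q 0 = p 0" "q 1 = p 1"
  using homotopic_with_imp_property assms unfolding path_homotopic_def by blast+

lemma path_homotopic_refl: "pathin X p \<Longrightarrow> path_homotopic X p p"
  by (simp add: path_homotopic_def pathin_def)

lemma path_homotopic_sym: "path_homotopic X p q \<Longrightarrow> path_homotopic X q p"
  using path_homotopic_ends[of X p q] by (simp add: path_homotopic_def homotopic_with_sym)

lemma path_homotopic_trans [trans]:
  "path_homotopic X p q \<Longrightarrow> path_homotopic X q r \<Longrightarrow> path_homotopic X p r"
  using path_homotopic_ends[of X p q] unfolding path_homotopic_def
  by (auto intro: homotopic_with_trans)

lemma path_class_eq_iff:
  assumes "pathin X p"
  shows "path_class X p = path_class X q \<longleftrightarrow> path_homotopic X p q"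
proof
  assume "path_class X p = path_class X q"
  then have "p \<in> path_class X q" using path_homotopic_refl[OF assms] by (auto simp: path_class_def)
  then show "path_homotopic X p q" by (simp add: path_class_def path_homotopic_sym)
next
  assume "path_homotopic X p q"
  then show "path_class X p = path_class X q" unfolding path_class_def
    using path_homotopic_sym path_homotopic_trans by blast
qed

lemma path_homotopic_map:
  assumes "continuous_map X Y f" "path_homotopic X p q"
  shows "path_homotopic Y (f \<circ> p) (f \<circ> q)"
  using assms unfolding path_homotopic_def
  by (intro homotopic_with_compose_continuous_map_left[of "\<lambda>r. r 0 = p 0 \<and> r 1 = p 1" _ X]) auto

text \<open>Straight line homotopies live in the convex parameter set \<open>C\<close> and are
  pushed forward by \<open>F\<close>, so reparametrisations and cancellations reduce to choosing two
  curves with common ends.\<close>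

lemma path_homotopic_convex:
  fixes C :: "'b::real_normed_vector set"
  assumes F: "continuous_map (top_of_set C) X F" and C: "convex C"
    and a: "continuous_on {0..1} \<alpha>" "\<alpha> ` {0..1} \<subseteq> C"
    and b: "continuous_on {0..1} \<beta>" "\<beta> ` {0..1} \<subseteq> C"
    and ends: "\<alpha> 0 = \<beta> 0" "\<alpha> 1 = \<beta> 1"
    and p: "\<And>t. t \<in> {0..1} \<Longrightarrow> p t = F (\<alpha> t)" and q: "\<And>t. t \<in> {0..1} \<Longrightarrow> q t = F (\<beta> t)"
  shows "path_homotopic X p q"
proof -
  let ?g = "\<lambda>z. (1 - fst z) *\<^sub>R \<alpha> (snd z) + fst z *\<^sub>R \<beta> (snd z)"
  have 1: "continuous_on ({0..1} \<times> {0..1}) (\<lambda>z::real\<times>real. \<alpha> (snd z))"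
    by (rule continuous_on_compose2[OF a(1)]) (auto intro: continuous_intros)
  have 2: "continuous_on ({0..1} \<times> {0..1}) (\<lambda>z::real\<times>real. \<beta> (snd z))"
    by (rule continuous_on_compose2[OF b(1)]) (auto intro: continuous_intros)
  have "continuous_on ({0..1} \<times> {0..1}) ?g"
    by (intro continuous_intros 1 2)
  moreover have "?g ` ({0..1} \<times> {0..1}) \<subseteq> C"
    using a(2) b(2) by (auto intro!: convexD[OF C])
  ultimately have "continuous_map (prod_topology unit_interval unit_interval) (top_of_set C) ?g"
    by auto
  then have "continuous_map (prod_topology unit_interval unit_interval) X (F \<circ> ?g)"
    by (rule continuous_map_compose[OF _ F])
  moreover have "(1 - s) *\<^sub>R x + s *\<^sub>R x = x" for s and x :: 'b
    by (simp add: algebra_simps)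
  ultimately show ?thesis unfolding path_homotopic_iff using ends p q
    by (intro exI[of _ "F \<circ> ?g"]) auto
qed

lemma pathin_reparam:
  assumes "pathin X p" "continuous_on {0..1} \<alpha>" "\<alpha> ` {0..1} \<subseteq> {0..1}"
  shows "pathin X (\<lambda>t. p (\<alpha> t))"
proof -
  have "continuous_map unit_interval unit_interval \<alpha>" using assms by auto
  then show ?thesis using assms(1) continuous_map_compose[of unit_interval unit_interval \<alpha> X p]
    by (simp add: pathin_def o_def)
qed

lemma pathin_map: "continuous_map X Y f \<Longrightarrow> pathin X p \<Longrightarrow> pathin Y (f \<circ> p)"
  unfolding pathin_def by (rule continuous_map_compose)

lemma pathin_rev: "pathin X p \<Longrightarrow> pathin X (path_rev p)"
  unfolding path_rev_def by (rule pathin_reparam) (auto intro: continuous_intros)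

lemma path_rev_ends [simp]: "path_rev p 0 = p 1" "path_rev p 1 = p 0" "path_rev (path_rev p) = p"
  by (auto simp: path_rev_def)

lemma path_join_ends [simp]: "path_join p q 0 = p 0" "path_join p q 1 = q 1"
  by (auto simp: path_join_def)

lemma join_homotopy:
  assumes h: "continuous_map (prod_topology unit_interval unit_interval) X h"
    and k: "continuous_map (prod_topology unit_interval unit_interval) X k"
    and eq: "\<And>s. s \<in> {0..1} \<Longrightarrow> h (s, 1) = k (s, 0)"
  shows "continuous_map (prod_topology unit_interval unit_interval) X
    (\<lambda>z. if snd z \<le> 1/2 then h (fst z, 2 * snd z) else k (fst z, 2 * snd z - 1))"
proof (rule continuous_map_cases_le)
  let ?T = "prod_topology unit_interval unit_interval"
  show "continuous_map ?T euclideanreal snd" "continuous_map ?T euclideanreal (\<lambda>x. 1/2)"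
    by (auto intro: continuous_intros)
  have "continuous_map (subtopology ?T {x \<in> topspace ?T. snd x \<le> 1/2}) ?T (\<lambda>z. (fst z, 2 * snd z))"
    by (auto simp: subtopology_subtopology intro!: continuous_intros)
  from continuous_map_compose[OF this h]
  show "continuous_map (subtopology ?T {x \<in> topspace ?T. snd x \<le> 1/2}) X (\<lambda>z. h (fst z, 2 * snd z))"
    by (simp add: o_def)
  have "continuous_map (subtopology ?T {x \<in> topspace ?T. 1/2 \<le> snd x}) ?T (\<lambda>z. (fst z, 2 * snd z - 1))"
    by (auto simp: subtopology_subtopology intro!: continuous_intros)
  from continuous_map_compose[OF this k]
  show "continuous_map (subtopology ?T {x \<in> topspace ?T. 1/2 \<le> snd x}) X (\<lambda>z. k (fst z, 2 * snd z - 1))"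
    by (simp add: o_def)
  fix z assume z: "z \<in> topspace (prod_topology unit_interval unit_interval)" "snd z = 1/2"
  then have "fst z \<in> {0..1}" by auto
  then show "h (fst z, 2 * snd z) = k (fst z, 2 * snd z - 1)" using eq[of "fst z"] by (simp add: z(2))
qed

lemma path_homotopic_join:
  assumes "path_homotopic X p p'" "path_homotopic X q q'" "p 1 = q 0"
  shows "path_homotopic X (path_join p q) (path_join p' q')"
proof -
  obtain h where h: "continuous_map (prod_topology unit_interval unit_interval) X h"
       "\<And>t. t\<in>{0..1} \<Longrightarrow> h (0, t) = p t \<and> h (1, t) = p' t"
       "\<And>s. s\<in>{0..1} \<Longrightarrow> h (s, 0) = p 0 \<and> h (s, 1) = p 1"
    using assms(1) unfolding path_homotopic_iff by blast
  obtain k where k: "continuous_map (prod_topology unit_interval unit_interval) X k"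
       "\<And>t. t\<in>{0..1} \<Longrightarrow> k (0, t) = q t \<and> k (1, t) = q' t"
       "\<And>s. s\<in>{0..1} \<Longrightarrow> k (s, 0) = q 0 \<and> k (s, 1) = q 1"
    using assms(2) unfolding path_homotopic_iff by blast
  show ?thesis unfolding path_homotopic_iff
    by (rule exI, intro conjI, rule join_homotopy[OF h(1) k(1)])
      (use assms(3) h(2,3) k(2,3) in \<open>auto simp: path_join_def\<close>)
qed

lemma pathin_join:
  assumes "pathin X p" "pathin X q" "p 1 = q 0"
  shows "pathin X (path_join p q)"
  using path_homotopic_imp_pathin path_homotopic_join path_homotopic_refl assms by metis

lemma path_homotopic_rev:
  assumes "path_homotopic X p q" shows "path_homotopic X (path_rev p) (path_rev q)"
proof -
  obtain h where h: "continuous_map (prod_topology unit_interval unit_interval) X h"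
       "\<And>t. t\<in>{0..1} \<Longrightarrow> h (0, t) = p t \<and> h (1, t) = q t"
       "\<And>s. s\<in>{0..1} \<Longrightarrow> h (s, 0) = p 0 \<and> h (s, 1) = p 1"
    using assms(1) unfolding path_homotopic_iff by blast
  have "continuous_map (prod_topology unit_interval unit_interval) (prod_topology unit_interval unit_interval)
      (\<lambda>z. (fst z, 1 - snd z))"
    by (auto intro!: continuous_intros)
  from continuous_map_compose[OF this h(1)]
  have "continuous_map (prod_topology unit_interval unit_interval) X (\<lambda>z. h (fst z, 1 - snd z))"
    by (simp add: o_def)
  then show ?thesis unfolding path_homotopic_iff
    by (intro exI[of _ "\<lambda>z. h (fst z, 1 - snd z)"] conjI) (use h(2,3) in \<open>auto simp: path_rev_def\<close>)
qed

lemma path_homotopic_reparam: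
  assumes "pathin X p" "continuous_on {0..1} \<alpha>" "\<alpha> ` {0..1} \<subseteq> {0..1}" "\<alpha> 0 = 0" "\<alpha> 1 = 1"
    "\<And>t. t \<in> {0..1} \<Longrightarrow> q t = p (\<alpha> t)"
  shows "path_homotopic X q p"
  by (rule path_homotopic_convex[of "{0..1::real}" X p \<alpha> id])
    (use assms in \<open>auto simp: pathin_def\<close>)

lemma continuous_on_piecewise:
  fixes f g :: "real \<Rightarrow> 'b::topological_space"
  assumes "continuous_on UNIV f" "continuous_on UNIV g" "f c = g c"
  shows "continuous_on S (\<lambda>t. if t \<le> c then f t else g t)"
proof -
  have "continuous_on ({..c} \<union> {c..}) (\<lambda>t. if t \<le> c then f t else g t)"
    using assms by (intro continuous_on_If) (auto intro: continuous_on_subset)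
  then show ?thesis by (rule continuous_on_subset) auto
qed

lemma path_join_assoc:
  assumes "pathin X p" "pathin X q" "pathin X r" "p 1 = q 0" "q 1 = r 0"
  shows "path_homotopic X (path_join (path_join p q) r) (path_join p (path_join q r))"
proof (rule path_homotopic_reparam)
  \<comment> \<open>Linear of slopes 2, 1 and 1/2, carrying the breakpoints 1/4 and 1/2 of the left
    bracketing to 1/2 and 3/4; the minimum switches at 1/4.\<close>
  let ?a = "\<lambda>t::real. if t \<le> 1/2 then min (2 * t) (t + 1/4) else (t + 1) / 2"
  show "continuous_on {0..1} ?a"
    by (rule continuous_on_piecewise) (auto intro!: continuous_intros)
  show "pathin X (path_join p (path_join q r))" using assms by (simp add: pathin_join)
  show "?a ` {0..1} \<subseteq> {0..1}" by (auto simp: min_def)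
  fix t :: real assume "t \<in> {0..1}"
  consider "t \<le> 1/4" | "1/4 < t" "t \<le> 1/2" | "1/2 < t" by linarith
  then show "path_join (path_join p q) r t = path_join p (path_join q r) (?a t)"
  proof cases
    case 2
    then have "2 * (2 * (t + 1/4) - 1) = 2 * (2 * t) - 1" by simp
    with 2 show ?thesis by (auto simp: path_join_def min_def)
  qed (auto simp: path_join_def min_def field_simps)
qed auto

lemma path_join_const_left:
  assumes "pathin X p" "p 0 = x" shows "path_homotopic X (path_join (\<lambda>_. x) p) p"
proof (rule path_homotopic_reparam[OF assms(1)])
  let ?a = "\<lambda>t::real. max 0 (2 * t - 1)"
  show "continuous_on {0..1} ?a" by (auto intro!: continuous_intros)
  fix t :: real
  consider "t < 1/2" | "t = 1/2" | "t > 1/2" by linarith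
  then show "path_join (\<lambda>_. x) p t = p (max 0 (2 * t - 1))"
  proof cases
    case 2
    have "path_join (\<lambda>_. x) p (1/2) = p (max 0 (2 * (1/2) - 1))" using assms(2) by (simp add: path_join_def)
    then show ?thesis by (simp only: 2)
  qed (use assms(2) in \<open>auto simp: path_join_def max_def\<close>)
qed auto

lemma path_join_const_right:
  assumes "pathin X p" "p 1 = x" shows "path_homotopic X (path_join p (\<lambda>_. x)) p"
proof (rule path_homotopic_reparam[OF assms(1)])
  let ?a = "\<lambda>t::real. min 1 (2 * t)"
  show "continuous_on {0..1} ?a" by (auto intro!: continuous_intros)
  fix t :: real
  consider "t < 1/2" | "t = 1/2" | "t > 1/2" by linarith
  then show "path_join p (\<lambda>_. x) t = p (min 1 (2 * t))"
  proof cases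
    case 2
    have "path_join p (\<lambda>_. x) (1/2) = p (min 1 (2 * (1/2)))" using assms(2) by (simp add: path_join_def)
    then show ?thesis by (simp only: 2)
  qed (use assms(2) in \<open>auto simp: path_join_def min_def\<close>)
qed auto

text \<open>The path follows \<open>p\<close> along a tent function on the unit interval, which
  contracts linearly to 0 with fixed ends.\<close>

lemma path_join_rev_right:
  assumes "pathin X p" shows "path_homotopic X (path_join p (path_rev p)) (\<lambda>_. p 0)"
proof (rule path_homotopic_convex[of "{0..1::real}" X p "\<lambda>t. if t \<le> 1/2 then 2 * t else 2 - 2 * t" "\<lambda>_. 0"])
  show "continuous_on {0..1} (\<lambda>t::real. if t \<le> 1/2 then 2 * t else 2 - 2 * t)"
    by (rule continuous_on_piecewise) (auto intro!: continuous_intros)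
qed (use assms in \<open>auto simp: pathin_def path_join_def path_rev_def\<close>)

lemma path_join_rev_left:
  assumes "pathin X p" shows "path_homotopic X (path_join (path_rev p) p) (\<lambda>_. p 1)"
  using path_join_rev_right[OF pathin_rev[OF assms]] by simp

lemma path_in_topspace: "pathin X p \<Longrightarrow> t \<in> {0..1} \<Longrightarrow> p t \<in> topspace X"
  using continuous_map_image_subset_topspace[of unit_interval X p] by (auto simp: pathin_def)

lemma path_join_cancel_left:
  assumes "pathin X p" "pathin X q" "p 0 = q 0"
  shows "path_homotopic X (path_join p (path_join (path_rev p) q)) q"
proof -
  have "path_homotopic X (path_join p (path_join (path_rev p) q)) (path_join (path_join p (path_rev p)) q)"
    by (rule path_homotopic_sym, rule path_join_assoc) (use assms in \<open>auto simp: pathin_rev\<close>)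
  also have "path_homotopic X \<dots> (path_join (\<lambda>_. p 0) q)"
    by (rule path_homotopic_join[OF path_join_rev_right path_homotopic_refl]) (use assms in auto)
  also have "path_homotopic X \<dots> q"
    by (rule path_join_const_left) (use assms in auto)
  finally show ?thesis .
qed

section \<open>Subpaths, and paths shrunk along a homotopy\<close>

definition path_part :: "(real \<Rightarrow> 'a) \<Rightarrow> real \<Rightarrow> real \<Rightarrow> real \<Rightarrow> 'a" where
  "path_part p a b = (\<lambda>t. p (a + (b - a) * t))"

lemma path_part_ends [simp]: "path_part p a b 0 = p a" "path_part p a b 1 = p b" "path_part p 0 1 = p"
  by (auto simp: path_part_def)

lemma affine_unit_interval:
  fixes a b t :: real
  assumes "0 \<le> a" "a \<le> b" "b \<le> 1" "0 \<le> t" "t \<le> 1"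
  shows "a \<le> a + (b - a) * t" "a + (b - a) * t \<le> b"
proof -
  show "a \<le> a + (b - a) * t" using assms by simp
  have "(b - a) * t \<le> (b - a) * 1" by (rule mult_left_mono) (use assms in auto)
  then show "a + (b - a) * t \<le> b" by simp
qed

lemma pathin_part:
  assumes "pathin X p" "0 \<le> a" "a \<le> b" "b \<le> 1"
  shows "pathin X (path_part p a b)"
  unfolding path_part_def
proof (rule pathin_reparam[OF assms(1)])
  show "(\<lambda>t. a + (b - a) * t) ` {0..1} \<subseteq> {0..1}"
    using affine_unit_interval[OF assms(2-4)] assms by fastforce
qed (auto intro: continuous_intros)

lemma path_part_join:
  assumes p: "pathin X p" and abc: "0 \<le> a" "a \<le> b" "b \<le> c" "c \<le> 1"
  shows "path_homotopic X (path_join (path_part p a b) (path_part p b c)) (path_part p a c)"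
proof (rule path_homotopic_convex[of "{0..1}" X p
      "\<lambda>t. if t \<le> 1/2 then a + (b - a) * (2 * t) else b + (c - b) * (2 * t - 1)" "\<lambda>t. a + (c - a) * t"])
  show "continuous_on {0..1} (\<lambda>t. if t \<le> 1/2 then a + (b - a) * (2 * t) else b + (c - b) * (2 * t - 1))"
    by (rule continuous_on_piecewise) (auto intro!: continuous_intros)
  have "a + (b - a) * (2 * t) \<in> {0..1}" if "0 \<le> t" "t \<le> 1/2" for t
    using affine_unit_interval[of a b "2 * t"] that abc by auto
  moreover have "b + (c - b) * (2 * t - 1) \<in> {0..1}" if "1/2 \<le> t" "t \<le> 1" for t
    using affine_unit_interval[of b c "2 * t - 1"] that abc by auto
  ultimately show "(\<lambda>t. if t \<le> 1/2 then a + (b - a) * (2 * t) else b + (c - b) * (2 * t - 1)) ` {0..1} \<subseteq> {0..1}"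
    by auto
  have "a + (c - a) * t \<in> {0..1}" if "t \<in> {0..1}" for t
    using affine_unit_interval[of a c t] that abc by auto
  then show "(\<lambda>t. a + (c - a) * t) ` {0..1} \<subseteq> {0..1}" by blast
qed (use p in \<open>auto simp: pathin_def path_join_def path_part_def intro!: continuous_intros\<close>)

text \<open>In a square the side \<open>s = 0\<close> is homotopic to the way round the other three
  sides, and the side \<open>s = 1\<close> is constant. In this form a retraction that moves the
  ends of a path yields a statement about homotopy with fixed ends.\<close>

lemma path_homotopic_tracks:
  assumes h: "continuous_map (prod_topology unit_interval unit_interval) X h"
    and p: "\<And>t. t \<in> {0..1} \<Longrightarrow> h (0, t) = p t"
    and x: "\<And>t. t \<in> {0..1} \<Longrightarrow> h (1, t) = x"
  shows "path_homotopic X p (path_join (\<lambda>s. h (s, 0)) (path_rev (\<lambda>s. h (s, 1))))"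
proof -
  \<comment> \<open>The way round the square: up along \<open>t = 0\<close> in the first quarter of
    time, across \<open>s = 1\<close> during the middle half, down along \<open>t = 1\<close> in the
    last quarter.\<close>
  let ?c = "\<lambda>t::real. (min 1 (min (4 * t) (4 - 4 * t)), max 0 (min 1 (2 * t - 1/2)))"
  have C: "continuous_map (top_of_set ({0..1} \<times> {0..1})) X h" using h by simp
  have c: "continuous_on {0..1} ?c" "?c ` {0..1} \<subseteq> {0..1} \<times> {0..1}"
    by (auto intro!: continuous_intros)
  have "path_homotopic X p (h \<circ> ?c)"
    by (rule path_homotopic_convex[OF C _ _ _ c, of "\<lambda>t. (0, t)"])
      (auto simp: p convex_Times intro!: continuous_intros)
  moreover have "path_homotopic X (path_join (\<lambda>s. h (s, 0)) (path_rev (\<lambda>s. h (s, 1)))) (h \<circ> ?c)"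
  proof -
    \<comment> \<open>Matches the curve with the join of the two tracks: the constant side is
      collapsed to the time 1/2.\<close>
    let ?\<gamma> = "\<lambda>t::real. min (2 * t) (max (1/2) (2 * t - 1))"
    have "h (?c t) = path_join (\<lambda>s. h (s, 0)) (path_rev (\<lambda>s. h (s, 1))) (?\<gamma> t)" if "t \<in> {0..1}" for t
    proof -
      consider "t \<le> 1/4" | "1/4 < t" "t < 3/4" | "3/4 \<le> t" by linarith
      then show ?thesis
      proof cases
        case 1
        then have "?c t = (4 * t, 0)" "?\<gamma> t = 2 * t" using that by (auto simp: min_def max_def)
        then show ?thesis using 1 by (simp add: path_join_def)
      next
        case 2
        then have "?c t = (1, 2 * t - 1/2)" "?\<gamma> t = 1/2" by (auto simp: min_def max_def)
        then show ?thesis using 2 x[of "2 * t - 1/2"] x[of 0] by (simp add: path_join_def)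
      next
        case 3
        then have "?c t = (4 - 4 * t, 1)" "?\<gamma> t = 2 * t - 1" using that by (auto simp: min_def max_def)
        then show ?thesis using 3 x[of 0] x[of 1] that
          by (cases "t = 3/4") (auto simp: path_join_def path_rev_def algebra_simps)
      qed
    qed
    moreover have "pathin X (path_join (\<lambda>s. h (s, 0)) (path_rev (\<lambda>s. h (s, 1))))"
    proof (intro pathin_join pathin_rev)
      have "continuous_map unit_interval (prod_topology unit_interval unit_interval) (\<lambda>s. (s, r))" if "r \<in> {0..1}" for r
        using that by (auto intro!: continuous_intros)
      from continuous_map_compose[OF this h] 
      show "pathin X (\<lambda>s. h (s, 0))" "pathin X (\<lambda>s. h (s, 1))" by (auto simp: pathin_def o_def)
    qed (use x in auto)
    moreover have "continuous_on {0..1} ?\<gamma>"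
      by (auto intro!: continuous_intros)
    ultimately have "path_homotopic X (h \<circ> ?c) (path_join (\<lambda>s. h (s, 0)) (path_rev (\<lambda>s. h (s, 1))))"
      by (intro path_homotopic_reparam[where \<alpha> = ?\<gamma>]) auto
    then show ?thesis by (rule path_homotopic_sym)
  qed
  ultimately show ?thesis using path_homotopic_sym path_homotopic_trans by blast
qed

section \<open>Parallel transport for locally constant cocycles\<close>

lemma pathin_nhd:
  assumes "pathin X p" "openin X W" "t \<in> {0..1}" "p t \<in> W"
  obtains d where "d > 0" "\<And>t'. t' \<in> {0..1} \<Longrightarrow> \<bar>t' - t\<bar> < d \<Longrightarrow> p t' \<in> W"
proof -
  have op: "openin unit_interval {t \<in> {0..1}. p t \<in> W}"
    using assms(1,2) unfolding pathin_def by (auto dest: openin_continuous_map_preimage)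
  have mem: "t \<in> {t \<in> {0..1}. p t \<in> W}" using assms by auto
  obtain d where "d > 0" "\<forall>t' \<in> {0..1}. dist t' t < d \<longrightarrow> t' \<in> {t \<in> {0..1}. p t \<in> W}"
    using bspec[OF conjunct2[OF openin_euclidean_subtopology_iff[THEN iffD1, OF op]] mem] by blast
  then show ?thesis using that by (auto simp: dist_real_def)
qed

lemma square_nhd:
  assumes "continuous_map (prod_topology unit_interval unit_interval) X h" "openin X W"
    "s \<in> {0..1}" "t \<in> {0..1}" "h (s, t) \<in> W"
  obtains d where "d > 0"
    "\<And>s' t'. s' \<in> {0..1} \<Longrightarrow> t' \<in> {0..1} \<Longrightarrow> \<bar>s' - s\<bar> < d \<Longrightarrow> \<bar>t' - t\<bar> < d \<Longrightarrow> h (s', t') \<in> W"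
proof -
  have op: "openin (top_of_set ({0..1} \<times> {0..1})) {z \<in> {0..1} \<times> {0..1}. h z \<in> W}"
    using openin_continuous_map_preimage[OF assms(1,2)] by simp
  have mem: "(s, t) \<in> {z \<in> {0..1} \<times> {0..1}. h z \<in> W}" using assms by auto
  obtain d where "d > 0"
      "\<forall>z \<in> {0..1} \<times> {0..1}. dist z (s, t) < d \<longrightarrow> z \<in> {z \<in> {0..1} \<times> {0..1}. h z \<in> W}"
    using bspec[OF conjunct2[OF openin_euclidean_subtopology_iff[THEN iffD1, OF op]] mem] by blast
  then have d: "d > 0" "\<And>z. z \<in> {0..1} \<times> {0..1} \<Longrightarrow> dist z (s, t) < d \<Longrightarrow> h z \<in> W"
    by blast+
  have "h (s', t') \<in> W" if "s' \<in> {0..1}" "t' \<in> {0..1}" "\<bar>s' - s\<bar> < d/2" "\<bar>t' - t\<bar> < d/2" for s' t'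
  proof (rule d(2))
    have "dist (s', t') (s, t) \<le> dist s' s + dist t' t"
      unfolding dist_Pair_Pair by (rule sqrt_sum_squares_le_sum) auto
    then show "dist (s', t') (s, t) < d" using that by (simp add: dist_real_def)
  qed (use that in auto)
  then show ?thesis using d(1) that[of "d/2"] by auto
qed

text \<open>\<open>\<beta> i\<close> is a potential on the chart \<open>U i\<close>. Two potentials
  differ by a locally constant summand on the left, which cancels in
  \<open>- \<beta> i (p a) + \<beta> i (p b)\<close>; in a nonabelian group the side
  matters.\<close>

locale transport =
  fixes X :: "'a topology" and I :: "'i set" and U :: "'i \<Rightarrow> 'a set"
    and \<beta> :: "'i \<Rightarrow> 'a \<Rightarrow> 'g::group_add"
  assumes U_open: "i \<in> I \<Longrightarrow> openin X (U i)"
    and U_cover: "x \<in> topspace X \<Longrightarrow> \<exists>i\<in>I. x \<in> U i"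
    and cocycle: "\<lbrakk>i \<in> I; j \<in> I; x \<in> U i; x \<in> U j\<rbrakk> \<Longrightarrow>
      \<exists>W. openin X W \<and> x \<in> W \<and> (\<forall>y\<in>W. y \<in> U i \<longrightarrow> y \<in> U j \<longrightarrow> \<beta> j y - \<beta> i y = \<beta> j x - \<beta> i x)"
begin

text \<open>The subdivision of the path into pieces that lie in charts is hidden in the derivation;
  existence and uniqueness of the transported element follow by compactness of the interval.\<close>

inductive transports :: "(real \<Rightarrow> 'a) \<Rightarrow> real \<Rightarrow> real \<Rightarrow> 'g \<Rightarrow> bool" for p where
  chart: "\<lbrakk>a \<le> b; i \<in> I; \<And>t. t \<in> {a..b} \<Longrightarrow> p t \<in> U i\<rbrakk> \<Longrightarrow> transports p a b (- \<beta> i (p a) + \<beta> i (p b))"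
| compose: "\<lbrakk>transports p a b g; transports p b c h\<rbrakk> \<Longrightarrow> transports p a c (g + h)"

lemma transports_le: "transports p a b g \<Longrightarrow> a \<le> b"
  by (induction rule: transports.induct) auto

lemma transports_split:
  "transports p a c g \<Longrightarrow> a \<le> b \<Longrightarrow> b \<le> c \<Longrightarrow>
     \<exists>g1 g2. transports p a b g1 \<and> transports p b c g2 \<and> g = g1 + g2"
proof (induction rule: transports.induct)
  case (chart a c i)
  have "transports p a b (- \<beta> i (p a) + \<beta> i (p b))" "transports p b c (- \<beta> i (p b) + \<beta> i (p c))"
    using chart by (auto intro!: transports.chart)
  then show ?case
    by (intro exI[of _ "- \<beta> i (p a) + \<beta> i (p b)"] exI[of _ "- \<beta> i (p b) + \<beta> i (p c)"])
      (simp add: add.assoc)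
next
  case (compose a x g c h)
  show ?case
  proof (cases "b \<le> x")
    case True
    then obtain g1 g2 where "transports p a b g1" "transports p b x g2" "g = g1 + g2"
      using compose by auto
    then show ?thesis using compose.hyps(2) transports.compose[of p b x g2 c h]
      by (intro exI[of _ g1] exI[of _ "g2 + h"]) (auto simp: add.assoc)
  next
    case False
    then obtain g1 g2 where "transports p x b g1" "transports p b c g2" "h = g1 + g2"
      using compose by auto
    then show ?thesis using compose.hyps(1) transports.compose[of p a x g b g1]
      by (intro exI[of _ "g + g1"] exI[of _ g2]) (auto simp: add.assoc)
  qed
qed

text \<open>A locally constant function on an interval is constant. The overlap of the two charts
  need not be connected, but the piece of path is.\<close>

lemma cocycle_along_path:
  assumes p: "pathin X p" and ij: "i \<in> I" "j \<in> I" and ab: "0 \<le> a" "a \<le> b" "b \<le> 1"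
    and U: "\<And>t. t \<in> {a..b} \<Longrightarrow> p t \<in> U i" "\<And>t. t \<in> {a..b} \<Longrightarrow> p t \<in> U j"
  shows "\<beta> j (p a) - \<beta> i (p a) = \<beta> j (p b) - \<beta> i (p b)"
proof -
  \<comment> \<open>The guards keep both points inside \<open>{a..b}\<close>: \<open>Bolzano\<close>
    also tests short intervals that stick out over the ends.\<close>
  let ?P = "\<lambda>x y. a \<le> x \<longrightarrow> y \<le> b \<longrightarrow> \<beta> j (p x) - \<beta> i (p x) = \<beta> j (p y) - \<beta> i (p y)"
  have "?P a b"
  proof (rule Bolzano[where P = ?P, OF ab(2)])
    fix x assume x: "a \<le> x" "x \<le> b"
    then obtain W where W: "openin X W" "p x \<in> W"
      "\<And>y. y \<in> W \<Longrightarrow> y \<in> U i \<Longrightarrow> y \<in> U j \<Longrightarrow> \<beta> j y - \<beta> i y = \<beta> j (p x) - \<beta> i (p x)"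
      using cocycle[OF ij, of "p x"] U[of x] by auto
    obtain d where d: "d > 0" "\<And>t'. t' \<in> {0..1} \<Longrightarrow> \<bar>t' - x\<bar> < d \<Longrightarrow> p t' \<in> W"
      using pathin_nhd[OF p W(1) _ W(2)] x ab by auto
    have "\<beta> j (p t) - \<beta> i (p t) = \<beta> j (p x) - \<beta> i (p x)" if "a \<le> t" "t \<le> b" "\<bar>t - x\<bar> < d" for t
      using that ab d(2)[of t] W(3)[of "p t"] U[of t] by auto
    note near = this
    have "?P u v" if "u \<le> x \<and> x \<le> v \<and> v - u < d" for u v
      using near[of u] near[of v] that x by (auto simp: abs_if)
    then show "\<exists>d>0. \<forall>u v. u \<le> x \<and> x \<le> v \<and> v - u < d \<longrightarrow> ?P u v"
      using d(1) by blast
  next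
    fix x y z :: real assume "?P x y" "?P y z" "x \<le> y" "y \<le> z"
    then show "?P x z" by auto
  qed
  then show ?thesis by auto
qed

lemma transports_in_chart:
  assumes "transports p a b g" "pathin X p" "i \<in> I" "0 \<le> a" "b \<le> 1"
    and "\<And>t. t \<in> {a..b} \<Longrightarrow> p t \<in> U i"
  shows "g = - \<beta> i (p a) + \<beta> i (p b)"
  using assms
proof (induction rule: transports.induct)
  case (chart a b j)
  have "\<beta> j (p a) - \<beta> i (p a) = \<beta> j (p b) - \<beta> i (p b)"
    by (rule cocycle_along_path) (use chart in auto)
  then have "- \<beta> i (p a) = - \<beta> j (p a) + (\<beta> j (p b) - \<beta> i (p b))"
    by (metis add.assoc add.left_neutral left_minus add_uminus_conv_diff)
  then show ?case by (simp add: add.assoc)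
next
  case (compose a b g c h)
  have "a \<le> b" "b \<le> c" using compose.hyps by (auto dest: transports_le)
  then have "g = - \<beta> i (p a) + \<beta> i (p b)" "h = - \<beta> i (p b) + \<beta> i (p c)"
    using compose by auto
  then show ?case by (simp add: add.assoc)
qed

lemma chart_nhd:
  assumes "pathin X p" "x \<in> {0..1}"
  obtains i d where "i \<in> I" "d > 0" "\<And>t. t \<in> {0..1} \<Longrightarrow> \<bar>t - x\<bar> < d \<Longrightarrow> p t \<in> U i"
proof -
  obtain i where "i \<in> I" "p x \<in> U i" using U_cover[OF path_in_topspace[OF assms]] by auto
  then show ?thesis using that pathin_nhd[OF assms(1) U_open assms(2)] by metis
qed

lemma transports_exists:
  assumes p: "pathin X p" shows "\<exists>g. transports p 0 1 g"
proof -
  let ?P = "\<lambda>x y. 0 \<le> x \<longrightarrow> y \<le> 1 \<longrightarrow> (\<exists>g. transports p x y g)"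
  have "?P 0 1"
  proof (rule Bolzano[where P = ?P])
    fix x :: real assume x: "0 \<le> x" "x \<le> 1"
    obtain i d where d: "i \<in> I" "d > 0" "\<And>t. t \<in> {0..1} \<Longrightarrow> \<bar>t - x\<bar> < d \<Longrightarrow> p t \<in> U i"
      using chart_nhd[OF p] x by auto
    have "?P u v" if "u \<le> x" "x \<le> v" "v - u < d" for u v
      using that d(3) by (auto intro!: exI[of _ "- \<beta> i (p u) + \<beta> i (p v)"] transports.chart[OF _ d(1)])
    then show "\<exists>d>0. \<forall>u v. u \<le> x \<and> x \<le> v \<and> v - u < d \<longrightarrow> ?P u v"
      using d(2) by blast
  next
    fix x y z :: real assume "?P x y" "?P y z" "x \<le> y" "y \<le> z"
    then show "?P x z" using transports.compose by (meson order_trans)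
  qed auto
  then show ?thesis by auto
qed

lemma transports_unique:
  assumes p: "pathin X p" and "transports p 0 1 g" "transports p 0 1 h"
  shows "g = h"
proof -
  let ?P = "\<lambda>x y. 0 \<le> x \<longrightarrow> y \<le> 1 \<longrightarrow> (\<forall>g h. transports p x y g \<longrightarrow> transports p x y h \<longrightarrow> g = h)"
  have "?P 0 1"
  proof (rule Bolzano[where P = ?P])
    fix x :: real assume x: "0 \<le> x" "x \<le> 1"
    obtain i d where d: "i \<in> I" "d > 0" "\<And>t. t \<in> {0..1} \<Longrightarrow> \<bar>t - x\<bar> < d \<Longrightarrow> p t \<in> U i"
      using chart_nhd[OF p] x by auto
    have "g = - \<beta> i (p u) + \<beta> i (p v)"
      if "u \<le> x" "x \<le> v" "v - u < d" "0 \<le> u" "v \<le> 1" "transports p u v g" for u v g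
      using that d(3) by (intro transports_in_chart[OF _ p d(1)]) auto
    then show "\<exists>d>0. \<forall>u v. u \<le> x \<and> x \<le> v \<and> v - u < d \<longrightarrow> ?P u v"
      using d(2) by (intro exI[of _ d]) blast
  next
    fix x y z :: real assume *: "?P x y" "?P y z" "x \<le> y" "y \<le> z"
    show "?P x z"
    proof (intro impI allI)
      fix g h assume 1: "0 \<le> x" "z \<le> 1" "transports p x z g" "transports p x z h"
      \<comment> \<open>Both transports are cut at the common point \<open>y\<close>, although their
        derivations may subdivide the interval differently.\<close>
      obtain g1 g2 where "transports p x y g1" "transports p y z g2" "g = g1 + g2"
        using transports_split[OF 1(3) *(3,4)] by blast
      moreover obtain h1 h2 where "transports p x y h1" "transports p y z h2" "h = h1 + h2"
        using transports_split[OF 1(4) *(3,4)] by blast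
      ultimately show "g = h" using * 1 by (metis order_trans)
    qed
  qed auto
  then show ?thesis using assms by auto
qed

section \<open>Holonomy and its invariance under homotopy\<close>

definition holonomy :: "(real \<Rightarrow> 'a) \<Rightarrow> 'g" where
  "holonomy p = (THE g. transports p 0 1 g)"

lemma holonomy_eqI: "pathin X p \<Longrightarrow> transports p 0 1 g \<Longrightarrow> holonomy p = g"
  unfolding holonomy_def by (rule the_equality) (auto intro: transports_unique)

lemma transports_holonomy: "pathin X p \<Longrightarrow> transports p 0 1 (holonomy p)"
  using transports_exists holonomy_eqI by blast

lemma transports_affine:
  "transports p a b g \<Longrightarrow> k > 0 \<Longrightarrow> (\<And>t. t \<in> {a..b} \<Longrightarrow> q (k * t + d) = p t) \<Longrightarrow>
     transports q (k * a + d) (k * b + d) g"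
proof (induction rule: transports.induct)
  case (chart a b i)
  have "q t \<in> U i" if "t \<in> {k * a + d..k * b + d}" for t
  proof -
    have "(t - d) / k \<in> {a..b}" using that chart.prems(1) by (auto simp: field_simps)
    from chart.prems(2)[OF this] chart.hyps(3)[OF this] chart.prems(1) show ?thesis by simp
  qed
  then have "transports q (k * a + d) (k * b + d) (- \<beta> i (q (k * a + d)) + \<beta> i (q (k * b + d)))"
    using chart by (intro transports.chart) auto
  then show ?case using chart by simp
next
  case (compose a b g c h)
  have "a \<le> b" "b \<le> c" using compose.hyps by (auto dest: transports_le)
  then show ?case using compose by (intro transports.compose[of q _ "k * b + d"]) auto
qed

lemma transports_reverse:
  "transports p a b g \<Longrightarrow> transports (path_rev p) (1 - b) (1 - a) (- g)"
proof (induction rule: transports.induct)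
  case (chart a b i)
  have "transports (path_rev p) (1 - b) (1 - a)
      (- \<beta> i (path_rev p (1 - b)) + \<beta> i (path_rev p (1 - a)))"
    by (rule transports.chart) (use chart in \<open>auto simp: path_rev_def\<close>)
  then show ?case by (simp add: path_rev_def minus_add)
next
  case (compose a b g c h)
  then show ?case using transports.compose[OF compose.IH(2,1)] by (simp add: minus_add)
qed

lemma holonomy_join:
  assumes "pathin X p" "pathin X q" "p 1 = q 0"
  shows "holonomy (path_join p q) = holonomy p + holonomy q"
proof (rule holonomy_eqI)
  show "pathin X (path_join p q)" using assms by (rule pathin_join)
  have "transports (path_join p q) (1/2 * 0 + 0) (1/2 * 1 + 0) (holonomy p)"
    by (rule transports_affine[OF transports_holonomy[OF assms(1)]]) (auto simp: path_join_def)
  moreover have "transports (path_join p q) (1/2 * 0 + 1/2) (1/2 * 1 + 1/2) (holonomy q)"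
    by (rule transports_affine[OF transports_holonomy[OF assms(2)]]) (use assms(3) in \<open>auto simp: path_join_def field_simps\<close>)
  ultimately show "transports (path_join p q) 0 1 (holonomy p + holonomy q)"
    by (intro transports.compose[of _ 0 "1/2"]) auto
qed

lemma holonomy_rev: "pathin X p \<Longrightarrow> holonomy (path_rev p) = - holonomy p"
  using transports_reverse[OF transports_holonomy[of p]] by (intro holonomy_eqI pathin_rev) auto

lemma holonomy_const: "x \<in> topspace X \<Longrightarrow> holonomy (\<lambda>_. x) = 0"
proof (rule holonomy_eqI)
  assume "x \<in> topspace X"
  then obtain i where "i \<in> I" "x \<in> U i" using U_cover by auto
  then show "transports (\<lambda>_. x) 0 1 0" using transports.chart[of 0 1 i "\<lambda>_. x"] by simp
qed simp

text \<open>On a subinterval the transport of the row \<open>s'\<close> varies with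
  \<open>s'\<close>, because the ends of this piece move. Once the potentials of the end charts are
  split off it becomes constant, and this form can be glued; over the whole row the ends are
  fixed.\<close>

lemma holonomy_locally_constant:
  assumes h: "continuous_map (prod_topology unit_interval unit_interval) X h"
    and ends: "\<And>s. s \<in> {0..1} \<Longrightarrow> h (s, 0) = x \<and> h (s, 1) = y" and s: "s \<in> {0..1}"
  shows "\<exists>d>0. \<exists>g. \<forall>s'\<in>{0..1}. \<bar>s' - s\<bar> < d \<longrightarrow> holonomy (\<lambda>t. h (s', t)) = g"
proof -
  let ?row = "\<lambda>s t. h (s, t)"
  \<comment> \<open>The quantifiers are the point: \<open>d\<close>, the two end charts and
    \<open>g\<close> are the same for all rows near \<open>s\<close>.\<close>
  let ?Q = "\<lambda>d i j g a b. \<forall>s'\<in>{0..1}. \<bar>s' - s\<bar> < d \<longrightarrow> h (s', a) \<in> U i \<and> h (s', b) \<in> U j \<and>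
      transports (?row s') a b (- \<beta> i (h (s', a)) + g + \<beta> j (h (s', b)))"
  let ?P = "\<lambda>a b. 0 \<le> a \<longrightarrow> b \<le> 1 \<longrightarrow> (\<exists>d>0. \<exists>i\<in>I. \<exists>j\<in>I. \<exists>g. ?Q d i j g a b)"
  have row: "pathin X (?row s)" if "s \<in> {0..1}" for s
  proof -
    have "continuous_map unit_interval (prod_topology unit_interval unit_interval) (\<lambda>t. (s, t))"
      using that by (auto intro!: continuous_intros)
    from continuous_map_compose[OF this h] show ?thesis by (simp add: pathin_def o_def)
  qed
  have "?P 0 1"
  proof (rule Bolzano[where P = ?P])
    fix t :: real assume t: "0 \<le> t" "t \<le> 1"
    have "h (s, t) \<in> topspace X" using path_in_topspace[OF row[OF s]] t by auto
    then obtain i where i: "i \<in> I" "h (s, t) \<in> U i" using U_cover by auto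
    obtain d where d: "d > 0" "\<And>s' t'. s' \<in> {0..1} \<Longrightarrow> t' \<in> {0..1} \<Longrightarrow> \<bar>s' - s\<bar> < d \<Longrightarrow> \<bar>t' - t\<bar> < d \<Longrightarrow> h (s', t') \<in> U i"
      using square_nhd[OF h U_open[OF i(1)] s _ i(2)] t by auto
    have "?P u v" if uv: "u \<le> t" "t \<le> v" "v - u < d" for u v
    proof (intro impI)
      assume 0: "0 \<le> u" "v \<le> 1"
      have "?Q d i i 0 u v"
      proof (intro ballI impI conjI)
        fix s' :: real assume s': "s' \<in> {0..1}" "\<bar>s' - s\<bar> < d"
        then show "h (s', u) \<in> U i" "h (s', v) \<in> U i" using uv 0 by (auto intro!: d(2))
        have "transports (?row s') u v (- \<beta> i (h (s', u)) + \<beta> i (h (s', v)))"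
          by (rule transports.chart[OF _ i(1)]) (use uv 0 s' in \<open>auto intro!: d(2)\<close>)
        then show "transports (?row s') u v (- \<beta> i (h (s', u)) + 0 + \<beta> i (h (s', v)))" by simp
      qed
      then show "\<exists>d>0. \<exists>i\<in>I. \<exists>j\<in>I. \<exists>g. ?Q d i j g u v" using d(1) i(1) by blast
    qed
    then show "\<exists>d>0. \<forall>u v. u \<le> t \<and> t \<le> v \<and> v - u < d \<longrightarrow> ?P u v" using d(1) by blast
  next
    fix a b c :: real assume *: "?P a b" "?P b c" "a \<le> b" "b \<le> c"
    show "?P a c"
    proof (intro impI)
      assume 0: "0 \<le> a" "c \<le> 1"
      obtain d1 i j g where 1: "d1 > 0" "i \<in> I" "j \<in> I" "?Q d1 i j g a b" using * 0 by force
      obtain d2 k l g' where 2: "d2 > 0" "k \<in> I" "l \<in> I" "?Q d2 k l g' b c" using * 0 by force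
      have jk: "h (s, b) \<in> U j" "h (s, b) \<in> U k" using 1(1,4) 2(1,4) s by auto
      obtain W where W: "openin X W" "h (s, b) \<in> W"
        "\<And>y. y \<in> W \<Longrightarrow> y \<in> U k \<Longrightarrow> y \<in> U j \<Longrightarrow> \<beta> j y - \<beta> k y = \<beta> j (h (s, b)) - \<beta> k (h (s, b))"
        using cocycle[OF 2(2) 1(3) jk(2,1)] by blast
      have b: "b \<in> {0..1}" using * 0 by auto
      obtain d3 where d3: "d3 > 0" "\<And>s' t'. s' \<in> {0..1} \<Longrightarrow> t' \<in> {0..1} \<Longrightarrow> \<bar>s' - s\<bar> < d3 \<Longrightarrow> \<bar>t' - b\<bar> < d3 \<Longrightarrow> h (s', t') \<in> W"
        using square_nhd[OF h W(1) s b W(2)] by blast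
      \<comment> \<open>Two charts meet at the junction; near \<open>(s, b)\<close> the difference
        of their potentials is constant, so it can be absorbed into the new middle term.\<close>
      let ?g = "g + (\<beta> j (h (s, b)) - \<beta> k (h (s, b))) + g'"
      have "?Q (min d1 (min d2 d3)) i l ?g a c"
      proof (intro ballI impI conjI)
        fix s' :: real assume s': "s' \<in> {0..1}" "\<bar>s' - s\<bar> < min d1 (min d2 d3)"
        show "h (s', a) \<in> U i" "h (s', c) \<in> U l" using 1(4) 2(4) s' by auto
        have "h (s', b) \<in> W" using d3 s' b by auto
        then have eq: "\<beta> j (h (s', b)) - \<beta> k (h (s', b)) = \<beta> j (h (s, b)) - \<beta> k (h (s, b))"
          using W(3) 1(4) 2(4) s' by auto
        have "transports (?row s') a c ((- \<beta> i (h (s', a)) + g + \<beta> j (h (s', b))) + (- \<beta> k (h (s', b)) + g' + \<beta> l (h (s', c))))"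
          by (rule transports.compose[of _ a b]) (use 1(4) 2(4) s' in auto)
        moreover have "(- \<beta> i (h (s', a)) + g + \<beta> j (h (s', b))) + (- \<beta> k (h (s', b)) + g' + \<beta> l (h (s', c)))
            = - \<beta> i (h (s', a)) + (g + (\<beta> j (h (s', b)) - \<beta> k (h (s', b))) + g') + \<beta> l (h (s', c))"
          by (simp only: diff_conv_add_uminus add.assoc)
        ultimately show "transports (?row s') a c (- \<beta> i (h (s', a)) + ?g + \<beta> l (h (s', c)))"
          by (simp only: eq)
      qed
      then show "\<exists>d>0. \<exists>i\<in>I. \<exists>j\<in>I. \<exists>g. ?Q d i j g a c"
        using 1(1,2) 2(1,3) d3(1)
        by (intro exI[of _ "min d1 (min d2 d3)"] conjI bexI[of _ i] bexI[of _ l] exI[of _ ?g]) simp_all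
    qed
  qed auto
  then obtain d i j g where "d > 0" "?Q d i j g 0 1" by auto
  then show ?thesis using ends row
    by (intro exI[of _ d] conjI exI[of _ "- \<beta> i x + g + \<beta> j y"]) (auto intro!: holonomy_eqI)
qed

lemma holonomy_homotopic:
  assumes "path_homotopic X p q" shows "holonomy p = holonomy q"
proof -
  obtain h where h: "continuous_map (prod_topology unit_interval unit_interval) X h"
    and pq: "\<And>t. t \<in> {0..1} \<Longrightarrow> h (0, t) = p t \<and> h (1, t) = q t"
    and ends: "\<And>s. s \<in> {0..1} \<Longrightarrow> h (s, 0) = p 0 \<and> h (s, 1) = p 1"
    using assms unfolding path_homotopic_iff by blast
  \<comment> \<open>A homotopy determines its end paths only on \<open>{0..1}\<close>, whereas paths
    are functions on all reals.\<close>
  have cong: "holonomy r = holonomy r'" if "pathin X r" "pathin X r'" "\<And>t. t \<in> {0..1} \<Longrightarrow> r t = r' t" for r r'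
  proof -
    have "transports r' (1 * 0 + 0) (1 * 1 + 0) (holonomy r)"
      by (rule transports_affine[OF transports_holonomy[OF that(1)]]) (use that(3) in auto)
    then show ?thesis using that(2) holonomy_eqI by simp
  qed
  let ?P = "\<lambda>a b. 0 \<le> a \<longrightarrow> b \<le> 1 \<longrightarrow> holonomy (\<lambda>t. h (a, t)) = holonomy (\<lambda>t. h (b, t))"
  have "?P 0 1"
  proof (rule Bolzano[where P = ?P])
    fix s :: real assume s: "0 \<le> s" "s \<le> 1"
    obtain d g where "d > 0" "\<forall>s'\<in>{0..1}. \<bar>s' - s\<bar> < d \<longrightarrow> holonomy (\<lambda>t. h (s', t)) = g"
      using holonomy_locally_constant[OF h ends, of s] s by auto
    then show "\<exists>d>0. \<forall>u v. u \<le> s \<and> s \<le> v \<and> v - u < d \<longrightarrow> ?P u v"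
      using s by (intro exI[of _ d]) auto
  qed auto
  moreover have "pathin X (\<lambda>t. h (s, t))" if "s \<in> {0..1}" for s
  proof -
    have "continuous_map unit_interval (prod_topology unit_interval unit_interval) (\<lambda>t. (s, t))"
      using that by (auto intro!: continuous_intros)
    from continuous_map_compose[OF this h] show ?thesis by (simp add: pathin_def o_def)
  qed
  ultimately show ?thesis
    using cong[of p "\<lambda>t. h (0, t)"] cong[of "\<lambda>t. h (1, t)" q] pq path_homotopic_imp_pathin[OF assms] by auto
qed

end

section \<open>Configuration spaces of graphs\<close>

lemma edge_point_simps [simp]:
  "edge_point G e 0 = Vertex (tail G e)" "edge_point G e 1 = Vertex (head G e)"
  by (auto simp: edge_point_def)

lemma edge_point_interior: "0 < t \<Longrightarrow> t < 1 \<Longrightarrow> edge_point G e t = Interior e t"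
  by (simp add: edge_point_def)

lemma edge_point_in_graph_points:
  assumes "wf_digraph G" "e \<in> arcs G" "t \<in> {0..1}"
  shows "edge_point G e t \<in> graph_points G"
  using assms by (auto simp: edge_point_def graph_points_def wf_digraph_def)

lemma continuous_map_edge_point:
  assumes "wf_digraph G" "e \<in> arcs G"
  shows "continuous_map unit_interval (graph_space G) (edge_point G e)"
  using assms unfolding continuous_map
  by (auto simp: topspace_graph_space openin_graph_space edge_point_in_graph_points)

lemma self_in_cell_carrier: "g \<in> graph_points G \<Longrightarrow> g \<in> cell_carrier G g"
  by (cases g) (auto simp: graph_points_def edge_point_def image_iff intro: bexI[of _ "_ :: real"])

lemma cell_carrier_edge_point: "u \<in> {0..1} \<Longrightarrow> cell_carrier G (edge_point G e u) \<subseteq> edge_point G e ` {0..1}"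
  using imageI[of 0 "{0..1}" "edge_point G e"] imageI[of 1 "{0..1}" "edge_point G e"]
  by (auto simp: edge_point_def[of _ _ u])

lemma locally_compact_unit_interval: "locally_compact_space unit_interval"
  by (intro compact_imp_locally_compact_space compact_space_subtopology) simp

text \<open>Continuity on a graph times an interval may be tested edge by edge: the graph is a
  quotient of a disjoint union of intervals, and multiplying a quotient map by the locally compact
  interval keeps it a quotient map.\<close>

lemma continuous_map_graph_prod:
  assumes G: "wf_digraph G" and W: "openin (graph_space G) W"
    and vert: "\<And>v. Vertex v \<in> W \<Longrightarrow> continuous_map unit_interval Y (\<lambda>s. F (Vertex v, s))"
    and edge: "\<And>e. e \<in> arcs G \<Longrightarrow>
      continuous_map (top_of_set ({t \<in> {0..1}. edge_point G e t \<in> W} \<times> {0..1})) Y (\<lambda>(t, s). F (edge_point G e t, s))"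
  shows "continuous_map (prod_topology (subtopology (graph_space G) W) unit_interval) Y F"
proof -
  \<comment> \<open>Every vertex also gets an interval, on which \<open>\<pi>\<close> is constant;
    so the disjoint union is simply a product with a discrete space.\<close>
  define K where "K = (Inl ` verts G \<union> Inr ` arcs G :: ('a + 'b) set)"
  define D where "D = prod_topology (discrete_topology K) unit_interval"
  define \<pi> where "\<pi> = (\<lambda>(k :: 'a + 'b, t). case k of Inl v \<Rightarrow> Vertex v | Inr e \<Rightarrow> edge_point G e t)"
  have topD: "topspace D = K \<times> {0..1}" by (simp add: D_def)
  have slice: "openin unit_interval {t \<in> {0..1}. (k, t) \<in> A}" if A: "openin D A" "k \<in> K" for A k
  proof -
    have "continuous_map unit_interval D (\<lambda>t. (k, t))"
      unfolding D_def using A(2) by (auto intro!: continuous_intros)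
    from openin_continuous_map_preimage[OF this A(1)] show ?thesis by simp
  qed
  have slices: "openin D A" if A: "A \<subseteq> K \<times> {0..1}" "\<And>k. k \<in> K \<Longrightarrow> openin unit_interval {t \<in> {0..1}. (k, t) \<in> A}" for A
  proof -
    have "A = (\<Union>k\<in>K. {k} \<times> {t \<in> {0..1}. (k, t) \<in> A})" using A(1) by auto
    moreover have "openin D ({k} \<times> {t \<in> {0..1}. (k, t) \<in> A})" if "k \<in> K" for k
      unfolding D_def openin_prod_Times_iff using A(2)[OF that] that by simp
    then have "openin D (\<Union>k\<in>K. {k} \<times> {t \<in> {0..1}. (k, t) \<in> A})" by auto
    ultimately show ?thesis by simp
  qed
  have img: "\<pi> ` topspace D = graph_points G"
  proof
    show "\<pi> ` topspace D \<subseteq> graph_points G"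
    proof (clarsimp simp: topD)
      fix k and t :: real assume "k \<in> K" "0 \<le> t" "t \<le> 1"
      then show "\<pi> (k, t) \<in> graph_points G"
        using edge_point_in_graph_points[OF G, of _ t]
        by (cases k) (auto simp: K_def \<pi>_def, simp add: graph_points_def)
    qed
    show "graph_points G \<subseteq> \<pi> ` topspace D"
    proof
      fix g assume "g \<in> graph_points G"
      then consider v where "v \<in> verts G" "g = Vertex v"
        | e t where "e \<in> arcs G" "0 < t" "t < 1" "g = Interior e t" by (auto simp: graph_points_def)
      then show "g \<in> \<pi> ` topspace D"
      proof cases
        case 1
        then show ?thesis by (intro image_eqI[of _ _ "(Inl v, 0)"]) (auto simp: \<pi>_def topD K_def)
      next
        case 2
        then show ?thesis
          by (intro image_eqI[of _ _ "(Inr e, t)"]) (auto simp: \<pi>_def topD K_def edge_point_interior)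
      qed
    qed
  qed
  have quo: "quotient_map D (graph_space G) \<pi>"
    unfolding quotient_map_def
  proof (intro conjI allI impI)
    show "\<pi> ` topspace D = topspace (graph_space G)" using img by (simp add: topspace_graph_space[OF G])
    fix U assume "U \<subseteq> topspace (graph_space G)"
    then have U: "U \<subseteq> graph_points G" by (simp add: topspace_graph_space[OF G])
    show "openin D {x \<in> topspace D. \<pi> x \<in> U} \<longleftrightarrow> openin (graph_space G) U"
    proof
      assume L: "openin D {x \<in> topspace D. \<pi> x \<in> U}"
      show "openin (graph_space G) U"
        unfolding openin_graph_space
      proof (intro conjI U ballI)
        fix e assume e: "e \<in> arcs G"
        have "{t \<in> {0..1}. (Inr e, t) \<in> {x \<in> topspace D. \<pi> x \<in> U}} = {t \<in> {0..1}. edge_point G e t \<in> U}"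
          using e by (auto simp: topD K_def \<pi>_def)
        then show "openin unit_interval {t \<in> {0..1}. edge_point G e t \<in> U}"
          using slice[OF L, of "Inr e"] e by (simp add: K_def)
      qed
    next
      assume R: "openin (graph_space G) U"
      show "openin D {x \<in> topspace D. \<pi> x \<in> U}"
      proof (rule slices)
        fix k assume k: "k \<in> K"
        show "openin unit_interval {t \<in> {0..1}. (k, t) \<in> {x \<in> topspace D. \<pi> x \<in> U}}"
        proof (cases k)
          case (Inl v)
          have "{t \<in> {0..1}. (k, t) \<in> {x \<in> topspace D. \<pi> x \<in> U}} = (if Vertex v \<in> U then {0..1} else {})"
            using k Inl by (auto simp: topD \<pi>_def)
          then show ?thesis by simp
        next
          case (Inr e)
          have "{t \<in> {0..1}. (k, t) \<in> {x \<in> topspace D. \<pi> x \<in> U}} = {t \<in> {0..1}. edge_point G e t \<in> U}"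
            using k Inr by (auto simp: topD \<pi>_def)
          then show ?thesis using R k Inr by (auto simp: openin_graph_space K_def)
        qed
      qed (auto simp: topD)
    qed
  qed
  let ?V = "{x \<in> topspace D. \<pi> x \<in> W}"
  have "quotient_map (subtopology D ?V) (subtopology (graph_space G) W) \<pi>"
    by (rule quotient_map_restriction[OF quo refl]) (use W in simp)
  then have quo': "quotient_map (prod_topology (subtopology D ?V) unit_interval)
      (prod_topology (subtopology (graph_space G) W) unit_interval) (\<lambda>(x, y). (\<pi> x, y))"
    by (intro quotient_map_prod_left locally_compact_unit_interval)
      (auto simp: Hausdorff_space_subtopology)
  have "continuous_map (prod_topology (subtopology D ?V) unit_interval) Y (F \<circ> (\<lambda>(x, y). (\<pi> x, y)))"
    unfolding continuous_map
  proof (intro conjI allI impI)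
    let ?T = "prod_topology (subtopology D ?V) unit_interval"
    have topT: "topspace ?T = ?V \<times> {0..1}" by (auto simp: topD)
    have V: "(k, t) \<in> ?V \<longleftrightarrow> (k \<in> K \<and> t \<in> {0..1} \<and> \<pi> (k, t) \<in> W)" for k t by (auto simp: topD)
    show "(F \<circ> (\<lambda>(x, y). (\<pi> x, y))) ` topspace ?T \<subseteq> topspace Y"
    proof (clarsimp simp del: atLeastAtMost_iff simp add: topD)
      fix k t s assume *: "k \<in> K" "t \<in> {0..1}" "\<pi> (k, t) \<in> W" "s \<in> {0..1::real}"
      show "F (\<pi> (k, t), s) \<in> topspace Y"
      proof (cases k)
        case (Inl v)
        then show ?thesis using continuous_map_image_subset_topspace[OF vert[of v]] * by (auto simp: \<pi>_def)
      next
        case (Inr e)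
        then have "e \<in> arcs G" using *(1) by (auto simp: K_def)
        from subsetD[OF continuous_map_image_subset_topspace[OF edge[OF this]] imageI[of "(t, s)"]]
        show ?thesis using * Inr by (auto simp: \<pi>_def)
      qed
    qed
    fix O' assume O': "openin Y O'"
    let ?A = "{x \<in> topspace ?T. (F \<circ> (\<lambda>(x, y). (\<pi> x, y))) x \<in> O'}"
    \<comment> \<open>Openness is local, and near \<open>x\<close> the index \<open>k\<close> is
      constant, so a single vertex or edge is involved.\<close>
    have "\<exists>B. openin ?T B \<and> x \<in> B \<and> B \<subseteq> ?A" if x: "x \<in> ?A" for x
    proof -
      obtain k t s where kts: "x = ((k, t), s)" by (metis surj_pair)
      have k: "k \<in> K" "t \<in> {0..1}" "s \<in> {0..1}" "\<pi> (k, t) \<in> W" "F (\<pi> (k, t), s) \<in> O'"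
        using x kts by (auto simp: topD)
      have c1: "continuous_map ?T (discrete_topology K) (\<lambda>x. fst (fst x))"
        "continuous_map ?T unit_interval (\<lambda>x. snd (fst x))" "continuous_map ?T unit_interval snd"
      proof -
        have "continuous_map ?T D fst"
          using continuous_map_fst[of "subtopology D ?V" unit_interval] by (simp add: continuous_map_in_subtopology)
        then show "continuous_map ?T (discrete_topology K) (\<lambda>x. fst (fst x))"
          "continuous_map ?T unit_interval (\<lambda>x. snd (fst x))"
          using continuous_map_compose[of ?T D fst _ fst] continuous_map_compose[of ?T D fst _ snd]
            continuous_map_fst[of "discrete_topology K" unit_interval] continuous_map_snd[of "discrete_topology K" unit_interval]
          by (auto simp: D_def o_def)
      qed (rule continuous_map_snd)
      have fk: "openin ?T {x \<in> topspace ?T. fst (fst x) \<in> {k}}"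
        by (rule openin_continuous_map_preimage[OF c1(1)]) (use k in simp)
      show ?thesis
      proof (cases k)
        case (Inl v)
        have "openin unit_interval {s \<in> {0..1}. F (Vertex v, s) \<in> O'}"
          using openin_continuous_map_preimage[OF vert O', of v] k Inl by (simp add: \<pi>_def)
        from openin_continuous_map_preimage[OF c1(3) this]
        have "openin ?T ({x \<in> topspace ?T. fst (fst x) \<in> {k}} \<inter> {x \<in> topspace ?T. snd x \<in> {s \<in> {0..1}. F (Vertex v, s) \<in> O'}})"
          using fk by (rule openin_Int[rotated])
        moreover have "x \<in> {x \<in> topspace ?T. fst (fst x) \<in> {k}} \<inter> {x \<in> topspace ?T. snd x \<in> {s \<in> {0..1}. F (Vertex v, s) \<in> O'}}"
          using x k kts Inl by (auto simp: \<pi>_def)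
        ultimately show ?thesis using Inl
          by (intro exI[of _ "{x \<in> topspace ?T. fst (fst x) \<in> {k}} \<inter> {x \<in> topspace ?T. snd x \<in> {s \<in> {0..1}. F (Vertex v, s) \<in> O'}}"])
            (auto simp: \<pi>_def)
      next
        case (Inr e)
        let ?P = "{t \<in> {0..1}. edge_point G e t \<in> W}"
        have e: "e \<in> arcs G" using k Inr by (auto simp: K_def)
        have P: "openin unit_interval ?P" using W e by (auto simp: openin_graph_space)
        have "openin (top_of_set (?P \<times> {0..1})) {x \<in> ?P \<times> {0..1}. (\<lambda>(t, s). F (edge_point G e t, s)) x \<in> O'}"
          using openin_continuous_map_preimage[OF edge[OF e] O'] by simp
        moreover have "openin (prod_topology unit_interval unit_interval) (?P \<times> {0..1})"
          unfolding openin_prod_Times_iff using P by simp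
        ultimately have "openin (prod_topology unit_interval unit_interval) {x \<in> ?P \<times> {0..1}. (\<lambda>(t, s). F (edge_point G e t, s)) x \<in> O'}"
          by (simp del: prod_topology_subtopology_eu add: prod_topology_subtopology_eu[symmetric]) (auto elim: openin_trans simp: prod_topology_subtopology_eu)
        from openin_continuous_map_preimage[OF continuous_map_pairedI[OF c1(2,3)] this]
        have "openin ?T ({x \<in> topspace ?T. fst (fst x) \<in> {k}} \<inter> {x \<in> topspace ?T. (snd (fst x), snd x) \<in> {x \<in> ?P \<times> {0..1}. (\<lambda>(t, s). F (edge_point G e t, s)) x \<in> O'}})"
          using fk by (rule openin_Int[rotated])
        moreover have "x \<in> {x \<in> topspace ?T. fst (fst x) \<in> {k}} \<inter> {x \<in> topspace ?T. (snd (fst x), snd x) \<in> {x \<in> ?P \<times> {0..1}. (\<lambda>(t, s). F (edge_point G e t, s)) x \<in> O'}}"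
          using x k kts Inr by (auto simp: \<pi>_def)
        moreover have "{x \<in> topspace ?T. fst (fst x) \<in> {k}} \<inter> {x \<in> topspace ?T. (snd (fst x), snd x) \<in> {x \<in> ?P \<times> {0..1}. (\<lambda>(t, s). F (edge_point G e t, s)) x \<in> O'}} \<subseteq> ?A"
          using Inr by (auto simp: \<pi>_def)
        ultimately show ?thesis by blast
      qed
    qed
    then show "openin ?T ?A" by (subst openin_subopen) blast
  qed
  then show ?thesis using continuous_compose_quotient_map[OF quo'] by blast
qed

section \<open>Points of configuration spaces, and continuous families of them\<close>

lemma in_topspace_conf_space:
  assumes "wf_digraph G"
  shows "x \<in> topspace (conf_space n G) \<longleftrightarrow> x \<in> {..<n} \<rightarrow>\<^sub>E graph_points G \<and>
    (\<forall>i<n. \<forall>j<n. i \<noteq> j \<longrightarrow> cell_carrier G (x i) \<inter> cell_carrier G (x j) = {})"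
  using assms by (auto simp: conf_space_def topspace_graph_space)

definition is_config :: "nat \<Rightarrow> ('v, 'e) pre_digraph \<Rightarrow> ('v, 'e) gpoint set \<Rightarrow> bool" where
  "is_config n G S \<longleftrightarrow> finite S \<and> card S = n \<and> S \<subseteq> graph_points G \<and>
     (\<forall>g\<in>S. \<forall>h\<in>S. g \<noteq> h \<longrightarrow> cell_carrier G g \<inter> cell_carrier G h = {})"

lemma conf_space_image_config:
  assumes G: "wf_digraph G" and x: "x \<in> topspace (conf_space n G)"
  shows "is_config n G (x ` {..<n})" "inj_on x {..<n}"
proof -
  have x': "x \<in> {..<n} \<rightarrow>\<^sub>E graph_points G" "\<And>i j. i < n \<Longrightarrow> j < n \<Longrightarrow> i \<noteq> j \<Longrightarrow> cell_carrier G (x i) \<inter> cell_carrier G (x j) = {}"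
    using x by (auto simp: in_topspace_conf_space[OF G])
  show inj: "inj_on x {..<n}"
  proof (rule inj_onI, rule ccontr)
    fix i j assume "i \<in> {..<n}" "j \<in> {..<n}" "x i = x j" "i \<noteq> j"
    \<comment> \<open>A point lies in its own carrier, so equal coordinates would make two carriers
      meet.\<close>
    moreover from this have "x i \<in> cell_carrier G (x i)" using x'(1) by (auto intro!: self_in_cell_carrier)
    ultimately show False using x'(2)[of i j] by auto
  qed
  show "is_config n G (x ` {..<n})"
    using x' inj unfolding is_config_def by (auto simp: card_image)
qed

lemma config_lift:
  assumes G: "wf_digraph G" and S: "is_config n G S"
  obtains x where "x \<in> topspace (conf_space n G)" "S = x ` {..<n}" "inj_on x {..<n}"
proof -
  obtain f where f: "bij_betw f {..<n} S"
    using S ex_bij_betw_nat_finite[of S] unfolding is_config_def by (auto simp: atLeast0LessThan)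
  let ?x = "restrict f {..<n}"
  have 1: "?x ` {..<n} = S" "inj_on ?x {..<n}" using f by (auto simp: bij_betw_def inj_on_def)
  have "?x \<in> topspace (conf_space n G)"
    unfolding in_topspace_conf_space[OF G]
  proof (intro conjI allI impI)
    show "?x \<in> {..<n} \<rightarrow>\<^sub>E graph_points G" using 1(1) S by (auto simp: is_config_def)
    fix i j assume "i < n" "j < n" "i \<noteq> j"
    then have "?x i \<in> S" "?x j \<in> S" "?x i \<noteq> ?x j" using 1 by (auto dest: inj_onD)
    then show "cell_carrier G (?x i) \<inter> cell_carrier G (?x j) = {}" using S by (auto simp: is_config_def)
  qed
  with 1 show ?thesis using that by metis
qed

lemma in_topspace_uconf_space:
  assumes "wf_digraph G"
  shows "S \<in> topspace (uconf_space n G) \<longleftrightarrow> is_config n G S"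
  unfolding uconf_space_def topspace_quotient_topology
  using conf_space_image_config[OF assms] config_lift[OF assms] by (metis (no_types, lifting) image_iff)

lemma quotient_map_uconf: "quotient_map (conf_space n G) (uconf_space n G) (\<lambda>x. x ` {..<n})"
  unfolding uconf_space_def by (rule quotient_map_quotient_topology)

lemma continuous_map_coordinate:
  "i < n \<Longrightarrow> continuous_map (conf_space n G) (graph_space G) (\<lambda>x. x i)"
  unfolding conf_space_def
  by (intro continuous_map_from_subtopology continuous_map_product_projection) simp

lemma openin_uconfI:
  assumes "U \<subseteq> topspace (uconf_space n G)"
    "openin (conf_space n G) {x \<in> topspace (conf_space n G). x ` {..<n} \<in> U}"
  shows "openin (uconf_space n G) U"
  using quotient_map_uconf[of n G] assms unfolding quotient_map_def by blast

lemma openin_uconf_subset: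
  assumes G: "wf_digraph G" and W: "openin (graph_space G) W"
  shows "openin (uconf_space n G) {S \<in> topspace (uconf_space n G). S \<subseteq> W}"
proof -
  have "openin (conf_space n G) ((\<Inter>i\<in>{..<n}. {x \<in> topspace (conf_space n G). x i \<in> W}) \<inter> topspace (conf_space n G))"
    by (intro openin_INT) (auto intro!: openin_continuous_map_preimage[OF continuous_map_coordinate W])
  moreover have "(\<Inter>i\<in>{..<n}. {x \<in> topspace (conf_space n G). x i \<in> W}) \<inter> topspace (conf_space n G)
      = {x \<in> topspace (conf_space n G). x ` {..<n} \<in> {S \<in> topspace (uconf_space n G). S \<subseteq> W}}"
    by (auto simp: in_topspace_uconf_space[OF G] conf_space_image_config[OF G])
  ultimately show ?thesis by (intro openin_uconfI) auto
qed

lemma openin_uconf_meets: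
  assumes G: "wf_digraph G" and W: "openin (graph_space G) W"
  shows "openin (uconf_space n G) {S \<in> topspace (uconf_space n G). S \<inter> W \<noteq> {}}"
proof -
  have "openin (conf_space n G) (\<Union>i\<in>{..<n}. {x \<in> topspace (conf_space n G). x i \<in> W})"
    by (intro openin_Union) (auto intro!: openin_continuous_map_preimage[OF continuous_map_coordinate W])
  moreover have "(\<Union>i\<in>{..<n}. {x \<in> topspace (conf_space n G). x i \<in> W})
      = {x \<in> topspace (conf_space n G). x ` {..<n} \<in> {S \<in> topspace (uconf_space n G). S \<inter> W \<noteq> {}}}"
    by (auto simp: in_topspace_uconf_space[OF G] conf_space_image_config[OF G])
  ultimately show ?thesis by (intro openin_uconfI) auto
qed

lemma continuous_map_into_conf:
  assumes G: "wf_digraph G"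
    and f: "\<And>i. i < n \<Longrightarrow> continuous_map Z (graph_space G) (f i)"
    and disj: "\<And>z i j. z \<in> topspace Z \<Longrightarrow> i < n \<Longrightarrow> j < n \<Longrightarrow> i \<noteq> j \<Longrightarrow>
       cell_carrier G (f i z) \<inter> cell_carrier G (f j z) = {}"
  shows "continuous_map Z (conf_space n G) (\<lambda>z. restrict (\<lambda>i. f i z) {..<n})"
  unfolding conf_space_def continuous_map_in_subtopology continuous_map_componentwise
  using f disj by auto

lemma continuous_map_into_uconf:
  assumes G: "wf_digraph G"
    and f: "\<And>i. i < n \<Longrightarrow> continuous_map Z (graph_space G) (f i)"
    and disj: "\<And>z i j. z \<in> topspace Z \<Longrightarrow> i < n \<Longrightarrow> j < n \<Longrightarrow> i \<noteq> j \<Longrightarrow>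
       cell_carrier G (f i z) \<inter> cell_carrier G (f j z) = {}"
  shows "continuous_map Z (uconf_space n G) (\<lambda>z. (\<lambda>i. f i z) ` {..<n})"
proof -
  have "continuous_map Z (uconf_space n G) ((\<lambda>x. x ` {..<n}) \<circ> (\<lambda>z. restrict (\<lambda>i. f i z) {..<n}))"
    by (rule continuous_map_compose[OF continuous_map_into_conf[OF assms] quotient_imp_continuous_map[OF quotient_map_uconf]])
  then show ?thesis by (simp add: o_def)
qed

text \<open>Particles that stay in the carriers they start in cannot collide, since the carriers of
  \<open>S\<close> are disjoint; only conditions on single particles remain.\<close>

lemma continuous_map_spread:
  assumes G: "wf_digraph G" and S: "is_config n G S"
    and f: "\<And>g. g \<in> S \<Longrightarrow> continuous_map Z (graph_space G) (f g)"
    and carrier: "\<And>g z. g \<in> S \<Longrightarrow> z \<in> topspace Z \<Longrightarrow> cell_carrier G (f g z) \<subseteq> cell_carrier G g"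
  shows "continuous_map Z (uconf_space n G) (\<lambda>z. (\<lambda>g. f g z) ` S)"
proof -
  obtain x where x: "x \<in> topspace (conf_space n G)" "S = x ` {..<n}" "inj_on x {..<n}"
    by (rule config_lift[OF G S])
  have "continuous_map Z (uconf_space n G) (\<lambda>z. (\<lambda>i. f (x i) z) ` {..<n})"
  proof (rule continuous_map_into_uconf[OF G])
    fix z i j assume *: "z \<in> topspace Z" "i < n" "j < n" "i \<noteq> j"
    then have "x i \<in> S" "x j \<in> S" "x i \<noteq> x j" using x(2,3) by (auto dest: inj_onD)
    then have "cell_carrier G (x i) \<inter> cell_carrier G (x j) = {}" using S by (auto simp: is_config_def)
    then show "cell_carrier G (f (x i) z) \<inter> cell_carrier G (f (x j) z) = {}"
      using carrier[of "x i" z] carrier[of "x j" z] * x(2) by auto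
  qed (use f x(2) in auto)
  then show ?thesis by (simp add: x(2) image_image)
qed

text \<open>One map \<open>r\<close> that moves single particles in time acts on all configurations
  in \<open>W\<close> at once. Joint continuity in configuration and time again passes through a
  quotient map times the interval, here the quotient by the symmetric group.\<close>

lemma continuous_map_uconf_prod:
  assumes G: "wf_digraph G" and W: "openin (graph_space G) W"
    and r: "continuous_map (prod_topology (subtopology (graph_space G) W) unit_interval) (graph_space G) r"
    and carrier: "\<And>g s. g \<in> W \<Longrightarrow> s \<in> {0..1} \<Longrightarrow> cell_carrier G (r (g, s)) \<subseteq> cell_carrier G g"
  shows "continuous_map
    (prod_topology (subtopology (uconf_space n G) {S \<in> topspace (uconf_space n G). S \<subseteq> W}) unit_interval)
    (uconf_space n G) (\<lambda>(S, s). (\<lambda>g. r (g, s)) ` S)"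
proof -
  let ?U = "{S \<in> topspace (uconf_space n G). S \<subseteq> W}"
  let ?q = "\<lambda>x :: nat \<Rightarrow> _. x ` {..<n}"
  let ?V = "{x \<in> topspace (conf_space n G). ?q x \<in> ?U}"
  have quo: "quotient_map (prod_topology (subtopology (conf_space n G) ?V) unit_interval)
      (prod_topology (subtopology (uconf_space n G) ?U) unit_interval) (\<lambda>(x, y). (?q x, y))"
    by (intro quotient_map_prod_left quotient_map_restriction[OF quotient_map_uconf refl] disjI1 openin_uconf_subset[OF G W]
        locally_compact_unit_interval)
      (auto simp: Hausdorff_space_subtopology)
  let ?Z = "prod_topology (subtopology (conf_space n G) ?V) unit_interval"
  have topZ: "topspace ?Z = ?V \<times> {0..1}" by auto
  have "continuous_map ?Z (uconf_space n G) (\<lambda>z. (\<lambda>i. r (fst z i, snd z)) ` {..<n})"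
  proof (rule continuous_map_into_uconf[OF G])
    fix i assume i: "i < n"
    have "continuous_map ?Z (prod_topology (subtopology (graph_space G) W) unit_interval) (\<lambda>z. (fst z i, snd z))"
    proof (intro continuous_map_pairedI)
      have "continuous_map (subtopology (conf_space n G) ?V) (graph_space G) (\<lambda>x. x i)"
        by (intro continuous_map_from_subtopology continuous_map_coordinate i)
      then have "continuous_map ?Z (graph_space G) (\<lambda>z. fst z i)"
        by (rule continuous_map_compose[OF continuous_map_fst, unfolded o_def])
      then show "continuous_map ?Z (subtopology (graph_space G) W) (\<lambda>z. fst z i)"
        by (rule continuous_map_into_subtopology) (use i in auto)
    qed (rule continuous_map_snd)
    from continuous_map_compose[OF this r]
    show "continuous_map ?Z (graph_space G) (\<lambda>z. r (fst z i, snd z))" by (simp add: o_def)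
  next
    fix z i j assume *: "z \<in> topspace ?Z" "i < n" "j < n" "i \<noteq> j"
    then have z: "fst z \<in> topspace (conf_space n G)" "fst z i \<in> W" "fst z j \<in> W" "snd z \<in> {0..1}" by auto
    then have "cell_carrier G (fst z i) \<inter> cell_carrier G (fst z j) = {}"
      using * by (simp add: in_topspace_conf_space[OF G])
    then show "cell_carrier G (r (fst z i, snd z)) \<inter> cell_carrier G (r (fst z j, snd z)) = {}"
      using carrier[OF z(2,4)] carrier[OF z(3,4)] by blast
  qed
  moreover have "(\<lambda>z. (\<lambda>i. r (fst z i, snd z)) ` {..<n}) = (\<lambda>(S, s). (\<lambda>g. r (g, s)) ` S) \<circ> (\<lambda>(x, y). (?q x, y))"
    by (simp add: fun_eq_iff image_image)
  ultimately show ?thesis by (intro continuous_compose_quotient_map[OF quo]) simp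
qed

text \<open>Associative without side conditions, since a composite of non-composable classes is empty.\<close>

definition path_comp :: "'a topology \<Rightarrow> (real \<Rightarrow> 'a) set \<Rightarrow> (real \<Rightarrow> 'a) set \<Rightarrow> (real \<Rightarrow> 'a) set" where
  "path_comp X A B = (\<Union>p\<in>A. \<Union>q\<in>{q\<in>B. p 1 = q 0}. path_class X (path_join p q))"

section \<open>Composition of homotopy classes of paths\<close>

lemma pathin_joinD:
  assumes "pathin X (path_join p q)" "p 1 = q 0"
  shows "pathin X p" "pathin X q"
proof -
  have "pathin X (\<lambda>t. path_join p q (t / 2))" "pathin X (\<lambda>t. path_join p q (t / 2 + 1/2))"
    by (auto intro!: pathin_reparam[OF assms(1)] continuous_intros)
  moreover have "path_join p q (t / 2) = p t" if "t \<in> {0..1}" for t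
    using that by (simp add: path_join_def)
  moreover have "path_join p q (t / 2 + 1/2) = q t" if "t \<in> {0..1}" for t
    using that assms(2) by (auto simp: path_join_def)
  ultimately show "pathin X p" "pathin X q" unfolding pathin_def
    using continuous_map_eq[of unit_interval X _ p] continuous_map_eq[of unit_interval X _ q] by auto
qed

lemma path_class_eq: "path_homotopic X p q \<Longrightarrow> path_class X p = path_class X q"
  using path_class_eq_iff path_homotopic_imp_pathin by blast

lemma path_class_empty: "\<not> pathin X p \<Longrightarrow> path_class X p = {}"
  by (auto simp: path_class_def dest: path_homotopic_imp_pathin)

text \<open>Continuity is not assumed: the class of a discontinuous path is empty, and then both
  sides are empty.\<close>

lemma path_class_join:
  assumes "p 1 = q 0"
  shows "path_class X (path_join p q) = path_comp X (path_class X p) (path_class X q)"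
proof (cases "pathin X (path_join p q)")
  case True
  then have pq: "pathin X p" "pathin X q" using pathin_joinD assms by auto
  have "path_class X (path_join p' q') = path_class X (path_join p q)"
    if "p' \<in> path_class X p" "q' \<in> path_class X q" for p' q'
    by (rule path_class_eq[OF path_homotopic_sym[OF path_homotopic_join]])
      (use that assms in \<open>auto simp: path_class_def\<close>)
  moreover have "p \<in> path_class X p" "q \<in> path_class X q"
    using pq by (auto simp: path_class_def path_homotopic_refl)
  ultimately show ?thesis unfolding path_comp_def using assms by blast
next
  case False
  then have "\<not> pathin X p \<or> \<not> pathin X q" using assms pathin_join by blast
  then show ?thesis using False by (auto simp: path_comp_def path_class_empty)
qed

lemma path_class_member:
  assumes "q \<in> path_class X p"
  shows "path_class X q = path_class X p" "q 0 = p 0" "q 1 = p 1" "pathin X p" "pathin X q"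
  using assms path_class_eq[of X p q] path_homotopic_ends[of X p q] path_homotopic_imp_pathin[of X p q]
  by (auto simp: path_class_def)

lemma path_comp_assoc_class:
  "path_comp X (path_comp X (path_class X p) (path_class X q)) (path_class X r)
   = path_comp X (path_class X p) (path_comp X (path_class X q) (path_class X r))"
proof (cases "p 1 = q 0 \<and> q 1 = r 0 \<and> pathin X p \<and> pathin X q \<and> pathin X r")
  case True
  then have "path_class X (path_join (path_join p q) r) = path_class X (path_join p (path_join q r))"
    by (intro path_class_eq path_join_assoc) auto
  then show ?thesis using True by (simp add: path_class_join)
next
  case False
  have e: "path_comp X (path_class X a) (path_class X b) = {}" if "a 1 \<noteq> b 0 \<or> \<not> pathin X a \<or> \<not> pathin X b" for a b :: "real \<Rightarrow> 'a"
    using that path_class_member(3)[of _ X a] path_class_member(2)[of _ X b]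
    by (cases "pathin X a \<and> pathin X b") (auto simp: path_comp_def path_class_empty)
  have n: "path_comp X {} B = {}" "path_comp X B {} = {}" for B by (auto simp: path_comp_def)
  show ?thesis
  proof (cases "p 1 = q 0 \<and> pathin X p \<and> pathin X q")
    case pq: True
    then have r: "q 1 \<noteq> r 0 \<or> \<not> pathin X r" using False by blast
    have "path_comp X (path_comp X (path_class X p) (path_class X q)) (path_class X r) = {}"
      using e[of "path_join p q" r] r pq by (simp add: path_class_join)
    then show ?thesis using e[of q r] r n by auto
  next
    case pq: False
    then have "path_comp X (path_class X p) (path_class X q) = {}" using e by blast
    moreover have "path_comp X (path_class X p) (path_comp X (path_class X q) (path_class X r)) = {}"
    proof (cases "q 1 = r 0 \<and> pathin X q \<and> pathin X r")
      case True
      then show ?thesis using e[of p "path_join q r"] pq by (auto simp: path_class_join)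
    next
      case False
      then show ?thesis using e[of q r] n by auto
    qed
    ultimately show ?thesis using n by simp
  qed
qed

lemma path_class_reverse_cancel:
  assumes "pathin X p" "pathin X q" "p 1 = q 0"
  shows "path_comp X (path_class X (path_rev p)) (path_comp X (path_class X p) (path_class X q)) = path_class X q"
    "path_comp X (path_class X p) (path_class X (\<lambda>_. q 0)) = path_class X p"
proof -
  have "path_homotopic X (path_join (path_rev p) (path_join (path_rev (path_rev p)) q)) q"
    by (rule path_join_cancel_left) (use assms in \<open>auto simp: pathin_rev\<close>)
  then show "path_comp X (path_class X (path_rev p)) (path_comp X (path_class X p) (path_class X q)) = path_class X q"
    using assms path_class_eq by (fastforce simp: path_class_join[symmetric])
  show "path_comp X (path_class X p) (path_class X (\<lambda>_. q 0)) = path_class X p"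
    using path_class_eq[OF path_join_const_right[OF assms(1)], of "q 0"] assms by (simp add: path_class_join)
qed

lemma path_class_const_left:
  assumes "pathin X q" "q 0 = x"
  shows "path_comp X (path_class X (\<lambda>_. x)) (path_class X q) = path_class X q"
  using path_class_eq[OF path_join_const_left[OF assms]] assms(2) by (simp add: path_class_join)

lemma path_rev_join:
  assumes "p 1 = q 0" shows "path_rev (path_join p q) = path_join (path_rev q) (path_rev p)"
proof
  fix t :: real
  show "path_rev (path_join p q) t = path_join (path_rev q) (path_rev p) t"
  proof (cases "t = 1/2")
    case True
    show ?thesis using assms unfolding True by (simp add: path_rev_def path_join_def)
  next
    case False
    then show ?thesis by (auto simp: path_rev_def path_join_def algebra_simps)
  qed
qed

section \<open>Charts of configuration spaces\<close>

lemma in_graph_points [simp]: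
  "Vertex v \<in> graph_points G \<longleftrightarrow> v \<in> verts G"
  "Interior e t \<in> graph_points G \<longleftrightarrow> e \<in> arcs G \<and> 0 < t \<and> t < 1"
  by (auto simp: graph_points_def)

lemma config_arc_unique:
  assumes "is_config n G S" "Interior e t \<in> S" "Interior e u \<in> S" shows "t = u"
proof (rule ccontr)
  assume "t \<noteq> u"
  then have "cell_carrier G (Interior e t) \<inter> cell_carrier G (Interior e u) = {}"
    using assms unfolding is_config_def by blast
  then show False by auto
qed

lemma config_arcs_disjoint:
  assumes "is_config n G S" "Interior e t \<in> S" "Interior f u \<in> S" "e \<noteq> f"
  shows "disjoint_arcs G e f"
proof -
  have "cell_carrier G (Interior e t) \<inter> cell_carrier G (Interior f u) = {}"
    using assms unfolding is_config_def by blast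
  moreover have "edge_point G e 0 \<in> cell_carrier G (Interior e t)" "edge_point G e 1 \<in> cell_carrier G (Interior e t)"
    "edge_point G f 0 \<in> cell_carrier G (Interior f u)" "edge_point G f 1 \<in> cell_carrier G (Interior f u)"
    unfolding cell_carrier.simps by (rule imageI, simp)+
  ultimately show ?thesis unfolding disjoint_arcs_def by auto
qed

text \<open>The preimage in each edge omits finitely many parameters, hence is open.\<close>

lemma openin_graph_cofinite:
  assumes "W \<subseteq> graph_points G"
    and "\<And>e t. e \<in> arcs G \<Longrightarrow> t \<in> {0..1} - F \<Longrightarrow> edge_point G e t \<in> W" and "finite F"
  shows "openin (graph_space G) W"
  unfolding openin_graph_space
proof (intro conjI ballI assms(1))
  fix e assume e: "e \<in> arcs G"
  let ?F = "{t \<in> F. edge_point G e t \<notin> W}"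
  have "{t \<in> {0..1}. edge_point G e t \<in> W} = {0..1} \<inter> - ?F" using assms(2)[OF e] by auto
  moreover have "open (- ?F)" using assms(3) by (intro open_Compl finite_imp_closed) simp
  ultimately show "openin unit_interval {t \<in> {0..1}. edge_point G e t \<in> W}"
    by (auto simp: openin_open)
qed

lemma openin_arc_segment:
  assumes "e \<in> arcs G" "0 \<le> a" "b \<le> 1"
  shows "openin (graph_space G) {Interior e t | t. a < t \<and> t < b}"
  unfolding openin_graph_space
proof (intro conjI ballI)
  show "{Interior e t |t. a < t \<and> t < b} \<subseteq> graph_points G"
    using assms by (auto simp: graph_points_def)
  fix f assume "f \<in> arcs G"
  have "{t \<in> {0..1}. edge_point G f t \<in> {Interior e t |t. a < t \<and> t < b}} = (if f = e then {a<..<b} else {})"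
    using assms by (auto simp: edge_point_def split: if_splits)
  moreover have "{a<..<b} = {0..1} \<inter> {a<..<b}" using assms by auto
  ultimately show "openin unit_interval {t \<in> {0..1}. edge_point G f t \<in> {Interior e t |t. a < t \<and> t < b}}"
    by (auto simp: openin_open)
qed

text \<open>The edges in \<open>E\<close> are kept as open cells, so their endpoints are left out;
  every other edge loses its midpoint, so that its two halves can retract to their ends.\<close>

definition chart_points :: "('v, 'e) pre_digraph \<Rightarrow> 'e set \<Rightarrow> ('v, 'e) gpoint set" where
  "chart_points G E = {Vertex v | v. v \<in> verts G \<and> (\<forall>e\<in>E. v \<noteq> tail G e \<and> v \<noteq> head G e)} \<union>
     {Interior f t | f t. f \<in> arcs G \<and> 0 < t \<and> t < 1 \<and> (f \<in> E \<or> t \<noteq> 1/2)}"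

definition chart :: "nat \<Rightarrow> ('v, 'e) pre_digraph \<Rightarrow> 'e set \<Rightarrow> ('v, 'e) gpoint set set" where
  "chart n G E = {S \<in> topspace (uconf_space n G). S \<subseteq> chart_points G E \<and> (\<forall>e\<in>E. \<exists>t. Interior e t \<in> S)}"

definition charts :: "('v, 'e) pre_digraph \<Rightarrow> 'e set set" where
  "charts G = {E. E \<subseteq> arcs G \<and> finite E}"

definition passed :: "('v, 'e) gpoint set \<Rightarrow> 'e set" where
  "passed S = {e. \<exists>t>1/2. Interior e t \<in> S}"

text \<open>The potential of a chart records the edges of \<open>E\<close> whose particle is beyond
  the midpoint. Particles on other edges cannot pass a midpoint inside the chart and contribute
  nothing.\<close>

definition chart_sum :: "('v, 'e) pre_digraph \<Rightarrow> 'e set \<Rightarrow> ('v, 'e) gpoint set \<Rightarrow> ('e \<times> bool) list set bijection" where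
  "chart_sum G E S = raag.commuting_sum (disjoint_arcs G) (E \<inter> passed S)"

lemma openin_chart_points:
  assumes "wf_digraph G" shows "openin (graph_space G) (chart_points G E)"
proof (rule openin_graph_cofinite[where F = "{0, 1/2, 1}"])
  show "chart_points G E \<subseteq> graph_points G" by (auto simp: chart_points_def graph_points_def)
qed (auto simp: chart_points_def edge_point_def)

locale graph_config =
  fixes G :: "('v, 'e) pre_digraph" and n :: nat
  assumes wf: "wf_digraph G"
begin

abbreviation X :: "('v, 'e) gpoint set topology" where
  "X \<equiv> uconf_space n G"

lemmas in_X = in_topspace_uconf_space[OF wf, where n = n]

lemma openin_chart:
  assumes "E \<in> charts G" shows "openin X (chart n G E)"
proof -
  have seg: "{S \<in> topspace X. \<exists>t. Interior e t \<in> S} = {S \<in> topspace X. S \<inter> {Interior e t | t. 0 < t \<and> t < 1} \<noteq> {}}" for e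
    by (auto simp: in_X is_config_def graph_points_def) blast
  have "openin X ({S \<in> topspace X. S \<subseteq> chart_points G E} \<inter>
      ((\<Inter>e\<in>E. {S \<in> topspace X. \<exists>t. Interior e t \<in> S}) \<inter> topspace X))"
    using assms unfolding charts_def seg
    by (intro openin_Int openin_INT openin_uconf_subset openin_uconf_meets openin_chart_points openin_arc_segment wf) auto
  moreover have "{S \<in> topspace X. S \<subseteq> chart_points G E} \<inter>
      ((\<Inter>e\<in>E. {S \<in> topspace X. \<exists>t. Interior e t \<in> S}) \<inter> topspace X) = chart n G E"
    by (auto simp: chart_def)
  ultimately show ?thesis by simp
qed

text \<open>Each edge of the chart carries a particle of \<open>S\<close>, and particles on
  different edges have disjoint carriers.\<close>

lemma commuting_chart:
  assumes "E \<in> charts G" "S \<in> chart n G E" shows "raag.commuting (disjoint_arcs G) E"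
  unfolding raag_arcs.commuting_def
proof (intro conjI ballI impI)
  show "finite E" using assms by (simp add: charts_def)
  fix e f assume "e \<in> E" "f \<in> E" "e \<noteq> f"
  moreover from this obtain t u where "Interior e t \<in> S" "Interior f u \<in> S"
    using assms(2) unfolding chart_def by blast
  ultimately show "disjoint_arcs G e f" using assms(2) config_arcs_disjoint
    by (auto simp: chart_def in_X)
qed

text \<open>The chart around a configuration takes for its edge set exactly the edges with a
  particle at the midpoint.\<close>

lemma charts_cover:
  assumes "S \<in> topspace X" shows "\<exists>E\<in>charts G. S \<in> chart n G E"
proof -
  let ?E = "{e. Interior e (1/2) \<in> S}"
  have S: "is_config n G S" using assms by (simp add: in_X)
  have "?E \<subseteq> arcs G" using S by (auto simp: is_config_def graph_points_def)
  moreover have "finite ((\<lambda>e. Interior e (1/2) :: ('v, 'e) gpoint) ` ?E)"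
    by (rule finite_subset[of _ S]) (use S in \<open>auto simp: is_config_def\<close>)
  then have "finite ?E" by (rule finite_imageD) (auto simp: inj_on_def)
  moreover have "g \<in> chart_points G ?E" if g: "g \<in> S" for g
  proof (cases g)
    case (Vertex v)
    have "v \<noteq> tail G e \<and> v \<noteq> head G e" if "Interior e (1/2) \<in> S" for e
    proof -
      have "cell_carrier G (Interior e (1/2)) \<inter> cell_carrier G g = {}"
        using S g that Vertex unfolding is_config_def by blast
      moreover have "edge_point G e 0 \<in> cell_carrier G (Interior e (1/2))" "edge_point G e 1 \<in> cell_carrier G (Interior e (1/2))"
        unfolding cell_carrier.simps by (rule imageI, simp)+
      ultimately show ?thesis using Vertex by auto
    qed
    then show ?thesis using S g Vertex by (auto simp: chart_points_def is_config_def graph_points_def)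
  next
    case (Interior f t)
    have "t = 1/2 \<longrightarrow> f \<in> ?E" using g Interior by blast
    then show ?thesis using S g Interior by (auto simp: chart_points_def is_config_def)
  qed
  ultimately show ?thesis using assms by (auto simp: charts_def chart_def)
qed

text \<open>An edge in both charts contributes equally to both potentials. An edge in only one of
  them carries a particle, which that chart keeps on the edge while the other keeps it off the
  midpoint, so the side of the midpoint is locally constant.\<close>

lemma chart_cocycle:
  assumes E: "E \<in> charts G" and F: "F \<in> charts G" and S: "S \<in> chart n G E" "S \<in> chart n G F"
  shows "\<exists>W. openin X W \<and> S \<in> W \<and> (\<forall>S'\<in>W. S' \<in> chart n G E \<longrightarrow> S' \<in> chart n G F \<longrightarrow>
      chart_sum G F S' - chart_sum G E S' = chart_sum G F S - chart_sum G E S)"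
proof -
  let ?D = "(E - F) \<union> (F - E)"
  let ?O = "\<lambda>e. {S' \<in> topspace X. S' \<inter> {Interior e t | t. (if e \<in> passed S then 1/2 else 0) < t \<and>
      t < (if e \<in> passed S then 1 else 1/2)} \<noteq> {}}"
  let ?W = "(\<Inter>e\<in>?D. ?O e) \<inter> topspace X"
  have "openin X ?W"
    using E F unfolding charts_def
    by (intro openin_INT openin_uconf_meets openin_arc_segment wf) auto
  moreover have "S \<in> ?W"
  proof -
    have "S \<in> ?O e" if e: "e \<in> ?D" for e
    proof -
      obtain t where t: "Interior e t \<in> S" using S e by (auto simp: chart_def)
      then have "0 < t" "t < 1" "t \<noteq> 1/2" using S e by (auto simp: chart_def chart_points_def)
      moreover have "u = t" if "Interior e u \<in> S" for u
        using config_arc_unique[OF _ that t, of n G] S by (simp add: chart_def in_X)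
      then have "e \<in> passed S \<longleftrightarrow> t > 1/2" using t unfolding passed_def by blast
      ultimately show ?thesis using t S by (auto simp: chart_def)
    qed
    then show ?thesis using S by (auto simp: chart_def)
  qed
  moreover have "chart_sum G F S' - chart_sum G E S' = chart_sum G F S - chart_sum G E S"
    if S': "S' \<in> ?W" "S' \<in> chart n G E" "S' \<in> chart n G F" for S'
  proof -
    have pass: "e \<in> passed S' \<longleftrightarrow> e \<in> passed S" if "e \<in> ?D" for e
    proof -
      have "S' \<in> ?O e" using S'(1) that by blast
      then obtain t where "Interior e t \<in> S'" "(if e \<in> passed S then 1/2 else 0) < t"
        "t < (if e \<in> passed S then 1 else 1/2)" by blast
      moreover from this have "u = t" if "Interior e u \<in> S'" for u
        using config_arc_unique[OF _ that, of n G t] S'(2) by (simp add: chart_def in_X)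
      ultimately have "e \<in> passed S' \<longleftrightarrow> t > 1/2" "(if e \<in> passed S then 1/2 else 0) < t"
        "t < (if e \<in> passed S then 1 else 1/2)" unfolding passed_def by blast+
      then show ?thesis by (auto split: if_splits)
    qed
    \<comment> \<open>The generators of a chart commute, so the common edges can be summed last,
      where they cancel in the difference of the two potentials.\<close>
    have split: "chart_sum G A T = raag.commuting_sum (disjoint_arcs G) ((A - B) \<inter> passed T)
        + raag.commuting_sum (disjoint_arcs G) (A \<inter> B \<inter> passed T)"
      if "A \<in> charts G" "T \<in> chart n G A" for A B T
    proof -
      have "raag.commuting (disjoint_arcs G) A" by (rule commuting_chart[OF that])
      then have "raag.commuting (disjoint_arcs G) ((A - B) \<inter> passed T \<union> (A \<inter> B \<inter> passed T))"
        by (rule raag_arcs.commuting_subset) auto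
      then show ?thesis unfolding chart_sum_def
        by (subst raag_arcs.commuting_sum_Un[symmetric]) (auto intro!: arg_cong[where f = "raag.commuting_sum (disjoint_arcs G)"])
    qed
    have diff: "chart_sum G F T - chart_sum G E T = raag.commuting_sum (disjoint_arcs G) ((F - E) \<inter> passed T)
        - raag.commuting_sum (disjoint_arcs G) ((E - F) \<inter> passed T)"
      if "T \<in> chart n G E" "T \<in> chart n G F" for T
      using split[OF E that(1), of F] split[OF F that(2), of E]
      by (simp add: Int_commute[of F E] diff_conv_add_uminus minus_add add.assoc del: add_uminus_conv_diff)
    have "(F - E) \<inter> passed S' = (F - E) \<inter> passed S" "(E - F) \<inter> passed S' = (E - F) \<inter> passed S"
      using pass by blast+
    then show ?thesis using diff S S' by simp
  qed
  ultimately show ?thesis by blast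
qed

sublocale transport X "charts G" "chart n G" "chart_sum G"
  by unfold_locales (auto intro: openin_chart charts_cover chart_cocycle)

end

abbreviation hol :: "nat \<Rightarrow> ('v, 'e) pre_digraph \<Rightarrow> (real \<Rightarrow> ('v, 'e) gpoint set) \<Rightarrow> ('e \<times> bool) list set bijection" where
  "hol n G \<equiv> transport.holonomy (charts G) (chart n G) (chart_sum G)"

section \<open>Cubes and edge paths\<close>

fun cell_point :: "('v, 'e) pre_digraph \<Rightarrow> ('v, 'e) gpoint \<Rightarrow> real \<Rightarrow> ('v, 'e) gpoint" where
  "cell_point G (Vertex v) u = Vertex v"
| "cell_point G (Interior e t) u = edge_point G e u"

text \<open>\<open>S\<close> serves as the name of a cube: an entry \<open>Interior e t\<close>
  makes \<open>e\<close> a coordinate direction, and \<open>t\<close> is ignored by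
  \<open>cell_point\<close>.\<close>

definition cube_path :: "('v, 'e) pre_digraph \<Rightarrow> ('v, 'e) gpoint set \<Rightarrow> (('v, 'e) gpoint \<Rightarrow> real \<Rightarrow> real) \<Rightarrow>
    real \<Rightarrow> ('v, 'e) gpoint set" where
  "cube_path G S \<alpha> = (\<lambda>t. (\<lambda>g. cell_point G g (\<alpha> g t)) ` S)"

lemma cell_point_in_carrier: "u \<in> {0..1} \<Longrightarrow> cell_point G g u \<in> cell_carrier G g"
  by (cases g) auto

lemma cell_carrier_cell_point: "u \<in> {0..1} \<Longrightarrow> cell_carrier G (cell_point G g u) \<subseteq> cell_carrier G g"
  using cell_carrier_edge_point[of u G] by (cases g) auto

lemma path_join_cube_path:
  "path_join (cube_path G S \<alpha>) (cube_path G S \<beta>) = cube_path G S (\<lambda>g. path_join (\<alpha> g) (\<beta> g))"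
  by (auto simp: fun_eq_iff path_join_def cube_path_def)

definition edge_path :: "('v, 'e) pre_digraph \<Rightarrow> 'v set \<Rightarrow> 'e \<times> bool \<Rightarrow> real \<Rightarrow> ('v, 'e) gpoint set" where
  "edge_path G T a = (\<lambda>t. insert (edge_point G (fst a) (if snd a then t else 1 - t))
      (Vertex ` (T - {arc_start G a})))"

fun word_path :: "('v, 'e) pre_digraph \<Rightarrow> 'v set \<Rightarrow> ('e \<times> bool) list \<Rightarrow> real \<Rightarrow> ('v, 'e) gpoint set" where
  "word_path G T [] = (\<lambda>_. Vertex ` T)"
| "word_path G T (a # w) = path_join (edge_path G T a) (word_path G (move G T a) w)"

definition vertex_config :: "nat \<Rightarrow> ('v, 'e) pre_digraph \<Rightarrow> 'v set \<Rightarrow> bool" where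
  "vertex_config n G T \<longleftrightarrow> T \<subseteq> verts G \<and> finite T \<and> card T = n"

lemma is_config_Vertex_image: "is_config n G (Vertex ` T) \<longleftrightarrow> vertex_config n G T"
proof -
  have "inj_on (Vertex :: 'a \<Rightarrow> ('a, 'b) gpoint) T" by (auto simp: inj_on_def)
  then show ?thesis
    by (auto simp: is_config_def vertex_config_def graph_points_def card_image finite_image_iff)
qed

lemma arc_ends_in_verts:
  "wf_digraph G \<Longrightarrow> fst a \<in> arcs G \<Longrightarrow> arc_start G a \<in> verts G \<and> arc_end G a \<in> verts G"
  by (auto simp: arc_start_def arc_end_def wf_digraph_def split: prod.splits)

lemma vertex_config_move:
  assumes "wf_digraph G" "vertex_config n G T" "can_move G T a"
  shows "vertex_config n G (move G T a)"
proof -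
  have "card (move G T a) = Suc (card (T - {arc_start G a}))"
    using assms unfolding move_def can_move_def vertex_config_def by (intro card_insert_disjoint) auto
  also have "\<dots> = card T"
    using assms unfolding can_move_def vertex_config_def by (intro card_Suc_Diff1) auto
  finally show ?thesis using assms arc_ends_in_verts[OF assms(1), of a]
    by (auto simp: vertex_config_def move_def can_move_def)
qed

lemma edge_path_ends:
  assumes "can_move G T a"
  shows "edge_path G T a 0 = Vertex ` T" "edge_path G T a 1 = Vertex ` move G T a"
  using assms by (auto simp: edge_path_def can_move_def move_def arc_start_def arc_end_def split: prod.splits if_splits)

lemma word_path_ends:
  assumes "legal G T w"
  shows "word_path G T w 0 = Vertex ` T" "word_path G T w 1 = Vertex ` dest G T w"
proof -
  show "word_path G T w 0 = Vertex ` T" using assms by (cases w) (auto simp: edge_path_ends)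
  show "word_path G T w 1 = Vertex ` dest G T w"
    using assms by (induction w arbitrary: T) (auto simp: edge_path_ends)
qed

lemma edge_path_flip:
  assumes "can_move G T a" shows "edge_path G (move G T a) (flip a) = path_rev (edge_path G T a)"
proof -
  have "move G T a - {arc_end G a} = T - {arc_start G a}"
    using assms by (auto simp: move_def can_move_def)
  then show ?thesis by (simp add: edge_path_def path_rev_def fun_eq_iff)
qed

context graph_config
begin

lemma vertex_config_dest: "vertex_config n G T \<Longrightarrow> legal G T w \<Longrightarrow> vertex_config n G (dest G T w)"
  by (induction w arbitrary: T) (auto intro: vertex_config_move[OF wf])

lemma continuous_map_cube:
  assumes "is_config n G S" "\<And>g. g \<in> S \<Longrightarrow> continuous_map Z unit_interval (\<alpha> g)"
  shows "continuous_map Z X (\<lambda>z. (\<lambda>g. cell_point G g (\<alpha> g z)) ` S)"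
proof (rule continuous_map_spread[OF wf assms(1)])
  fix g assume g: "g \<in> S"
  then have gp: "g \<in> graph_points G" using assms(1) by (auto simp: is_config_def)
  show "continuous_map Z (graph_space G) (\<lambda>z. cell_point G g (\<alpha> g z))"
  proof (cases g)
    case (Vertex v)
    then show ?thesis using gp by (simp add: topspace_graph_space[OF wf])
  next
    case (Interior e t)
    then have "e \<in> arcs G" using gp by (auto simp: graph_points_def)
    from continuous_map_compose[OF assms(2)[OF g] continuous_map_edge_point[OF wf this]]
    show ?thesis using Interior by (simp add: o_def)
  qed
  fix z assume "z \<in> topspace Z"
  then have "\<alpha> g z \<in> {0..1}" using continuous_map_image_subset_topspace[OF assms(2)[OF g]] by auto
  then show "cell_carrier G (cell_point G g (\<alpha> g z)) \<subseteq> cell_carrier G g"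
    by (rule cell_carrier_cell_point)
qed

text \<open>Coordinates in a cube vary independently, so paths in one cube with the same ends are
  joined by a straight line.\<close>

lemma cube_path_homotopic:
  assumes S: "is_config n G S"
    and a: "\<And>g. g \<in> S \<Longrightarrow> pathin unit_interval (\<alpha> g)" and b: "\<And>g. g \<in> S \<Longrightarrow> pathin unit_interval (\<beta> g)"
    and ends: "\<And>g. g \<in> S \<Longrightarrow> \<alpha> g 0 = \<beta> g 0 \<and> \<alpha> g 1 = \<beta> g 1"
  shows "path_homotopic X (cube_path G S \<alpha>) (cube_path G S \<beta>)"
proof -
  let ?\<gamma> = "\<lambda>g z. (1 - fst z) * \<alpha> g (snd z) + fst z * \<beta> g (snd z)"
  have "continuous_map (prod_topology unit_interval unit_interval) unit_interval (?\<gamma> g)" if g: "g \<in> S" for g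
  proof -
    have ab: "continuous_on {0..1} (\<alpha> g)" "\<And>t. t \<in> {0..1} \<Longrightarrow> \<alpha> g t \<in> {0..1}"
      "continuous_on {0..1} (\<beta> g)" "\<And>t. t \<in> {0..1} \<Longrightarrow> \<beta> g t \<in> {0..1}"
      using a[OF g] b[OF g] by (auto simp: pathin_def image_subset_iff)
    have 1: "continuous_on ({0..1} \<times> {0..1}) (\<lambda>z::real\<times>real. \<alpha> g (snd z))"
      by (rule continuous_on_compose2[OF ab(1)]) (auto intro: continuous_intros)
    have 2: "continuous_on ({0..1} \<times> {0..1}) (\<lambda>z::real\<times>real. \<beta> g (snd z))"
      by (rule continuous_on_compose2[OF ab(3)]) (auto intro: continuous_intros)
    have "?\<gamma> g z \<in> {0..1}" if "z \<in> {0..1} \<times> {0..1}" for z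
      using convexD[of "{0..1::real}" "\<alpha> g (snd z)" "\<beta> g (snd z)" "1 - fst z" "fst z"] ab(2,4)[of "snd z"] that
      by (auto simp: mem_Times_iff)
    moreover have "continuous_on ({0..1} \<times> {0..1}) (?\<gamma> g)" by (intro continuous_intros 1 2)
    ultimately show ?thesis by (simp add: image_subset_iff)
  qed
  from continuous_map_cube[OF S this]
  have "continuous_map (prod_topology unit_interval unit_interval) X (\<lambda>z. (\<lambda>g. cell_point G g (?\<gamma> g z)) ` S)" .
  moreover have "(1 - s) * x + s * x = x" for s x :: real by (simp add: algebra_simps)
  ultimately show ?thesis unfolding path_homotopic_iff cube_path_def using ends
    by (intro exI[of _ "\<lambda>z. (\<lambda>g. cell_point G g (?\<gamma> g z)) ` S"]) (auto intro!: image_cong)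
qed

lemma pathin_cube_path:
  assumes "is_config n G S" "\<And>g. g \<in> S \<Longrightarrow> pathin unit_interval (\<alpha> g)"
  shows "pathin X (cube_path G S \<alpha>)"
  using path_homotopic_imp_pathin(1) cube_path_homotopic[of S \<alpha> \<alpha>] assms by blast

text \<open>An edge is a cube of dimension one; the parameter 1/2 merely marks the moving particle
  and could be any interior value.\<close>

lemma edge_path_cube:
  assumes T: "vertex_config n G T" and a: "can_move G T a"
  defines "M \<equiv> insert (Interior (fst a) (1/2)) (Vertex ` (T - {arc_start G a}))"
  shows "is_config n G M" "edge_path G T a = cube_path G M (\<lambda>_ t. if snd a then t else 1 - t)"
proof -
  have ends: "cell_carrier G (Interior (fst a) (1/2)) \<inter> Vertex ` (T - {arc_start G a}) = {}"
    using a by (auto simp: edge_point_def can_move_def arc_start_def arc_end_def split: prod.splits if_splits)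
  have "card M = Suc (card (Vertex ` (T - {arc_start G a}) :: ('v, 'e) gpoint set))"
    unfolding M_def using T by (intro card_insert_disjoint) (auto simp: vertex_config_def)
  also have "\<dots> = Suc (card (T - {arc_start G a}))" by (subst card_image) (auto simp: inj_on_def)
  also have "\<dots> = n" using T a unfolding can_move_def vertex_config_def by (metis card_Suc_Diff1)
  finally show "is_config n G M"
    using T a ends unfolding is_config_def M_def
    by (auto simp: vertex_config_def can_move_def simp del: cell_carrier.simps(2))
  show "edge_path G T a = cube_path G M (\<lambda>_ t. if snd a then t else 1 - t)"
    unfolding edge_path_def cube_path_def M_def by (simp add: image_image fun_eq_iff)
qed

lemma pathin_edge_path: "vertex_config n G T \<Longrightarrow> can_move G T a \<Longrightarrow> pathin X (edge_path G T a)"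
  by (simp only: edge_path_cube(2), rule pathin_cube_path[OF edge_path_cube(1)])
    (auto simp: pathin_def intro: continuous_intros)

lemma pathin_word_path: "vertex_config n G T \<Longrightarrow> legal G T w \<Longrightarrow> pathin X (word_path G T w)"
proof (induction w arbitrary: T)
  case Nil
  then show ?case by (simp add: in_X is_config_Vertex_image)
next
  case (Cons a w)
  then show ?case
    by (auto intro!: pathin_join pathin_edge_path Cons.IH vertex_config_move[OF wf] simp: edge_path_ends word_path_ends)
qed

lemma word_path_append:
  assumes "vertex_config n G T" "legal G T (u @ w)"
  shows "path_class X (word_path G T (u @ w)) = path_comp X (path_class X (word_path G T u)) (path_class X (word_path G (dest G T u) w))"
  using assms
proof (induction u arbitrary: T)
  case Nil
  then show ?case
    by (simp add: path_class_const_left pathin_word_path word_path_ends)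
next
  case (Cons a u)
  then have "vertex_config n G (move G T a)" by (auto intro: vertex_config_move[OF wf])
  with Cons show ?case
    by (simp add: path_class_join edge_path_ends word_path_ends path_comp_assoc_class)
qed

text \<open>Both ways round the square lie in one two-dimensional cube, and their coordinates have
  the same ends.\<close>

lemma edge_path_swap:
  assumes T: "vertex_config n G T" and d: "disjoint_arcs G (fst a) (fst b)"
    and a: "can_move G T a" and b: "can_move G (move G T a) b"
  shows "path_homotopic X (path_join (edge_path G T a) (edge_path G (move G T a) b))
     (path_join (edge_path G T b) (edge_path G (move G T b) a))"
proof -
  note b' = move_commute(1)[OF d a b] and dd = ends_disjoint[OF d]
  let ?R = "Vertex ` (T - {arc_start G a, arc_start G b}) :: ('v, 'e) gpoint set"
  let ?A = "Interior (fst a) (1/2) :: ('v, 'e) gpoint" and ?B = "Interior (fst b) (1/2) :: ('v, 'e) gpoint"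
  define M where "M = insert ?A (insert ?B ?R)"
  have ne: "fst a \<noteq> fst b" using d by (auto simp: disjoint_arcs_def)
  have mem: "arc_start G a \<in> T" "arc_start G b \<in> T" "arc_start G a \<noteq> arc_start G b"
    "arc_end G a \<notin> T - {arc_start G a}" "arc_end G b \<notin> T - {arc_start G b}"
    using a b' dd by (auto simp: can_move_def)
  have cc: "cell_carrier G ?A \<inter> ?R = {}" "cell_carrier G ?B \<inter> ?R = {}" "cell_carrier G ?A \<inter> cell_carrier G ?B = {}"
    using mem dd ne by (auto simp: edge_point_def arc_start_def arc_end_def split: prod.splits if_splits)
  have M: "is_config n G M"
  proof -
    have fin: "finite T" "card T = n" "T \<subseteq> verts G" using T by (auto simp: vertex_config_def)
    have "card M = Suc (Suc (card ?R))" unfolding M_def using fin ne by (auto simp: card_insert_if)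
    also have "card ?R = card (T - {arc_start G a, arc_start G b})" by (subst card_image) (auto simp: inj_on_def)
    also have "\<dots> = n - 2" using fin mem by (subst card_Diff_subset) auto
    also have "Suc (Suc (n - 2)) = n"
      using card_mono[of T "{arc_start G a, arc_start G b}"] fin mem by auto
    finally have "card M = n" .
    moreover have "M \<subseteq> graph_points G" unfolding M_def using fin a b' by (auto simp: can_move_def)
    moreover have "finite M" using fin by (simp add: M_def)
    moreover have "cell_carrier G g \<inter> cell_carrier G h = {}" if "g \<in> M" "h \<in> M" "g \<noteq> h" for g h
      using that cc unfolding M_def by auto
    ultimately show ?thesis unfolding is_config_def by blast
  qed
  define p where "p = (\<lambda>(x :: 'e \<times> bool) t. if snd x then t else 1 - t :: real)"
  \<comment> \<open>While one particle moves, the coordinate of the other rests at \<open>c\<close>;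
    resting vertices get the coordinate 0, which \<open>cell_point\<close> ignores.\<close>
  let ?k = "\<lambda>y c g. if g = Interior (fst y) (1/2) then (\<lambda>_::real. c) else (\<lambda>_. 0)"
  let ?st = "\<lambda>x. p x 0" and ?en = "\<lambda>x. p x 1"
  have path: "edge_path G T x = cube_path G M (\<lambda>g. if g = Interior (fst x) (1/2) then p x else ?k y (?st y) g)"
    and path': "edge_path G (move G T y) x = cube_path G M (\<lambda>g. if g = Interior (fst x) (1/2) then p x else ?k y (?en y) g)"
    if "x = a \<and> y = b \<or> x = b \<and> y = a" for x y
  proof -
    have M': "M = insert (Interior (fst x) (1/2)) (insert (Interior (fst y) (1/2)) (Vertex ` (T - {arc_start G x, arc_start G y})))"
      using that by (auto simp: M_def)
    have "T - {arc_start G x} = insert (arc_start G y) (T - {arc_start G x, arc_start G y})"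
      "move G T y - {arc_start G x} = insert (arc_end G y) (T - {arc_start G x, arc_start G y})"
      using that mem dd by (auto simp: move_def)
    moreover have "edge_point G (fst y) (?st y) = Vertex (arc_start G y)" "edge_point G (fst y) (?en y) = Vertex (arc_end G y)"
      by (auto simp: p_def arc_start_def arc_end_def split: prod.splits)
    moreover have "fst x \<noteq> fst y" using that ne by auto
    ultimately show "edge_path G T x = cube_path G M (\<lambda>g. if g = Interior (fst x) (1/2) then p x else ?k y (?st y) g)"
      "edge_path G (move G T y) x = cube_path G M (\<lambda>g. if g = Interior (fst x) (1/2) then p x else ?k y (?en y) g)"
      unfolding edge_path_def cube_path_def M'
      by (simp_all add: image_image fun_eq_iff p_def)
  qed
  have pI: "pathin unit_interval (p x)" "p x 0 \<in> {0..1}" "p x 1 \<in> {0..1}" for x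
    by (auto simp: p_def pathin_def intro: continuous_intros)
  have pJ: "pathin unit_interval (path_join (if g = ?A then p a else ?k b (?st b) g) (if g = ?B then p b else ?k a (?en a) g))"
    "pathin unit_interval (path_join (if g = ?B then p b else ?k a (?st a) g) (if g = ?A then p a else ?k b (?en b) g))" for g
    using pI ne by (cases "g = ?A"; cases "g = ?B"; auto intro!: pathin_join)+
  show ?thesis
    unfolding path[of a b, simplified] path[of b a, simplified] path'[of a b, simplified] path'[of b a, simplified] path_join_cube_path
    by (rule cube_path_homotopic[OF M pJ]) (use ne in auto)
qed

lemma word_path_homotopic:
  assumes "vertex_config n G T" "legal G T u" "legal G T w" "arc_eval G u = arc_eval G w"
  shows "dest G T u = dest G T w" "path_class X (word_path G T u) = path_class X (word_path G T w)"
proof -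
  define Q where "Q = (\<lambda>T u w. path_class X (word_path G T u) = path_class X (word_path G T w))"
  have swap: "Q T (a # b # w) (b # a # w)"
    if *: "vertex_config n G T" "disjoint_arcs G (fst a) (fst b)" "legal G T (a # b # w)" for T a b w
  proof -
    have ab: "can_move G T a" "can_move G (move G T a) b" "legal G (move G (move G T a) b) w" using *(3) by auto
    note m = move_commute[OF *(2) ab(1,2)]
    have "path_class X (path_join (edge_path G T a) (edge_path G (move G T a) b)) =
        path_class X (path_join (edge_path G T b) (edge_path G (move G T b) a))"
      by (rule path_class_eq[OF edge_path_swap[OF *(1,2) ab(1,2)]])
    then show ?thesis using ab m
      by (simp add: Q_def path_class_join edge_path_ends word_path_ends path_comp_assoc_class[symmetric])
  qed
  have cancel: "Q T (a # flip a # w) w" if *: "vertex_config n G T" "can_move G T a" "legal G T w" for T a w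
  proof -
    have "path_homotopic X (path_join (edge_path G T a) (path_join (path_rev (edge_path G T a)) (word_path G T w))) (word_path G T w)"
      by (rule path_join_cancel_left) (use * in \<open>auto simp: pathin_edge_path pathin_word_path edge_path_ends word_path_ends\<close>)
    then show ?thesis using * by (simp add: Q_def move_flip edge_path_flip path_class_eq)
  qed
  have cons: "Q T (a # u) (a # w)"
    if "can_move G T a" "legal G (move G T a) u" "legal G (move G T a) w" "Q (move G T a) u w" for T a u w
    using that by (simp add: Q_def path_class_join edge_path_ends word_path_ends)
  have equiv: "Q T u u" "Q T u w \<Longrightarrow> Q T w u" "Q T u v \<Longrightarrow> Q T v w \<Longrightarrow> Q T u w" for T u v w
    by (simp_all add: Q_def)
  note * = arc_eval_eq_imp_Q[where P = "vertex_config n G" and Q = Q and G = G]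
  show "dest G T u = dest G T w"
    by (rule *(1)) (use assms in \<open>blast intro: vertex_config_move[OF wf] cons swap cancel equiv\<close>)+
  have "Q T u w"
    by (rule *(2)) (use assms in \<open>blast intro: vertex_config_move[OF wf] cons swap cancel equiv\<close>)+
  then show "path_class X (word_path G T u) = path_class X (word_path G T w)" by (simp add: Q_def)
qed

end

text \<open>The empty set is included because it is the value of \<open>path_comp\<close> on classes
  that do not compose; so the set is closed under composition.\<close>

definition path_classes :: "'a topology \<Rightarrow> (real \<Rightarrow> 'a) set set" where
  "path_classes X = insert {} (range (path_class X))"

lemma path_class_in_path_classes [simp]: "path_class X p \<in> path_classes X"
  by (simp add: path_classes_def)

lemma path_comp_empty [simp]: "path_comp X {} B = {}" "path_comp X A {} = {}"
  by (auto simp: path_comp_def)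

lemma path_comp_in_path_classes [simp]:
  assumes "A \<in> path_classes X" "B \<in> path_classes X" shows "path_comp X A B \<in> path_classes X"
proof (cases "\<exists>p q. A = path_class X p \<and> B = path_class X q \<and> p 1 = q 0")
  case True
  then show ?thesis using path_class_join[of _ _ X] by (metis path_class_in_path_classes)
next
  case False
  then have "path_comp X A B = {}"
    using assms unfolding path_classes_def path_comp_def
    by (auto dest: path_class_member(1))
  then show ?thesis by (simp add: path_classes_def)
qed

lemma path_comp_assoc:
  assumes "A \<in> path_classes X" "B \<in> path_classes X" "C \<in> path_classes X"
  shows "path_comp X (path_comp X A B) C = path_comp X A (path_comp X B C)"
  using assms unfolding path_classes_def by (auto simp: path_comp_assoc_class)

section \<open>Sliding configurations to vertices\<close>

definition corner :: "('v, 'e) pre_digraph \<Rightarrow> ('v, 'e) gpoint set \<Rightarrow> ('v, 'e) gpoint set \<Rightarrow> 'v set" where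
  "corner G S A = {v. Vertex v \<in> (\<lambda>g. cell_point G g (if g \<in> A then 1 else 0)) ` S}"

text \<open>The term with \<open>sgn\<close> is 0 before the midpoint, 1 beyond it and 1/2 at the
  midpoint, where no vertex would be reached; this is why charts leave out the midpoints of edges
  outside \<open>E\<close>.\<close>

fun slide_param :: "'e set \<Rightarrow> ('v, 'e) gpoint \<Rightarrow> real \<Rightarrow> real" where
  "slide_param E (Vertex v) s = 0"
| "slide_param E (Interior f t) s = (1 - s) * t + s * (if f \<in> E then 0 else (1 + sgn (t - 1/2)) / 2)"

text \<open>
  The particles on edges in \<open>E\<close> slide to the initial vertex, those on other edges to the
  nearest vertex.
\<close>

definition track :: "('v, 'e) pre_digraph \<Rightarrow> 'e set \<Rightarrow> ('v, 'e) gpoint set \<Rightarrow> real \<Rightarrow> ('v, 'e) gpoint set" where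
  "track G E S = cube_path G S (slide_param E)"

lemma corner_image:
  "Vertex ` corner G S A = (\<lambda>g. cell_point G g (if g \<in> A then 1 else 0)) ` S"
proof -
  have "cell_point G g (if g \<in> A then 1 else 0) \<in> range Vertex" for g by (cases g) auto
  then have "(\<lambda>g. cell_point G g (if g \<in> A then 1 else 0)) ` S \<subseteq> range Vertex" by blast
  moreover have "Vertex ` {v. Vertex v \<in> B} = B" if "B \<subseteq> range Vertex" for B :: "('a, 'b) gpoint set"
    using that by auto
  ultimately show ?thesis unfolding corner_def by simp
qed

lemma corner_Vertex [simp]: "corner G (Vertex ` T) A = T"
  by (auto simp: corner_def image_image)

lemma convex_unit: "0 \<le> s \<Longrightarrow> s \<le> 1 \<Longrightarrow> 0 \<le> t \<Longrightarrow> t \<le> 1 \<Longrightarrow> 0 \<le> u \<Longrightarrow> u \<le> 1 \<Longrightarrow> (1 - s) * t + s * u \<in> {0..1::real}"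
  using convexD[of "{0..1::real}" t u "1 - s" s] by simp

lemma pathin_slide_param: "g \<in> graph_points G \<Longrightarrow> pathin unit_interval (slide_param E g)"
proof (cases g)
  case (Interior f t)
  assume "g \<in> graph_points G"
  then have t: "0 \<le> t" "t \<le> 1" using Interior by auto
  have "(1 - s) * t + s * (if f \<in> E then 0 else (1 + sgn (t - 1/2)) / 2) \<in> {0..1}" if "s \<in> {0..1}" for s
    using that t by (intro convex_unit) (auto simp: sgn_if)
  moreover have "slide_param E g = (\<lambda>s. (1 - s) * t + s * (if f \<in> E then 0 else (1 + sgn (t - 1/2)) / 2))"
    using Interior by (simp add: fun_eq_iff)
  moreover have "continuous_on {0..1} (\<lambda>s. (1 - s) * t + s * (if f \<in> E then 0 else (1 + sgn (t - 1/2)) / 2))"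
    by (intro continuous_intros)
  ultimately show ?thesis unfolding pathin_def by (simp add: image_subset_iff)
next
  case (Vertex v)
  then have "slide_param E g = (\<lambda>_. 0)" by (simp add: fun_eq_iff)
  then show ?thesis by (simp add: pathin_def)
qed

lemma slide_param_0: "cell_point G g (slide_param E g 0) = g" if "g \<in> graph_points G" for g
  using that by (cases g) (auto simp: edge_point_interior)

lemma continuous_map_slide:
  assumes "wf_digraph G"
  shows "continuous_map (prod_topology (subtopology (graph_space G) (chart_points G E)) unit_interval)
    (graph_space G) (\<lambda>(g, s). cell_point G g (slide_param E g s))"
proof (rule continuous_map_graph_prod[OF assms openin_chart_points[OF assms]])
  fix v :: 'a assume "Vertex v \<in> chart_points G E"
  then have "v \<in> verts G" by (auto simp: chart_points_def)
  then show "continuous_map unit_interval (graph_space G) (\<lambda>s. case (Vertex v, s) of (g, s) \<Rightarrow> cell_point G g (slide_param E g s))"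
    by (simp add: topspace_graph_space[OF assms])
next
  fix e assume e: "e \<in> arcs G"
  let ?P = "{t \<in> {0..1}. edge_point G e t \<in> chart_points G E} \<times> {0..1::real}"
  let ?u = "\<lambda>t::real. if e \<in> E then 0 else (1 + sgn (t - 1/2)) / 2"
  let ?g = "\<lambda>(t, s). (1 - s) * t + s * ?u t"
  \<comment> \<open>The target \<open>?u\<close> jumps only at 1/2, which is no parameter of a chart
    point unless \<open>e\<close> is in \<open>E\<close>, and then \<open>?u\<close> is constantly
    0.\<close>
  have P: "t \<noteq> 1/2" if "e \<notin> E" "(t, s) \<in> ?P" for t s
    using that by (auto simp: chart_points_def edge_point_def)
  have "continuous_on ?P (\<lambda>z. ?u (fst z))"
  proof (cases "e \<in> E")
    case False
    then show ?thesis using P by (auto intro!: continuous_intros)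
  qed simp
  then have "continuous_on ?P (\<lambda>z. (1 - snd z) * fst z + snd z * ?u (fst z))"
    by (intro continuous_intros)
  moreover have "(1 - s) * t + s * ?u t \<in> {0..1}" if "(t, s) \<in> ?P" for t s
    using that by (intro convex_unit) (auto simp: sgn_if)
  ultimately have "continuous_map (top_of_set ?P) unit_interval ?g"
    by (auto simp: case_prod_beta' simp del: atLeastAtMost_iff)
  from continuous_map_compose[OF this continuous_map_edge_point[OF assms e]]
  show "continuous_map (top_of_set ?P) (graph_space G)
      (\<lambda>(t, s). case (edge_point G e t, s) of (g, s) \<Rightarrow> cell_point G g (slide_param E g s))"
  proof (rule continuous_map_eq)
    fix z assume "z \<in> topspace (top_of_set ?P)"
    then obtain t s where z: "z = (t, s)" "(t, s) \<in> ?P" by (cases z) auto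
    \<comment> \<open>At the parameters 0 and 1 the point is a vertex and must not move. For
      \<open>e\<close> in \<open>E\<close> the formula would move the end 1, but the endpoints of
      such edges are no chart points.\<close>
    consider "t = 0" | "t = 1" | "t \<noteq> 0" "t \<noteq> 1" by blast
    then show "(edge_point G e \<circ> ?g) z = (case z of (t, s) \<Rightarrow> case (edge_point G e t, s) of (g, s) \<Rightarrow> cell_point G g (slide_param E g s))"
    proof cases
      case 1
      then show ?thesis using z by (auto simp: chart_points_def)
    next
      case 2
      then show ?thesis using z by (auto simp: chart_points_def)
    next
      case 3
      then show ?thesis using z by (simp add: edge_point_def[of G e t])
    qed
  qed
qed

context graph_config
begin

lemma config_in_graph_points: "is_config n G S \<Longrightarrow> g \<in> S \<Longrightarrow> g \<in> graph_points G"
  by (auto simp: is_config_def)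

lemma vertex_config_corner:
  assumes "is_config n G S" shows "vertex_config n G (corner G S A)"
proof -
  have "pathin X (cube_path G S (\<lambda>g _. if g \<in> A then 1 else 0))"
    by (rule pathin_cube_path[OF assms]) (simp add: pathin_def)
  from path_in_topspace[OF this, of 0] show ?thesis
    by (simp add: cube_path_def in_X is_config_Vertex_image[symmetric] corner_image)
qed

lemma pathin_track: "is_config n G S \<Longrightarrow> pathin X (track G E S)"
  unfolding track_def by (rule pathin_cube_path) (auto intro!: pathin_slide_param config_in_graph_points)

lemma track_0: "is_config n G S \<Longrightarrow> track G E S 0 = S"
  using slide_param_0[OF config_in_graph_points] by (auto simp: track_def cube_path_def image_iff)

lemma track_UNIV_1: "track G UNIV S 1 = Vertex ` corner G S {}"
proof -
  have "cell_point G g (slide_param UNIV g 1) = cell_point G g 0" for g by (cases g) auto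
  then show ?thesis by (simp add: track_def cube_path_def corner_image)
qed

lemma track_1:
  assumes "S \<in> chart n G E"
  shows "track G E S 1 = Vertex ` corner G S {Interior f t | f t. f \<notin> E \<and> 1/2 < t}"
    and "\<And>g. g \<in> S \<Longrightarrow> g \<in> range Vertex \<or> slide_param E g 1 = (if g \<in> {Interior f t | f t. f \<notin> E \<and> 1/2 < t} then 1 else 0)"
proof -
  show *: "g \<in> range Vertex \<or> slide_param E g 1 = (if g \<in> {Interior f t | f t. f \<notin> E \<and> 1/2 < t} then 1 else 0)"
    if "g \<in> S" for g
  proof (cases g)
    case (Interior f t)
    have "g \<in> chart_points G E" using assms that by (auto simp: chart_def)
    then have "f \<in> E \<or> t \<noteq> 1/2" using Interior by (simp add: chart_points_def)
    then show ?thesis using Interior by (auto simp: sgn_if)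
  qed simp
  show "track G E S 1 = Vertex ` corner G S {Interior f t | f t. f \<notin> E \<and> 1/2 < t}"
    unfolding corner_image track_def cube_path_def
  proof (rule image_cong[OF refl])
    fix g assume "g \<in> S"
    then show "cell_point G g (slide_param E g 1) = cell_point G g (if g \<in> {Interior f t | f t. f \<notin> E \<and> 1/2 < t} then 1 else 0)"
      using *[of g] by auto
  qed
qed

text \<open>Only the particle at \<open>g\<close> moves, and the others cannot block its way: they
  stay in their own carriers, which miss the closed edge.\<close>

lemma corner_step:
  assumes S: "is_config n G S" and g: "g \<in> S" "g = Interior e u" "g \<notin> A"
  shows "can_move G (corner G S A) (e, True)"
    "move G (corner G S A) (e, True) = corner G S (insert g A)"
    "edge_path G (corner G S A) (e, True)
       = cube_path G S (\<lambda>h t. if h \<in> A then 1 else if h = g then t else 0)"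
proof -
  let ?c = "\<lambda>h. cell_point G h (if h \<in> A then 1 else 0)"
  let ?R = "?c ` (S - {g})"
  have S': "S = insert g (S - {g})" using g by auto
  have e: "e \<in> arcs G" using config_in_graph_points[OF S g(1)] g(2) by simp
  have dis: "Vertex (tail G e) \<notin> ?R" "Vertex (head G e) \<notin> ?R"
  proof -
    have "?R \<inter> cell_carrier G g = {}"
    proof -
      have "?c h \<notin> cell_carrier G g" if "h \<in> S - {g}" for h
      proof -
        have "?c h \<in> cell_carrier G h" by (rule cell_point_in_carrier) simp
        moreover have "cell_carrier G h \<inter> cell_carrier G g = {}" using S that g unfolding is_config_def by blast
        ultimately show ?thesis by blast
      qed
      then show ?thesis by blast
    qed
    moreover have "edge_point G e 0 \<in> cell_carrier G g" "edge_point G e 1 \<in> cell_carrier G g"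
      unfolding g(2) cell_carrier.simps by (rule imageI, simp)+
    ultimately show "Vertex (tail G e) \<notin> ?R" "Vertex (head G e) \<notin> ?R" by auto
  qed
  have cA: "Vertex ` corner G S A = insert (Vertex (tail G e)) ?R"
  proof -
    have "?c g = Vertex (tail G e)" using g(3) unfolding g(2) by simp
    then show ?thesis unfolding corner_image by (subst S') (simp only: image_insert)
  qed
  have R: "Vertex ` (corner G S A - {tail G e}) = ?R"
  proof -
    have "Vertex ` (corner G S A - {tail G e}) = Vertex ` corner G S A - {Vertex (tail G e)}"
      by (auto simp: image_iff)
    then show ?thesis using cA dis(1) by auto
  qed
  have cgA: "Vertex ` corner G S (insert g A) = insert (Vertex (head G e)) ?R"
  proof -
    have "(\<lambda>h. cell_point G h (if h \<in> insert g A then 1 else 0)) ` (S - {g}) = ?R" by (rule image_cong) auto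
    then show ?thesis unfolding corner_image by (subst S') (simp only: image_insert, simp add: g)
  qed
  have inj: "T = T'" if "Vertex ` T = (Vertex ` T' :: ('v, 'e) gpoint set)" for T T'
    using that by (auto simp: inj_image_eq_iff inj_def)
  have tl: "tail G e \<in> corner G S A"
  proof -
    have "Vertex (tail G e) \<in> (Vertex ` corner G S A :: ('v, 'e) gpoint set)" unfolding cA by simp
    then show ?thesis by auto
  qed
  have hd: "head G e \<notin> corner G S A - {tail G e}"
  proof
    assume "head G e \<in> corner G S A - {tail G e}"
    then have "Vertex (head G e) \<in> (Vertex ` (corner G S A - {tail G e}) :: ('v, 'e) gpoint set)" by blast
    then show False using R dis(2) by simp
  qed
  show "can_move G (corner G S A) (e, True)"
    using tl hd e by (simp add: can_move_def arc_start_def arc_end_def)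
  show "move G (corner G S A) (e, True) = corner G S (insert g A)"
    by (rule inj) (simp only: cgA move_def arc_start_def arc_end_def case_prod_conv if_True image_insert R)
  show "edge_path G (corner G S A) (e, True)
       = cube_path G S (\<lambda>h t. if h \<in> A then 1 else if h = g then t else 0)"
  proof
    fix t
    have "(\<lambda>h. cell_point G h (if h \<in> A then 1 else if h = g then t else 0)) ` (S - {g}) = ?R"
      by (rule image_cong) auto
    moreover have "cell_point G g (if g \<in> A then 1 else if g = g then t else 0) = edge_point G e t"
      using g(3) unfolding g(2) by simp
    ultimately have "cube_path G S (\<lambda>h t. if h \<in> A then 1 else if h = g then t else 0) t = insert (edge_point G e t) ?R"
      unfolding cube_path_def by (subst S') (simp only: image_insert)
    then show "edge_path G (corner G S A) (e, True) t = cube_path G S (\<lambda>h t. if h \<in> A then 1 else if h = g then t else 0) t"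
      unfolding edge_path_def using R by (simp add: arc_start_def)
  qed
qed

text \<open>The path runs along the diagonal of a face of the cube of \<open>S\<close>; inside the
  cube it can be replaced by moving the particles of \<open>A\<close> one after the other.\<close>

lemma corner_path:
  assumes S: "is_config n G S" and A: "finite A" "A \<subseteq> S" "A \<inter> range Vertex = {}"
  shows "\<exists>w. legal G (corner G S {}) w \<and> dest G (corner G S {}) w = corner G S A \<and>
     path_class X (cube_path G S (\<lambda>g t. if g \<in> A then t else 0)) = path_class X (word_path G (corner G S {}) w)"
  using A
proof (induction A rule: finite_induct)
  case empty
  show ?case by (rule exI[of _ "[]"]) (simp add: cube_path_def corner_image)
next
  case (insert g A)
  then obtain w where w: "legal G (corner G S {}) w" "dest G (corner G S {}) w = corner G S A"
    "path_class X (cube_path G S (\<lambda>g t. if g \<in> A then t else 0)) = path_class X (word_path G (corner G S {}) w)"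
    by auto
  obtain e u where g: "g = Interior e u" using insert.prems by (cases g) auto
  note step = corner_step[OF S _ g insert.hyps(2)]
  let ?a = "\<lambda>g t::real. if g \<in> A then t else 0" and ?b = "\<lambda>h t. if h \<in> A then 1 else if h = g then t else 0"
  have pI: "pathin unit_interval (?a h)" "pathin unit_interval (?b h)" for h
    by (cases "h \<in> A"; cases "h = g"; auto simp: pathin_def)+
  have "path_homotopic X (cube_path G S (\<lambda>h t. if h \<in> insert g A then t else 0))
      (path_join (cube_path G S ?a) (cube_path G S ?b))"
    unfolding path_join_cube_path
    by (rule cube_path_homotopic[OF S _ pathin_join[OF pI]]) (use insert.hyps in \<open>auto simp: pathin_def\<close>)
  then have "path_class X (cube_path G S (\<lambda>h t. if h \<in> insert g A then t else 0))
      = path_comp X (path_class X (cube_path G S ?a)) (path_class X (cube_path G S ?b))"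
    using insert.hyps by (subst path_class_join[symmetric]) (auto simp: cube_path_def path_class_eq intro!: image_cong)
  also have "\<dots> = path_comp X (path_class X (word_path G (corner G S {}) w)) (path_class X (edge_path G (corner G S A) (e, True)))"
    using step(3) insert.prems w(3) by simp
  also have "path_class X (edge_path G (corner G S A) (e, True)) = path_class X (word_path G (corner G S A) [(e, True)])"
  proof -
    have c: "vertex_config n G (corner G S A)" by (rule vertex_config_corner[OF S])
    have "path_homotopic X (path_join (edge_path G (corner G S A) (e, True)) (\<lambda>_. Vertex ` move G (corner G S A) (e, True)))
       (edge_path G (corner G S A) (e, True))"
      using insert.prems step(1) by (intro path_join_const_right pathin_edge_path[OF c]) (auto simp: edge_path_ends)
    then show ?thesis by (simp add: path_class_eq)
  qed
  also have "path_comp X (path_class X (word_path G (corner G S {}) w)) \<dots> = path_class X (word_path G (corner G S {}) (w @ [(e, True)]))"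
    using w step insert.prems by (subst word_path_append) (auto simp: vertex_config_corner[OF S])
  finally show ?case using w step insert.prems by (intro exI[of _ "w @ [(e, True)]"]) auto
qed

text \<open>Both paths stay in the cube of \<open>S\<close> and end in the same corner. Passing
  through the initial corner, which does not depend on \<open>E\<close>, makes the tracks of
  different charts comparable.\<close>

lemma track_word:
  assumes "S \<in> chart n G E"
  shows "\<exists>w T. legal G (corner G S {}) w \<and> dest G (corner G S {}) w = T \<and> track G E S 1 = Vertex ` T \<and>
    path_class X (track G E S) = path_comp X (path_class X (track G UNIV S)) (path_class X (word_path G (corner G S {}) w))"
proof -
  have S: "is_config n G S" using assms by (simp add: chart_def in_X)
  let ?B = "{Interior f t | f t. f \<notin> E \<and> 1/2 < t}"
  let ?A = "S \<inter> ?B"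
  obtain w where w: "legal G (corner G S {}) w" "dest G (corner G S {}) w = corner G S ?A"
    "path_class X (cube_path G S (\<lambda>g t. if g \<in> ?A then t else 0)) = path_class X (word_path G (corner G S {}) w)"
    using corner_path[OF S, of ?A] S by (auto simp: is_config_def)
  have cA: "corner G S ?A = corner G S ?B" unfolding corner_def by (auto simp: image_iff)
  have cong: "cube_path G S \<alpha> = cube_path G S \<beta>" if "\<And>g. g \<in> S - range Vertex \<Longrightarrow> \<alpha> g = \<beta> g" for \<alpha> \<beta>
  proof
    fix t
    show "cube_path G S \<alpha> t = cube_path G S \<beta> t"
      unfolding cube_path_def
    proof (rule image_cong[OF refl])
      fix g assume "g \<in> S"
      then show "cell_point G g (\<alpha> g t) = cell_point G g (\<beta> g t)" using that[of g] by (cases g) (auto simp: image_iff)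
    qed
  qed
  let ?z = "\<lambda>a g. if g \<in> range Vertex then (\<lambda>_::real. 0::real) else a g"
  have pI: "pathin unit_interval (?z (slide_param E') g)" "pathin unit_interval (\<lambda>t. if g \<in> ?A then t else 0)" if "g \<in> S" for g E'
    using pathin_slide_param[OF config_in_graph_points[OF S that]] by (auto simp: pathin_def)
  have "path_homotopic X (cube_path G S (?z (slide_param E)))
     (path_join (cube_path G S (?z (slide_param UNIV))) (cube_path G S (\<lambda>g t. if g \<in> ?A then t else 0)))"
    unfolding path_join_cube_path
  proof (rule cube_path_homotopic[OF S pI(1) pathin_join[OF pI]])
    fix g assume g: "g \<in> S"
    show "?z (slide_param UNIV) g 1 = (if g \<in> ?A then 0 else 0)" by (cases g) auto
    show "?z (slide_param E) g 0 = path_join (?z (slide_param UNIV) g) (\<lambda>t. if g \<in> ?A then t else 0) 0 \<and>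
      ?z (slide_param E) g 1 = path_join (?z (slide_param UNIV) g) (\<lambda>t. if g \<in> ?A then t else 0) 1"
      using track_1(2)[OF assms g] g by (cases g) auto
  qed
  moreover have "cube_path G S (?z (slide_param E')) = track G E' S" for E'
    unfolding track_def by (rule cong) auto
  ultimately have "path_class X (track G E S) = path_class X (path_join (track G UNIV S) (cube_path G S (\<lambda>g t. if g \<in> ?A then t else 0)))"
    by (simp add: path_class_eq)
  also have "\<dots> = path_comp X (path_class X (track G UNIV S)) (path_class X (word_path G (corner G S {}) w))"
    unfolding w(3)[symmetric]
    by (rule path_class_join) (simp add: track_UNIV_1 corner_image cube_path_def)
  finally show ?thesis using w track_1(1)[OF assms] cA by auto
qed

text \<open>The open set omits the vertices outside \<open>T\<close>; a configuration of equally
  many vertices inside \<open>T\<close> is \<open>T\<close> itself.\<close>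

lemma vertex_config_isolated:
  assumes "vertex_config n G T"
  obtains W where "openin X W" "Vertex ` T \<in> W" "\<And>T'. Vertex ` T' \<in> W \<Longrightarrow> T' = T"
proof -
  let ?W = "graph_points G - Vertex ` (verts G - T)"
  have "openin (graph_space G) ?W"
  proof (rule openin_graph_cofinite[where F = "{0, 1}"])
    fix e t assume "e \<in> arcs G" "t \<in> {0..1::real} - {0, 1}"
    then show "edge_point G e t \<in> ?W" by (auto simp: edge_point_def)
  qed auto
  then have "openin X {S \<in> topspace X. S \<subseteq> ?W}" by (rule openin_uconf_subset[OF wf])
  moreover have "Vertex ` T \<in> {S \<in> topspace X. S \<subseteq> ?W}"
    using assms by (auto simp: in_X is_config_Vertex_image) (auto simp: vertex_config_def)
  moreover have "T' = T" if "Vertex ` T' \<in> {S \<in> topspace X. S \<subseteq> ?W}" for T'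
  proof -
    have "vertex_config n G T'" using that by (simp add: in_X is_config_Vertex_image)
    moreover have "T' \<subseteq> T"
    proof
      fix x assume "x \<in> T'"
      then have "Vertex x \<in> ?W" using that by blast
      then show "x \<in> T" by auto
    qed
    ultimately show ?thesis using assms by (auto simp: vertex_config_def card_subset_eq)
  qed
  ultimately show ?thesis using that by blast
qed

lemma vertex_path_constant:
  assumes p: "pathin X p" and v: "\<And>t. t \<in> {0..1} \<Longrightarrow> \<exists>T. p t = Vertex ` T" and t: "t \<in> {0..1}"
  shows "p t = p 0"
proof -
  let ?P = "\<lambda>a b. 0 \<le> a \<longrightarrow> b \<le> 1 \<longrightarrow> p b = p a"
  have "?P 0 t"
  proof (rule Bolzano[where P = ?P])
    fix x assume x: "0 \<le> x" "x \<le> t"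
    then have x': "x \<in> {0..1}" using t by auto
    then obtain T where T: "p x = Vertex ` T" using v by blast
    have "vertex_config n G T" using path_in_topspace[OF p x'] T by (simp add: in_X is_config_Vertex_image)
    then obtain W where W: "openin X W" "Vertex ` T \<in> W" "\<And>T'. Vertex ` T' \<in> W \<Longrightarrow> T' = T"
      using vertex_config_isolated by blast
    obtain d where d: "d > 0" "\<And>t'. t' \<in> {0..1} \<Longrightarrow> \<bar>t' - x\<bar> < d \<Longrightarrow> p t' \<in> W"
      using pathin_nhd[OF p W(1) x'] W(2) T by auto
    have near: "p y = p x" if y: "y \<in> {0..1}" "\<bar>y - x\<bar> < d" for y
    proof -
      obtain T' where T': "p y = Vertex ` T'" using v[OF y(1)] by blast
      have "T' = T" using d(2)[OF y] W(3) T' by simp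
      then show ?thesis using T T' by simp
    qed
    have "p v = p u" if "u \<le> x" "x \<le> v" "v - u < d" "0 \<le> u" "v \<le> 1" for u v
      using near[of u] near[of v] that by simp
    then show "\<exists>d>0. \<forall>a b. a \<le> x \<and> x \<le> b \<and> b - a < d \<longrightarrow> ?P a b"
      using d(1) by blast
  qed (use t in auto)
  then show ?thesis using t by auto
qed

lemma continuous_map_tracks:
  "continuous_map
    (prod_topology (subtopology X {S \<in> topspace X. S \<subseteq> chart_points G E}) unit_interval)
    X (\<lambda>(S, s). track G E S s)"
proof -
  have "cell_carrier G (cell_point G g (slide_param E g s)) \<subseteq> cell_carrier G g"
    if "g \<in> chart_points G E" "s \<in> {0..1}" for g s
  proof (rule cell_carrier_cell_point)
    have "g \<in> graph_points G" using that by (auto simp: chart_points_def)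
    then show "slide_param E g s \<in> {0..1}"
      using path_in_topspace[OF pathin_slide_param that(2)] by simp
  qed
  then show ?thesis
    using continuous_map_uconf_prod[OF wf openin_chart_points[OF wf] continuous_map_slide[OF wf], of E n]
    by (simp add: track_def cube_path_def)
qed

text \<open>Sliding all points of the path at once is a homotopy to a path of vertex configurations,
  which is constant because these are isolated from each other; then
  \<open>path_homotopic_tracks\<close> applies.\<close>

lemma path_in_chart:
  assumes p: "pathin X p" and E: "\<And>t. t \<in> {0..1} \<Longrightarrow> p t \<in> chart n G E"
  shows "track G E (p 1) 1 = track G E (p 0) 1"
    "path_homotopic X p (path_join (track G E (p 0)) (path_rev (track G E (p 1))))"
proof -
  let ?U = "{S \<in> topspace X. S \<subseteq> chart_points G E}"
  let ?I2 = "prod_topology unit_interval unit_interval"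
  have "continuous_map ?I2 X (\<lambda>z. p (snd z))"
    using continuous_map_compose[OF continuous_map_snd, of unit_interval X p unit_interval] p by (simp add: pathin_def o_def)
  then have "continuous_map ?I2 (subtopology X ?U) (\<lambda>z. p (snd z))"
  proof (rule continuous_map_into_subtopology, intro Pi_I)
    fix z :: "real \<times> real" assume "z \<in> topspace ?I2"
    then have "snd z \<in> {0..1}" by auto
    from E[OF this] show "p (snd z) \<in> ?U" by (simp add: chart_def)
  qed
  then have "continuous_map ?I2 (prod_topology (subtopology X ?U) unit_interval) (\<lambda>z. (p (snd z), fst z))"
    by (intro continuous_map_pairedI continuous_map_fst)
  from continuous_map_compose[OF this continuous_map_tracks]
  have h: "continuous_map ?I2 X (\<lambda>z. track G E (p (snd z)) (fst z))" by (simp add: o_def)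
  have "continuous_map unit_interval ?I2 (\<lambda>t. (1, t))"
    by (intro continuous_map_pairedI) auto
  from continuous_map_compose[OF this h]
  have q: "pathin X (\<lambda>t. track G E (p t) 1)" by (simp add: pathin_def o_def)
  have const: "track G E (p t) 1 = track G E (p 0) 1" if "t \<in> {0..1}" for t
  proof (rule vertex_path_constant[OF q _ that])
    fix u :: real assume "u \<in> {0..1}"
    show "\<exists>T. track G E (p u) 1 = Vertex ` T"
      by (rule exI, rule track_1(1)[OF E]) fact
  qed
  show "track G E (p 1) 1 = track G E (p 0) 1" by (rule const) simp
  have "p t = track G E (p t) 0" if "t \<in> {0..1}" for t
    using track_0[of "p t" E] E[OF that] by (simp add: chart_def in_X)
  then show "path_homotopic X p (path_join (track G E (p 0)) (path_rev (track G E (p 1))))"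
    using path_homotopic_tracks[OF h, of p "track G E (p 0) 1", unfolded fst_conv snd_conv] const by blast
qed

lemma path_class_rev_word_path:
  assumes "vertex_config n G T" "legal G T w"
  shows "path_class X (path_rev (word_path G T w)) = path_class X (word_path G (dest G T w) (rev_word w))"
  using assms
proof (induction w arbitrary: T)
  case Nil
  then show ?case by (simp add: path_rev_def)
next
  case (Cons a w)
  have a: "can_move G T a" "legal G (move G T a) w" and c: "vertex_config n G (move G T a)" "vertex_config n G (dest G (move G T a) w)"
    using Cons.prems by (auto intro: vertex_config_move[OF wf] vertex_config_dest)
  have l: "legal G (dest G (move G T a) w) (rev_word w)" "dest G (dest G (move G T a) w) (rev_word w) = move G T a"
    using legal_rev_word[OF a(2)] by auto
  have fl: "can_move G (move G T a) (flip a)" "move G (move G T a) (flip a) = T" by (rule move_flip[OF a(1)])+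
  have "path_homotopic X (path_join (edge_path G (move G T a) (flip a)) (\<lambda>_. Vertex ` T)) (edge_path G (move G T a) (flip a))"
    by (rule path_join_const_right) (use fl c in \<open>auto simp: pathin_edge_path edge_path_ends\<close>)
  then have single: "path_class X (word_path G (move G T a) [flip a]) = path_class X (path_rev (edge_path G T a))"
    using fl edge_path_flip[OF a(1)] by (simp add: path_class_eq)
  have "path_class X (path_rev (word_path G T (a # w))) =
      path_comp X (path_class X (path_rev (word_path G (move G T a) w))) (path_class X (path_rev (edge_path G T a)))"
    using a by (simp add: path_rev_join path_class_join edge_path_ends word_path_ends)
  also have "\<dots> = path_class X (word_path G (dest G (move G T a) w) (rev_word w @ [flip a]))"
    using Cons.IH[OF c(1) a(2)] single l fl c by (subst word_path_append) auto
  finally show ?case by simp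
qed

text \<open>A class of this form is given by an edge path up to the tracks at its ends, which depend
  on nothing but the ends.\<close>

definition standard :: "('v, 'e) gpoint set \<Rightarrow> ('v, 'e) gpoint set \<Rightarrow> ('e \<times> bool) list \<Rightarrow> (real \<Rightarrow> ('v, 'e) gpoint set) set" where
  "standard S S' w = path_comp X (path_class X (track G UNIV S))
     (path_comp X (path_class X (word_path G (corner G S {}) w)) (path_class X (path_rev (track G UNIV S'))))"

lemma path_in_chart_standard:
  assumes p: "pathin X p" and E: "\<And>t. t \<in> {0..1} \<Longrightarrow> p t \<in> chart n G E"
  shows "\<exists>w. legal G (corner G (p 0) {}) w \<and> dest G (corner G (p 0) {}) w = corner G (p 1) {} \<and>
     path_class X p = standard (p 0) (p 1) w"
proof -
  have E01: "p 0 \<in> chart n G E" "p 1 \<in> chart n G E" using E by auto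
  then have c: "is_config n G (p 0)" "is_config n G (p 1)" by (auto simp: chart_def in_X)
  obtain w T where w: "legal G (corner G (p 0) {}) w" "dest G (corner G (p 0) {}) w = T" "track G E (p 0) 1 = Vertex ` T"
    "path_class X (track G E (p 0)) = path_comp X (path_class X (track G UNIV (p 0))) (path_class X (word_path G (corner G (p 0) {}) w))"
    using track_word[OF E01(1)] by blast
  obtain u T' where u: "legal G (corner G (p 1) {}) u" "dest G (corner G (p 1) {}) u = T'" "track G E (p 1) 1 = Vertex ` T'"
    "path_class X (track G E (p 1)) = path_comp X (path_class X (track G UNIV (p 1))) (path_class X (word_path G (corner G (p 1) {}) u))"
    using track_word[OF E01(2)] by blast
  \<comment> \<open>Both ends of the path slide to the same vertex configuration, so
    \<open>w\<close> leads to it and \<open>rev_word u\<close> leads away from it.\<close>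
  have T: "T' = T" using path_in_chart(1)[OF p E] w(3) u(3) by (auto simp: inj_image_eq_iff inj_def)
  have cc: "vertex_config n G (corner G (p 0) {})" "vertex_config n G (corner G (p 1) {})"
    using c by (auto intro: vertex_config_corner)
  have ends: "track G UNIV (p 1) 1 = word_path G (corner G (p 1) {}) u 0"
    using u(1) by (simp add: track_UNIV_1 word_path_ends)
  have "path_class X (track G E (p 1)) = path_class X (path_join (track G UNIV (p 1)) (word_path G (corner G (p 1) {}) u))"
    using u(4) ends by (simp add: path_class_join)
  then have "path_homotopic X (track G E (p 1)) (path_join (track G UNIV (p 1)) (word_path G (corner G (p 1) {}) u))"
    using pathin_track[OF c(2)] path_class_eq_iff by blast
  then have "path_class X (path_rev (track G E (p 1))) = path_class X (path_rev (path_join (track G UNIV (p 1)) (word_path G (corner G (p 1) {}) u)))"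
    by (intro path_class_eq path_homotopic_rev)
  also have "\<dots> = path_comp X (path_class X (word_path G T (rev_word u))) (path_class X (path_rev (track G UNIV (p 1))))"
    using ends u cc T by (simp add: path_rev_join path_class_join path_class_rev_word_path)
  finally have rev: "path_class X (path_rev (track G E (p 1))) = \<dots>" .
  have "path_class X p = path_comp X (path_class X (track G E (p 0))) (path_class X (path_rev (track G E (p 1))))"
    using path_class_eq[OF path_in_chart(2)[OF p E]] path_in_chart(1)[OF p E] by (simp add: path_class_join)
  also have "\<dots> = standard (p 0) (p 1) (w @ rev_word u)"
    unfolding rev w(4) standard_def
    using legal_rev_word[OF u(1)] w u T cc
    by (subst word_path_append) (auto simp: path_comp_assoc)
  finally show ?thesis using legal_rev_word[OF u(1)] w u T by (intro exI[of _ "w @ rev_word u"]) auto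
qed

lemma standard_comp:
  assumes c: "is_config n G S" "is_config n G S'" "is_config n G S''"
    and w: "legal G (corner G S {}) w" "dest G (corner G S {}) w = corner G S' {}"
    and u: "legal G (corner G S' {}) u"
  shows "path_comp X (standard S S' w) (standard S' S'' u) = standard S S'' (w @ u)"
proof -
  let ?t = "path_class X (track G UNIV S)" and ?t' = "path_class X (track G UNIV S')"
    and ?r' = "path_class X (path_rev (track G UNIV S'))"  and ?r'' = "path_class X (path_rev (track G UNIV S''))"
    and ?w = "path_class X (word_path G (corner G S {}) w)" and ?u = "path_class X (word_path G (corner G S' {}) u)"
  have "path_comp X ?r' (path_comp X ?t' ?u) = ?u"
    by (rule path_class_reverse_cancel(1))
      (use c u in \<open>auto simp: pathin_track pathin_word_path vertex_config_corner track_UNIV_1 word_path_ends\<close>)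
  then have "path_comp X ?r' (path_comp X ?t' (path_comp X ?u ?r'')) = path_comp X ?u ?r''"
    by (simp add: path_comp_assoc[symmetric])
  moreover have "path_class X (word_path G (corner G S {}) (w @ u)) = path_comp X ?w ?u"
    using w u c by (subst word_path_append) (auto simp: vertex_config_corner)
  ultimately show ?thesis unfolding standard_def by (simp add: path_comp_assoc)
qed

text \<open>Cellular approximation: short pieces of the path lie in charts, and where two pieces
  meet the tracks cancel.\<close>

lemma path_standard:
  assumes p: "pathin X p"
  shows "\<exists>w. legal G (corner G (p 0) {}) w \<and> dest G (corner G (p 0) {}) w = corner G (p 1) {} \<and>
     path_class X p = standard (p 0) (p 1) w"
proof -
  let ?P = "\<lambda>a b. 0 \<le> a \<longrightarrow> b \<le> 1 \<longrightarrow> (\<exists>w. legal G (corner G (p a) {}) w \<and>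
      dest G (corner G (p a) {}) w = corner G (p b) {} \<and> path_class X (path_part p a b) = standard (p a) (p b) w)"
  have conf: "is_config n G (p t)" if "0 \<le> t" "t \<le> 1" for t
    using path_in_topspace[OF p, of t] that by (simp add: in_X)
  have "?P 0 1"
  proof (rule Bolzano[where P = ?P])
    fix a b c :: real assume *: "?P a b" "?P b c" "a \<le> b" "b \<le> c"
    show "?P a c"
    proof (intro impI)
      assume 0: "0 \<le> a" "c \<le> 1"
      obtain w where w: "legal G (corner G (p a) {}) w" "dest G (corner G (p a) {}) w = corner G (p b) {}"
        "path_class X (path_part p a b) = standard (p a) (p b) w" using *(1,4) 0 by auto
      obtain u where u: "legal G (corner G (p b) {}) u" "dest G (corner G (p b) {}) u = corner G (p c) {}"
        "path_class X (path_part p b c) = standard (p b) (p c) u" using *(2,3) 0 by auto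
      have "path_class X (path_part p a c) = path_comp X (path_class X (path_part p a b)) (path_class X (path_part p b c))"
        using path_class_eq[OF path_part_join[OF p 0(1) *(3,4) 0(2)]] by (simp add: path_class_join)
      also have "\<dots> = standard (p a) (p c) (w @ u)"
        unfolding w(3) u(3) by (rule standard_comp) (use w u * 0 conf in auto)
      finally show "\<exists>w. legal G (corner G (p a) {}) w \<and> dest G (corner G (p a) {}) w = corner G (p c) {} \<and>
          path_class X (path_part p a c) = standard (p a) (p c) w"
        using w u by (intro exI[of _ "w @ u"]) auto
    qed
  next
    fix x :: real assume x: "0 \<le> x" "x \<le> 1"
    then obtain E d where d: "E \<in> charts G" "d > 0" "\<And>t. t \<in> {0..1} \<Longrightarrow> \<bar>t - x\<bar> < d \<Longrightarrow> p t \<in> chart n G E"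
      using chart_nhd[OF p, of x] by auto
    have "?P u v" if uv: "u \<le> x" "x \<le> v" "v - u < d" for u v
    proof (intro impI)
      assume 0: "0 \<le> u" "v \<le> 1"
      have "path_part p u v t \<in> chart n G E" if "t \<in> {0..1}" for t
        unfolding path_part_def
      proof (rule d(3))
        have "u \<le> u + (v - u) * t" "u + (v - u) * t \<le> v"
          by (rule affine_unit_interval; use that uv 0 in auto)+
        then show "u + (v - u) * t \<in> {0..1}" "\<bar>u + (v - u) * t - x\<bar> < d" using uv 0 by auto
      qed
      from path_in_chart_standard[OF pathin_part[OF p 0(1) _ 0(2)] this]
      show "\<exists>w. legal G (corner G (p u) {}) w \<and>
        dest G (corner G (p u) {}) w = corner G (p v) {} \<and> path_class X (path_part p u v) = standard (p u) (p v) w"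
        using uv by auto
    qed
    then show "\<exists>d>0. \<forall>u v. u \<le> x \<and> x \<le> v \<and> v - u < d \<longrightarrow> ?P u v" using d(2) by blast
  qed auto
  then show ?thesis by simp
qed

section \<open>Holonomy of edge paths, and faithfulness\<close>

lemma holonomy_edge_path:
  assumes T: "vertex_config n G T" and a: "can_move G T a"
  shows "holonomy (edge_path G T a) = arc_gen G a"
proof -
  have pos: "holonomy (edge_path G T (e, True)) = arc_gen G (e, True)"
    if T: "vertex_config n G T" and a: "can_move G T (e, True)" for T e
  proof (rule holonomy_eqI)
    let ?p = "edge_path G T (e, True)" and ?R = "Vertex ` (T - {tail G e}) :: ('v, 'e) gpoint set"
    show p: "pathin X ?p" by (rule pathin_edge_path[OF T a])
    have e: "e \<in> arcs G" "tail G e \<in> T" "head G e \<notin> T - {tail G e}"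
      using a by (auto simp: can_move_def arc_start_def arc_end_def)
    have Tv: "T \<subseteq> verts G" using T by (simp add: vertex_config_def)
    have p_eq: "?p t = insert (edge_point G e t) ?R" for t by (simp add: edge_path_def arc_start_def)
    have top: "?p t \<in> topspace X" if "t \<in> {0..1}" for t using path_in_topspace[OF p that] .
    have empty: "?p t \<in> chart n G {}" if "t \<in> {0..1}" "t \<noteq> 1/2" for t
      using top[OF that(1)] that e Tv wf unfolding chart_def p_eq
      by (auto simp: chart_points_def edge_point_def wf_digraph_def)
    have e_chart: "?p t \<in> chart n G {e}" if "0 < t" "t < 1" for t
      using top[of t] that e Tv unfolding chart_def p_eq
      by (auto simp: chart_points_def edge_point_interior)
    have E: "{} \<in> charts G" "{e} \<in> charts G" using e by (auto simp: charts_def)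
    have zero: "chart_sum G {} S = 0" for S by (simp add: chart_sum_def)
    \<comment> \<open>Outside the middle half the particle is away from the midpoint and the chart
      \<open>{}\<close> has potential 0; in the middle half the chart \<open>{e}\<close> counts the
      passage.\<close>
    have "transports ?p 0 (1/4) (- chart_sum G {} (?p 0) + chart_sum G {} (?p (1/4)))"
      by (rule transports.chart) (auto intro: empty E)
    moreover have "transports ?p (1/4) (3/4) (- chart_sum G {e} (?p (1/4)) + chart_sum G {e} (?p (3/4)))"
      by (rule transports.chart) (auto intro: e_chart E)
    moreover have "transports ?p (3/4) 1 (- chart_sum G {} (?p (3/4)) + chart_sum G {} (?p 1))"
      by (rule transports.chart) (auto intro: empty E)
    moreover have "passed (?p (1/4)) = {}" "passed (?p (3/4)) = {e}"
      unfolding p_eq by (auto simp: passed_def edge_point_interior intro!: exI[of _ "3/4"])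
    ultimately have "transports ?p 0 1 (0 + (arc_gen G (e, True) + 0))"
      unfolding zero by (intro transports.compose[of ?p 0 "1/4"] transports.compose[of ?p "1/4" "3/4"]) (auto simp: chart_sum_def)
    then show "transports ?p 0 1 (arc_gen G (e, True))" by simp
  qed
  obtain e s where es: "a = (e, s)" by (cases a)
  show ?thesis
  proof (cases s)
    case True
    then show ?thesis using pos[OF T] a es by simp
  next
    case False
    let ?b = "(e, True)" and ?T = "move G T a"
    have fl: "flip a = ?b" using es False by (simp add: flip_def)
    have "edge_path G T a = path_rev (edge_path G ?T ?b)"
      using edge_path_flip[OF a] fl by simp
    moreover have "vertex_config n G ?T" "can_move G ?T ?b"
      using vertex_config_move[OF wf T a] move_flip(1)[OF a] fl by auto
    ultimately have "holonomy (edge_path G T a) = - arc_gen G ?b"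
      using holonomy_rev pathin_edge_path pos by simp
    also have "\<dots> = arc_gen G a" using raag_arcs.gen_flip[of G ?b] fl by (metis flip_simps(3))
    finally show ?thesis .
  qed
qed

lemma holonomy_word_path:
  "vertex_config n G T \<Longrightarrow> legal G T w \<Longrightarrow> holonomy (word_path G T w) = arc_eval G w"
proof (induction w arbitrary: T)
  case Nil
  then show ?case by (simp add: holonomy_const in_X is_config_Vertex_image)
next
  case (Cons a w)
  then have "vertex_config n G (move G T a)" by (auto intro: vertex_config_move[OF wf])
  with Cons show ?case
    by (simp add: holonomy_join pathin_edge_path pathin_word_path edge_path_ends word_path_ends holonomy_edge_path)
qed

lemma holonomy_standard:
  assumes p: "pathin X p" and w: "legal G (corner G (p 0) {}) w" "dest G (corner G (p 0) {}) w = corner G (p 1) {}"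
    and eq: "path_class X p = standard (p 0) (p 1) w"
  shows "holonomy p = holonomy (track G UNIV (p 0)) + arc_eval G w - holonomy (track G UNIV (p 1))"
proof -
  have c: "is_config n G (p 0)" "is_config n G (p 1)" using path_in_topspace[OF p] by (auto simp: in_X)
  let ?q = "path_join (track G UNIV (p 0)) (path_join (word_path G (corner G (p 0) {}) w) (path_rev (track G UNIV (p 1))))"
  have paths: "pathin X (track G UNIV (p 0))" "pathin X (word_path G (corner G (p 0) {}) w)" "pathin X (track G UNIV (p 1))"
    using c w by (auto intro: pathin_track pathin_word_path vertex_config_corner)
  have e: "track G UNIV (p 0) 1 = word_path G (corner G (p 0) {}) w 0" "word_path G (corner G (p 0) {}) w 1 = track G UNIV (p 1) 1"
    using w by (auto simp: track_UNIV_1 word_path_ends)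
  have "path_class X p = path_class X ?q" unfolding eq standard_def using e by (simp add: path_class_join)
  then have "path_homotopic X p ?q" using path_class_eq_iff[OF p] by blast
  then have "holonomy p = holonomy ?q" by (rule holonomy_homotopic)
  also have "\<dots> = holonomy (track G UNIV (p 0)) + (arc_eval G w + - holonomy (track G UNIV (p 1)))"
    using paths e c w by (simp add: holonomy_join pathin_join pathin_rev holonomy_rev holonomy_word_path vertex_config_corner)
  finally show ?thesis by (simp add: algebra_simps)
qed

text \<open>The standard forms of the two paths share their tracks, so equal holonomies force equal
  values of the two words, and legal words of equal value give homotopic edge paths.\<close>

theorem holonomy_faithful:
  assumes p: "pathin X p" and q: "pathin X q" and ends: "p 0 = q 0" "p 1 = q 1" and hol: "holonomy p = holonomy q"
  shows "path_homotopic X p q"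
proof -
  obtain w where w: "legal G (corner G (p 0) {}) w" "dest G (corner G (p 0) {}) w = corner G (p 1) {}"
     "path_class X p = standard (p 0) (p 1) w" using path_standard[OF p] by blast
  obtain u where u: "legal G (corner G (q 0) {}) u" "dest G (corner G (q 0) {}) u = corner G (q 1) {}"
     "path_class X q = standard (q 0) (q 1) u" using path_standard[OF q] by blast
  have "holonomy (track G UNIV (p 0)) + arc_eval G w - holonomy (track G UNIV (p 1))
      = holonomy (track G UNIV (p 0)) + arc_eval G u - holonomy (track G UNIV (p 1))"
    using holonomy_standard[OF p w] holonomy_standard[OF q u] hol ends by simp
  then have "arc_eval G w = arc_eval G u" by (metis add_left_cancel diff_add_cancel)
  moreover have "vertex_config n G (corner G (p 0) {})"
    using path_in_topspace[OF p] by (auto simp: in_X intro: vertex_config_corner)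
  ultimately have "path_class X (word_path G (corner G (p 0) {}) w) = path_class X (word_path G (corner G (p 0) {}) u)"
    using w u ends by (intro word_path_homotopic) auto
  then have "path_class X p = path_class X q" using w(3) u(3) ends by (simp add: standard_def)
  then show ?thesis using path_class_eq_iff[OF p] by blast
qed

lemma track_Vertex: "track G E (Vertex ` T) = (\<lambda>_. Vertex ` T)"
  by (auto simp: track_def cube_path_def image_image fun_eq_iff)

lemma vertex_path_word:
  assumes p: "pathin X p" and ends: "p 0 = Vertex ` T" "p 1 = Vertex ` T'"
  shows "\<exists>w. legal G T w \<and> dest G T w = T' \<and> holonomy p = arc_eval G w"
proof -
  obtain w where w: "legal G (corner G (p 0) {}) w" "dest G (corner G (p 0) {}) w = corner G (p 1) {}"
     "path_class X p = standard (p 0) (p 1) w" using path_standard[OF p] by blast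
  have "Vertex ` T \<in> topspace X" "Vertex ` T' \<in> topspace X" using path_in_topspace[OF p] ends by (metis atLeastAtMost_iff order_refl zero_le_one)+
  then show ?thesis using holonomy_standard[OF p w] w(1,2) by (auto simp: ends track_Vertex holonomy_const)
qed

text \<open>Path components are open: a configuration in the chart that slides to the same vertex
  configuration as \<open>S1\<close> is joined to \<open>S1\<close> by two tracks, and this
  condition is open. As they partition the space, they are also closed.\<close>

lemma path_component_eq_connected_component:
  "path_component_of X = connected_component_of X"
proof (intro ext iffI)
  fix S S' assume "path_component_of X S S'"
  then show "connected_component_of X S S'" by (rule path_imp_connected_component_of)
next
  fix S S' assume SS': "connected_component_of X S S'"
  let ?C = "\<lambda>S. {S'. path_component_of X S S'}"
  have op: "openin X (?C S)" for S
  proof (subst openin_subopen, intro ballI)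
    fix S1 assume "S1 \<in> ?C S"
    then have S1: "path_component_of X S S1" by simp
    have "S1 \<in> topspace X" using path_component_in_topspace[OF S1] by simp
    then obtain E where E: "E \<in> charts G" "S1 \<in> chart n G E" using charts_cover by blast
    let ?U = "{S \<in> topspace X. S \<subseteq> chart_points G E}"
    obtain T where T: "track G E S1 1 = Vertex ` T" using track_1(1)[OF E(2)] by blast
    have conf1: "is_config n G S1" using E by (simp add: chart_def in_X)
    have "vertex_config n G T" using path_in_topspace[OF pathin_track[OF conf1, of E], of 1] T
      by (simp add: in_X is_config_Vertex_image)
    then obtain W where W: "openin X W" "Vertex ` T \<in> W" "\<And>T'. Vertex ` T' \<in> W \<Longrightarrow> T' = T"
      using vertex_config_isolated by blast
    have "continuous_map (subtopology X ?U) (prod_topology (subtopology X ?U) unit_interval) (\<lambda>S. (S, 1))"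
      by (intro continuous_map_pairedI) auto
    from continuous_map_compose[OF this continuous_map_tracks]
    have c: "continuous_map (subtopology X ?U) X (\<lambda>S. track G E S 1)" by (simp add: o_def)
    have U: "openin X ?U" by (rule openin_uconf_subset[OF wf openin_chart_points[OF wf]])
    have "openin (subtopology X ?U) {S \<in> topspace (subtopology X ?U). track G E S 1 \<in> W}"
      by (rule openin_continuous_map_preimage[OF c W(1)])
    then have "openin X {S \<in> topspace (subtopology X ?U). track G E S 1 \<in> W}"
      using U openin_trans_full by blast
    then have op: "openin X ({S \<in> topspace (subtopology X ?U). track G E S 1 \<in> W} \<inter> chart n G E)"
      by (rule openin_Int[OF _ openin_chart[OF E(1)]])
    have "S2 \<in> ?C S" if S2: "S2 \<in> {S \<in> topspace (subtopology X ?U). track G E S 1 \<in> W} \<inter> chart n G E" for S2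
    proof -
      have S2c: "S2 \<in> chart n G E" "track G E S2 1 \<in> W" using S2 by auto
      obtain T2 where T2: "track G E S2 1 = Vertex ` T2" using track_1(1)[OF S2c(1)] by blast
      then have "T2 = T" using W(3) S2c by simp
      have conf2: "is_config n G S2" using S2c by (simp add: chart_def in_X)
      let ?p = "path_join (track G E S1) (path_rev (track G E S2))"
      have "pathin X ?p" using T T2 \<open>T2 = T\<close> by (intro pathin_join pathin_rev pathin_track conf1 conf2) auto
      moreover have "?p 0 = S1" "?p 1 = S2" using track_0 conf1 conf2 by auto
      ultimately have "path_component_of X S1 S2" unfolding path_component_of_def by blast
      from path_component_of_trans[OF S1 this] show ?thesis by simp
    qed
    moreover have "S1 \<in> {S \<in> topspace (subtopology X ?U). track G E S 1 \<in> W} \<inter> chart n G E"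
      using E T W(2) by (auto simp: chart_def)
    ultimately show "\<exists>T. openin X T \<and> S1 \<in> T \<and> T \<subseteq> ?C S" using op by blast
  qed
  have "topspace X - ?C S = (\<Union>S1 \<in> topspace X - ?C S. ?C S1)"
  proof (intro equalityI subsetI)
    fix x assume "x \<in> topspace X - ?C S"
    then show "x \<in> (\<Union>S1 \<in> topspace X - ?C S. ?C S1)" by (intro UN_I[of x]) (auto simp: path_component_of_refl)
  next
    fix x assume "x \<in> (\<Union>S1 \<in> topspace X - ?C S. ?C S1)"
    then obtain S1 where S1: "\<not> path_component_of X S S1" "path_component_of X S1 x" by auto
    moreover have "path_component_of X x S1" by (rule path_component_of_sym[OF S1(2)])
    ultimately have "\<not> path_component_of X S x" using path_component_of_trans[of X S x S1] by blast
    then show "x \<in> topspace X - ?C S" using path_component_in_topspace[OF S1(2)] by simp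
  qed
  moreover have "openin X (\<Union>S1 \<in> topspace X - ?C S. ?C S1)" using op by auto
  ultimately have clopen: "closedin X (?C S)" "openin X (?C S)"
    using op by (auto simp: closedin_def path_component_in_topspace)
  obtain C where C: "connectedin X C" "S \<in> C" "S' \<in> C" using SS' unfolding connected_component_of_def by blast
  have "S \<in> topspace X" using C connectedin_subset_topspace by blast
  then have "S \<in> C \<inter> ?C S" using C(2) by (simp add: path_component_of_refl)
  then have "C \<subseteq> ?C S"
    using connectedin_clopen_cases[OF C(1) clopen] by (auto simp: disjnt_def)
  then show "path_component_of X S S'" using C by blast
qed

end

section \<open>Adding resting particles\<close>

lemma subgraph_simps:
  assumes "subgraph G' G"
  shows "tail G' = tail G" "head G' = head G" "edge_point G' = edge_point G" "cell_carrier G' = cell_carrier G"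
    "disjoint_arcs G' = disjoint_arcs G" "arc_start G' = arc_start G" "arc_end G' = arc_end G" "move G' = move G" "dest G' = dest G"
proof -
  show *: "tail G' = tail G" "head G' = head G" using assms by (auto simp: subgraph_def compatible_def)
  then show e: "edge_point G' = edge_point G" by (auto simp: edge_point_def fun_eq_iff)
  have "cell_carrier G' g = cell_carrier G g" for g by (cases g) (auto simp: e)
  then show "cell_carrier G' = cell_carrier G" by auto
  show "disjoint_arcs G' = disjoint_arcs G" by (auto simp: disjoint_arcs_def fun_eq_iff *)
  show a: "arc_start G' = arc_start G" "arc_end G' = arc_end G" by (auto simp: arc_start_def arc_end_def *)
  show "move G' = move G" by (auto simp: move_def fun_eq_iff a)
  then show "dest G' = dest G" by (simp add: dest_def[abs_def])
qed

lemma subgraph_legal: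
  assumes "subgraph G' G" shows "legal G' T w \<Longrightarrow> legal G T w"
proof (induction w arbitrary: T)
  case (Cons a w)
  then show ?case using assms by (auto simp: can_move_def subgraph_simps[OF assms] subgraph_def)
qed simp

lemma subgraph_graph_points: "subgraph G' G \<Longrightarrow> graph_points G' \<subseteq> graph_points G"
  unfolding subgraph_def graph_points_def by blast

lemma subgraph_graph_space:
  assumes "subgraph G' G" shows "continuous_map (graph_space G') (graph_space G) (\<lambda>g. g)"
proof -
  have wf: "wf_digraph G'" "wf_digraph G" using assms by (auto simp: subgraph_def)
  have "openin (graph_space G') {g \<in> graph_points G'. g \<in> U}" if U: "openin (graph_space G) U" for U
    unfolding openin_graph_space
  proof (intro conjI ballI)
    fix e assume e: "e \<in> arcs G'"
    then have "{t \<in> {0..1}. edge_point G' e t \<in> {g \<in> graph_points G'. g \<in> U}} = {t \<in> {0..1}. edge_point G e t \<in> U}"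
      using edge_point_in_graph_points[OF wf(1) e] by (auto simp: subgraph_simps[OF assms])
    moreover have "e \<in> arcs G" using e assms by (auto simp: subgraph_def)
    ultimately show "openin unit_interval {t \<in> {0..1}. edge_point G' e t \<in> {g \<in> graph_points G'. g \<in> U}}"
      using U by (simp add: openin_graph_space)
  qed auto
  then show ?thesis unfolding continuous_map
    using subgraph_graph_points[OF assms] by (auto simp: topspace_graph_space wf)
qed

text \<open>Used with \<open>B\<close> consisting of an endpoint of a cut edge, for the two
  combinatorial hyperplanes, and with \<open>B\<close> empty, for the inclusion of the cut
  graph.\<close>

locale add_particles =
  fixes G' G :: "('v, 'e) pre_digraph" and B :: "'v set" and k n :: nat
  assumes sub: "subgraph G' G" and B: "finite B" "B \<subseteq> verts G - verts G'" and n: "n = k + card B"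
begin

abbreviation add :: "('v, 'e) gpoint set \<Rightarrow> ('v, 'e) gpoint set" where
  "add S \<equiv> S \<union> Vertex ` B"

lemma wf_G': "wf_digraph G'" and wf_G: "wf_digraph G"
  using sub by (auto simp: subgraph_def)

sublocale C': graph_config G' k by (rule graph_config.intro[OF wf_G'])
sublocale C: graph_config G n by (rule graph_config.intro[OF wf_G])

text \<open>The carrier of a point of \<open>G'\<close> contains no vertices but those of
  \<open>G'\<close>, and \<open>B\<close> avoids these.\<close>

lemma cell_carrier_avoids:
  assumes "g \<in> graph_points G'" "b \<in> B" shows "Vertex b \<notin> cell_carrier G g"
proof
  assume "Vertex b \<in> cell_carrier G g"
  then have "b \<in> verts G'"
  proof (cases g)
    case (Interior e t)
    then have e: "e \<in> arcs G'" using assms by simp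
    assume "Vertex b \<in> cell_carrier G g"
    then obtain u where "u \<in> {0..1}" "Vertex b = edge_point G' e u" using Interior by (auto simp: subgraph_simps[OF sub])
    then show ?thesis using edge_point_in_graph_points[OF wf_G' e] by (metis in_graph_points(1))
  qed (use assms in auto)
  then show False using assms B by auto
qed

lemma continuous_map_add: "continuous_map C'.X C.X add"
proof -
  obtain b where b: "bij_betw b {..<card B} B"
    using ex_bij_betw_nat_finite[OF B(1)] by (auto simp: atLeast0LessThan)
  \<comment> \<open>The first \<open>k\<close> coordinates are the moving particles, the others
    enumerate \<open>B\<close>.\<close>
  let ?f = "\<lambda>i x. if i < k then x i else Vertex (b (i - k))"
  have bB: "b (i - k) \<in> B" if "i < n" "\<not> i < k" for i
    using b that n by (auto simp: bij_betw_def)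
  have "continuous_map (conf_space k G') C.X (\<lambda>x. (\<lambda>i. ?f i x) ` {..<n})"
  proof (rule continuous_map_into_uconf[OF wf_G])
    fix i assume i: "i < n"
    show "continuous_map (conf_space k G') (graph_space G) (?f i)"
    proof (cases "i < k")
      case True
      then show ?thesis
        using continuous_map_compose[OF continuous_map_coordinate[OF True] subgraph_graph_space[OF sub]] by (simp add: o_def)
    next
      case False
      then show ?thesis using bB[OF i False] B by (auto simp: topspace_graph_space[OF wf_G])
    qed
  next
    fix x i j assume x: "x \<in> topspace (conf_space k G')" and ij: "i < n" "j < n" "i \<noteq> j"
    have gp: "x i \<in> graph_points G'" if "i < k" for i
      using x that by (auto simp: in_topspace_conf_space[OF wf_G'])
    have "b (i - k) \<noteq> b (j - k)" if "\<not> i < k" "\<not> j < k"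
    proof
      assume "b (i - k) = b (j - k)"
      then have "i - k = j - k" using b n ij that unfolding bij_betw_def by (intro inj_onD[of b "{..<card B}"]) auto
      then show False using that ij by auto
    qed
    then show "cell_carrier G (?f i x) \<inter> cell_carrier G (?f j x) = {}"
      using x ij cell_carrier_avoids[OF gp bB] by (auto simp: in_topspace_conf_space[OF wf_G'] subgraph_simps[OF sub])
  qed
  moreover have "(\<lambda>i. ?f i x) ` {..<n} = add (x ` {..<k})" for x
  proof -
    have "{..<n} = {..<k} \<union> (\<lambda>j. k + j) ` {..<card B}"
    proof (intro equalityI subsetI)
      fix i assume i: "i \<in> {..<n}"
      show "i \<in> {..<k} \<union> (\<lambda>j. k + j) ` {..<card B}"
      proof (cases "i < k")
        case False
        then show ?thesis using i n by (intro UnI2 image_eqI[of _ _ "i - k"]) auto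
      qed simp
    qed (auto simp: n)
    moreover have "(\<lambda>i. ?f i x) ` {..<k} = x ` {..<k}" by (rule image_cong) auto
    moreover have "(\<lambda>i. ?f i x) ` (\<lambda>j. k + j) ` {..<card B} = Vertex ` b ` {..<card B}"
      unfolding image_image by (rule image_cong) auto
    ultimately have "(\<lambda>i. ?f i x) ` {..<n} = x ` {..<k} \<union> Vertex ` b ` {..<card B}"
      by (simp only: image_Un)
    then show ?thesis using b by (simp add: bij_betw_def)
  qed
  ultimately have "continuous_map (conf_space k G') C.X (add \<circ> (\<lambda>x. x ` {..<k}))" by (simp add: o_def)
  then show ?thesis by (rule continuous_compose_quotient_map[OF quotient_map_uconf])
qed

lemma chart_add:
  assumes "E \<in> charts G'" "S \<in> chart k G' E"
  shows "E \<in> charts G" "add S \<in> chart n G E" "chart_sum G E (add S) = chart_sum G' E S"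
proof -
  show "E \<in> charts G" using assms sub by (auto simp: charts_def subgraph_def)
  have S: "S \<in> topspace C'.X" "S \<subseteq> chart_points G' E" "\<forall>e\<in>E. \<exists>t. Interior e t \<in> S"
    using assms by (auto simp: chart_def)
  have "add S \<in> topspace C.X" using continuous_map_image_subset_topspace[OF continuous_map_add] S(1) by blast
  moreover have "chart_points G' E \<subseteq> chart_points G E"
    using sub unfolding chart_points_def subgraph_def compatible_def by auto
  moreover have "Vertex ` B \<subseteq> chart_points G E"
  proof -
    have "b \<noteq> tail G e \<and> b \<noteq> head G e" if "b \<in> B" "e \<in> E" for b e
      using that assms(1) B(2) wf_G' subgraph_simps(1,2)[OF sub] by (auto simp: charts_def wf_digraph_def)
    then show ?thesis using B by (auto simp: chart_points_def)
  qed
  ultimately show "add S \<in> chart n G E" using S by (auto simp: chart_def)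
  have "passed (add S) = passed S" by (auto simp: passed_def)
  then show "chart_sum G E (add S) = chart_sum G' E S" by (simp add: chart_sum_def subgraph_simps[OF sub])
qed

lemma transports_add: "C'.transports p a b g \<Longrightarrow> C.transports (add \<circ> p) a b g"
proof (induction rule: C'.transports.induct)
  case (chart a b E)
  have "C.transports (add \<circ> p) a b (- chart_sum G E ((add \<circ> p) a) + chart_sum G E ((add \<circ> p) b))"
    using chart by (intro C.transports.chart) (auto intro: chart_add)
  moreover have "chart_sum G E (add (p a)) = chart_sum G' E (p a)" "chart_sum G E (add (p b)) = chart_sum G' E (p b)"
    using chart by (auto intro!: chart_add(3))
  ultimately show ?case by (simp only: o_def)
next
  case (compose a b g c h)
  then show ?case by (rule_tac C.transports.compose)
qed

text \<open>Resting particles pass no midpoint. Together with faithfulness this is the source of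
  injectivity of the maps induced on fundamental groups.\<close>

lemma holonomy_add: "pathin C'.X p \<Longrightarrow> C.holonomy (add \<circ> p) = C'.holonomy p"
  by (intro C.holonomy_eqI pathin_map[OF continuous_map_add] transports_add C'.transports_holonomy)

end

section \<open>Configurations of a connected graph\<close>

lemma arc_stepE:
  assumes "(x, y) \<in> (arcs_ends G)\<^sup>s"
  obtains a where "fst a \<in> arcs G" "arc_start G a = x" "arc_end G a = y"
proof -
  from assms consider e where "e \<in> arcs G" "x = tail G e" "y = head G e" | e where "e \<in> arcs G" "y = tail G e" "x = head G e"
    by (auto simp: symcl_def arcs_ends_def arc_to_ends_def)
  then show ?thesis
    by cases (auto intro: that[of "(_, True)"] that[of "(_, False)"] simp: arc_start_def arc_end_def)
qed

text \<open>Particles are indistinguishable: one that stands in the way moves on to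
  \<open>b\<close>, and the particle from \<open>a\<close> takes its place.\<close>

lemma slide_particle:
  assumes "(a, b) \<in> rtrancl_on (verts G) ((arcs_ends G)\<^sup>s)" "a \<in> T" "b \<notin> T"
  shows "\<exists>w. legal G T w \<and> dest G T w = insert b (T - {a})"
  using assms
proof (induction arbitrary: T rule: rtrancl_on_induct)
  case base
  then show ?case by simp
next
  case (step c b)
  obtain x where x: "fst x \<in> arcs G" "arc_start G x = c" "arc_end G x = b" using step.hyps by (auto elim: arc_stepE)
  consider "c = a" | "c = b" "c \<noteq> a" | "c \<noteq> a" "c \<noteq> b" "c \<notin> T" | "c \<noteq> a" "c \<in> T" by blast
  then show ?case
  proof cases
    case 1
    then have "can_move G T x" using x step.prems by (simp add: can_move_def)
    then show ?thesis using x 1 by (intro exI[of _ "[x]"]) (simp add: move_def)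
  next
    case 2
    then show ?thesis using step by auto
  next
    case 3
    then obtain w where w: "legal G T w" "dest G T w = insert c (T - {a})" using step by blast
    have "can_move G (insert c (T - {a})) x" using x step.prems 3 by (auto simp: can_move_def)
    moreover have "move G (insert c (T - {a})) x = insert b (T - {a})" using x 3 by (auto simp: move_def)
    ultimately show ?thesis using w by (intro exI[of _ "w @ [x]"]) simp
  next
    case 4
    then have m: "can_move G T x" using x step.prems by (simp add: can_move_def)
    have "a \<in> move G T x" "c \<notin> move G T x" using x 4 step.prems by (auto simp: move_def)
    then obtain w where w: "legal G (move G T x) w" "dest G (move G T x) w = insert c (move G T x - {a})" using step.IH by blast
    have "insert c (move G T x - {a}) = insert b (T - {a})" using x 4 step.prems by (auto simp: move_def)
    then show ?thesis using w m by (intro exI[of _ "x # w"]) simp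
  qed
qed

lemma connected_legal_word:
  assumes conn: "Digraph_Component.connected G" and T: "vertex_config n G T" and T': "vertex_config n G T'"
  shows "\<exists>w. legal G T w \<and> dest G T w = T'"
  using T
proof (induction "card (T - T')" arbitrary: T)
  case 0
  then have "T \<subseteq> T'" by (auto simp: vertex_config_def)
  then have "T = T'" using 0 T' by (auto simp: vertex_config_def card_subset_eq)
  then show ?case by (intro exI[of _ "[]"]) simp
next
  case (Suc m)
  have fin: "finite T" "finite T'" "card T = card T'" "T \<subseteq> verts G" "T' \<subseteq> verts G" using Suc.prems T' by (auto simp: vertex_config_def)
  obtain a where a: "a \<in> T - T'" using Suc.hyps(2) by (metis card.empty ex_in_conv nat.distinct(1))
  have "\<not> T' \<subseteq> T" using a card_subset_eq[of T T'] fin by auto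
  then obtain b where b: "b \<in> T' - T" by auto
  have "(a, b) \<in> rtrancl_on (verts G) ((arcs_ends G)\<^sup>s)" using conn a b fin unfolding connected_conv by auto
  from slide_particle[OF this, of T] obtain w where w: "legal G T w" "dest G T w = insert b (T - {a})" using a b by auto
  let ?T = "insert b (T - {a})"
  have "?T - T' = (T - T') - {a}" using a b by auto
  then have "card (?T - T') = m" using Suc.hyps(2) a fin by simp
  moreover have "vertex_config n G ?T"
  proof -
    have "card ?T = Suc (card (T - {a}))" using fin b by (intro card_insert_disjoint) auto
    also have "\<dots> = card T" using fin a by (intro card_Suc_Diff1) auto
    finally show ?thesis using Suc.prems b fin by (auto simp: vertex_config_def)
  qed
  ultimately obtain u where "legal G ?T u" "dest G ?T u = T'" using Suc.hyps(1)[of ?T] by auto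
  then show ?case using w by (intro exI[of _ "w @ u"]) simp
qed

context graph_config
begin

lemma word_imp_path:
  assumes "vertex_config n G T" "legal G T w"
  obtains p where "pathin X p" "p 0 = Vertex ` T" "p 1 = Vertex ` dest G T w" "holonomy p = arc_eval G w"
  by (rule that[OF pathin_word_path[OF assms] word_path_ends[OF assms(2)] holonomy_word_path[OF assms]])

lemma path_connected_uconf:
  assumes "Digraph_Component.connected G" "S \<in> topspace X" "S' \<in> topspace X"
  obtains p where "pathin X p" "p 0 = S" "p 1 = S'"
proof -
  have c: "is_config n G S" "is_config n G S'" using assms by (auto simp: in_X)
  note v = c[THEN vertex_config_corner, of "{}"]
  obtain w where w: "legal G (corner G S {}) w" "dest G (corner G S {}) w = corner G S' {}"
    using connected_legal_word[OF assms(1) v] by blast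
  let ?p = "path_join (track G UNIV S) (path_join (word_path G (corner G S {}) w) (path_rev (track G UNIV S')))"
  have "pathin X ?p"
    using c v w by (intro pathin_join pathin_rev pathin_track pathin_word_path) (auto simp: track_UNIV_1 word_path_ends)
  then show ?thesis using that[of ?p] c by (simp add: track_0)
qed

end

section \<open>Hyperplanes\<close>

lemma subgraph_remove_closed_edge:
  assumes "wf_digraph G" shows "subgraph (remove_closed_edge G e) G"
  using assms unfolding remove_closed_edge_def subgraph_def compatible_def
  by (auto simp: wf_digraph_def induce_subgraph_def)

lemma subgraph_remove_open_edges:
  assumes "wf_digraph G" shows "subgraph (remove_open_edges G A) G"
  using assms unfolding remove_open_edges_def subgraph_def compatible_def
  by (auto simp: wf_digraph_def)

lemma verts_remove_closed_edge [simp]: "verts (remove_closed_edge G e) = verts G - {tail G e, head G e}"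
  by (simp add: remove_closed_edge_def)

lemma arcs_remove_closed_edge:
  assumes "wf_digraph G"
  shows "f \<in> arcs (remove_closed_edge G e) \<longleftrightarrow> f \<in> arcs G \<and> disjoint_arcs G e f"
  using assms by (auto simp: remove_closed_edge_def disjoint_arcs_def wf_digraph_def)

lemma uconf_edges_iff:
  assumes "n \<ge> 1"
  shows "(e, T) \<in> uconf_edges n G \<longleftrightarrow> e \<in> arcs G \<and> vertex_config (n - 1) (remove_closed_edge G e) T"
  using assms by (auto simp: uconf_edges_def vertex_config_def)

text \<open>A square with a side labelled \<open>e\<close> is a move of the remaining particles away
  from \<open>e\<close>; thus parallelism becomes reachability by edge paths in
  \<open>remove_closed_edge G e\<close>.\<close>

lemma opposite_edges_move:
  assumes G: "wf_digraph G" and n: "n \<ge> 1"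
  defines "\<Delta> \<equiv> \<lambda>e. remove_closed_edge G e"
  shows "((e, T), (e', T')) \<in> opposite_edges n G \<union> (opposite_edges n G)\<inverse> \<longleftrightarrow>
    e' = e \<and> e \<in> arcs G \<and> vertex_config (n - 1) (\<Delta> e) T \<and> (\<exists>a. can_move (\<Delta> e) T a \<and> T' = move (\<Delta> e) T a)"
    (is "?L \<longleftrightarrow> ?R")
proof -
  note s = subgraph_simps[OF subgraph_remove_closed_edge[OF G], of e]
  have opp: "e' = e \<and> e \<in> arcs G \<and> vertex_config (n - 1) (\<Delta> e) T \<and> can_move (\<Delta> e) T (f, s) \<and> T' = move (\<Delta> e) T (f, s)"
    if "e' = e" "e \<in> arcs G" "f \<in> arcs G" "{tail G e, head G e} \<inter> {tail G f, head G f} = {}"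
      "T0 \<subseteq> verts G - {tail G e, head G e, tail G f, head G f}" "finite T0" "card T0 + 2 = n"
      "T = insert (if s then tail G f else head G f) T0" "T' = insert (if s then head G f else tail G f) T0" for f s T0
  proof -
    have "f \<in> arcs (\<Delta> e)" using that by (auto simp: \<Delta>_def arcs_remove_closed_edge[OF G] disjoint_arcs_def)
    moreover have "tail G f \<notin> T0" "head G f \<notin> T0" using that by auto
    moreover have "tail G f \<in> verts G" "head G f \<in> verts G" using that G by (auto simp: wf_digraph_def)
    ultimately show ?thesis using that s unfolding \<Delta>_def
      by (auto simp: vertex_config_def can_move_def move_def arc_start_def arc_end_def)
  qed
  show ?thesis
  proof
    assume ?L
    then consider (1) "((e, T), (e', T')) \<in> opposite_edges n G" | (2) "((e', T'), (e, T)) \<in> opposite_edges n G" by auto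
    then show ?R
    proof cases
      case 1
      then obtain f T0 where "e' = e" "e \<in> arcs G" "f \<in> arcs G" "{tail G e, head G e} \<inter> {tail G f, head G f} = {}"
        "T0 \<subseteq> verts G - {tail G e, head G e, tail G f, head G f}" "finite T0" "card T0 + 2 = n"
        "T = insert (tail G f) T0" "T' = insert (head G f) T0" unfolding opposite_edges_def by blast
      then show ?thesis using opp[of f T0 True] by auto
    next
      case 2
      then obtain f T0 where "e' = e" "e \<in> arcs G" "f \<in> arcs G" "{tail G e, head G e} \<inter> {tail G f, head G f} = {}"
        "T0 \<subseteq> verts G - {tail G e, head G e, tail G f, head G f}" "finite T0" "card T0 + 2 = n"
        "T = insert (head G f) T0" "T' = insert (tail G f) T0" unfolding opposite_edges_def by blast
      then show ?thesis using opp[of f T0 False] by auto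
    qed
  next
    assume ?R
    then obtain f s where R: "e' = e" "e \<in> arcs G" "vertex_config (n - 1) (\<Delta> e) T" "can_move (\<Delta> e) T (f, s)" "T' = move (\<Delta> e) T (f, s)"
      by auto
    let ?T0 = "T - {arc_start G (f, s)}"
    have f: "f \<in> arcs G" "{tail G e, head G e} \<inter> {tail G f, head G f} = {}"
      using R(4) by (auto simp: can_move_def \<Delta>_def arcs_remove_closed_edge[OF G] disjoint_arcs_def)
    have mem: "arc_start G (f, s) \<in> T" "arc_end G (f, s) \<notin> ?T0" using R(4) s by (auto simp: can_move_def \<Delta>_def)
    have T0: "?T0 \<subseteq> verts G - {tail G e, head G e, tail G f, head G f}" "finite ?T0"
      using R(3) mem by (auto simp: vertex_config_def \<Delta>_def arc_start_def arc_end_def split: if_splits)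
    have "card ?T0 + 1 = card T" using mem R(3) card_Suc_Diff1[of T "arc_start G (f, s)"] by (simp add: vertex_config_def)
    moreover have "card T > 0" using mem R(3) card_gt_0_iff[of T] unfolding vertex_config_def by blast
    ultimately have card: "card ?T0 + 2 = n" using R(3) n by (auto simp: vertex_config_def)
    have T: "T = insert (arc_start G (f, s)) ?T0" "T' = insert (arc_end G (f, s)) ?T0"
      using mem R(5) s by (auto simp: move_def \<Delta>_def)
    have "((e, insert (tail G f) ?T0), (e, insert (head G f) ?T0)) \<in> opposite_edges n G"
      unfolding opposite_edges_def using R(2) f T0 card by blast
    then have "((e, insert (arc_start G (f, s)) ?T0), (e, insert (arc_end G (f, s)) ?T0)) \<in> opposite_edges n G \<union> (opposite_edges n G)\<inverse>"
      by (cases s) (auto simp: arc_start_def arc_end_def)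
    then show ?L using T R(1) by metis
  qed
qed

text \<open>The parallelism class of \<open>(e, T)\<close>, described by the positions that the
  other particles can reach away from \<open>e\<close>.\<close>

definition hyperplane_of :: "('v, 'e) pre_digraph \<Rightarrow> 'e \<Rightarrow> 'v set \<Rightarrow> ('e \<times> 'v set) set" where
  "hyperplane_of G e T = {(e, T') | T'. \<exists>w. legal (remove_closed_edge G e) T w \<and> dest (remove_closed_edge G e) T w = T'}"

lemma parallelism_class:
  assumes G: "wf_digraph G" and n: "n \<ge> 1" and e: "e \<in> arcs G" and T: "vertex_config (n - 1) (remove_closed_edge G e) T"
  shows "parallelism n G `` {(e, T)} = hyperplane_of G e T"
proof -
  let ?r = "opposite_edges n G \<union> (opposite_edges n G)\<inverse>" and ?D = "remove_closed_edge G e"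
  have wf: "wf_digraph ?D" using subgraph_remove_closed_edge[OF G] by (auto simp: subgraph_def)
  have 1: "\<exists>w. legal ?D T w \<and> x = (e, dest ?D T w) \<and> vertex_config (n - 1) ?D (dest ?D T w)"
    if "((e, T), x) \<in> ?r\<^sup>*" for x
    using that
  proof (induction rule: rtrancl_induct)
    case base
    then show ?case using T by (intro exI[of _ "[]"]) simp
  next
    case (step y z)
    then obtain w where w: "legal ?D T w" "y = (e, dest ?D T w)" "vertex_config (n - 1) ?D (dest ?D T w)" by blast
    obtain e' T' where z: "z = (e', T')" by (cases z)
    from step.hyps(2) obtain a where a: "e' = e" "can_move ?D (dest ?D T w) a" "T' = move ?D (dest ?D T w) a"
      unfolding w(2) z opposite_edges_move[OF G n] by blast
    then show ?case using w z vertex_config_move[OF wf w(3) a(2)] by (intro exI[of _ "w @ [a]"]) simp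
  qed
  have 2: "((e, T), (e, dest ?D T w)) \<in> ?r\<^sup>*" if "legal ?D T w" for w
    using that T
  proof (induction w arbitrary: T)
    case (Cons a w)
    then have "((e, T), (e, move ?D T a)) \<in> ?r"
      unfolding opposite_edges_move[OF G n] using e by (intro conjI exI[of _ a]) auto
    moreover have "((e, move ?D T a), (e, dest ?D (move ?D T a) w)) \<in> ?r\<^sup>*"
      using Cons by (auto intro: vertex_config_move[OF wf])
    ultimately show ?case by (simp add: converse_rtrancl_into_rtrancl)
  qed simp
  have "(e, T) \<in> uconf_edges n G" using e T n by (simp add: uconf_edges_iff)
  then show ?thesis unfolding hyperplane_of_def parallelism_def using 1 2 by (auto simp: Image_singleton) blast+
qed

lemma hyperplanes_labelled_eq:
  assumes "wf_digraph G" "n \<ge> 1" "e \<in> arcs G"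
  shows "hyperplanes_labelled n G e = {hyperplane_of G e T | T. vertex_config (n - 1) (remove_closed_edge G e) T}"
proof (intro equalityI subsetI)
  fix H assume "H \<in> hyperplanes_labelled n G e"
  then obtain e' T T' where H: "(e', T') \<in> uconf_edges n G" "H = parallelism n G `` {(e', T')}" "(e, T) \<in> H"
    unfolding hyperplanes_labelled_def hyperplanes_def by (auto elim!: quotientE)
  have v: "e' \<in> arcs G" "vertex_config (n - 1) (remove_closed_edge G e') T'" using H(1) assms by (auto simp: uconf_edges_iff)
  have "H = hyperplane_of G e' T'" using H(2) parallelism_class[OF assms(1,2) v] by simp
  moreover from this H(3) have "e' = e" by (auto simp: hyperplane_of_def)
  ultimately show "H \<in> {hyperplane_of G e T | T. vertex_config (n - 1) (remove_closed_edge G e) T}" using v by blast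
next
  fix H assume "H \<in> {hyperplane_of G e T | T. vertex_config (n - 1) (remove_closed_edge G e) T}"
  then obtain T where T: "H = hyperplane_of G e T" "vertex_config (n - 1) (remove_closed_edge G e) T" by blast
  then have "(e, T) \<in> uconf_edges n G" using assms by (simp add: uconf_edges_iff)
  then have "H \<in> hyperplanes n G"
    unfolding hyperplanes_def T(1) parallelism_class[OF assms T(2), symmetric] by (rule quotientI)
  moreover have "(e, T) \<in> H" unfolding T(1) hyperplane_of_def by (auto intro: exI[of _ "[]"])
  ultimately show "H \<in> hyperplanes_labelled n G e" unfolding hyperplanes_labelled_def by blast
qed

lemma hyperplane_of_eq:
  assumes "legal (remove_closed_edge G e) T w"
  shows "hyperplane_of G e (dest (remove_closed_edge G e) T w) = hyperplane_of G e T"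
proof -
  let ?D = "remove_closed_edge G e"
  have 1: "\<exists>u'. legal ?D (dest ?D T w) u' \<and> dest ?D (dest ?D T w) u' = dest ?D T u" if "legal ?D T u" for u
    using legal_rev_word[OF assms] that by (intro exI[of _ "rev_word w @ u"]) simp
  have 2: "\<exists>u'. legal ?D T u' \<and> dest ?D T u' = dest ?D (dest ?D T w) u" if "legal ?D (dest ?D T w) u" for u
    using assms that by (intro exI[of _ "w @ u"]) simp
  have "(\<exists>u. legal ?D (dest ?D T w) u \<and> dest ?D (dest ?D T w) u = T') \<longleftrightarrow> (\<exists>u. legal ?D T u \<and> dest ?D T u = T')" for T'
  proof
    assume "\<exists>u. legal ?D (dest ?D T w) u \<and> dest ?D (dest ?D T w) u = T'"
    then obtain u where "legal ?D (dest ?D T w) u" "dest ?D (dest ?D T w) u = T'" by blast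
    then show "\<exists>u. legal ?D T u \<and> dest ?D T u = T'" using 2[of u] by simp
  next
    assume "\<exists>u. legal ?D T u \<and> dest ?D T u = T'"
    then obtain u where "legal ?D T u" "dest ?D T u = T'" by blast
    then show "\<exists>u. legal ?D (dest ?D T w) u \<and> dest ?D (dest ?D T w) u = T'" using 1[of u] by simp
  qed
  then show ?thesis unfolding hyperplane_of_def by simp
qed

text \<open>The elements of the class are joined by edge paths, so they lie in one component, and
  components are disjoint; this pins down the \<open>THE\<close>.\<close>

lemma hyperplane_component_eq:
  assumes G: "wf_digraph G" and T: "vertex_config (n - 1) (remove_closed_edge G e) T"
  shows "hyperplane_component n G e (hyperplane_of G e T)
    = connected_component_of_set (uconf_space (n - 1) (remove_closed_edge G e)) (Vertex ` T)"
proof -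
  let ?D = "remove_closed_edge G e" and ?Y = "uconf_space (n - 1) (remove_closed_edge G e)"
  interpret Y: graph_config ?D "n - 1"
    by (rule graph_config.intro) (use subgraph_remove_closed_edge[OF G, of e] in \<open>simp add: subgraph_def\<close>)
  have top: "Vertex ` T \<in> topspace ?Y" unfolding Y.in_X is_config_Vertex_image by (rule T)
  have self: "(e, T) \<in> hyperplane_of G e T" unfolding hyperplane_of_def by (auto intro: exI[of _ "[]"])
  show ?thesis unfolding hyperplane_component_def
  proof (rule the_equality)
    have "Vertex ` T' \<in> connected_component_of_set ?Y (Vertex ` T)" if T': "(e, T') \<in> hyperplane_of G e T" for T'
    proof -
      obtain w where w: "legal ?D T w" "dest ?D T w = T'" using T' by (auto simp: hyperplane_of_def)
      obtain p where "pathin ?Y p" "p 0 = Vertex ` T" "p 1 = Vertex ` T'"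
        using Y.word_imp_path[OF T w(1)] unfolding w(2) .
      then have "path_component_of ?Y (Vertex ` T) (Vertex ` T')" unfolding path_component_of_def by blast
      then show ?thesis unfolding Y.path_component_eq_connected_component by simp
    qed
    then show "connected_component_of_set ?Y (Vertex ` T) \<in> connected_components_of ?Y \<and>
        (\<forall>T'. (e, T') \<in> hyperplane_of G e T \<longrightarrow> Vertex ` T' \<in> connected_component_of_set ?Y (Vertex ` T))"
      using top by (auto simp: connected_components_of_def)
  next
    fix C assume "C \<in> connected_components_of ?Y \<and> (\<forall>T'. (e, T') \<in> hyperplane_of G e T \<longrightarrow> Vertex ` T' \<in> C)"
    then have C: "C \<in> connected_components_of ?Y" "Vertex ` T \<in> C" using self by auto
    then obtain x where x: "x \<in> topspace ?Y" "C = connected_component_of_set ?Y x" by (auto simp: connected_components_of_def)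
    then have "connected_component_of ?Y x (Vertex ` T)" using C by simp
    then show "C = connected_component_of_set ?Y (Vertex ` T)"
      using x by (metis connected_component_of_equiv)
  qed
qed

section \<open>Fundamental groups and holonomy\<close>

definition additive_group :: "'g::group_add set \<Rightarrow> 'g monoid" where
  "additive_group H = \<lparr>carrier = H, mult = (+), one = 0\<rparr>"

lemma additive_group_simps [simp]:
  "carrier (additive_group H) = H" "x \<otimes>\<^bsub>additive_group H\<^esub> y = x + y" "\<one>\<^bsub>additive_group H\<^esub> = 0"
  by (auto simp: additive_group_def)

lemma group_additive_group:
  assumes "0 \<in> H" "\<And>x y. x \<in> H \<Longrightarrow> y \<in> H \<Longrightarrow> x + y \<in> H" "\<And>x. x \<in> H \<Longrightarrow> - x \<in> H"
  shows "group (additive_group H)"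
proof (rule groupI)
  fix x assume "x \<in> carrier (additive_group H)"
  then show "\<exists>y\<in>carrier (additive_group H). y \<otimes>\<^bsub>additive_group H\<^esub> x = \<one>\<^bsub>additive_group H\<^esub>"
    using assms by (intro bexI[of _ "- x"]) auto
qed (use assms in \<open>auto simp: add.assoc\<close>)

lemma fundamental_group_simps [simp]:
  "carrier (fundamental_group X x) = path_class X ` loops X x"
  "\<one>\<^bsub>fundamental_group X x\<^esub> = path_class X (\<lambda>_. x)"
  by (auto simp: fundamental_group_def)

lemma UN_UN_const:
  "(\<And>x y. x \<in> A \<Longrightarrow> y \<in> B \<Longrightarrow> f x y = c) \<Longrightarrow> a \<in> A \<Longrightarrow> b \<in> B \<Longrightarrow> (\<Union>x\<in>A. \<Union>y\<in>B. f x y) = c"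
  by auto

lemma fundamental_group_mult:
  assumes "p \<in> loops X x" "q \<in> loops X x"
  shows "path_class X p \<otimes>\<^bsub>fundamental_group X x\<^esub> path_class X q = path_class X (path_join p q)"
proof -
  have "path_class X (path_join p' q') = path_class X (path_join p q)"
    if "p' \<in> path_class X p" "q' \<in> path_class X q" for p' q'
    by (rule path_class_eq[OF path_homotopic_sym[OF path_homotopic_join]])
      (use that assms in \<open>auto simp: path_class_def loops_def\<close>)
  moreover have "p \<in> path_class X p" "q \<in> path_class X q"
    using assms by (auto simp: path_class_def loops_def path_homotopic_refl)
  ultimately show ?thesis unfolding fundamental_group_def monoid.simps by (intro UN_UN_const)
qed

lemma loops_join: "p \<in> loops X x \<Longrightarrow> q \<in> loops X x \<Longrightarrow> path_join p q \<in> loops X x"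
  by (auto simp: loops_def pathin_join)

lemma loops_rev: "p \<in> loops X x \<Longrightarrow> path_rev p \<in> loops X x"
  by (auto simp: loops_def pathin_rev)

lemma group_fundamental_group:
  assumes "x \<in> topspace X" shows "group (fundamental_group X x)"
proof (rule groupI)
  have c: "(\<lambda>_. x) \<in> loops X x" using assms by (simp add: loops_def)
  then show "\<one>\<^bsub>fundamental_group X x\<^esub> \<in> carrier (fundamental_group X x)" by auto
  fix A assume "A \<in> carrier (fundamental_group X x)"
  then obtain p where p: "p \<in> loops X x" "A = path_class X p" by auto
  have p': "pathin X p" "p 0 = x" "p 1 = x" using p by (auto simp: loops_def)
  show "\<one>\<^bsub>fundamental_group X x\<^esub> \<otimes>\<^bsub>fundamental_group X x\<^esub> A = A"
    using path_class_eq[OF path_join_const_left[OF p'(1,2)]] fundamental_group_mult[OF c p(1)] p(2) by simp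
  have "path_class X (path_rev p) \<otimes>\<^bsub>fundamental_group X x\<^esub> A = \<one>\<^bsub>fundamental_group X x\<^esub>"
    using path_class_eq[OF path_join_rev_left[OF p'(1)]] fundamental_group_mult[OF loops_rev[OF p(1)] p(1)] p(2) p'(3) by simp
  then show "\<exists>B\<in>carrier (fundamental_group X x). B \<otimes>\<^bsub>fundamental_group X x\<^esub> A = \<one>\<^bsub>fundamental_group X x\<^esub>"
    using loops_rev[OF p(1)] by auto
  fix B assume "B \<in> carrier (fundamental_group X x)"
  then obtain q where q: "q \<in> loops X x" "B = path_class X q" by auto
  show "A \<otimes>\<^bsub>fundamental_group X x\<^esub> B \<in> carrier (fundamental_group X x)"
    using fundamental_group_mult[OF p(1) q(1)] p q loops_join[OF p(1) q(1)] by simp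
  fix C assume "C \<in> carrier (fundamental_group X x)"
  then obtain r where r: "r \<in> loops X x" "C = path_class X r" by auto
  have "path_homotopic X (path_join (path_join p q) r) (path_join p (path_join q r))"
    by (rule path_join_assoc) (use p q r in \<open>auto simp: loops_def\<close>)
  then show "A \<otimes>\<^bsub>fundamental_group X x\<^esub> B \<otimes>\<^bsub>fundamental_group X x\<^esub> C = A \<otimes>\<^bsub>fundamental_group X x\<^esub> (B \<otimes>\<^bsub>fundamental_group X x\<^esub> C)"
    using p q r by (simp add: fundamental_group_mult loops_join path_class_eq)
qed

context graph_config
begin

text \<open>The morphisms of the fundamental groupoid from \<open>x\<close> to \<open>y\<close>,
  seen in the Artin group, with addition as composition. Membership in these sets replaces most
  explicit constructions of paths later on.\<close>

definition hols :: "('v, 'e) gpoint set \<Rightarrow> ('v, 'e) gpoint set \<Rightarrow> ('e \<times> bool) list set bijection set" where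
  "hols x y = {holonomy p | p. pathin X p \<and> p 0 = x \<and> p 1 = y}"

definition hol_class :: "(real \<Rightarrow> ('v, 'e) gpoint set) set \<Rightarrow> ('e \<times> bool) list set bijection" where
  "hol_class A = holonomy (SOME p. p \<in> A)"

definition class_of_hol :: "('v, 'e) gpoint set \<Rightarrow> ('e \<times> bool) list set bijection \<Rightarrow> (real \<Rightarrow> ('v, 'e) gpoint set) set" where
  "class_of_hol x g = path_class X (SOME p. p \<in> loops X x \<and> holonomy p = g)"

lemma hol_class_path_class: "pathin X p \<Longrightarrow> hol_class (path_class X p) = holonomy p"
proof -
  assume "pathin X p"
  then have "p \<in> path_class X p" by (simp add: path_class_def path_homotopic_refl)
  then have "(SOME q. q \<in> path_class X p) \<in> path_class X p" by (rule someI[where P = "\<lambda>q. q \<in> path_class X p"])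
  then show ?thesis unfolding hol_class_def by (simp add: path_class_def[of X p] holonomy_homotopic)
qed

lemma hols_add: "a \<in> hols x y \<Longrightarrow> b \<in> hols y z \<Longrightarrow> a + b \<in> hols x z"
  unfolding hols_def
proof clarify
  fix p q assume *: "pathin X p" "pathin X q" "q 0 = p 1"
  then show "\<exists>r. holonomy p + holonomy q = holonomy r \<and> pathin X r \<and> r 0 = p 0 \<and> r 1 = q 1"
    by (intro exI[of _ "path_join p q"]) (simp add: holonomy_join pathin_join)
qed

lemma hols_uminus: "a \<in> hols x y \<Longrightarrow> - a \<in> hols y x"
  unfolding hols_def
proof clarify
  fix p assume "pathin X p"
  then show "\<exists>r. - holonomy p = holonomy r \<and> pathin X r \<and> r 0 = p 1 \<and> r 1 = p 0"
    by (intro exI[of _ "path_rev p"]) (simp add: holonomy_rev pathin_rev)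
qed

lemma hols_diff: "a \<in> hols x y \<Longrightarrow> b \<in> hols z y \<Longrightarrow> a - b \<in> hols x z"
  using hols_add[OF _ hols_uminus, of a x y b z] by simp

lemma hols_zero: "x \<in> topspace X \<Longrightarrow> 0 \<in> hols x x"
  unfolding hols_def by (auto intro!: exI[of _ "\<lambda>_. x"] simp: holonomy_const)

lemma hols_move:
  assumes "vertex_config n G T" "can_move G T a"
  shows "arc_gen G a \<in> hols (Vertex ` T) (Vertex ` move G T a)"
proof -
  have "pathin X (edge_path G T a) \<and> edge_path G T a 0 = Vertex ` T \<and> edge_path G T a 1 = Vertex ` move G T a"
    using pathin_edge_path[OF assms] edge_path_ends[OF assms(2)] by simp
  then show ?thesis unfolding hols_def holonomy_edge_path[OF assms, symmetric] by blast
qed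

lemma hols_word:
  assumes "vertex_config n G T" "legal G T w"
  shows "arc_eval G w \<in> hols (Vertex ` T) (Vertex ` dest G T w)"
proof -
  obtain p where "pathin X p" "p 0 = Vertex ` T" "p 1 = Vertex ` dest G T w" "holonomy p = arc_eval G w"
    by (rule word_imp_path[OF assms])
  then show ?thesis unfolding hols_def by (auto intro!: exI[of _ p])
qed

lemma hols_component:
  assumes "K \<in> connected_components_of X" "x \<in> K" "y \<in> K"
  obtains a where "a \<in> hols x y"
proof -
  have "connected_component_of X x y"
  proof -
    obtain z where "K = connected_component_of_set X z" using assms(1) by (auto simp: connected_components_of_def)
    then have z: "connected_component_of X z x" "connected_component_of X z y" using assms(2,3) by auto
    from connected_component_of_trans[OF connected_component_of_sym[THEN iffD1, OF z(1)] z(2)] show ?thesis .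
  qed
  then have "path_component_of X x y" by (simp add: path_component_eq_connected_component)
  then show ?thesis using that unfolding path_component_of_def hols_def by blast
qed

lemma hols_imp_component:
  assumes "a \<in> hols x y" "K \<in> connected_components_of X" "x \<in> K" shows "y \<in> K"
proof -
  have "path_component_of X x y" using assms(1) unfolding path_component_of_def hols_def by blast
  then have "connected_component_of X x y" by (simp add: path_component_eq_connected_component)
  then show ?thesis using assms(2,3) by (auto simp: connected_components_of_def intro: connected_component_of_trans)
qed

lemma hol_class_in_hols: "A \<in> carrier (RB n G x) \<Longrightarrow> hol_class A \<in> hols x x"
  unfolding RB_def hols_def by (auto simp: loops_def hol_class_path_class)

lemma class_of_hol:
  assumes "g \<in> hols x x"
  shows "class_of_hol x g \<in> carrier (RB n G x)" "hol_class (class_of_hol x g) = g"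
proof -
  have "\<exists>p. p \<in> loops X x \<and> holonomy p = g" using assms by (auto simp: hols_def loops_def)
  from someI_ex[OF this] show "class_of_hol x g \<in> carrier (RB n G x)" "hol_class (class_of_hol x g) = g"
    unfolding class_of_hol_def RB_def by (auto simp: hol_class_path_class loops_def)
qed

lemma hol_class_inj:
  assumes "A \<in> carrier (RB n G x)" "B \<in> carrier (RB n G x)" "hol_class A = hol_class B" shows "A = B"
proof -
  obtain p q where pq: "p \<in> loops X x" "q \<in> loops X x" "A = path_class X p" "B = path_class X q"
    using assms by (auto simp: RB_def)
  then have "path_homotopic X p q"
    using assms(3) by (intro holonomy_faithful) (auto simp: loops_def hol_class_path_class)
  then show ?thesis using pq by (simp add: path_class_eq)
qed

lemma hol_class_mult:
  assumes "A \<in> carrier (RB n G x)" "B \<in> carrier (RB n G x)"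
  shows "hol_class (A \<otimes>\<^bsub>RB n G x\<^esub> B) = hol_class A + hol_class B"
proof -
  obtain p q where pq: "p \<in> loops X x" "q \<in> loops X x" "A = path_class X p" "B = path_class X q"
    using assms by (auto simp: RB_def)
  then show ?thesis unfolding RB_def
    by (auto simp: fundamental_group_mult hol_class_path_class holonomy_join pathin_join loops_def)
qed

lemma group_RB: "x \<in> topspace X \<Longrightarrow> group (RB n G x)"
  unfolding RB_def by (rule group_fundamental_group)

lemma class_of_hol_unique: "A \<in> carrier (RB n G x) \<Longrightarrow> class_of_hol x (hol_class A) = A"
  using class_of_hol hol_class_in_hols hol_class_inj by blast

lemma class_of_hol_mult:
  assumes "x \<in> topspace X" "g \<in> hols x x" "h \<in> hols x x"
  shows "class_of_hol x g \<otimes>\<^bsub>RB n G x\<^esub> class_of_hol x h = class_of_hol x (g + h)"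
proof (rule hol_class_inj)
  interpret group "RB n G x" by (rule group_RB[OF assms(1)])
  show "class_of_hol x g \<otimes>\<^bsub>RB n G x\<^esub> class_of_hol x h \<in> carrier (RB n G x)" using assms class_of_hol by simp
  show "class_of_hol x (g + h) \<in> carrier (RB n G x)" using assms class_of_hol hols_add by blast
  show "hol_class (class_of_hol x g \<otimes>\<^bsub>RB n G x\<^esub> class_of_hol x h) = hol_class (class_of_hol x (g + h))"
    using assms class_of_hol[of _ x] hols_add[of g x x h x] by (simp add: hol_class_mult)
qed

lemma class_of_hol_zero:
  assumes "x \<in> topspace X" shows "class_of_hol x 0 = \<one>\<^bsub>RB n G x\<^esub>"
proof (rule hol_class_inj)
  interpret group "RB n G x" by (rule group_RB[OF assms(1)])
  show "\<one>\<^bsub>RB n G x\<^esub> \<in> carrier (RB n G x)" by simp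
  show "class_of_hol x 0 \<in> carrier (RB n G x)" using assms class_of_hol hols_zero by blast
  show "hol_class (class_of_hol x 0) = hol_class \<one>\<^bsub>RB n G x\<^esub>"
    using class_of_hol(2)[OF hols_zero[OF assms]] assms by (simp add: RB_def hol_class_path_class holonomy_const)
qed

lemma RB_iso_hols:
  assumes "x \<in> topspace X"
  shows "RB n G x \<cong> additive_group (hols x x)"
proof -
  have "hol_class \<in> hom (RB n G x) (additive_group (hols x x))"
    by (rule homI) (auto simp: hol_class_in_hols hol_class_mult)
  moreover have "bij_betw hol_class (carrier (RB n G x)) (hols x x)"
    unfolding bij_betw_def
  proof
    show "inj_on hol_class (carrier (RB n G x))" using hol_class_inj by (auto intro: inj_onI)
    show "hol_class ` carrier (RB n G x) = hols x x"
      using hol_class_in_hols class_of_hol by (auto simp: image_iff) metis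
  qed
  ultimately show ?thesis unfolding is_iso_def iso_def by auto
qed

lemma group_hols: "x \<in> topspace X \<Longrightarrow> group (additive_group (hols x x))"
  by (rule group_additive_group) (auto intro: hols_zero hols_add hols_uminus)

end

context add_particles
begin

lemma hols_add_particles: "g \<in> C'.hols x y \<Longrightarrow> g \<in> C.hols (add x) (add y)"
  unfolding C'.hols_def C.hols_def
proof clarify
  fix p assume "pathin C'.X p"
  then show "\<exists>q. C'.holonomy p = C.holonomy q \<and> pathin C.X q \<and> q 0 = add (p 0) \<and> q 1 = add (p 1)"
    using holonomy_add pathin_map[OF continuous_map_add] by (intro exI[of _ "add \<circ> p"]) auto
qed

text \<open>The conjugating element is the holonomy of the path \<open>\<delta>\<close> that the
  definition of an induced map leaves unspecified.\<close>

lemma induced_holonomy: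
  assumes "induced_by_map C'.X x C.X y add \<phi>"
  shows "\<exists>d\<in>C.hols y (add x). \<forall>A\<in>carrier (RB k G' x).
    \<phi> A \<in> carrier (RB n G y) \<and> C.hol_class (\<phi> A) = d + C'.hol_class A - d"
proof -
  obtain \<delta> where d: "pathin C.X \<delta>" "\<delta> 0 = y" "\<delta> 1 = add x"
    and \<phi>: "\<And>p. p \<in> loops C'.X x \<Longrightarrow> \<phi> (path_class C'.X p) = path_class C.X (path_join \<delta> (path_join (add \<circ> p) (path_rev \<delta>)))"
    using assms unfolding induced_by_map_def by blast
  have "\<phi> A \<in> carrier (RB n G y) \<and> C.hol_class (\<phi> A) = C.holonomy \<delta> + C'.hol_class A - C.holonomy \<delta>"
    if A: "A \<in> carrier (RB k G' x)" for A
  proof -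
    obtain p where p: "p \<in> loops C'.X x" "A = path_class C'.X p" using A by (auto simp: RB_def)
    have p': "pathin C'.X p" "p 0 = x" "p 1 = x" using p by (auto simp: loops_def)
    have ap: "pathin C.X (add \<circ> p)" "(add \<circ> p) 0 = add x" "(add \<circ> p) 1 = add x"
      using pathin_map[OF continuous_map_add p'(1)] p' by auto
    let ?q = "path_join \<delta> (path_join (add \<circ> p) (path_rev \<delta>))"
    have q: "pathin C.X ?q" using ap d by (intro pathin_join pathin_rev) auto
    then have "?q \<in> loops C.X y" using d by (simp add: loops_def)
    moreover have "C.holonomy ?q = C.holonomy \<delta> + (C'.holonomy p + - C.holonomy \<delta>)"
      using ap d by (simp add: C.holonomy_join pathin_join pathin_rev C.holonomy_rev holonomy_add[OF p'(1)] del: o_apply)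
    ultimately show ?thesis using p p' \<phi>[OF p(1)] q
      by (simp add: RB_def C.hol_class_path_class C'.hol_class_path_class add.assoc)
        (simp add: diff_conv_add_uminus add.assoc del: add_uminus_conv_diff)
  qed
  moreover have "C.holonomy \<delta> \<in> C.hols y (add x)" using d unfolding C.hols_def by blast
  ultimately show ?thesis by blast
qed

lemma induced_exists:
  assumes "d \<in> C.hols y (add x)" shows "\<exists>\<phi>. induced_by_map C'.X x C.X y add \<phi>"
proof -
  obtain \<delta> where d: "pathin C.X \<delta>" "\<delta> 0 = y" "\<delta> 1 = add x" using assms unfolding C.hols_def by blast
  \<comment> \<open>Picking a path makes \<open>?\<phi>\<close> a function of classes; homotopic
    picks give the same value.\<close>
  let ?\<phi> = "\<lambda>A. path_class C.X (path_join \<delta> (path_join (add \<circ> (SOME p. p \<in> A)) (path_rev \<delta>)))"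
  have "?\<phi> (path_class C'.X p) = path_class C.X (path_join \<delta> (path_join (add \<circ> p) (path_rev \<delta>)))"
    if p: "p \<in> loops C'.X x" for p
  proof -
    let ?q = "SOME q. q \<in> path_class C'.X p"
    have "p \<in> path_class C'.X p" using p by (simp add: path_class_def path_homotopic_refl loops_def)
    then have "?q \<in> path_class C'.X p" by (rule someI[where P = "\<lambda>q. q \<in> path_class C'.X p"])
    then have q: "path_homotopic C'.X ?q p" by (simp add: path_class_def[of C'.X p] path_homotopic_sym)
    have e: "?q 0 = x" "?q 1 = x" using path_homotopic_ends[OF q] p by (auto simp: loops_def)
    have m: "path_homotopic C.X (add \<circ> ?q) (add \<circ> p)" by (rule path_homotopic_map[OF continuous_map_add q])
    have "path_homotopic C.X (path_join (add \<circ> ?q) (path_rev \<delta>)) (path_join (add \<circ> p) (path_rev \<delta>))"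
      by (rule path_homotopic_join[OF m path_homotopic_refl]) (simp_all add: pathin_rev d e)
    then have "path_homotopic C.X (path_join \<delta> (path_join (add \<circ> ?q) (path_rev \<delta>))) (path_join \<delta> (path_join (add \<circ> p) (path_rev \<delta>)))"
      by (rule path_homotopic_join[OF path_homotopic_refl[OF d(1)]]) (simp add: d e)
    then show ?thesis by (rule path_class_eq)
  qed
  then show ?thesis unfolding induced_by_map_def
    by (intro exI[of _ ?\<phi>] exI[of _ \<delta>] conjI d ballI)
qed

end

section \<open>Free products\<close>

locale free_product =
  fixes V :: "'k set" and Gr :: "'k \<Rightarrow> 'a monoid" and E :: "'h set"
  assumes groups: "k \<in> V \<Longrightarrow> group (Gr k)"
begin

abbreviation "words \<equiv> fp_words V Gr E"
abbreviation "cls \<equiv> fp_class V Gr E"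
abbreviation "step \<equiv> fp_step V Gr E"
abbreviation "F \<equiv> free_product_free V Gr E"

lemma words_append [simp]: "u @ w \<in> words \<longleftrightarrow> u \<in> words \<and> w \<in> words"
  by (auto simp: fp_words_def)

lemma words_Nil [simp]: "[] \<in> words" by (simp add: fp_words_def)

lemma words_Cons: "x # w \<in> words \<longleftrightarrow> [x] \<in> words \<and> w \<in> words"
  by (auto simp: fp_words_def)

lemma words_letter [simp]:
  "VLetter k g # w \<in> words \<longleftrightarrow> k \<in> V \<and> g \<in> carrier (Gr k) \<and> w \<in> words"
  "ELetter h s # w \<in> words \<longleftrightarrow> h \<in> E \<and> w \<in> words"
  by (auto simp: fp_words_def)

lemma step_words:
  assumes "step u w" shows "u \<in> words \<longleftrightarrow> w \<in> words"
  using assms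
proof cases
  case (fp_mult k g g' xs ys)
  then interpret group "Gr k" by (simp add: groups)
  show ?thesis using fp_mult by auto
next
  case (fp_one k xs ys)
  then interpret group "Gr k" by (simp add: groups)
  show ?thesis using fp_one by auto
next
  case (fp_cancel h xs s ys)
  then show ?thesis by auto
qed

lemma equiv_induct [consumes 1, case_names refl step step_rev]:
  assumes "equivclp step u w" "P u" "\<And>x y. equivclp step u x \<Longrightarrow> P x \<Longrightarrow> step x y \<Longrightarrow> P y"
    "\<And>x y. equivclp step u x \<Longrightarrow> P x \<Longrightarrow> step y x \<Longrightarrow> P y"
  shows "P w"
  using assms(1) unfolding equivclp_def
proof (induction rule: rtranclp_induct)
  case base
  show ?case by fact
next
  case (step y z)
  then show ?case using assms(3,4)[of y z] unfolding equivclp_def symclp_def by blast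
qed

lemma step_equiv: "step u w \<Longrightarrow> equivclp step u w"
  by (simp add: r_into_equivclp)

lemma equiv_words: "equivclp step u w \<Longrightarrow> u \<in> words \<longleftrightarrow> w \<in> words"
  by (induction rule: equiv_induct) (auto dest: step_words)

lemma step_context: "step u w \<Longrightarrow> step (x @ u @ y) (x @ w @ y)"
proof (induction rule: fp_step.induct)
  case (fp_mult k g g' xs ys)
  from fp_step.fp_mult[where V = V and G = Gr and E = E and xs = "x @ xs" and ys = "ys @ y", OF this] show ?case by simp
next
  case (fp_one k xs ys)
  from fp_step.fp_one[where V = V and G = Gr and E = E and xs = "x @ xs" and ys = "ys @ y", OF this] show ?case by simp
next
  case (fp_cancel h xs s ys)
  from fp_step.fp_cancel[where V = V and G = Gr and E = E and xs = "x @ xs" and ys = "ys @ y", OF this] show ?case by simp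
qed

lemma equiv_context: "equivclp step u w \<Longrightarrow> equivclp step (x @ u @ y) (x @ w @ y)"
proof (induction rule: equiv_induct)
  case refl
  then show ?case by simp
next
  case (step v w)
  then show ?case using step_equiv[OF step_context[OF step.hyps(2)]] by (meson equivclp_trans)
next
  case (step_rev v w)
  then show ?case using equivclp_sym[OF step_equiv[OF step_context[OF step_rev.hyps(2)]]] by (meson equivclp_trans)
qed

lemma cls_eq_iff: "u \<in> words \<Longrightarrow> cls u = cls w \<longleftrightarrow> equivclp step u w"
proof
  assume u: "u \<in> words" "cls u = cls w"
  have "u \<in> cls u" using u(1) by (simp add: fp_class_def)
  then have "u \<in> cls w" unfolding u(2) .
  then show "equivclp step u w" by (simp add: fp_class_def equivclp_sym)
next
  assume *: "equivclp step u w"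
  have "equivclp step u x \<longleftrightarrow> equivclp step w x" for x
    using equivclp_trans[OF *] equivclp_trans[OF equivclp_sym[OF *]] by (rule iffI[rotated])
  then show "cls u = cls w" unfolding fp_class_def by simp
qed

lemma cls_self: "u \<in> words \<Longrightarrow> u \<in> cls u" by (simp add: fp_class_def)

lemma F_simps [simp]: "carrier F = cls ` words" "\<one>\<^bsub>F\<^esub> = cls []"
  by (auto simp: free_product_free_def)

lemma F_mult: "u \<in> words \<Longrightarrow> w \<in> words \<Longrightarrow> cls u \<otimes>\<^bsub>F\<^esub> cls w = cls (u @ w)"
proof -
  assume uw: "u \<in> words" "w \<in> words"
  have "cls (u' @ w') = cls (u @ w)" if "u' \<in> cls u" "w' \<in> cls w" for u' w'
  proof -
    have e: "u' \<in> words" "w' \<in> words" "equivclp step u u'" "equivclp step w w'" using that by (auto simp: fp_class_def)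
    have "equivclp step (u @ w) (u' @ w)" "equivclp step (u' @ w) (u' @ w')"
      using equiv_context[OF e(3), of "[]" w] equiv_context[OF e(4), of u' "[]"] by simp_all
    then have "equivclp step (u @ w) (u' @ w')" by (rule equivclp_trans)
    then show ?thesis using uw cls_eq_iff[of "u @ w" "u' @ w'"] by simp
  qed
  then show ?thesis unfolding free_product_free_def monoid.simps
    using cls_self[OF uw(1)] cls_self[OF uw(2)] by (intro UN_UN_const)
qed

fun inv_letter :: "('k, 'a, 'h) letter \<Rightarrow> ('k, 'a, 'h) letter" where
  "inv_letter (VLetter k g) = VLetter k (inv\<^bsub>Gr k\<^esub> g)"
| "inv_letter (ELetter h s) = ELetter h (\<not> s)"

definition inv_word :: "('k, 'a, 'h) letter list \<Rightarrow> ('k, 'a, 'h) letter list" where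
  "inv_word w = rev (map inv_letter w)"

lemma inv_word_simps [simp]: "inv_word [] = []" "inv_word (x # w) = inv_word w @ [inv_letter x]"
  "inv_word (u @ w) = inv_word w @ inv_word u"
  by (auto simp: inv_word_def)

lemma inv_word_words: "w \<in> words \<Longrightarrow> inv_word w \<in> words"
proof (induction w)
  case (Cons x w)
  have "[inv_letter x] \<in> words"
  proof (cases x)
    case (VLetter k g)
    then have "k \<in> V" "g \<in> carrier (Gr k)" using Cons.prems words_Cons[of x w] by auto
    then show ?thesis using group.inv_closed[OF groups] VLetter by simp
  next
    case (ELetter h s)
    then show ?thesis using Cons.prems words_Cons[of x w] by auto
  qed
  then show ?case using Cons words_Cons[of x w] by simp
qed simp

lemma inv_word_cancel: "w \<in> words \<Longrightarrow> equivclp step (inv_word w @ w) []"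
proof (induction w)
  case (Cons x w)
  have w: "[x] \<in> words" "w \<in> words" using Cons.prems words_Cons[of x w] by auto
  have "equivclp step [inv_letter x, x] []"
  proof (cases x)
    case (VLetter k g)
    then have k: "k \<in> V" "g \<in> carrier (Gr k)" using w by auto
    interpret group "Gr k" by (rule groups[OF k(1)])
    have "step ([] @ [VLetter k (inv\<^bsub>Gr k\<^esub> g), VLetter k g] @ []) ([] @ [VLetter k (inv\<^bsub>Gr k\<^esub> g \<otimes>\<^bsub>Gr k\<^esub> g)] @ [])"
      using k by (intro fp_mult) auto
    then have "step [VLetter k (inv\<^bsub>Gr k\<^esub> g), VLetter k g] [VLetter k \<one>\<^bsub>Gr k\<^esub>]" using k by simp
    moreover have "step [VLetter k \<one>\<^bsub>Gr k\<^esub>] []" using fp_one[OF k(1), of Gr E "[]" "[]"] by simp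
    ultimately show ?thesis unfolding VLetter inv_letter.simps by (rule equivclp_trans[OF step_equiv step_equiv])
  next
    case (ELetter h s)
    have "step ([] @ [ELetter h (\<not> s), ELetter h (\<not> \<not> s)] @ []) ([] @ [])" using w ELetter by (intro fp_cancel) auto
    then have "step [ELetter h (\<not> s), ELetter h s] []" by simp
    then show ?thesis unfolding ELetter inv_letter.simps by (rule step_equiv)
  qed
  from equiv_context[OF this, of "inv_word w" w]
  have "equivclp step (inv_word (x # w) @ x # w) (inv_word w @ w)" by simp
  from equivclp_trans[OF this Cons.IH[OF w(2)]] show ?case .
qed simp

lemma group_F: "group F"
proof (rule groupI)
  fix A assume "A \<in> carrier F"
  then obtain u where u: "u \<in> words" "A = cls u" by auto
  show "\<one>\<^bsub>F\<^esub> \<otimes>\<^bsub>F\<^esub> A = A" using u F_mult[of "[]" u] by simp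
  show "\<exists>B\<in>carrier F. B \<otimes>\<^bsub>F\<^esub> A = \<one>\<^bsub>F\<^esub>"
    using u inv_word_words[OF u(1)] F_mult[of "inv_word u" u] inv_word_cancel[OF u(1)]
    by (intro bexI[of _ "cls (inv_word u)"]) (auto simp: cls_eq_iff)
qed (auto simp: F_mult)

lemma F_inv: "w \<in> words \<Longrightarrow> inv\<^bsub>F\<^esub> (cls w) = cls (inv_word w)"
proof -
  interpret group F by (rule group_F)
  assume w: "w \<in> words"
  show ?thesis
    by (rule inv_equality) (use w inv_word_words[OF w] inv_word_cancel[OF w] in \<open>auto simp: F_mult cls_eq_iff\<close>)
qed

end

lemma (in group) normal_closure:
  assumes "R \<subseteq> carrier G"
  shows "normal_closure G R \<lhd> G" "R \<subseteq> normal_closure G R" "\<And>N. N \<lhd> G \<Longrightarrow> R \<subseteq> N \<Longrightarrow> normal_closure G R \<subseteq> N"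
proof -
  let ?A = "{N. N \<lhd> G \<and> R \<subseteq> N}"
  \<comment> \<open>The whole group belongs to the family, so the intersection is not over the empty
    family.\<close>
  have "carrier G \<lhd> G" by (rule normal_invI) (auto simp: subgroup_self)
  then have ne: "carrier G \<in> ?A" using assms by simp
  have "subgroup (\<Inter>?A) G" by (rule subgroups_Inter) (use ne in \<open>auto dest: normal_imp_subgroup\<close>)
  moreover have "x \<otimes> h \<otimes> inv x \<in> \<Inter>?A" if "x \<in> carrier G" "h \<in> \<Inter>?A" for x h
    using that normal_invE(2) by auto
  ultimately show "normal_closure G R \<lhd> G" unfolding normal_closure_def by (rule normal_invI)
qed (auto simp: normal_closure_def)

section \<open>Growing spanning trees\<close>

text \<open>A tree recorded by the order in which its leaves are attached: acyclicity, connectedness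
  and the extension of potentials all follow by induction on this order.\<close>

inductive grown_tree :: "('k, 'h) pre_digraph \<Rightarrow> 'k \<Rightarrow> 'k set \<Rightarrow> 'h set \<Rightarrow> bool" for \<Lambda> r where
  root: "r \<in> verts \<Lambda> \<Longrightarrow> grown_tree \<Lambda> r {r} {}"
| grow: "\<lbrakk>grown_tree \<Lambda> r V A; fst a \<in> arcs \<Lambda>; arc_start \<Lambda> a \<in> V; arc_end \<Lambda> a \<notin> V\<rbrakk> \<Longrightarrow>
    grown_tree \<Lambda> r (insert (arc_end \<Lambda> a) V) (insert (fst a) A)"

lemma grown_tree_subset:
  "grown_tree \<Lambda> r V A \<Longrightarrow> wf_digraph \<Lambda> \<Longrightarrow> r \<in> V \<and> V \<subseteq> verts \<Lambda> \<and> A \<subseteq> arcs \<Lambda> \<and> (\<forall>h\<in>A. tail \<Lambda> h \<in> V \<and> head \<Lambda> h \<in> V)"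
proof (induction rule: grown_tree.induct)
  case (grow V A a)
  have "arc_end \<Lambda> a \<in> verts \<Lambda>" using arc_ends_in_verts[OF grow.prems grow.hyps(2)] by simp
  moreover have "tail \<Lambda> (fst a) \<in> insert (arc_end \<Lambda> a) V" "head \<Lambda> (fst a) \<in> insert (arc_end \<Lambda> a) V"
    using grow.hyps(3) by (auto simp: arc_start_def arc_end_def split: prod.splits if_splits)
  ultimately show ?case using grow by auto
qed simp

lemma grown_tree_exists:
  assumes wf: "wf_digraph \<Lambda>" and fin: "finite (verts \<Lambda>)" and conn: "Digraph_Component.connected \<Lambda>" and r: "r \<in> verts \<Lambda>"
  shows "\<exists>A. grown_tree \<Lambda> r (verts \<Lambda>) A"
proof -
  have "\<exists>V A. grown_tree \<Lambda> r V A \<and> card V = Suc m" if "Suc m \<le> card (verts \<Lambda>)" for m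
    using that
  proof (induction m)
    case 0
    show ?case using root[OF r] by (intro exI[of _ "{r}"] exI[of _ "{}"]) simp
  next
    case (Suc m)
    then obtain V A where VA: "grown_tree \<Lambda> r V A" "card V = Suc m" by auto
    have V: "r \<in> V" "V \<subseteq> verts \<Lambda>" using grown_tree_subset[OF VA(1) wf] by auto
    have "V \<noteq> verts \<Lambda>" using VA(2) Suc.prems by auto
    then obtain k where k: "k \<in> verts \<Lambda>" "k \<notin> V" using V by auto
    have "(r, k) \<in> rtrancl_on (verts \<Lambda>) ((arcs_ends \<Lambda>)\<^sup>s)" using conn r k by (auto simp: connected_conv)
    \<comment> \<open>A path from the root to a missing vertex has to leave \<open>V\<close> along
      some arc.\<close>
    then have "\<exists>x y. (x, y) \<in> (arcs_ends \<Lambda>)\<^sup>s \<and> x \<in> V \<and> y \<notin> V" using k(2)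
    proof (induction rule: rtrancl_on_induct)
      case base
      then show ?case using V by simp
    next
      case (step b c)
      then show ?case by (cases "b \<in> V") auto
    qed
    then obtain x y where xy: "(x, y) \<in> (arcs_ends \<Lambda>)\<^sup>s" "x \<in> V" "y \<notin> V" by blast
    obtain a where a: "fst a \<in> arcs \<Lambda>" "arc_start \<Lambda> a = x" "arc_end \<Lambda> a = y" by (rule arc_stepE[OF xy(1)])
    have "grown_tree \<Lambda> r (insert (arc_end \<Lambda> a) V) (insert (fst a) A)" by (rule grow[OF VA(1)]) (use a xy in auto)
    moreover have "card (insert (arc_end \<Lambda> a) V) = Suc (Suc m)"
      using a xy VA(2) finite_subset[OF V(2) fin] by simp
    ultimately show ?case by blast
  qed
  from this[of "card (verts \<Lambda>) - 1"] obtain V A where VA: "grown_tree \<Lambda> r V A" "card V = card (verts \<Lambda>)"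
    using r fin by (metis One_nat_def Suc_diff_1 card_gt_0_iff empty_iff order_refl)
  then have "V = verts \<Lambda>" using grown_tree_subset[OF VA(1) wf] fin by (simp add: card_subset_eq)
  then show ?thesis using VA by blast
qed

lemma undirected_cycle_cong:
  assumes "tail G = tail G'" "head G = head G'"
  shows "undirected_cycle G p \<longleftrightarrow> p \<noteq> [] \<and> fst ` set p \<subseteq> arcs G \<and>
     (\<forall>i. Suc i < length p \<longrightarrow> arc_end G' (p ! i) = arc_start G' (p ! Suc i)) \<and>
     arc_end G' (last p) = arc_start G' (hd p) \<and>
     distinct (map fst p) \<and> distinct (map (arc_start G') p)"
proof -
  have "arc_start G = arc_start G'" "arc_end G = arc_end G'" using assms by (auto simp: arc_start_def arc_end_def)
  then show ?thesis by (simp add: undirected_cycle_def)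
qed

text \<open>A cycle through the new arc meets the new leaf, so the arc of the cycle before or after
  it meets the leaf as well; but the leaf has only one arc, and a cycle uses it once.\<close>

lemma grown_tree_acyclic:
  assumes "grown_tree \<Lambda> r V A" "wf_digraph \<Lambda>"
  shows "\<not> undirected_cycle (\<Lambda>\<lparr>verts := V, arcs := A\<rparr>) p"
  using assms
proof (induction arbitrary: p rule: grown_tree.induct)
  case root
  then show ?case by (auto simp: undirected_cycle_def)
next
  case (grow V A a)
  let ?k = "arc_end \<Lambda> a" and ?T = "\<Lambda>\<lparr>verts := insert (arc_end \<Lambda> a) V, arcs := insert (fst a) A\<rparr>"
  have sub: "\<forall>h\<in>A. tail \<Lambda> h \<in> V \<and> head \<Lambda> h \<in> V" using grown_tree_subset[OF grow.hyps(1) grow.prems] by blast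
  show ?case
  proof
    assume "undirected_cycle ?T p"
    then have c: "p \<noteq> []" "fst ` set p \<subseteq> insert (fst a) A"
      "\<And>i. Suc i < length p \<Longrightarrow> arc_end \<Lambda> (p ! i) = arc_start \<Lambda> (p ! Suc i)"
      "arc_end \<Lambda> (last p) = arc_start \<Lambda> (hd p)" "distinct (map fst p)" "distinct (map (arc_start \<Lambda>) p)"
      using undirected_cycle_cong[of ?T \<Lambda> p] by auto
    have not: "fst a \<in> fst ` set p"
    proof (rule ccontr)
      assume "fst a \<notin> fst ` set p"
      from subset_insert[THEN iffD1, OF this c(2)] have "fst ` set p \<subseteq> A" .
      then have "undirected_cycle (\<Lambda>\<lparr>verts := V, arcs := A\<rparr>) p"
        by (subst undirected_cycle_cong[of _ \<Lambda>]) (use c(1,3-6) in simp_all)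
      then show False using grow.IH grow.prems by blast
    qed
    have only: "fst x = fst a" if "x \<in> set p" "arc_start \<Lambda> x = ?k \<or> arc_end \<Lambda> x = ?k" for x
    proof (rule ccontr)
      assume "fst x \<noteq> fst a"
      moreover have "fst x \<in> insert (fst a) A" by (rule subsetD[OF c(2) imageI[OF that(1)]])
      ultimately have "fst x \<in> A" by simp
      then have "arc_start \<Lambda> x \<in> V" "arc_end \<Lambda> x \<in> V" using sub by (auto simp: arc_start_def arc_end_def split: prod.splits)
      then show False using that(2) grow.hyps(4) by auto
    qed
    obtain x where "x \<in> set p" "fst x = fst a" using not by (metis imageE)
    then obtain i where i: "i < length p" "fst (p ! i) = fst a" by (metis in_set_conv_nth)
    \<comment> \<open>The new arc is not a loop; this excludes the cycle of length one, in which the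
      neighbouring arc would be the arc itself.\<close>
    have ends: "arc_start \<Lambda> (p ! i) = ?k \<and> arc_end \<Lambda> (p ! i) \<noteq> ?k \<or> arc_end \<Lambda> (p ! i) = ?k \<and> arc_start \<Lambda> (p ! i) \<noteq> ?k"
    proof -
      have "arc_start \<Lambda> a \<noteq> ?k" using grow.hyps(3,4) by metis
      moreover have "p ! i = a \<or> p ! i = flip a" using i(2) by (cases "p ! i"; cases a) (auto simp: flip_def)
      ultimately show ?thesis by (elim disjE) simp_all
    qed
    have uniq: "j = i" if "j < length p" "arc_start \<Lambda> (p ! j) = ?k \<or> arc_end \<Lambda> (p ! j) = ?k" for j
    proof -
      have "fst (p ! j) = fst a" using only[of "p ! j"] that by simp
      then have "map fst p ! j = map fst p ! i" using i that by simp
      then show ?thesis using c(5) i that by (simp add: nth_eq_iff_index_eq del: nth_map)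
    qed
    show False
    proof (cases "arc_end \<Lambda> (p ! i) = ?k")
      case True
      show False
      proof (cases "Suc i < length p")
        case 1: True
        then show False using c(3)[OF 1] uniq[of "Suc i"] True by auto
      next
        case False
        then have "p ! i = last p" using i c(1) by (metis Suc_lessI diff_Suc_1 last_conv_nth)
        then have "arc_start \<Lambda> (p ! 0) = ?k" using c(1,4) True by (simp add: hd_conv_nth)
        then have "i = 0" using uniq[of 0] c(1) by auto
        then show False using \<open>arc_start \<Lambda> (p ! 0) = ?k\<close> ends True by auto
      qed
    next
      case False
      then have s: "arc_start \<Lambda> (p ! i) = ?k" using ends by auto
      show False
      proof (cases i)
        case (Suc j)
        then show False using c(3)[of j] uniq[of j] s i by auto
      next
        case 0
        then have "arc_end \<Lambda> (p ! (length p - 1)) = ?k" using c(1,4) s by (simp add: hd_conv_nth last_conv_nth)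
        then have "length p - 1 = i" using uniq[of "length p - 1"] c(1) by auto
        then show False using \<open>arc_end \<Lambda> (p ! (length p - 1)) = ?k\<close> False by simp
      qed
    qed
  qed
qed

lemma grown_tree_connected:
  assumes "grown_tree \<Lambda> r V A" "wf_digraph \<Lambda>" "k \<in> V"
  shows "(r, k) \<in> rtrancl_on V ((arcs_ends (\<Lambda>\<lparr>verts := V, arcs := A\<rparr>))\<^sup>s)"
  using assms
proof (induction arbitrary: k rule: grown_tree.induct)
  case root
  then show ?case by auto
next
  case (grow V A a)
  let ?T = "\<Lambda>\<lparr>verts := insert (arc_end \<Lambda> a) V, arcs := insert (fst a) A\<rparr>"
  have mono: "(r, k) \<in> rtrancl_on (insert (arc_end \<Lambda> a) V) ((arcs_ends ?T)\<^sup>s)" if "k \<in> V" for k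
    by (rule rtrancl_on_mono[OF _ _ grow.IH[OF grow.prems(1) that]])
      (auto simp: symcl_def arcs_ends_def arc_to_ends_def)
  show ?case
  proof (cases "k \<in> V")
    case False
    then have k: "k = arc_end \<Lambda> a" using grow.prems by auto
    have "(arc_start \<Lambda> a, arc_end \<Lambda> a) \<in> (arcs_ends ?T)\<^sup>s"
      by (cases a) (auto simp: symcl_def arcs_ends_def arc_to_ends_def arc_start_def arc_end_def)
    with mono[OF grow.hyps(3)] show ?thesis unfolding k by (rule rtrancl_on_into_rtrancl_on) simp
  qed (rule mono)
qed

lemma grown_tree_spanning:
  assumes "grown_tree \<Lambda> r (verts \<Lambda>) A" "wf_digraph \<Lambda>"
  shows "is_spanning_tree (\<Lambda>\<lparr>arcs := A\<rparr>) \<Lambda>"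
proof -
  have eq: "\<Lambda>\<lparr>verts := verts \<Lambda>, arcs := A\<rparr> = \<Lambda>\<lparr>arcs := A\<rparr>" by simp
  have sub: "r \<in> verts \<Lambda>" "A \<subseteq> arcs \<Lambda>" using grown_tree_subset[OF assms] by auto
  have "spanning (\<Lambda>\<lparr>arcs := A\<rparr>) \<Lambda>"
    using sub assms(2) unfolding spanning_def subgraph_def compatible_def by (auto simp: wf_digraph_def)
  moreover have "Digraph_Component.connected (\<Lambda>\<lparr>arcs := A\<rparr>)"
    unfolding connected_conv
  proof (intro conjI ballI)
    show "verts (\<Lambda>\<lparr>arcs := A\<rparr>) \<noteq> {}" using sub by auto
    fix u v assume uv: "u \<in> verts (\<Lambda>\<lparr>arcs := A\<rparr>)" "v \<in> verts (\<Lambda>\<lparr>arcs := A\<rparr>)"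
    let ?r = "(arcs_ends (\<Lambda>\<lparr>arcs := A\<rparr>))\<^sup>s"
    have 1: "(r, u) \<in> rtrancl_on (verts \<Lambda>) ?r" "(r, v) \<in> rtrancl_on (verts \<Lambda>) ?r"
      using grown_tree_connected[OF assms] uv unfolding eq by auto
    have "sym ?r" by (auto simp: sym_def symcl_def)
    then have "(u, r) \<in> rtrancl_on (verts \<Lambda>) ?r" using 1(1) by (meson rtrancl_on_sym symD)
    from rtrancl_on_trans[OF this 1(2)] show "(u, v) \<in> rtrancl_on (verts (\<Lambda>\<lparr>arcs := A\<rparr>)) ?r" by simp
  qed
  ultimately show ?thesis unfolding is_spanning_tree_def using grown_tree_acyclic[OF assms] unfolding eq by blast
qed

text \<open>The value at a new leaf is forced by its arc. The invariant \<open>P\<close> carries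
  along what has to be known at each vertex, in the application an edge path that realises the
  value.\<close>

lemma grown_tree_potential:
  fixes l :: "'h \<Rightarrow> 'g::group_add"
  assumes "grown_tree \<Lambda> r V A" "wf_digraph \<Lambda>" "P r c0"
    and "\<And>h x. h \<in> A \<Longrightarrow> P (tail \<Lambda> h) x \<Longrightarrow> P (head \<Lambda> h) (x + l h)"
    and "\<And>h x. h \<in> A \<Longrightarrow> P (head \<Lambda> h) x \<Longrightarrow> P (tail \<Lambda> h) (x - l h)"
  shows "\<exists>c. c r = c0 \<and> (\<forall>k\<in>V. P k (c k)) \<and> (\<forall>h\<in>A. c (head \<Lambda> h) = c (tail \<Lambda> h) + l h)"
  using assms
proof (induction rule: grown_tree.induct)
  case root
  then show ?case by (intro exI[of _ "\<lambda>_. c0"]) auto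
next
  case (grow V A a)
  have "\<exists>c. c r = c0 \<and> (\<forall>k\<in>V. P k (c k)) \<and> (\<forall>h\<in>A. c (head \<Lambda> h) = c (tail \<Lambda> h) + l h)"
    by (rule grow.IH[OF grow.prems(1,2)]) (use grow.prems(3,4) in simp_all)
  then obtain c where c: "c r = c0" "\<forall>k\<in>V. P k (c k)" "\<forall>h\<in>A. c (head \<Lambda> h) = c (tail \<Lambda> h) + l h"
    by blast
  have sub: "r \<in> V" "\<forall>h\<in>A. tail \<Lambda> h \<in> V \<and> head \<Lambda> h \<in> V"
    using grown_tree_subset[OF grow.hyps(1) grow.prems(1)] by auto
  obtain h s where a: "a = (h, s)" by (cases a)
  let ?x = "if s then c (tail \<Lambda> h) + l h else c (head \<Lambda> h) - l h"
  define c' where "c' = c(arc_end \<Lambda> a := ?x)"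
  have P: "P (arc_end \<Lambda> a) (c' (arc_end \<Lambda> a))"
    using grow.prems(3,4)[of h] c(2) grow.hyps(3) a by (auto simp: c'_def arc_start_def arc_end_def)
  have new: "c' (head \<Lambda> h) = c' (tail \<Lambda> h) + l h"
    using grow.hyps(3,4) a by (auto simp: c'_def arc_start_def arc_end_def)
  have old: "c' k = c k" if "k \<in> V" for k using that grow.hyps(4) by (auto simp: c'_def)
  show ?case
  proof (intro exI[of _ c'] conjI ballI)
    show "c' r = c0" using old[OF sub(1)] c(1) by simp
    fix k assume "k \<in> insert (arc_end \<Lambda> a) V"
    then show "P k (c' k)" using P c(2) old by auto
  next
    fix h' assume "h' \<in> insert (fst a) A"
    then show "c' (head \<Lambda> h') = c' (tail \<Lambda> h') + l h'" using new a c(3) sub(2) old by auto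
  qed
qed

section \<open>Cutting along hyperplanes\<close>

text \<open>\<open>k\<close> is the number of particles left when one sits on a cut edge. The common
  vertex \<open>v\<close> enters through the fact that any two cut edges meet.\<close>

locale cutting =
  fixes \<Gamma> :: "('v, 'e) pre_digraph" and n k :: nat and cuts :: "'e set" and v :: 'v
    and S :: "('v, 'e) gpoint set" and sK :: "('v, 'e) gpoint set set \<Rightarrow> ('v, 'e) gpoint set"
    and sH :: "('e \<times> 'v set) set \<Rightarrow> ('v, 'e) gpoint set"
  assumes fin: "fin_digraph \<Gamma>" and conn: "Digraph_Component.connected \<Gamma>" and n: "n = Suc k"
    and cutsD: "\<And>f. f \<in> cuts \<Longrightarrow> f \<in> arcs \<Gamma> \<and> v \<in> {tail \<Gamma> f, head \<Gamma> f}"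
    and S: "S \<in> topspace (uconf_space n \<Gamma>)"
    and sK: "\<And>K. K \<in> connected_components_of (uconf_space n (remove_open_edges \<Gamma> cuts)) \<Longrightarrow> sK K \<in> K"
    and sH: "\<And>f H. f \<in> cuts \<Longrightarrow> H \<in> hyperplanes_labelled n \<Gamma> f \<Longrightarrow>
           sH H \<in> comb_hyperplane_minus n \<Gamma> f H \<union> comb_hyperplane_plus n \<Gamma> f H \<and>
           sH H \<subseteq> range Vertex"
begin

abbreviation "\<Gamma>' \<equiv> remove_open_edges \<Gamma> cuts"
abbreviation "\<Delta> f \<equiv> remove_closed_edge \<Gamma> f"
abbreviation "planes \<equiv> \<Union>f\<in>cuts. hyperplanes_labelled n \<Gamma> f"
abbreviation "gen \<equiv> arc_gen \<Gamma>"

lemma n1: "n - 1 = k" "n \<ge> 1" using n by auto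

lemma wf: "wf_digraph \<Gamma>" using fin by (rule fin_digraph.axioms(1))

lemma sub': "subgraph \<Gamma>' \<Gamma>" by (rule subgraph_remove_open_edges[OF wf])

lemma wf': "wf_digraph \<Gamma>'" using sub' by (simp add: subgraph_def)

lemma wf\<Delta>: "wf_digraph (\<Delta> f)" using subgraph_remove_closed_edge[OF wf, of f] by (simp add: subgraph_def)

sublocale X: graph_config \<Gamma> n by (rule graph_config.intro[OF wf])
sublocale X0: graph_config \<Gamma>' n by (rule graph_config.intro[OF wf'])
sublocale Y: graph_config "\<Delta> f" k for f by (rule graph_config.intro[OF wf\<Delta>])

lemma verts' [simp]: "verts \<Gamma>' = verts \<Gamma>" "tail \<Gamma>' = tail \<Gamma>" "head \<Gamma>' = head \<Gamma>"
  by (auto simp: remove_open_edges_def)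

lemma arcs' [simp]: "f \<in> arcs \<Gamma>' \<longleftrightarrow> f \<in> arcs \<Gamma> \<and> f \<notin> cuts"
  by (auto simp: remove_open_edges_def)

lemmas same' = subgraph_simps[OF sub']
lemmas same\<Delta> = subgraph_simps[OF subgraph_remove_closed_edge[OF wf]]

lemma vertex_config' [simp]: "vertex_config n \<Gamma>' T = vertex_config n \<Gamma> T"
  by (simp add: vertex_config_def)

lemma cuts_not_disjoint: "f \<in> cuts \<Longrightarrow> g \<in> cuts \<Longrightarrow> \<not> disjoint_arcs \<Gamma> f g"
  using cutsD[of f] cutsD[of g] by (auto simp: disjoint_arcs_def)

text \<open>An edge disjoint from the closed edge \<open>f\<close> is no cut edge, as cut edges
  meet; hence the particles beside \<open>f\<close> move in the cut graph.\<close>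

lemma sub\<Delta>': "f \<in> cuts \<Longrightarrow> subgraph (\<Delta> f) \<Gamma>'"
  using subgraph_remove_closed_edge[OF wf, of f] sub' cuts_not_disjoint[of f]
  by (auto simp: subgraph_def compatible_def arcs_remove_closed_edge[OF wf])

lemma insert_particle:
  "f \<in> cuts \<Longrightarrow> a \<in> {tail \<Gamma> f, head \<Gamma> f} \<Longrightarrow> add_particles (\<Delta> f) \<Gamma>' {a} k n"
  using sub\<Delta>'[of f] cutsD[of f] wf n by unfold_locales (auto simp: wf_digraph_def)

lemma inclusion: "add_particles \<Gamma>' \<Gamma> {} n n"
  using sub' by unfold_locales auto

lemma hols0_hols: "g \<in> X0.hols x y \<Longrightarrow> g \<in> X.hols x y"
  using add_particles.hols_add_particles[OF inclusion, of g x y] by simp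

lemma holsY_hols0:
  assumes "f \<in> cuts" "a \<in> {tail \<Gamma> f, head \<Gamma> f}" "g \<in> Y.hols f x y"
  shows "g \<in> X0.hols (insert (Vertex a) x) (insert (Vertex a) y)"
  using add_particles.hols_add_particles[OF insert_particle[OF assms(1,2)] assms(3)] by simp

lemma arc_gen_same [simp]: "arc_gen \<Gamma>' = gen" "arc_gen (\<Delta> f) = gen" "arc_eval \<Gamma>' = arc_eval \<Gamma>" "arc_eval (\<Delta> f) = arc_eval \<Gamma>"
  by (simp_all add: same' same\<Delta>)

text \<open>Between vertex configurations the holonomy is the value of an edge path away from
  \<open>f\<close>, and all letters of it are disjoint from \<open>f\<close>.\<close>

lemma gen_commute_holsY:
  assumes "g \<in> Y.hols f (Vertex ` T) (Vertex ` T')"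
  shows "gen (f, s) + g = g + gen (f, s)"
proof -
  obtain p where p: "pathin (uconf_space k (\<Delta> f)) p" "p 0 = Vertex ` T" "p 1 = Vertex ` T'" "g = Y.holonomy f p"
    using assms unfolding Y.hols_def by blast
  obtain w where w: "legal (\<Delta> f) T w" "g = arc_eval \<Gamma> w" using Y.vertex_path_word[OF p(1-3)] p(4) by auto
  have "fst ` set w \<subseteq> arcs (\<Delta> f)" using w(1)
    by (induction w arbitrary: T) (auto simp: can_move_def)
  then have "\<forall>a\<in>set w. disjoint_arcs \<Gamma> f (fst a)" by (auto simp: arcs_remove_closed_edge[OF wf])
  then have "gen (f, s) + arc_eval \<Gamma> w = arc_eval \<Gamma> w + gen (f, s)"
  proof (induction w)
    case (Cons a w)
    have 1: "gen (f, s) + gen a = gen a + gen (f, s)" by (rule raag_arcs.gen_commute) (use Cons.prems in simp)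
    have 2: "gen (f, s) + arc_eval \<Gamma> w = arc_eval \<Gamma> w + gen (f, s)" using Cons by simp
    have "gen (f, s) + (gen a + arc_eval \<Gamma> w) = gen a + (gen (f, s) + arc_eval \<Gamma> w)"
      by (simp only: add.assoc[symmetric] 1)
    then show ?case by (simp only: 2 raag_arcs.word_eval_simps add.assoc)
  qed simp
  then show ?thesis using w(2) by simp
qed

lemma planes_cases:
  assumes "f \<in> cuts" "H \<in> hyperplanes_labelled n \<Gamma> f"
  obtains T where "vertex_config k (\<Delta> f) T" "H = hyperplane_of \<Gamma> f T"
  using assms hyperplanes_labelled_eq[OF wf n1(2), of f] cutsD[of f] n1(1) by auto

lemma plane_of:
  assumes "f \<in> cuts" "vertex_config k (\<Delta> f) T"
  shows "hyperplane_of \<Gamma> f T \<in> hyperplanes_labelled n \<Gamma> f"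
  using assms hyperplanes_labelled_eq[OF wf n1(2), of f] cutsD[of f] n1(1) by auto

lemma hyperplane_of_self: "(f, T) \<in> hyperplane_of \<Gamma> f T"
  unfolding hyperplane_of_def by (auto intro: exI[of _ "[]"])

lemma label_unique:
  assumes "f \<in> cuts" "g \<in> cuts" "H \<in> hyperplanes_labelled n \<Gamma> f" "H \<in> hyperplanes_labelled n \<Gamma> g"
  shows "f = g"
proof -
  obtain T T' where "H = hyperplane_of \<Gamma> f T" "H = hyperplane_of \<Gamma> g T'"
    using planes_cases assms by metis
  then have "(f, T) \<in> hyperplane_of \<Gamma> g T'" using hyperplane_of_self by metis
  then show ?thesis by (auto simp: hyperplane_of_def)
qed

section \<open>Labels, resting positions and sides of hyperplanes\<close>

definition label :: "('e \<times> 'v set) set \<Rightarrow> 'e" where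
  "label H = (SOME f. f \<in> cuts \<and> H \<in> hyperplanes_labelled n \<Gamma> f)"

lemma label: "H \<in> planes \<Longrightarrow> label H \<in> cuts \<and> H \<in> hyperplanes_labelled n \<Gamma> (label H)"
  unfolding label_def by (rule someI_ex) auto

lemma label_eq: "f \<in> cuts \<Longrightarrow> H \<in> hyperplanes_labelled n \<Gamma> f \<Longrightarrow> H \<in> planes \<and> label H = f"
  using label[of H] label_unique[of f "label H" H] by auto

lemma component_eq:
  assumes "f \<in> cuts" "vertex_config k (\<Delta> f) T"
  shows "hyperplane_component n \<Gamma> f (hyperplane_of \<Gamma> f T) = connected_component_of_set (uconf_space k (\<Delta> f)) (Vertex ` T)"
  using hyperplane_component_eq[OF wf, of n f T] assms n1(1) by simp

lemma Y_component_iff: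
  "c \<in> connected_component_of_set (uconf_space k (\<Delta> f)) x \<longleftrightarrow> (\<exists>g. g \<in> Y.hols f x c)"
  using Y.path_component_eq_connected_component[of f, symmetric] unfolding Y.hols_def path_component_of_def by auto

lemma X0_component_iff:
  "c \<in> connected_component_of_set X0.X x \<longleftrightarrow> (\<exists>g. g \<in> X0.hols x c)"
  using X0.path_component_eq_connected_component[symmetric] unfolding X0.hols_def path_component_of_def by auto

text \<open>Whichever of the two combinatorial hyperplanes contains \<open>sH H\<close>, dropping
  the particle on \<open>f\<close> leaves a vertex configuration that an edge path joins to a
  representative of \<open>H\<close>; so it is a representative itself.\<close>

lemma rest_exists:
  assumes "f \<in> cuts" "H \<in> hyperplanes_labelled n \<Gamma> f"
  shows "\<exists>T. vertex_config k (\<Delta> f) T \<and> H = hyperplane_of \<Gamma> f T \<and> sH H \<inter> graph_points (\<Delta> f) = Vertex ` T"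
proof -
  obtain T1 where T1: "vertex_config k (\<Delta> f) T1" "H = hyperplane_of \<Gamma> f T1" by (rule planes_cases[OF assms])
  have "sH H \<in> comb_hyperplane_minus n \<Gamma> f H \<union> comb_hyperplane_plus n \<Gamma> f H" "sH H \<subseteq> range Vertex"
    using sH[OF assms] by auto
  then obtain a c where ac: "a \<in> {tail \<Gamma> f, head \<Gamma> f}" "c \<in> hyperplane_component n \<Gamma> f H" "sH H = insert (Vertex a) c" "sH H \<subseteq> range Vertex"
    unfolding comb_hyperplane_minus_def comb_hyperplane_plus_def by blast
  then obtain g where g: "g \<in> Y.hols f (Vertex ` T1) c"
    unfolding T1(2) component_eq[OF assms(1) T1(1)] Y_component_iff by blast
  then have c: "is_config k (\<Delta> f) c" using path_in_topspace[of "uconf_space k (\<Delta> f)" _ 1]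
    unfolding Y.hols_def by (auto simp: Y.in_X)
  have "c \<subseteq> range Vertex" using ac by auto
  then obtain T where T: "c = Vertex ` T" by (metis subset_imageE)
  have v: "vertex_config k (\<Delta> f) T" using c T by (simp add: is_config_Vertex_image)
  have "c \<subseteq> graph_points (\<Delta> f)" using c by (simp add: is_config_def)
  moreover have "Vertex a \<notin> graph_points (\<Delta> f)" using ac(1) by auto
  ultimately have "sH H \<inter> graph_points (\<Delta> f) = Vertex ` T" using ac(3) T by auto
  moreover have "H = hyperplane_of \<Gamma> f T"
  proof -
    obtain p where p: "pathin (uconf_space k (\<Delta> f)) p" "p 0 = Vertex ` T1" "p 1 = Vertex ` T"
      using g T unfolding Y.hols_def by blast
    obtain w where "legal (\<Delta> f) T1 w" "dest (\<Delta> f) T1 w = T" using Y.vertex_path_word[OF p] by blast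
    then show ?thesis using hyperplane_of_eq[of \<Gamma> f T1 w] T1(2) by simp
  qed
  ultimately show ?thesis using v by blast
qed

definition rest :: "('e \<times> 'v set) set \<Rightarrow> 'v set" where
  "rest H = (SOME T. vertex_config k (\<Delta> (label H)) T \<and> H = hyperplane_of \<Gamma> (label H) T \<and>
      sH H \<inter> graph_points (\<Delta> (label H)) = Vertex ` T)"

lemma rest:
  assumes "H \<in> planes"
  shows "vertex_config k (\<Delta> (label H)) (rest H)" "H = hyperplane_of \<Gamma> (label H) (rest H)"
    "sH H \<inter> graph_points (\<Delta> (label H)) = Vertex ` rest H"
proof -
  have "vertex_config k (\<Delta> (label H)) (rest H) \<and> H = hyperplane_of \<Gamma> (label H) (rest H) \<and>
      sH H \<inter> graph_points (\<Delta> (label H)) = Vertex ` rest H"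
    unfolding rest_def by (rule someI_ex) (use rest_exists label[OF assms] in blast)
  then show "vertex_config k (\<Delta> (label H)) (rest H)" "H = hyperplane_of \<Gamma> (label H) (rest H)"
    "sH H \<inter> graph_points (\<Delta> (label H)) = Vertex ` rest H" by auto
qed

lemma to_rest:
  assumes "f \<in> cuts" "vertex_config k (\<Delta> f) T"
  shows "\<exists>g. g \<in> Y.hols f (Vertex ` T) (Vertex ` rest (hyperplane_of \<Gamma> f T))"
proof -
  let ?H = "hyperplane_of \<Gamma> f T"
  have H: "?H \<in> planes" "label ?H = f" using label_eq[OF assms(1) plane_of[OF assms]] by auto
  have "(f, rest ?H) \<in> ?H" using rest(2)[OF H(1)] hyperplane_of_self[of f "rest ?H"] H(2) by simp
  then obtain w where "legal (\<Delta> f) T w" "dest (\<Delta> f) T w = rest ?H" unfolding hyperplane_of_def by auto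
  then show ?thesis using Y.hols_word[OF assms(2)] by metis
qed

lemma plane_vertex:
  assumes "f \<in> cuts" "vertex_config k (\<Delta> f) T" "a \<in> {tail \<Gamma> f, head \<Gamma> f}"
  shows "vertex_config n \<Gamma> (insert a T)" "a \<notin> T" "tail \<Gamma> f \<notin> T" "head \<Gamma> f \<notin> T"
proof -
  show T: "a \<notin> T" "tail \<Gamma> f \<notin> T" "head \<Gamma> f \<notin> T" using assms(2,3) by (auto simp: vertex_config_def)
  have "a \<in> verts \<Gamma>" using assms(3) cutsD[OF assms(1)] wf by (auto simp: wf_digraph_def)
  then show "vertex_config n \<Gamma> (insert a T)" using T(1) assms(2) n by (auto simp: vertex_config_def)
qed

text \<open>\<open>True\<close> belongs to the minus hyperplane and \<open>False\<close> to the plus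
  one. With this indexing the move \<open>(label H, s)\<close> leads from \<open>side s H\<close> to
  \<open>side (\<not> s) H\<close>, and both directions can be treated together.\<close>

definition side :: "bool \<Rightarrow> ('e \<times> 'v set) set \<Rightarrow> ('v, 'e) gpoint set set" where
  "side s H = connected_component_of_set X0.X (insert (Vertex (arc_start \<Gamma> (label H, s))) (Vertex ` rest H))"

lemma arc_start_cases: "arc_start \<Gamma> (f, s) \<in> {tail \<Gamma> f, head \<Gamma> f}"
  by (auto simp: arc_start_def)

lemma side_point:
  assumes "H \<in> planes"
  shows "insert (Vertex (arc_start \<Gamma> (label H, s))) (Vertex ` rest H) \<in> topspace X0.X"
  using plane_vertex(1)[of "label H" "rest H", OF _ rest(1)[OF assms] arc_start_cases[of _ s]] label[OF assms]
    is_config_Vertex_image[of n \<Gamma>' "insert (arc_start \<Gamma> (label H, s)) (rest H)"]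
  by (simp add: X0.in_X)

lemma side_component:
  assumes "H \<in> planes" shows "side s H \<in> connected_components_of X0.X"
  unfolding side_def connected_components_of_def by (rule imageI[OF side_point[OF assms]])

lemma comb_hyperplane_side:
  assumes "H \<in> planes"
  shows "insert (Vertex (arc_start \<Gamma> (label H, s))) ` hyperplane_component n \<Gamma> (label H) H \<subseteq> side s H"
    "insert (Vertex (arc_start \<Gamma> (label H, s))) (Vertex ` rest H) \<in>
       insert (Vertex (arc_start \<Gamma> (label H, s))) ` hyperplane_component n \<Gamma> (label H) H"
proof -
  let ?f = "label H" and ?a = "Vertex (arc_start \<Gamma> (label H, s)) :: ('v, 'e) gpoint"
  have f: "?f \<in> cuts" using label[OF assms] by blast
  have C: "hyperplane_component n \<Gamma> ?f H = connected_component_of_set (uconf_space k (\<Delta> ?f)) (Vertex ` rest H)"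
    using component_eq[OF f rest(1)[OF assms]] rest(2)[OF assms] by simp
  show "insert ?a ` hyperplane_component n \<Gamma> ?f H \<subseteq> side s H"
  proof
    fix x assume "x \<in> insert ?a ` hyperplane_component n \<Gamma> ?f H"
    then obtain c where c: "x = insert ?a c" "c \<in> connected_component_of_set (uconf_space k (\<Delta> ?f)) (Vertex ` rest H)"
      unfolding C by blast
    then obtain g where "g \<in> Y.hols ?f (Vertex ` rest H) c" unfolding Y_component_iff by blast
    from holsY_hols0[OF f arc_start_cases this] show "x \<in> side s H"
      unfolding side_def c(1) X0_component_iff by blast
  qed
  have "Vertex ` rest H \<in> topspace (uconf_space k (\<Delta> ?f))"
    using rest(1)[OF assms] by (simp add: Y.in_X is_config_Vertex_image)
  then have "0 \<in> Y.hols ?f (Vertex ` rest H) (Vertex ` rest H)" by (rule Y.hols_zero)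
  then have "Vertex ` rest H \<in> hyperplane_component n \<Gamma> ?f H" unfolding C Y_component_iff by blast
  then show "insert ?a (Vertex ` rest H) \<in> insert ?a ` hyperplane_component n \<Gamma> ?f H" by (rule imageI)
qed

lemma components_eq:
  assumes "K \<in> connected_components_of X0.X" "L \<in> connected_components_of X0.X" "x \<in> K" "x \<in> L"
  shows "K = L"
  using assms connected_components_of_disjoint[of K X0.X L] by (auto simp: disjnt_def)

lemma side_iff:
  assumes "H \<in> planes"
  shows "(K \<in> connected_components_of X0.X \<and>
      insert (Vertex (arc_start \<Gamma> (label H, s))) ` hyperplane_component n \<Gamma> (label H) H \<subseteq> K) \<longleftrightarrow> K = side s H"
proof
  assume K: "K \<in> connected_components_of X0.X \<and>
      insert (Vertex (arc_start \<Gamma> (label H, s))) ` hyperplane_component n \<Gamma> (label H) H \<subseteq> K"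
  show "K = side s H"
    by (rule components_eq[OF conjunct1[OF K] side_component[OF assms] subsetD[OF conjunct2[OF K] comb_hyperplane_side(2)[OF assms]]
          subsetD[OF comb_hyperplane_side[OF assms]]])
next
  assume "K = side s H"
  then show "K \<in> connected_components_of X0.X \<and>
      insert (Vertex (arc_start \<Gamma> (label H, s))) ` hyperplane_component n \<Gamma> (label H) H \<subseteq> K"
    using side_component[OF assms] comb_hyperplane_side(1)[OF assms] by simp
qed

definition incl :: "bool \<Rightarrow> ('e \<times> 'v set) set \<Rightarrow> ((real \<Rightarrow> ('v, 'e) gpoint set) set \<Rightarrow> (real \<Rightarrow> ('v, 'e) gpoint set) set) \<Rightarrow> bool" where
  "incl s H \<phi> \<longleftrightarrow> induced_by_map (uconf_space k (\<Delta> (label H))) (Vertex ` rest H) X0.X (sK (side s H))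
      (insert (Vertex (arc_start \<Gamma> (label H, s)))) \<phi>"

lemma insert_eq_add: "insert (Vertex a) = (\<lambda>S. S \<union> Vertex ` {a})"
  by auto

lemma incl_exists:
  assumes "H \<in> planes" shows "\<exists>\<phi>. incl s H \<phi>"
proof -
  let ?a = "arc_start \<Gamma> (label H, s)"
  interpret A: add_particles "\<Delta> (label H)" \<Gamma>' "{?a}" k n
    by (rule insert_particle[OF _ arc_start_cases]) (use label[OF assms] in blast)
  have K: "side s H \<in> connected_components_of X0.X" by (rule side_component[OF assms])
  have "insert (Vertex ?a) (Vertex ` rest H) \<in> side s H" by (rule subsetD[OF comb_hyperplane_side[OF assms]])
  then obtain d where "d \<in> X0.hols (sK (side s H)) (insert (Vertex ?a) (Vertex ` rest H))"
    using X0.hols_component[OF K sK[OF K]] by blast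
  then show ?thesis unfolding incl_def insert_eq_add by (intro A.induced_exists) simp
qed

lemma incl_holonomy:
  assumes "H \<in> planes" "incl s H \<phi>"
  shows "\<exists>d. d \<in> X0.hols (sK (side s H)) (insert (Vertex (arc_start \<Gamma> (label H, s))) (Vertex ` rest H)) \<and>
    (\<forall>A\<in>carrier (RB k (\<Delta> (label H)) (Vertex ` rest H)).
      \<phi> A \<in> carrier (RB n \<Gamma>' (sK (side s H))) \<and> X0.hol_class (\<phi> A) = d + Y.hol_class (label H) A - d)"
proof -
  let ?a = "arc_start \<Gamma> (label H, s)"
  interpret A: add_particles "\<Delta> (label H)" \<Gamma>' "{?a}" k n
    by (rule insert_particle[OF _ arc_start_cases]) (use label[OF assms(1)] in blast)
  have "(\<lambda>S. S \<union> Vertex ` {?a}) (Vertex ` rest H) = insert (Vertex ?a) (Vertex ` rest H)" by simp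
  then show ?thesis using A.induced_holonomy[OF assms(2)[unfolded incl_def insert_eq_add]] unfolding Bex_def by metis
qed

text \<open>The conditions on the ends of an arc leave no choice, because components are disjoint;
  since each hyperplane has one label, the quantifier over the indices of the cut edges
  disappears.\<close>

lemma splitting_iff:
  assumes "cuts = e ` {1..m}"
  shows "hyperplane_splitting \<Gamma> n m e sK sH \<G> \<longleftrightarrow>
    (let \<Lambda> = base_graph \<G> in
      verts \<Lambda> = connected_components_of X0.X \<and> arcs \<Lambda> = planes \<and>
      (\<forall>H\<in>planes. tail \<Lambda> H = side True H \<and> head \<Lambda> H = side False H) \<and>
      (\<forall>K\<in>connected_components_of X0.X. vertex_group \<G> K = RB n \<Gamma>' (sK K)) \<and>
      (\<forall>H\<in>planes. edge_group \<G> H = RB k (\<Delta> (label H)) (Vertex ` rest H) \<and>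
         incl True H (mono_minus \<G> H) \<and> incl False H (mono_plus \<G> H)))"
proof -
  have pl: "(\<Union>i\<in>{1..m}. hyperplanes_labelled n \<Gamma> (e i)) = planes" unfolding assms by auto
  have ball: "(\<forall>i\<in>{1..m}. \<forall>H \<in> hyperplanes_labelled n \<Gamma> (e i). P (e i) H) \<longleftrightarrow> (\<forall>H\<in>planes. P (label H) H)" for P
  proof
    assume L: "\<forall>i\<in>{1..m}. \<forall>H \<in> hyperplanes_labelled n \<Gamma> (e i). P (e i) H"
    show "\<forall>H\<in>planes. P (label H) H" 
    proof
      fix H assume "H \<in> planes"
      then have "label H \<in> e ` {1..m}" "H \<in> hyperplanes_labelled n \<Gamma> (label H)" using label[of H] unfolding assms by auto
      then show "P (label H) H" using L by auto
    qed
  next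
    assume R: "\<forall>H\<in>planes. P (label H) H"
    show "\<forall>i\<in>{1..m}. \<forall>H \<in> hyperplanes_labelled n \<Gamma> (e i). P (e i) H"
    proof (intro ballI)
      fix i H assume "i \<in> {1..m}" "H \<in> hyperplanes_labelled n \<Gamma> (e i)"
      moreover from this have "e i \<in> cuts" unfolding assms by blast
      ultimately have "H \<in> planes" "label H = e i" using label_eq[of "e i" H] by blast+
      then show "P (e i) H" using bspec[OF R, of H] by simp
    qed
  qed
  have st: "arc_start \<Gamma> (f, True) = tail \<Gamma> f" "arc_start \<Gamma> (f, False) = head \<Gamma> f" for f
    by (auto simp: arc_start_def)
  have sides: "(tl \<in> connected_components_of X0.X \<and> comb_hyperplane_minus n \<Gamma> (label H) H \<subseteq> tl \<and>
        hd \<in> connected_components_of X0.X \<and> comb_hyperplane_plus n \<Gamma> (label H) H \<subseteq> hd) \<longleftrightarrow>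
      (tl = side True H \<and> hd = side False H)" if H: "H \<in> planes" for H tl hd
    using side_iff[OF H, of tl True] side_iff[OF H, of hd False]
    unfolding comb_hyperplane_minus_def comb_hyperplane_plus_def st by argo
  show ?thesis
    unfolding hyperplane_splitting_def Let_def n1(1) pl assms[symmetric]
      ball[of "\<lambda>f H. tail (base_graph \<G>) H \<in> verts (base_graph \<G>) \<and> comb_hyperplane_minus n \<Gamma> f H \<subseteq> tail (base_graph \<G>) H \<and>
         head (base_graph \<G>) H \<in> verts (base_graph \<G>) \<and> comb_hyperplane_plus n \<Gamma> f H \<subseteq> head (base_graph \<G>) H"]
      ball[of "\<lambda>f H. edge_group \<G> H = RB k (\<Delta> f) (sH H \<inter> graph_points (\<Delta> f)) \<and>
           induced_by_map (uconf_space k (\<Delta> f)) (sH H \<inter> graph_points (\<Delta> f)) X0.X (sK (tail (base_graph \<G>) H))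
             (insert (Vertex (tail \<Gamma> f))) (mono_minus \<G> H) \<and>
           induced_by_map (uconf_space k (\<Delta> f)) (sH H \<inter> graph_points (\<Delta> f)) X0.X (sK (head (base_graph \<G>) H))
             (insert (Vertex (head \<Gamma> f))) (mono_plus \<G> H)"]
    by (intro conj_cong refl) (auto simp: sides rest(3) incl_def st)
qed

lemma splitting_exists:
  assumes "cuts = e ` {1..m}" shows "\<exists>\<G>. hyperplane_splitting \<Gamma> n m e sK sH \<G>"
proof -
  define \<Lambda> where "\<Lambda> = \<lparr>verts = connected_components_of X0.X, arcs = planes, tail = side True, head = side False\<rparr>"
  define \<G> where "\<G> = \<lparr>base_graph = \<Lambda>, vertex_group = (\<lambda>K. RB n \<Gamma>' (sK K)),
      edge_group = (\<lambda>H. RB k (\<Delta> (label H)) (Vertex ` rest H)),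
      mono_minus = (\<lambda>H. SOME \<phi>. incl True H \<phi>), mono_plus = (\<lambda>H. SOME \<phi>. incl False H \<phi>)\<rparr>"
  have "incl s H (SOME \<phi>. incl s H \<phi>)" if "H \<in> planes" for s H by (rule someI_ex[OF incl_exists[OF that]])
  then show ?thesis unfolding splitting_iff[OF assms] by (intro exI[of _ \<G>]) (simp add: \<G>_def \<Lambda>_def)
qed

section \<open>Components of the cut configuration space\<close>

abbreviation comp :: "'v set \<Rightarrow> ('v, 'e) gpoint set set" where
  "comp T \<equiv> connected_component_of_set X0.X (Vertex ` T)"

lemma comp_component:
  assumes "vertex_config n \<Gamma> T" shows "comp T \<in> connected_components_of X0.X" "Vertex ` T \<in> comp T"
proof -
  have "Vertex ` T \<in> topspace X0.X" using assms by (simp add: X0.in_X is_config_Vertex_image)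
  then show "comp T \<in> connected_components_of X0.X" "Vertex ` T \<in> comp T"
    by (auto simp: connected_components_of_def connected_component_of_refl)
qed

lemma comp_eq:
  assumes "g \<in> X0.hols (Vertex ` T) (Vertex ` T')" "vertex_config n \<Gamma> T" "vertex_config n \<Gamma> T'" shows "comp T' = comp T"
  by (rule components_eq[OF comp_component(1)[OF assms(3)] comp_component(1)[OF assms(2)] comp_component(2)[OF assms(3)]
        X0.hols_imp_component[OF assms(1) comp_component[OF assms(2)]]])

lemma can_move': "can_move \<Gamma> T a \<Longrightarrow> fst a \<notin> cuts \<Longrightarrow> can_move \<Gamma>' T a"
  by (auto simp: can_move_def same')

lemma comp_move:
  assumes "vertex_config n \<Gamma> T" "can_move \<Gamma> T a" "fst a \<notin> cuts"
  shows "comp (move \<Gamma> T a) = comp T" "gen a \<in> X0.hols (Vertex ` T) (Vertex ` move \<Gamma> T a)"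
proof -
  show g: "gen a \<in> X0.hols (Vertex ` T) (Vertex ` move \<Gamma> T a)"
    using X0.hols_move[OF _ can_move'[OF assms(2,3)]] assms(1) by (simp add: same')
  show "comp (move \<Gamma> T a) = comp T" by (rule comp_eq[OF g assms(1) vertex_config_move[OF wf assms(1,2)]])
qed

lemma cut_move:
  assumes T: "vertex_config n \<Gamma> T" and a: "can_move \<Gamma> T (f, s)" "f \<in> cuts"
  shows "vertex_config k (\<Delta> f) (T - {arc_start \<Gamma> (f, s)})"
    "T = insert (arc_start \<Gamma> (f, s)) (T - {arc_start \<Gamma> (f, s)})"
    "move \<Gamma> T (f, s) = insert (arc_start \<Gamma> (f, \<not> s)) (T - {arc_start \<Gamma> (f, s)})"
proof -
  have "arc_end \<Gamma> (f, s) = arc_start \<Gamma> (f, \<not> s)" by (simp add: arc_start_def arc_end_def)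
  then show "move \<Gamma> T (f, s) = insert (arc_start \<Gamma> (f, \<not> s)) (T - {arc_start \<Gamma> (f, s)})" by (simp add: move_def)
  show "T = insert (arc_start \<Gamma> (f, s)) (T - {arc_start \<Gamma> (f, s)})" using a by (auto simp: can_move_def)
  show "vertex_config k (\<Delta> f) (T - {arc_start \<Gamma> (f, s)})"
    using T a n by (auto simp: vertex_config_def can_move_def arc_start_def arc_end_def split: if_splits)
qed

lemma comp_side:
  assumes "f \<in> cuts" "vertex_config k (\<Delta> f) T"
  shows "comp (insert (arc_start \<Gamma> (f, s)) T) = side s (hyperplane_of \<Gamma> f T)"
proof -
  let ?H = "hyperplane_of \<Gamma> f T" and ?a = "arc_start \<Gamma> (f, s)"
  have H: "?H \<in> planes" "label ?H = f" using label_eq[OF assms(1) plane_of[OF assms]] by auto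
  obtain g where "g \<in> Y.hols f (Vertex ` T) (Vertex ` rest ?H)" using to_rest[OF assms] by blast
  from holsY_hols0[OF assms(1) arc_start_cases this]
  have g: "g \<in> X0.hols (Vertex ` insert ?a T) (Vertex ` insert ?a (rest ?H))" by simp
  have "comp (insert ?a (rest ?H)) = comp (insert ?a T)"
    by (rule comp_eq[OF g]) (use plane_vertex(1)[OF assms(1) _ arc_start_cases] assms(2) rest(1)[OF H(1)] H(2) in auto)
  then show ?thesis using H(2) by (simp add: side_def)
qed

text \<open>Sliding the base point along its track to a vertex configuration does not leave the
  component.\<close>

lemma comp_vertex:
  assumes "K \<in> connected_components_of X0.X"
  obtains T where "vertex_config n \<Gamma> T" "comp T = K"
proof -
  have x: "sK K \<in> K" by (rule sK[OF assms])
  then have "sK K \<in> topspace X0.X" using assms connected_components_of_subset by blast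
  then have c: "is_config n \<Gamma>' (sK K)" by (simp add: X0.in_X)
  let ?T = "corner \<Gamma>' (sK K) {}"
  have v: "vertex_config n \<Gamma> ?T" using X0.vertex_config_corner[OF c] by simp
  have "X0.holonomy (track \<Gamma>' UNIV (sK K)) \<in> X0.hols (sK K) (Vertex ` ?T)"
    unfolding X0.hols_def using X0.pathin_track[OF c] X0.track_0[OF c] X0.track_UNIV_1 by blast
  from X0.hols_imp_component[OF this assms x] have "comp ?T = K"
    using components_eq[OF comp_component(1)[OF v] assms comp_component(2)[OF v]] by blast
  then show ?thesis using that v by blast
qed

end

section \<open>The graph of groups of a splitting\<close>

lemmas group_add_nf = diff_conv_add_uminus add.assoc minus_add

context free_product
begin

text \<open>Calculations in the quotient are carried out on representing words, so that the stable
  letters stay visible.\<close>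

definition congr :: "('k, 'a, 'h) letter list set set \<Rightarrow> ('k, 'a, 'h) letter list \<Rightarrow> ('k, 'a, 'h) letter list \<Rightarrow> bool" where
  "congr N u w \<longleftrightarrow> u \<in> words \<and> w \<in> words \<and> N #>\<^bsub>F\<^esub> cls u = N #>\<^bsub>F\<^esub> cls w"

lemma congr_refl: "u \<in> words \<Longrightarrow> congr N u u" by (simp add: congr_def)

lemma congr_sym: "congr N u w \<Longrightarrow> congr N w u" by (simp add: congr_def)

lemma congr_trans [trans]: "congr N u v \<Longrightarrow> congr N v w \<Longrightarrow> congr N u w" by (simp add: congr_def)

lemma congr_step:
  assumes "step u w" "u \<in> words" shows "congr N u w"
  using assms step_words[OF assms(1)] cls_eq_iff[of u w] step_equiv[OF assms(1)] by (simp add: congr_def)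

lemma congr_append:
  assumes N: "N \<lhd> F" and "congr N u u'" "congr N w w'" shows "congr N (u @ w) (u' @ w')"
proof -
  interpret normal N F by (rule N)
  have "N #>\<^bsub>F\<^esub> cls (x @ y) = (N #>\<^bsub>F\<^esub> cls x) <#>\<^bsub>F\<^esub> (N #>\<^bsub>F\<^esub> cls y)" if "x \<in> words" "y \<in> words" for x y
    using that by (simp add: rcos_sum F_mult)
  then show ?thesis using assms(2,3) by (simp add: congr_def)
qed

lemma congr_context:
  assumes "N \<lhd> F" "congr N u w" "x \<in> words" "y \<in> words" shows "congr N (x @ u @ y) (x @ w @ y)"
  using assms by (intro congr_append congr_refl)

lemma congr_Nil_iff:
  assumes N: "N \<lhd> F" shows "congr N w [] \<longleftrightarrow> w \<in> words \<and> cls w \<in> N"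
proof -
  interpret normal N F by (rule N)
  have N1: "N #>\<^bsub>F\<^esub> cls [] = N" using coset_mult_one[OF subset] by simp
  show ?thesis
  proof
    assume "congr N w []"
    then show "w \<in> words \<and> cls w \<in> N"
      using N1 coset_join1[of N "cls w"] subgroup_axioms by (auto simp: congr_def)
  next
    assume "w \<in> words \<and> cls w \<in> N"
    then show "congr N w []" using N1 coset_join2[of "cls w" N] subgroup_axioms by (auto simp: congr_def)
  qed
qed

end

locale splitting = cutting \<Gamma> n k cuts v S sK sH
  for \<Gamma> :: "('v, 'e) pre_digraph" and n k cuts v S sK sH +
  fixes \<G> :: "(('v, 'e) gpoint set set, ('e \<times> 'v set) set,
      (real \<Rightarrow> ('v, 'e) gpoint set) set, (real \<Rightarrow> ('v, 'e) gpoint set) set) graph_of_groups"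
  assumes verts_base: "verts (base_graph \<G>) = connected_components_of X0.X" and arcs_base: "arcs (base_graph \<G>) = planes"
    and tail_base: "\<And>H. H \<in> planes \<Longrightarrow> tail (base_graph \<G>) H = side True H"
    and head_base: "\<And>H. H \<in> planes \<Longrightarrow> head (base_graph \<G>) H = side False H"
    and vertex_group: "\<And>K. K \<in> connected_components_of X0.X \<Longrightarrow> vertex_group \<G> K = RB n \<Gamma>' (sK K)"
    and edge_group: "\<And>H. H \<in> planes \<Longrightarrow> edge_group \<G> H = RB k (\<Delta> (label H)) (Vertex ` rest H)"
    and incl_minus: "\<And>H. H \<in> planes \<Longrightarrow> incl True H (mono_minus \<G> H)"
    and incl_plus: "\<And>H. H \<in> planes \<Longrightarrow> incl False H (mono_plus \<G> H)"
begin

abbreviation "\<Lambda> \<equiv> base_graph \<G>"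
abbreviation "comps \<equiv> connected_components_of X0.X"

definition mono :: "bool \<Rightarrow> ('e \<times> 'v set) set \<Rightarrow> (real \<Rightarrow> ('v, 'e) gpoint set) set \<Rightarrow> (real \<Rightarrow> ('v, 'e) gpoint set) set" where
  "mono s H = (if s then mono_minus \<G> H else mono_plus \<G> H)"

text \<open>The holonomy of a path along which the given map of the splitting is induced. The
  splitting only asserts that such a path exists, so one is fixed for each side.\<close>

definition side_hol :: "bool \<Rightarrow> ('e \<times> 'v set) set \<Rightarrow> ('e \<times> bool) list set bijection" where
  "side_hol s H = (SOME d. d \<in> X0.hols (sK (side s H)) (Vertex ` insert (arc_start \<Gamma> (label H, s)) (rest H)) \<and>
    (\<forall>A\<in>carrier (RB k (\<Delta> (label H)) (Vertex ` rest H)).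
      mono s H A \<in> carrier (RB n \<Gamma>' (sK (side s H))) \<and> X0.hol_class (mono s H A) = d + Y.hol_class (label H) A - d))"

lemma side_hol:
  assumes "H \<in> planes"
  shows "side_hol s H \<in> X0.hols (sK (side s H)) (Vertex ` insert (arc_start \<Gamma> (label H, s)) (rest H))"
    "A \<in> carrier (RB k (\<Delta> (label H)) (Vertex ` rest H)) \<Longrightarrow>
      mono s H A \<in> carrier (RB n \<Gamma>' (sK (side s H))) \<and> X0.hol_class (mono s H A) = side_hol s H + Y.hol_class (label H) A - side_hol s H"
proof -
  have "incl s H (mono s H)" using incl_minus incl_plus assms by (simp add: mono_def)
  from someI_ex[OF incl_holonomy[OF assms this]]
  have *: "side_hol s H \<in> X0.hols (sK (side s H)) (Vertex ` insert (arc_start \<Gamma> (label H, s)) (rest H)) \<and>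
    (\<forall>A\<in>carrier (RB k (\<Delta> (label H)) (Vertex ` rest H)).
      mono s H A \<in> carrier (RB n \<Gamma>' (sK (side s H))) \<and> X0.hol_class (mono s H A) = side_hol s H + Y.hol_class (label H) A - side_hol s H)"
    unfolding side_hol_def image_insert .
  then show "side_hol s H \<in> X0.hols (sK (side s H)) (Vertex ` insert (arc_start \<Gamma> (label H, s)) (rest H))" by blast
  show "A \<in> carrier (RB k (\<Delta> (label H)) (Vertex ` rest H)) \<Longrightarrow>
      mono s H A \<in> carrier (RB n \<Gamma>' (sK (side s H))) \<and> X0.hol_class (mono s H A) = side_hol s H + Y.hol_class (label H) A - side_hol s H"
    using * by blast
qed

text \<open>Paths between vertex configurations are closed up to loops at the base points by these
  elements.\<close>

definition base_hol :: "'v set \<Rightarrow> ('e \<times> bool) list set bijection" where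
  "base_hol T = (SOME g. g \<in> X0.hols (sK (comp T)) (Vertex ` T))"

lemma base_hol:
  assumes "vertex_config n \<Gamma> T" shows "base_hol T \<in> X0.hols (sK (comp T)) (Vertex ` T)"
proof -
  have "\<exists>g. g \<in> X0.hols (sK (comp T)) (Vertex ` T)"
    using X0.hols_component[OF comp_component(1)[OF assms] sK[OF comp_component(1)[OF assms]] comp_component(2)[OF assms]] by metis
  from someI_ex[OF this] show ?thesis unfolding base_hol_def .
qed

text \<open>Brings the particles beside \<open>f\<close> to the resting position at which the edge
  group is based.\<close>

definition rest_hol :: "'e \<Rightarrow> 'v set \<Rightarrow> ('e \<times> bool) list set bijection" where
  "rest_hol f T = (SOME g. g \<in> Y.hols f (Vertex ` T) (Vertex ` rest (hyperplane_of \<Gamma> f T)))"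

lemma rest_hol:
  assumes "f \<in> cuts" "vertex_config k (\<Delta> f) T"
  shows "rest_hol f T \<in> Y.hols f (Vertex ` T) (Vertex ` rest (hyperplane_of \<Gamma> f T))"
    "rest_hol f T \<in> X0.hols (Vertex ` insert (arc_start \<Gamma> (f, s)) T) (Vertex ` insert (arc_start \<Gamma> (f, s)) (rest (hyperplane_of \<Gamma> f T)))"
    "gen (f, s') + rest_hol f T = rest_hol f T + gen (f, s')"
proof -
  show *: "rest_hol f T \<in> Y.hols f (Vertex ` T) (Vertex ` rest (hyperplane_of \<Gamma> f T))"
    unfolding rest_hol_def by (rule someI_ex[OF to_rest[OF assms]])
  show "rest_hol f T \<in> X0.hols (Vertex ` insert (arc_start \<Gamma> (f, s)) T) (Vertex ` insert (arc_start \<Gamma> (f, s)) (rest (hyperplane_of \<Gamma> f T)))"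
    using holsY_hols0[OF assms(1) arc_start_cases *] by simp
  show "gen (f, s') + rest_hol f T = rest_hol f T + gen (f, s')" by (rule gen_commute_holsY[OF *])
qed

lemma sK_top: "K \<in> comps \<Longrightarrow> sK K \<in> topspace X0.X"
  using sK connected_components_of_subset by blast

lemma group_vertex_group: "K \<in> comps \<Longrightarrow> group (vertex_group \<G> K)"
  using X0.group_RB[OF sK_top] vertex_group by simp

sublocale FP: free_product "verts \<Lambda>" "vertex_group \<G>" "arcs \<Lambda>"
  by (rule free_product.intro) (simp add: verts_base group_vertex_group)

lemma gog_F: "gog_free_product \<G> = FP.F" by (simp add: gog_free_product_def)

text \<open>Letters indexed by holonomies, so that products in a vertex group become sums.\<close>

definition V :: "('v, 'e) gpoint set set \<Rightarrow> ('e \<times> bool) list set bijection \<Rightarrow>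
    (('v, 'e) gpoint set set, (real \<Rightarrow> ('v, 'e) gpoint set) set, ('e \<times> 'v set) set) letter list" where
  "V K g = [VLetter K (X0.class_of_hol (sK K) g)]"

abbreviation "hK K \<equiv> X0.hols (sK K) (sK K)"

lemma V_words: "K \<in> comps \<Longrightarrow> g \<in> hK K \<Longrightarrow> V K g \<in> FP.words"
  unfolding V_def FP.words_letter(1)
  by (intro conjI FP.words_Nil) (simp_all add: verts_base vertex_group X0.class_of_hol(1))

lemma E_words: "H \<in> planes \<Longrightarrow> [ELetter H s] \<in> FP.words"
  unfolding FP.words_letter(2) by (intro conjI FP.words_Nil) (simp add: arcs_base)

lemma V_add:
  assumes "K \<in> comps" "g \<in> hK K" "h \<in> hK K" shows "FP.congr N (V K g @ V K h) (V K (g + h))"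
proof -
  have "FP.step ([] @ [VLetter K (X0.class_of_hol (sK K) g), VLetter K (X0.class_of_hol (sK K) h)] @ [])
     ([] @ [VLetter K (X0.class_of_hol (sK K) g \<otimes>\<^bsub>vertex_group \<G> K\<^esub> X0.class_of_hol (sK K) h)] @ [])"
    using assms X0.class_of_hol(1) by (intro fp_mult) (auto simp: verts_base vertex_group)
  then have "FP.step (V K g @ V K h) (V K (g + h))"
    using assms X0.class_of_hol_mult[OF sK_top] by (simp add: V_def vertex_group)
  then show ?thesis by (rule FP.congr_step) (simp add: V_words assms)
qed

lemma V_zero:
  assumes "K \<in> comps" shows "FP.congr N (V K 0) []"
proof -
  have "FP.step ([] @ [VLetter K \<one>\<^bsub>vertex_group \<G> K\<^esub>] @ []) ([] @ [])" using assms by (intro fp_one) (simp add: verts_base)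
  then have "FP.step (V K 0) []" using assms X0.class_of_hol_zero[OF sK_top] by (simp add: V_def vertex_group)
  then show ?thesis by (rule FP.congr_step) (simp add: V_words assms X0.hols_zero sK_top)
qed

lemma E_cancel:
  assumes "H \<in> planes" shows "FP.congr N ([ELetter H s] @ [ELetter H (\<not> s)]) []"
proof -
  have "FP.step ([] @ [ELetter H s, ELetter H (\<not> s)] @ []) ([] @ [])" using assms by (intro fp_cancel) (simp add: arcs_base)
  then have "FP.step ([ELetter H s] @ [ELetter H (\<not> s)]) []" by simp
  then show ?thesis by (rule FP.congr_step) (simp only: FP.words_append E_words[OF assms] simp_thms)
qed

text \<open>
  The element of the free product traced out by the move \<open>a\<close> from \<open>T\<close>: crossing a hyperplane
  contributes its stable letter, and the chosen paths to base points close up the rest to loops.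
\<close>

definition letter_word where
  "letter_word T a =
    (if fst a \<in> cuts
     then let U = T - {arc_start \<Gamma> a}; H = hyperplane_of \<Gamma> (fst a) U; s = snd a in
       V (side s H) (base_hol T + rest_hol (fst a) U - side_hol s H) @ [ELetter H s] @
       V (side (\<not> s) H) (side_hol (\<not> s) H - rest_hol (fst a) U - base_hol (move \<Gamma> T a))
     else V (comp T) (base_hol T + gen a - base_hol (move \<Gamma> T a)))"

fun path_word where
  "path_word T [] = []"
| "path_word T (a # w) = letter_word T a @ path_word (move \<Gamma> T a) w"

lemma path_word_append: "path_word T (u @ w) = path_word T u @ path_word (dest \<Gamma> T u) w"
  by (induction u arbitrary: T) auto

lemma letter_word_free:
  assumes "vertex_config n \<Gamma> T" "can_move \<Gamma> T a" "fst a \<notin> cuts"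
  shows "letter_word T a = V (comp T) (base_hol T + gen a - base_hol (move \<Gamma> T a))"
    "comp T \<in> comps" "base_hol T + gen a - base_hol (move \<Gamma> T a) \<in> hK (comp T)"
proof -
  show "letter_word T a = V (comp T) (base_hol T + gen a - base_hol (move \<Gamma> T a))" using assms by (simp add: letter_word_def)
  show "comp T \<in> comps" by (rule comp_component(1)[OF assms(1)])
  show "base_hol T + gen a - base_hol (move \<Gamma> T a) \<in> hK (comp T)"
    using base_hol[OF assms(1)] comp_move[OF assms] base_hol[OF vertex_config_move[OF wf assms(1,2)]]
    by (auto intro: X0.hols_add X0.hols_diff)
qed

text \<open>The outer letters are loops because their three terms lead from the base point through
  \<open>T\<close> to the resting position and back, and on the other side through the resting
  position to the moved configuration and back.\<close>

lemma letter_word_cut: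
  assumes T: "vertex_config n \<Gamma> T" and a: "can_move \<Gamma> T (f, s)" "f \<in> cuts"
  defines "U \<equiv> T - {arc_start \<Gamma> (f, s)}"
  defines "H \<equiv> hyperplane_of \<Gamma> f U"
  shows "letter_word T (f, s) = V (side s H) (base_hol T + rest_hol f U - side_hol s H) @ [ELetter H s] @
       V (side (\<not> s) H) (side_hol (\<not> s) H - rest_hol f U - base_hol (move \<Gamma> T (f, s)))"
    "H \<in> planes" "label H = f" "comp T = side s H" "comp (move \<Gamma> T (f, s)) = side (\<not> s) H"
    "base_hol T + rest_hol f U - side_hol s H \<in> hK (side s H)" "side_hol (\<not> s) H - rest_hol f U - base_hol (move \<Gamma> T (f, s)) \<in> hK (side (\<not> s) H)"
    "vertex_config k (\<Delta> f) U"
proof -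
  note c = cut_move[OF T a, folded U_def]
  show U: "vertex_config k (\<Delta> f) U" by (rule c(1))
  show "letter_word T (f, s) = V (side s H) (base_hol T + rest_hol f U - side_hol s H) @ [ELetter H s] @
       V (side (\<not> s) H) (side_hol (\<not> s) H - rest_hol f U - base_hol (move \<Gamma> T (f, s)))"
    using a by (simp add: letter_word_def Let_def U_def H_def)
  show H: "H \<in> planes" "label H = f" using label_eq[OF a(2) plane_of[OF a(2) U]] by (auto simp: H_def)
  show cT: "comp T = side s H" using comp_side[OF a(2) U, of s] c(2) by (simp add: H_def)
  show cT': "comp (move \<Gamma> T (f, s)) = side (\<not> s) H" using comp_side[OF a(2) U, of "\<not> s"] c(3) by (simp add: H_def)
  have b: "rest_hol f U \<in> X0.hols (Vertex ` T) (Vertex ` insert (arc_start \<Gamma> (f, s)) (rest H))"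
    "rest_hol f U \<in> X0.hols (Vertex ` move \<Gamma> T (f, s)) (Vertex ` insert (arc_start \<Gamma> (f, \<not> s)) (rest H))"
    using rest_hol(2)[OF a(2) U, of s] rest_hol(2)[OF a(2) U, of "\<not> s"] c(2,3) unfolding H_def by metis+
  have d: "side_hol s' H \<in> X0.hols (sK (side s' H)) (Vertex ` insert (arc_start \<Gamma> (f, s')) (rest H))" for s'
    using side_hol(1)[OF H(1)] H(2) by simp
  show "base_hol T + rest_hol f U - side_hol s H \<in> hK (side s H)"
    using base_hol[OF T] b(1) d[of s] unfolding cT by (blast intro: X0.hols_add X0.hols_diff)
  show "side_hol (\<not> s) H - rest_hol f U - base_hol (move \<Gamma> T (f, s)) \<in> hK (side (\<not> s) H)"
    using base_hol[OF vertex_config_move[OF wf T a(1)]] b(2) d[of "\<not> s"] unfolding cT' by (blast intro: X0.hols_diff)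
qed

lemma letter_word_words:
  assumes "vertex_config n \<Gamma> T" "can_move \<Gamma> T a" shows "letter_word T a \<in> FP.words"
proof (cases "fst a \<in> cuts")
  case True
  obtain f s where a: "a = (f, s)" by (cases a)
  note c = letter_word_cut[OF assms(1), of f s]
  show ?thesis using c assms True V_words[OF side_component] E_words unfolding a by simp
next
  case False
  then show ?thesis using letter_word_free[OF assms] V_words by simp
qed

lemma path_word_words: "vertex_config n \<Gamma> T \<Longrightarrow> legal \<Gamma> T w \<Longrightarrow> path_word T w \<in> FP.words"
  by (induction w arbitrary: T) (auto intro: letter_word_words vertex_config_move[OF wf])

section \<open>The base graph and its groups\<close>

lemma wf_base: "wf_digraph \<Lambda>"
  unfolding wf_digraph_def verts_base arcs_base using tail_base head_base side_component by auto

lemma base_step: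
  assumes "H \<in> planes" shows "(side s H, side (\<not> s) H) \<in> (arcs_ends \<Lambda>)\<^sup>s"
proof -
  have "(side True H, side False H) \<in> arcs_ends \<Lambda>"
    using assms tail_base[OF assms] head_base[OF assms] arcs_base by (force simp: arcs_ends_def arc_to_ends_def)
  then show ?thesis by (cases s) (force simp: symcl_def)+
qed

text \<open>A cut move crosses an arc of the base graph and any other move stays in its component,
  so edge paths in \<open>\<Gamma>\<close> project to walks in the base graph.\<close>

lemma base_reachable:
  "vertex_config n \<Gamma> T \<Longrightarrow> legal \<Gamma> T w \<Longrightarrow> (comp T, comp (dest \<Gamma> T w)) \<in> rtrancl_on comps ((arcs_ends \<Lambda>)\<^sup>s)"
proof (induction w arbitrary: T)
  case Nil
  then show ?case by (simp add: comp_component(1))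
next
  case (Cons a w)
  have a: "can_move \<Gamma> T a" "vertex_config n \<Gamma> (move \<Gamma> T a)" using Cons.prems by (auto intro: vertex_config_move[OF wf])
  have IH: "(comp (move \<Gamma> T a), comp (dest \<Gamma> T (a # w))) \<in> rtrancl_on comps ((arcs_ends \<Lambda>)\<^sup>s)"
    using Cons a by simp
  show ?case
  proof (cases "fst a \<in> cuts")
    case True
    obtain f s where fs: "a = (f, s)" by (cases a)
    note c = letter_word_cut[OF Cons.prems(1) a(1)[unfolded fs]]
    have "(comp T, comp (move \<Gamma> T a)) \<in> (arcs_ends \<Lambda>)\<^sup>s"
      using base_step[OF c(2)] c(4,5) True fs by simp
    then show ?thesis using converse_rtrancl_on_into_rtrancl_on[OF _ IH] comp_component(1)[OF Cons.prems(1)] by blast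
  next
    case False
    then show ?thesis using IH comp_move(1)[OF Cons.prems(1) a(1)] by simp
  qed
qed

lemma base_connected: "Digraph_Component.connected \<Lambda>"
  unfolding connected_conv verts_base
proof (intro conjI ballI)
  have c: "is_config n \<Gamma> S" using S by (simp add: X.in_X)
  show "comps \<noteq> {}" using comp_component(1)[OF X.vertex_config_corner[OF c]] by blast
  fix K L assume K: "K \<in> comps" and L: "L \<in> comps"
  obtain T where T: "vertex_config n \<Gamma> T" "comp T = K" by (rule comp_vertex[OF K])
  obtain T' where T': "vertex_config n \<Gamma> T'" "comp T' = L" by (rule comp_vertex[OF L])
  obtain w where "legal \<Gamma> T w" "dest \<Gamma> T w = T'" using connected_legal_word[OF conn T(1) T'(1)] by blast
  then show "(K, L) \<in> rtrancl_on comps ((arcs_ends \<Lambda>)\<^sup>s)" using base_reachable[OF T(1)] T T' by auto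
qed

text \<open>Every component contains one of the finitely many vertex configurations. Finiteness is
  what lets a spanning tree be grown step by step.\<close>

lemma base_finite: "finite comps"
proof -
  have "comps \<subseteq> comp ` {T. vertex_config n \<Gamma> T}"
  proof
    fix K assume "K \<in> comps"
    then obtain T where "vertex_config n \<Gamma> T" "comp T = K" by (rule comp_vertex)
    then show "K \<in> comp ` {T. vertex_config n \<Gamma> T}" by blast
  qed
  moreover have "{T. vertex_config n \<Gamma> T} \<subseteq> Pow (verts \<Gamma>)" by (auto simp: vertex_config_def)
  then have "finite {T. vertex_config n \<Gamma> T}" using fin by (meson fin_digraph.finite_verts finite_Pow_iff finite_subset)
  ultimately show ?thesis by (meson finite_imageI finite_subset)
qed

lemma rest_top: "H \<in> planes \<Longrightarrow> Vertex ` rest H \<in> topspace (uconf_space k (\<Delta> (label H)))"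
  using rest(1) by (simp add: Y.in_X is_config_Vertex_image)

text \<open>In terms of holonomy the map is a conjugation, and \<open>hol_class\<close> is injective
  on both groups.\<close>

lemma mono_mon:
  assumes "H \<in> planes"
  shows "mono s H \<in> mon (edge_group \<G> H) (vertex_group \<G> (side s H))"
proof -
  let ?E = "RB k (\<Delta> (label H)) (Vertex ` rest H)" and ?W = "RB n \<Gamma>' (sK (side s H))"
  interpret E: group ?E by (rule Y.group_RB[OF rest_top[OF assms]])
  interpret W: group ?W by (rule X0.group_RB[OF sK_top[OF side_component[OF assms]]])
  note d = side_hol(2)[OF assms, of _ s]
  have "mono s H \<in> hom ?E ?W"
  proof (rule homI)
    fix A B assume AB: "A \<in> carrier ?E" "B \<in> carrier ?E"
    show "mono s H (A \<otimes>\<^bsub>?E\<^esub> B) = mono s H A \<otimes>\<^bsub>?W\<^esub> mono s H B"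
    proof (rule X0.hol_class_inj)
      show "mono s H (A \<otimes>\<^bsub>?E\<^esub> B) \<in> carrier ?W" "mono s H A \<otimes>\<^bsub>?W\<^esub> mono s H B \<in> carrier ?W"
        using d AB by auto
      show "X0.hol_class (mono s H (A \<otimes>\<^bsub>?E\<^esub> B)) = X0.hol_class (mono s H A \<otimes>\<^bsub>?W\<^esub> mono s H B)"
        using d AB by (simp add: X0.hol_class_mult Y.hol_class_mult group_add_nf del: add_uminus_conv_diff)
    qed
  qed (use d in auto)
  moreover have "inj_on (mono s H) (carrier ?E)"
  proof (rule inj_onI)
    fix A B assume AB: "A \<in> carrier ?E" "B \<in> carrier ?E" "mono s H A = mono s H B"
    then have "side_hol s H + Y.hol_class (label H) A - side_hol s H = side_hol s H + Y.hol_class (label H) B - side_hol s H" using d by metis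
    then have "Y.hol_class (label H) A = Y.hol_class (label H) B" by (metis add_left_cancel diff_add_cancel)
    then show "A = B" using Y.hol_class_inj AB by blast
  qed
  ultimately show ?thesis using edge_group[OF assms] vertex_group[OF side_component[OF assms]] by (simp add: mon_def)
qed

lemma is_graph_of_groups: "is_graph_of_groups \<G>"
  unfolding is_graph_of_groups_def
proof (intro conjI ballI)
  show "wf_digraph \<Lambda>" "Digraph_Component.connected \<Lambda>" by (rule wf_base, rule base_connected)
  show "group (vertex_group \<G> K)" if "K \<in> verts \<Lambda>" for K using that group_vertex_group verts_base by simp
  fix H assume "H \<in> arcs \<Lambda>"
  then have H: "H \<in> planes" by (simp add: arcs_base)
  show "group (edge_group \<G> H)" using edge_group[OF H] Y.group_RB[OF rest_top[OF H]] by simp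
  show "mono_minus \<G> H \<in> mon (edge_group \<G> H) (vertex_group \<G> (tail \<Lambda> H))"
    using mono_mon[OF H, of True] tail_base[OF H] by (simp add: mono_def)
  show "mono_plus \<G> H \<in> mon (edge_group \<G> H) (vertex_group \<G> (head \<Lambda> H))"
    using mono_mon[OF H, of False] head_base[OF H] by (simp add: mono_def)
qed

end

section \<open>Edge paths modulo the relators\<close>

lemma (in free_product) congr_equiv:
  assumes "equivclp step u w" "u \<in> words" shows "congr N u w"
  using assms equiv_words[OF assms(1)] cls_eq_iff[of u w] by (simp add: congr_def)

lemma (in free_product) congr_mixed_trans [trans]:
  "u = v \<Longrightarrow> congr N v w \<Longrightarrow> congr N u w" "congr N u v \<Longrightarrow> v = w \<Longrightarrow> congr N u w"
  by simp_all

text \<open>\<open>N\<close> is kept abstract: the calculations use that it is normal and contains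
  the relators. It becomes their normal closure at the very end.\<close>

locale quotient_splitting = splitting \<Gamma> n k cuts v S sK sH \<G>
  for \<Gamma> :: "('v, 'e) pre_digraph" and n k cuts v S sK sH \<G> +
  fixes N :: "(('v, 'e) gpoint set set, (real \<Rightarrow> ('v, 'e) gpoint set) set, ('e \<times> 'v set) set) letter list set set"
    and A :: "('e \<times> 'v set) set set"
  assumes N: "N \<lhd> FP.F" and relators: "gog_relators \<G> (\<Lambda>\<lparr>arcs := A\<rparr>) \<subseteq> N" and A: "A \<subseteq> planes"
begin

abbreviation congruent (infix "\<approx>" 50) where "u \<approx> w \<equiv> FP.congr N u w"

lemmas context_congr = FP.congr_context[OF N]
lemmas append_congr = FP.congr_append[OF N]

lemma side_loop:
  assumes "H \<in> planes" "g \<in> Y.hols (label H) (Vertex ` rest H) (Vertex ` rest H)"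
  shows "side_hol s H + g - side_hol s H \<in> hK (side s H)"
proof -
  have "g \<in> X0.hols (Vertex ` insert (arc_start \<Gamma> (label H, s)) (rest H)) (Vertex ` insert (arc_start \<Gamma> (label H, s)) (rest H))"
    using holsY_hols0[OF _ arc_start_cases assms(2), of s] label[OF assms(1)] by simp
  then show ?thesis using side_hol(1)[OF assms(1), of s] by (blast intro: X0.hols_add X0.hols_diff)
qed

lemma mono_V:
  assumes "H \<in> planes" "g \<in> Y.hols (label H) (Vertex ` rest H) (Vertex ` rest H)"
  shows "[VLetter (side s H) (mono s H (Y.class_of_hol (label H) (Vertex ` rest H) g))] = V (side s H) (side_hol s H + g - side_hol s H)"
proof -
  note c = Y.class_of_hol[OF assms(2)]
  note d = side_hol(2)[OF assms(1) c(1), of s]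
  have "X0.class_of_hol (sK (side s H)) (X0.hol_class (mono s H (Y.class_of_hol (label H) (Vertex ` rest H) g)))
      = mono s H (Y.class_of_hol (label H) (Vertex ` rest H) g)"
    by (rule X0.class_of_hol_unique) (use d in blast)
  then show ?thesis using d c(2) by (simp add: V_def)
qed

lemma edge_relation_True:
  assumes H: "H \<in> planes" and g: "g \<in> Y.hols (label H) (Vertex ` rest H) (Vertex ` rest H)"
  shows "V (side True H) (side_hol True H + g - side_hol True H) @ [ELetter H True] \<approx> [ELetter H True] @ V (side False H) (side_hol False H + g - side_hol False H)"
proof -
  let ?V = "V (side True H) (side_hol True H + g - side_hol True H)" and ?W = "V (side False H) (side_hol False H + g - side_hol False H)"
  let ?E = "[ELetter H True]" and ?E' = "[ELetter H False]"
  let ?A = "Y.class_of_hol (label H) (Vertex ` rest H) g"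
  have w: "?V \<in> FP.words" "?W \<in> FP.words" "?E \<in> FP.words" "?E' \<in> FP.words" "FP.inv_word ?W \<in> FP.words" "FP.inv_word ?E \<in> FP.words"
    using V_words[OF side_component[OF H] side_loop[OF H g]] E_words[OF H] FP.inv_word_words by blast+
  have "inv\<^bsub>FP.F\<^esub> (FP.cls ?E) \<otimes>\<^bsub>FP.F\<^esub> FP.cls ?V \<otimes>\<^bsub>FP.F\<^esub> FP.cls ?E \<otimes>\<^bsub>FP.F\<^esub> inv\<^bsub>FP.F\<^esub> (FP.cls ?W) \<in> gog_relators \<G> (\<Lambda>\<lparr>arcs := A\<rparr>)"
  proof -
    have "H \<in> arcs \<Lambda>" "?A \<in> carrier (edge_group \<G> H)" using H arcs_base edge_group[OF H] Y.class_of_hol(1)[OF g] by auto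
    moreover have "gog_edge_elem \<G> H = FP.cls ?E" by (simp add: gog_edge_elem_def)
    moreover have "gog_vertex_elem \<G> (tail \<Lambda> H) (mono_minus \<G> H ?A) = FP.cls ?V"
      using mono_V[OF H g, of True] tail_base[OF H] by (simp add: gog_vertex_elem_def mono_def)
    moreover have "gog_vertex_elem \<G> (head \<Lambda> H) (mono_plus \<G> H ?A) = FP.cls ?W"
      using mono_V[OF H g, of False] head_base[OF H] by (simp add: gog_vertex_elem_def mono_def)
    ultimately show ?thesis unfolding gog_relators_def Let_def gog_F by (intro UnI1 CollectI exI[of _ H] exI[of _ ?A]) simp
  qed
  then have "FP.cls (((FP.inv_word ?E @ ?V) @ ?E) @ FP.inv_word ?W) \<in> N"
    using relators w by (simp add: FP.F_inv FP.F_mult subset_iff del: append_assoc)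
  moreover have "FP.inv_word ?E = ?E'" by simp
  ultimately have rel: "?E' @ ?V @ ?E @ FP.inv_word ?W \<approx> []"
    using w by (subst FP.congr_Nil_iff[OF N]) auto
  \<comment> \<open>Inserts \<open>?E @ ?E'\<close> in front and \<open>FP.inv_word ?W @ ?W\<close>
    behind, so that the relator appears in the middle.\<close>
  have "?V @ ?E \<approx> (?E @ ?E') @ ?V @ ?E"
    using context_congr[OF FP.congr_sym[OF E_cancel[OF H, of _ True]], of "[]" "?V @ ?E"] w by simp
  also have "(?E @ ?E') @ ?V @ ?E \<approx> (?E @ ?E' @ ?V @ ?E) @ (FP.inv_word ?W @ ?W)"
    using context_congr[OF FP.congr_sym[OF FP.congr_equiv[OF FP.inv_word_cancel[OF w(2)]]], of "?E @ ?E' @ ?V @ ?E" "[]"] w by simp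
  also have "(?E @ ?E' @ ?V @ ?E) @ (FP.inv_word ?W @ ?W) = ?E @ (?E' @ ?V @ ?E @ FP.inv_word ?W) @ ?W" by simp
  also have "?E @ (?E' @ ?V @ ?E @ FP.inv_word ?W) @ ?W \<approx> ?E @ [] @ ?W" by (rule context_congr[OF rel w(3,2)])
  finally show ?thesis by simp
qed

lemma edge_relation:
  assumes H: "H \<in> planes" and g: "g \<in> Y.hols (label H) (Vertex ` rest H) (Vertex ` rest H)"
  shows "V (side s H) (side_hol s H + g - side_hol s H) @ [ELetter H s] \<approx> [ELetter H s] @ V (side (\<not> s) H) (side_hol (\<not> s) H + g - side_hol (\<not> s) H)"
proof (cases s)
  case True
  then show ?thesis using edge_relation_True[OF assms] by simp
next
  case False
  let ?V = "V (side True H) (side_hol True H + g - side_hol True H)" and ?W = "V (side False H) (side_hol False H + g - side_hol False H)"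
  let ?E = "[ELetter H True]" and ?E' = "[ELetter H False]"
  have w: "?V \<in> FP.words" "?W \<in> FP.words" "?E \<in> FP.words" "?E' \<in> FP.words"
    using V_words[OF side_component[OF H] side_loop[OF H g]] E_words[OF H] by blast+
  have "?W @ ?E' \<approx> (?E' @ ?E) @ ?W @ ?E'"
    using context_congr[OF FP.congr_sym[OF E_cancel[OF H, of _ False]], of "[]" "?W @ ?E'"] w by simp
  also have "(?E' @ ?E) @ ?W @ ?E' = ?E' @ (?E @ ?W) @ ?E'" by simp
  also have "?E' @ (?E @ ?W) @ ?E' \<approx> ?E' @ (?V @ ?E) @ ?E'"
    by (rule context_congr[OF FP.congr_sym[OF edge_relation_True[OF assms]] w(4,4)])
  also have "?E' @ (?V @ ?E) @ ?E' = (?E' @ ?V) @ (?E @ ?E') @ []" by simp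
  also have "(?E' @ ?V) @ (?E @ ?E') @ [] \<approx> (?E' @ ?V) @ [] @ []"
    using context_congr[OF E_cancel[OF H, of _ True], of "?E' @ ?V" "[]"] w by simp
  finally show ?thesis using False by simp
qed

text \<open>The edge relation in the form in which it is applied: an element of the edge group
  passes from the end of one vertex letter, across the stable letter, to the front of the
  next.\<close>

lemma slide:
  assumes H: "H \<in> planes" and g: "g \<in> Y.hols (label H) (Vertex ` rest H) (Vertex ` rest H)"
    and x: "x \<in> hK (side s H)" and y: "y \<in> hK (side (\<not> s) H)"
  shows "V (side s H) (x + (side_hol s H + g - side_hol s H)) @ [ELetter H s] @ V (side (\<not> s) H) y
     \<approx> V (side s H) x @ [ELetter H s] @ V (side (\<not> s) H) ((side_hol (\<not> s) H + g - side_hol (\<not> s) H) + y)"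
proof -
  let ?K = "side s H" and ?L = "side (\<not> s) H" and ?E = "[ELetter H s]"
  let ?g = "side_hol s H + g - side_hol s H" and ?g' = "side_hol (\<not> s) H + g - side_hol (\<not> s) H"
  note K = side_component[OF H]
  have gg: "?g \<in> hK ?K" "?g' \<in> hK ?L" using side_loop[OF H g] by blast+
  note w = V_words[OF K x] V_words[OF K y] V_words[OF K gg(1)] V_words[OF K gg(2)] E_words[OF H, of s]
  have "V ?K (x + ?g) @ (?E @ V ?L y) \<approx> (V ?K x @ V ?K ?g) @ (?E @ V ?L y)"
    by (rule append_congr[OF FP.congr_sym[OF V_add[OF K x gg(1)]] FP.congr_refl]) (use w in simp)
  also have "(V ?K x @ V ?K ?g) @ (?E @ V ?L y) = V ?K x @ (V ?K ?g @ ?E) @ V ?L y" by simp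
  also have "V ?K x @ (V ?K ?g @ ?E) @ V ?L y \<approx> V ?K x @ (?E @ V ?L ?g') @ V ?L y"
    by (rule context_congr[OF edge_relation[OF H g] w(1,2)])
  also have "V ?K x @ (?E @ V ?L ?g') @ V ?L y = (V ?K x @ ?E) @ (V ?L ?g' @ V ?L y)" by simp
  also have "(V ?K x @ ?E) @ (V ?L ?g' @ V ?L y) \<approx> (V ?K x @ ?E) @ V ?L (?g' + y)"
    by (rule append_congr[OF FP.congr_refl V_add[OF K gg(2) y]]) (use w in simp)
  finally show ?thesis by simp
qed

text \<open>The free move takes place beside the hyperplane and can be made before or after the
  crossing. The two words differ by carrying one loop of the edge group across the stable
  letter.\<close>

lemma swap_free_cut:
  assumes T: "vertex_config n \<Gamma> T" and d: "disjoint_arcs \<Gamma> f (fst b)" and f: "f \<in> cuts" and b: "fst b \<notin> cuts"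
    and ma: "can_move \<Gamma> T (f, s)" and mb: "can_move \<Gamma> (move \<Gamma> T (f, s)) b"
  shows "letter_word T (f, s) @ letter_word (move \<Gamma> T (f, s)) b \<approx> letter_word T b @ letter_word (move \<Gamma> T b) (f, s)"
proof -
  let ?a = "(f, s)" and ?Ta = "move \<Gamma> T (f, s)" and ?Tb = "move \<Gamma> T b" and ?Tab = "move \<Gamma> (move \<Gamma> T (f, s)) b"
  have d': "disjoint_arcs \<Gamma> (fst ?a) (fst b)" using d by simp
  note mc = move_commute[OF d' ma mb]
  have Ta: "vertex_config n \<Gamma> ?Ta" and Tb: "vertex_config n \<Gamma> ?Tb"
    using vertex_config_move[OF wf T] ma mc(1) by auto
  have Tab: "vertex_config n \<Gamma> ?Tab" by (rule vertex_config_move[OF wf Ta mb])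
  define U where "U = T - {arc_start \<Gamma> ?a}"
  define U' where "U' = ?Tb - {arc_start \<Gamma> ?a}"
  define H where "H = hyperplane_of \<Gamma> f U"
  note ends = ends_disjoint[OF d']
  note c = letter_word_cut[OF T ma f, folded U_def, folded H_def]
  have mU: "can_move (\<Delta> f) U b" "move \<Gamma> U b = U'"
    using mc(1) ends d by (auto simp: can_move_def U_def U'_def same\<Delta> arcs_remove_closed_edge[OF wf] move_def)
  have H': "hyperplane_of \<Gamma> f U' = H"
    using hyperplane_of_eq[of \<Gamma> f U "[b]"] mU by (simp add: H_def same\<Delta>)
  note c' = letter_word_cut[OF Tb mc(2) f, folded U'_def, unfolded H' mc(3)[symmetric]]
  note fa = letter_word_free[OF Ta mb b] and fb = letter_word_free[OF T mc(1) b]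
  let ?K = "side s H" and ?L = "side (\<not> s) H" and ?E = "[ELetter H s]" and ?d = "side_hol s H" and ?e = "side_hol (\<not> s) H"
  \<comment> \<open>The free move \<open>b\<close>, closed up to a loop at the resting position of
    \<open>H\<close>.\<close>
  let ?k = "- rest_hol f U + gen b + rest_hol f U'"
  have k: "?k \<in> Y.hols (label H) (Vertex ` rest H) (Vertex ` rest H)"
  proof -
    have "gen b \<in> Y.hols f (Vertex ` U) (Vertex ` U')" using Y.hols_move[OF c(8) mU(1)] mU(2) by (simp add: same\<Delta>)
    moreover have "rest_hol f U \<in> Y.hols f (Vertex ` U) (Vertex ` rest H)" "rest_hol f U' \<in> Y.hols f (Vertex ` U') (Vertex ` rest H)"
      using rest_hol(1)[OF f c(8)] rest_hol(1)[OF f c'(8)] H' by (auto simp: H_def)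
    ultimately show ?thesis unfolding c(3) by (blast intro: Y.hols_add Y.hols_uminus)
  qed
  note K = side_component[OF c(2)]
  have cTa: "comp ?Ta = ?L" "comp T = ?K" using c(4,5) by auto
  have "letter_word T ?a @ letter_word ?Ta b = (V ?K (base_hol T + rest_hol f U - ?d) @ ?E) @ (V ?L (?e - rest_hol f U - base_hol ?Ta) @ V ?L (base_hol ?Ta + gen b - base_hol ?Tab))"
    unfolding c(1) fa(1) cTa by simp
  also have "\<dots> \<approx> (V ?K (base_hol T + rest_hol f U - ?d) @ ?E) @ V ?L ((?e - rest_hol f U - base_hol ?Ta) + (base_hol ?Ta + gen b - base_hol ?Tab))"
    by (rule append_congr[OF FP.congr_refl V_add[OF K c(7)]])
      (use fa(3) V_words[OF K c(6)] E_words[OF c(2)] in \<open>simp_all add: cTa\<close>)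
  finally have 1: "letter_word T ?a @ letter_word ?Ta b \<approx> V ?K (base_hol T + rest_hol f U - ?d) @ ?E @ V ?L ((?e - rest_hol f U - base_hol ?Ta) + (base_hol ?Ta + gen b - base_hol ?Tab))"
    by simp
  have "letter_word T b @ letter_word ?Tb ?a = (V ?K (base_hol T + gen b - base_hol ?Tb) @ V ?K (base_hol ?Tb + rest_hol f U' - ?d)) @ (?E @ V ?L (?e - rest_hol f U' - base_hol ?Tab))"
    unfolding c'(1) fb(1) cTa by simp
  also have "\<dots> \<approx> V ?K ((base_hol T + gen b - base_hol ?Tb) + (base_hol ?Tb + rest_hol f U' - ?d)) @ (?E @ V ?L (?e - rest_hol f U' - base_hol ?Tab))"
    by (rule append_congr[OF V_add[OF K _ c'(6)] FP.congr_refl])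
      (use fb(3) V_words[OF K c'(7)] E_words[OF c(2)] in \<open>simp_all add: cTa\<close>)
  also have "(base_hol T + gen b - base_hol ?Tb) + (base_hol ?Tb + rest_hol f U' - ?d) = (base_hol T + rest_hol f U - ?d) + (?d + ?k - ?d)"
    by (simp add: group_add_nf del: add_uminus_conv_diff)
  also have "V ?K ((base_hol T + rest_hol f U - ?d) + (?d + ?k - ?d)) @ ?E @ V ?L (?e - rest_hol f U' - base_hol ?Tab)
     \<approx> V ?K (base_hol T + rest_hol f U - ?d) @ ?E @ V ?L ((?e + ?k - ?e) + (?e - rest_hol f U' - base_hol ?Tab))"
    by (rule slide[OF c(2) k c(6) c'(7)])
  also have "(?e + ?k - ?e) + (?e - rest_hol f U' - base_hol ?Tab) = (?e - rest_hol f U - base_hol ?Ta) + (base_hol ?Ta + gen b - base_hol ?Tab)"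
    by (simp add: group_add_nf del: add_uminus_conv_diff)
  finally have 2: "letter_word T b @ letter_word ?Tb ?a \<approx> V ?K (base_hol T + rest_hol f U - ?d) @ ?E @ V ?L ((?e - rest_hol f U - base_hol ?Ta) + (base_hol ?Ta + gen b - base_hol ?Tab))" .
  show ?thesis by (rule FP.congr_trans[OF 1 FP.congr_sym[OF 2]])
qed

text \<open>Two cut edges are never disjoint, so at most one letter is a cut. If none is, both words
  collapse to the same letter of one vertex group.\<close>

lemma swap_letters:
  assumes T: "vertex_config n \<Gamma> T" and d: "disjoint_arcs \<Gamma> (fst a) (fst b)"
    and ma: "can_move \<Gamma> T a" and mb: "can_move \<Gamma> (move \<Gamma> T a) b"
  shows "letter_word T a @ letter_word (move \<Gamma> T a) b \<approx> letter_word T b @ letter_word (move \<Gamma> T b) a"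
proof -
  note mc = move_commute[OF d ma mb]
  have d2: "disjoint_arcs \<Gamma> (fst b) (fst a)" using d by (auto simp: disjoint_arcs_def)
  consider "fst a \<in> cuts" "fst b \<notin> cuts" | "fst a \<notin> cuts" "fst b \<in> cuts" | "fst a \<notin> cuts" "fst b \<notin> cuts"
    using cuts_not_disjoint d by blast
  then show ?thesis
  proof cases
    case 1
    then show ?thesis using swap_free_cut[OF T, of "fst a" b "snd a"] d ma mb by simp
  next
    case 2
    from swap_free_cut[OF T, of "fst b" a "snd b"] show ?thesis
      using 2 d2 mc by (simp add: FP.congr_sym)
  next
    case 3
    have Ta: "vertex_config n \<Gamma> (move \<Gamma> T a)" and Tb: "vertex_config n \<Gamma> (move \<Gamma> T b)"
      using vertex_config_move[OF wf T] ma mc(1) by auto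
    let ?R = "V (comp T) (base_hol T + (gen a + gen b) - base_hol (move \<Gamma> (move \<Gamma> T a) b))"
    have half: "letter_word T x @ letter_word (move \<Gamma> T x) y \<approx> V (comp T) (base_hol T + (gen x + gen y) - base_hol (move \<Gamma> (move \<Gamma> T x) y))"
      if x: "fst x \<notin> cuts" "can_move \<Gamma> T x" and y: "fst y \<notin> cuts" "can_move \<Gamma> (move \<Gamma> T x) y" "vertex_config n \<Gamma> (move \<Gamma> T x)" for x y
    proof -
      note fx = letter_word_free[OF T x(2,1)] and fy = letter_word_free[OF y(3,2,1)]
      have c: "comp (move \<Gamma> T x) = comp T" by (rule comp_move(1)[OF T x(2,1)])
      have "V (comp T) (base_hol T + gen x - base_hol (move \<Gamma> T x)) @ V (comp T) (base_hol (move \<Gamma> T x) + gen y - base_hol (move \<Gamma> (move \<Gamma> T x) y))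
        \<approx> V (comp T) ((base_hol T + gen x - base_hol (move \<Gamma> T x)) + (base_hol (move \<Gamma> T x) + gen y - base_hol (move \<Gamma> (move \<Gamma> T x) y)))"
        by (rule V_add[OF fx(2,3)]) (use fy(3) c in simp)
      moreover have "(base_hol T + gen x - base_hol (move \<Gamma> T x)) + (base_hol (move \<Gamma> T x) + gen y - base_hol (move \<Gamma> (move \<Gamma> T x) y)) = base_hol T + (gen x + gen y) - base_hol (move \<Gamma> (move \<Gamma> T x) y)"
        by (simp add: group_add_nf del: add_uminus_conv_diff)
      ultimately show ?thesis using fx(1) fy(1) c by simp
    qed
    have 1: "letter_word T a @ letter_word (move \<Gamma> T a) b \<approx> ?R" by (rule half[OF 3(1) ma 3(2) mb Ta])
    have 2: "letter_word T b @ letter_word (move \<Gamma> T b) a \<approx> ?R"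
      using half[OF 3(2) mc(1) 3(1) mc(2) Tb] mc(3) raag_arcs.gen_commute[OF d] by simp
    show ?thesis by (rule FP.congr_trans[OF 1 FP.congr_sym[OF 2]])
  qed
qed

text \<open>Crossing a hyperplane and returning passes the same resting position, so the inner
  vertex letters cancel first, then the stable letters, then the outer ones.\<close>

lemma cancel_letters:
  assumes T: "vertex_config n \<Gamma> T" and ma: "can_move \<Gamma> T a"
  shows "letter_word T a @ letter_word (move \<Gamma> T a) (flip a) \<approx> []"
proof -
  let ?T' = "move \<Gamma> T a"
  have T': "vertex_config n \<Gamma> ?T'" by (rule vertex_config_move[OF wf T ma])
  note fl = move_flip[OF ma]
  show ?thesis
  proof (cases "fst a \<in> cuts")
    case False
    note f = letter_word_free[OF T ma False]
    have f': "letter_word ?T' (flip a) = V (comp T) (base_hol ?T' - gen a - base_hol T)" "base_hol ?T' - gen a - base_hol T \<in> hK (comp T)"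
      using letter_word_free[OF T' fl(1)] False fl(2) comp_move(1)[OF T ma False] raag_arcs.gen_flip[of \<Gamma> a] by auto
    have "V (comp T) (base_hol T + gen a - base_hol ?T') @ V (comp T) (base_hol ?T' - gen a - base_hol T) \<approx> V (comp T) ((base_hol T + gen a - base_hol ?T') + (base_hol ?T' - gen a - base_hol T))"
      by (rule V_add[OF f(2,3) f'(2)])
    also have "(base_hol T + gen a - base_hol ?T') + (base_hol ?T' - gen a - base_hol T) = 0"
      by (simp add: group_add_nf del: add_uminus_conv_diff)
    also have "V (comp T) 0 \<approx> []" by (rule V_zero[OF f(2)])
    finally show ?thesis using f(1) f'(1) by simp
  next
    case True
    obtain f s where a: "a = (f, s)" by (cases a)
    have f: "f \<in> cuts" using True a by simp
    define U where "U = T - {arc_start \<Gamma> (f, s)}"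
    define H where "H = hyperplane_of \<Gamma> f U"
    note c = letter_word_cut[OF T ma[unfolded a] f, folded U_def, folded H_def]
    have U': "?T' - {arc_start \<Gamma> (f, \<not> s)} = U"
      using cut_move(3)[OF T ma[unfolded a] f] c(8) plane_vertex(2)[OF f c(8) arc_start_cases[of _ "\<not> s"]] by (auto simp: a U_def)
    have fl': "can_move \<Gamma> (move \<Gamma> T (f, s)) (f, \<not> s)" "move \<Gamma> (move \<Gamma> T (f, s)) (f, \<not> s) = T"
      using fl by (auto simp: a flip_def)
    note c' = letter_word_cut[OF T'[unfolded a] fl'(1) f, unfolded U'[unfolded a], folded H_def, unfolded fl'(2) not_not]
    let ?T' = "move \<Gamma> T (f, s)"
    let ?K = "side s H" and ?L = "side (\<not> s) H" and ?d = "side_hol s H" and ?e = "side_hol (\<not> s) H" and ?E = "[ELetter H s]" and ?E' = "[ELetter H (\<not> s)]"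
    let ?x = "base_hol T + rest_hol f U - ?d" and ?y = "?e - rest_hol f U - base_hol ?T'" and ?y' = "base_hol ?T' + rest_hol f U - ?e" and ?x' = "?d - rest_hol f U - base_hol T"
    note K = side_component[OF c(2)]
    note w = V_words[OF K c(6)] V_words[OF K c'(7)] E_words[OF c(2)]
    have y: "?y + ?y' = 0" "?x + ?x' = 0" by (simp_all add: group_add_nf del: add_uminus_conv_diff)
    have "letter_word T (f, s) @ letter_word ?T' (f, \<not> s) = (V ?K ?x @ ?E) @ (V ?L ?y @ V ?L ?y') @ (?E' @ V ?K ?x')"
      unfolding c(1) c'(1) by simp
    also have "\<dots> \<approx> (V ?K ?x @ ?E) @ V ?L (?y + ?y') @ (?E' @ V ?K ?x')"
      by (rule context_congr[OF V_add[OF K c(7) c'(6)]]) (use w in simp_all)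
    also have "(V ?K ?x @ ?E) @ V ?L (?y + ?y') @ (?E' @ V ?K ?x') \<approx> (V ?K ?x @ ?E) @ [] @ (?E' @ V ?K ?x')"
      unfolding y by (rule context_congr[OF V_zero[OF K]]) (use w in simp_all)
    also have "(V ?K ?x @ ?E) @ [] @ (?E' @ V ?K ?x') = V ?K ?x @ (?E @ ?E') @ V ?K ?x'" by simp
    also have "V ?K ?x @ (?E @ ?E') @ V ?K ?x' \<approx> V ?K ?x @ [] @ V ?K ?x'"
      by (rule context_congr[OF E_cancel[OF c(2)] w(1,2)])
    also have "V ?K ?x @ [] @ V ?K ?x' = V ?K ?x @ V ?K ?x'" by simp
    also have "V ?K ?x @ V ?K ?x' \<approx> V ?K (?x + ?x')" by (rule V_add[OF K c(6) c'(7)])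
    also have "V ?K (?x + ?x') \<approx> []" unfolding y by (rule V_zero[OF K])
    finally show ?thesis by (simp add: a flip_def)
  qed
qed

text \<open>Equality in the Artin group is realised by legal swaps and cancellations, each of which
  preserves the word modulo \<open>N\<close>. The computation of the kernel rests on this.\<close>

lemma path_word_congr:
  assumes "vertex_config n \<Gamma> T" "legal \<Gamma> T u" "legal \<Gamma> T w" "arc_eval \<Gamma> u = arc_eval \<Gamma> w"
  shows "path_word T u \<approx> path_word T w"
proof (rule arc_eval_eq_imp_Q(2)[where G = \<Gamma> and P = "vertex_config n \<Gamma>" and Q = "\<lambda>T u w. path_word T u \<approx> path_word T w"])
  fix T a assume "vertex_config n \<Gamma> T" "can_move \<Gamma> T a"
  then show "vertex_config n \<Gamma> (move \<Gamma> T a)" by (rule vertex_config_move[OF wf])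
next
  fix T w assume "vertex_config n \<Gamma> T" "legal \<Gamma> T w"
  then show "path_word T w \<approx> path_word T w" by (intro FP.congr_refl path_word_words)
next
  fix T u w assume "path_word T u \<approx> path_word T w" then show "path_word T w \<approx> path_word T u" by (rule FP.congr_sym)
next
  fix T u v w assume "path_word T u \<approx> path_word T v" "path_word T v \<approx> path_word T w"
  then show "path_word T u \<approx> path_word T w" by (rule FP.congr_trans)
next
  fix T a u w assume "vertex_config n \<Gamma> T" "can_move \<Gamma> T a" "path_word (move \<Gamma> T a) u \<approx> path_word (move \<Gamma> T a) w"
  then show "path_word T (a # u) \<approx> path_word T (a # w)"
    by (simp add: append_congr FP.congr_refl letter_word_words)
next
  fix T a b w assume *: "vertex_config n \<Gamma> T" "disjoint_arcs \<Gamma> (fst a) (fst b)" "legal \<Gamma> T (a # b # w)"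
  then have ab: "can_move \<Gamma> T a" "can_move \<Gamma> (move \<Gamma> T a) b" "legal \<Gamma> (move \<Gamma> (move \<Gamma> T a) b) w" by auto
  have "vertex_config n \<Gamma> (move \<Gamma> (move \<Gamma> T a) b)" using * ab by (auto intro: vertex_config_move[OF wf])
  from append_congr[OF swap_letters[OF *(1,2) ab(1,2)] FP.congr_refl[OF path_word_words[OF this ab(3)]]]
  show "path_word T (a # b # w) \<approx> path_word T (b # a # w)" using move_commute(3)[OF *(2) ab(1,2)] by simp
next
  fix T a w assume *: "vertex_config n \<Gamma> T" "can_move \<Gamma> T a" "legal \<Gamma> T w"
  from append_congr[OF cancel_letters[OF *(1,2)] FP.congr_refl[OF path_word_words[OF *(1,3)]]]
  show "path_word T (a # flip a # w) \<approx> path_word T w" using move_flip(2)[OF *(2)] by simp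
qed (rule assms)+

text \<open>Without cut moves all letters belong to one vertex group, and the chosen paths to
  intermediate configurations telescope.\<close>

lemma free_word:
  "vertex_config n \<Gamma> T \<Longrightarrow> legal \<Gamma>' T w \<Longrightarrow>
    path_word T w \<approx> V (comp T) (base_hol T + arc_eval \<Gamma> w - base_hol (dest \<Gamma> T w)) \<and> comp (dest \<Gamma> T w) = comp T \<and>
    base_hol T + arc_eval \<Gamma> w - base_hol (dest \<Gamma> T w) \<in> hK (comp T)"
proof (induction w arbitrary: T)
  case Nil
  have "0 \<in> hK (comp T)" using X0.hols_zero sK_top comp_component(1)[OF Nil(1)] by blast
  then show ?case using FP.congr_sym[OF V_zero[OF comp_component(1)[OF Nil(1)]]] by simp
next
  case (Cons a w)
  have a: "can_move \<Gamma> T a" "fst a \<notin> cuts" "legal \<Gamma>' (move \<Gamma> T a) w" using Cons.prems(2) by (auto simp: can_move_def same')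
  have T': "vertex_config n \<Gamma> (move \<Gamma> T a)" by (rule vertex_config_move[OF wf Cons.prems(1) a(1)])
  note IH = Cons.IH[OF T' a(3)] and f = letter_word_free[OF Cons.prems(1) a(1,2)]
  have c: "comp (move \<Gamma> T a) = comp T" by (rule comp_move(1)[OF Cons.prems(1) a(1,2)])
  let ?x = "base_hol T + gen a - base_hol (move \<Gamma> T a)" and ?y = "base_hol (move \<Gamma> T a) + arc_eval \<Gamma> w - base_hol (dest \<Gamma> (move \<Gamma> T a) w)"
  have y: "?y \<in> hK (comp T)" using IH c by simp
  have "letter_word T a @ path_word (move \<Gamma> T a) w \<approx> V (comp T) ?x @ V (comp T) ?y"
    by (rule append_congr) (use IH c f FP.congr_refl[OF V_words[OF f(2,3)]] in auto)
  also have "V (comp T) ?x @ V (comp T) ?y \<approx> V (comp T) (?x + ?y)" by (rule V_add[OF f(2,3) y])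
  also have "?x + ?y = base_hol T + arc_eval \<Gamma> (a # w) - base_hol (dest \<Gamma> T (a # w))"
    by (simp add: group_add_nf del: add_uminus_conv_diff)
  finally show ?case using X0.hols_add[OF f(3) y] IH c
    by (simp add: group_add_nf del: add_uminus_conv_diff)
qed

lemma free_word_exists:
  assumes "vertex_config n \<Gamma> T" "g \<in> X0.hols (Vertex ` T) (Vertex ` T')"
  obtains w where "legal \<Gamma> T w" "dest \<Gamma> T w = T'" "arc_eval \<Gamma> w = g" "path_word T w \<approx> V (comp T) (base_hol T + g - base_hol T')"
    "base_hol T + g - base_hol T' \<in> hK (comp T)"
proof -
  obtain p where p: "pathin X0.X p" "p 0 = Vertex ` T" "p 1 = Vertex ` T'" "g = X0.holonomy p"
    using assms(2) unfolding X0.hols_def by blast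
  obtain w where w: "legal \<Gamma>' T w" "dest \<Gamma>' T w = T'" "g = arc_eval \<Gamma> w" using X0.vertex_path_word[OF p(1-3)] p(4) by auto
  have "dest \<Gamma> T w = T'" using w(2) by (simp add: same')
  then show ?thesis using that[OF subgraph_legal[OF sub' w(1)]] w(3) free_word[OF assms(1) w(1)] by simp
qed

text \<open>Edge paths begin and end at vertex configurations, whereas \<open>sK K\<close> is an
  arbitrary point of \<open>K\<close>; so each component gets this second base.\<close>

definition base :: "('v, 'e) gpoint set set \<Rightarrow> 'v set" where
  "base K = (SOME T. vertex_config n \<Gamma> T \<and> comp T = K)"

lemma base: "K \<in> comps \<Longrightarrow> vertex_config n \<Gamma> (base K) \<and> comp (base K) = K"
  unfolding base_def by (rule someI_ex) (meson comp_vertex)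

lemma base_hol_at_base: "K \<in> comps \<Longrightarrow> base_hol (base K) \<in> X0.hols (sK K) (Vertex ` base K)"
  using base_hol[of "base K"] base[of K] by simp

text \<open>A single stable letter is the word of an edge path that goes to the hyperplane, crosses
  it and goes on to the base of the other side. The ways to and from the hyperplane follow
  \<open>side_hol\<close>, so that the vertex letters cancel.\<close>

lemma cross:
  assumes H: "H \<in> planes"
  shows "\<exists>x. legal \<Gamma> (base (side s H)) x \<and> dest \<Gamma> (base (side s H)) x = base (side (\<not> s) H) \<and>
    arc_eval \<Gamma> x = - base_hol (base (side s H)) + side_hol s H + gen (label H, s) - side_hol (\<not> s) H + base_hol (base (side (\<not> s) H)) \<and>
    path_word (base (side s H)) x \<approx> [ELetter H s]"
proof -
  let ?f = "label H" and ?K = "side s H" and ?L = "side (\<not> s) H" and ?E = "[ELetter H s]" and ?d = "side_hol s H" and ?e = "side_hol (\<not> s) H"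
  let ?T = "insert (arc_start \<Gamma> (label H, s)) (rest H)" and ?T' = "insert (arc_start \<Gamma> (label H, \<not> s)) (rest H)"
  have f: "?f \<in> cuts" using label[OF H] by blast
  note r = rest(1)[OF H] and K = side_component[OF H]
  have T: "vertex_config n \<Gamma> ?T" and T': "vertex_config n \<Gamma> ?T'" using plane_vertex(1)[OF f r arc_start_cases] by auto
  have nin: "arc_start \<Gamma> (?f, s') \<notin> rest H" for s' by (rule plane_vertex(2)[OF f r arc_start_cases])
  have en: "arc_end \<Gamma> (?f, s) = arc_start \<Gamma> (?f, \<not> s)" by (simp add: arc_start_def arc_end_def)
  have m: "can_move \<Gamma> ?T (?f, s)" using cutsD[OF f] nin by (auto simp: can_move_def en)
  have mv: "move \<Gamma> ?T (?f, s) = ?T'" "?T - {arc_start \<Gamma> (?f, s)} = rest H" using nin by (auto simp: move_def en)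
  note c = letter_word_cut[OF T m f, unfolded mv rest(2)[OF H, symmetric]]
  \<comment> \<open>At the resting position itself this is an arbitrary loop and need not be 0;
    \<open>slide\<close> carries it across the stable letter, where it cancels.\<close>
  let ?b = "rest_hol ?f (rest H)"
  have b: "?b \<in> Y.hols ?f (Vertex ` rest H) (Vertex ` rest H)" using rest_hol(1)[OF f r] rest(2)[OF H] by simp
  note BK = base[OF K[of s]] and BL = base[OF K[of "\<not> s"]]
  have d: "?d \<in> X0.hols (sK ?K) (Vertex ` ?T)" "?e \<in> X0.hols (sK ?L) (Vertex ` ?T')" using side_hol(1)[OF H] by auto
  have "- base_hol (base ?K) + ?d \<in> X0.hols (Vertex ` base ?K) (Vertex ` ?T)"
    using base_hol_at_base[OF K] d(1) by (blast intro: X0.hols_add X0.hols_uminus)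
  then obtain w1 where w1: "legal \<Gamma> (base ?K) w1" "dest \<Gamma> (base ?K) w1 = ?T" "arc_eval \<Gamma> w1 = - base_hol (base ?K) + ?d"
    "path_word (base ?K) w1 \<approx> V (comp (base ?K)) (base_hol (base ?K) + (- base_hol (base ?K) + ?d) - base_hol ?T)"
    "base_hol (base ?K) + (- base_hol (base ?K) + ?d) - base_hol ?T \<in> hK (comp (base ?K))"
    by (rule free_word_exists[OF conjunct1[OF BK]])
  have "- ?e + base_hol (base ?L) \<in> X0.hols (Vertex ` ?T') (Vertex ` base ?L)"
    using base_hol_at_base[OF K] d(2) by (blast intro: X0.hols_add X0.hols_uminus)
  then obtain w2 where w2: "legal \<Gamma> ?T' w2" "dest \<Gamma> ?T' w2 = base ?L" "arc_eval \<Gamma> w2 = - ?e + base_hol (base ?L)"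
    "path_word ?T' w2 \<approx> V (comp ?T') (base_hol ?T' + (- ?e + base_hol (base ?L)) - base_hol (base ?L))"
    "base_hol ?T' + (- ?e + base_hol (base ?L)) - base_hol (base ?L) \<in> hK (comp ?T')"
    by (rule free_word_exists[OF T'])
  have p1: "path_word (base ?K) w1 \<approx> V ?K (?d - base_hol ?T)" "?d - base_hol ?T \<in> hK ?K" using w1(4,5) BK by (simp_all add: add.assoc[symmetric])
  have p2: "path_word ?T' w2 \<approx> V ?L (base_hol ?T' - ?e)" "base_hol ?T' - ?e \<in> hK ?L"
    using w2(4,5) c(5) mv by (simp_all add: add.assoc[symmetric])
  let ?x = "w1 @ (?f, s) # w2"
  let ?p = "base_hol ?T + ?b - ?d" and ?q = "?e - ?b - base_hol ?T'"
  note w = V_words[OF K c(6)] V_words[OF K c(7)] V_words[OF K p1(2)] V_words[OF K p2(2)] E_words[OF H, of s]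
  have "path_word (base ?K) ?x = path_word (base ?K) w1 @ letter_word ?T (?f, s) @ path_word ?T' w2"
    using w1(2) mv by (simp add: path_word_append)
  also have "\<dots> \<approx> V ?K (?d - base_hol ?T) @ letter_word ?T (?f, s) @ V ?L (base_hol ?T' - ?e)"
    by (intro append_congr p1(1) p2(1) FP.congr_refl letter_word_words[OF T m])
  also have "\<dots> = (V ?K (?d - base_hol ?T) @ V ?K ?p) @ ?E @ (V ?L ?q @ V ?L (base_hol ?T' - ?e))" unfolding c(1) by simp
  also have "\<dots> \<approx> V ?K ((?d - base_hol ?T) + ?p) @ ?E @ V ?L (?q + (base_hol ?T' - ?e))"
    by (intro append_congr V_add K p1(2) p2(2) c(6) c(7) FP.congr_refl w)
  also have "(?d - base_hol ?T) + ?p = 0 + (?d + ?b - ?d)" by (simp add: group_add_nf del: add_uminus_conv_diff)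
  also have "V ?K (0 + (?d + ?b - ?d)) @ ?E @ V ?L (?q + (base_hol ?T' - ?e))
      \<approx> V ?K 0 @ ?E @ V ?L ((?e + ?b - ?e) + (?q + (base_hol ?T' - ?e)))"
    by (rule slide[OF H b X0.hols_zero[OF sK_top[OF K]] X0.hols_add[OF c(7) p2(2)]])
  also have "(?e + ?b - ?e) + (?q + (base_hol ?T' - ?e)) = 0" by (simp add: group_add_nf del: add_uminus_conv_diff)
  also have "V ?K 0 @ ?E @ V ?L 0 \<approx> [] @ ?E @ []" by (intro append_congr V_zero K FP.congr_refl w)
  finally have "path_word (base ?K) ?x \<approx> ?E" by simp
  moreover have "legal \<Gamma> (base ?K) ?x" "dest \<Gamma> (base ?K) ?x = base ?L" using w1 w2 m mv by auto
  moreover have "arc_eval \<Gamma> ?x = - base_hol (base ?K) + ?d + gen (?f, s) - ?e + base_hol (base ?L)"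
    using w1(3) w2(3) by (simp add: group_add_nf del: add_uminus_conv_diff)
  ultimately show ?thesis by blast
qed

text \<open>The relators contain only the positively oriented stable letters of the tree; the
  inverse letters follow by free cancellation.\<close>

lemma tree_edge:
  assumes "H \<in> A" shows "[ELetter H s] \<approx> []"
proof -
  have H: "H \<in> planes" using assms A by blast
  have "gog_edge_elem \<G> H \<in> N" using relators assms unfolding gog_relators_def Let_def by auto
  then have t: "[ELetter H True] \<approx> []"
    using FP.congr_Nil_iff[OF N] E_words[OF H] by (simp add: gog_edge_elem_def)
  show ?thesis
  proof (cases s)
    case False
    have "[] @ [ELetter H False] \<approx> [ELetter H True] @ [ELetter H False]"
      by (rule append_congr[OF FP.congr_sym[OF t] FP.congr_refl[OF E_words[OF H]]])
    also have "[ELetter H True] @ [ELetter H False] \<approx> []" using E_cancel[OF H, of N True] by simp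
    finally show ?thesis using False by simp
  qed (use t in simp)
qed

end

section \<open>The fundamental group of the splitting\<close>

context splitting
begin

text \<open>The holonomy of crossing \<open>H\<close> between the base points of its two
  sides.\<close>

definition jump :: "bool \<Rightarrow> ('e \<times> 'v set) set \<Rightarrow> ('e \<times> bool) list set bijection" where
  "jump s H = side_hol s H + gen (label H, s) - side_hol (\<not> s) H"

lemma jump_not: "jump (\<not> s) H = - jump s H"
proof -
  have "gen (label H, \<not> s) = - gen (label H, s)" using raag_arcs.gen_flip[of \<Gamma> "(label H, s)"] by (simp add: flip_def)
  then show ?thesis unfolding jump_def not_not by (simp add: group_add_nf del: add_uminus_conv_diff)
qed

lemma jump_hols:
  assumes H: "H \<in> planes" shows "jump s H \<in> X.hols (sK (side s H)) (sK (side (\<not> s) H))"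
proof -
  let ?f = "label H" and ?T = "insert (arc_start \<Gamma> (label H, s)) (rest H)" and ?T' = "insert (arc_start \<Gamma> (label H, \<not> s)) (rest H)"
  have f: "?f \<in> cuts" using label[OF H] by blast
  note r = rest(1)[OF H]
  have T: "vertex_config n \<Gamma> ?T" by (rule plane_vertex(1)[OF f r arc_start_cases])
  have nin: "arc_start \<Gamma> (?f, s') \<notin> rest H" for s' by (rule plane_vertex(2)[OF f r arc_start_cases])
  have en: "arc_end \<Gamma> (?f, s) = arc_start \<Gamma> (?f, \<not> s)" by (simp add: arc_start_def arc_end_def)
  have m: "can_move \<Gamma> ?T (?f, s)" using cutsD[OF f] nin by (auto simp: can_move_def en)
  have mv: "move \<Gamma> ?T (?f, s) = ?T'" using nin by (auto simp: move_def en)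
  have g: "gen (?f, s) \<in> X.hols (Vertex ` ?T) (Vertex ` ?T')" using X.hols_move[OF T m] mv by simp
  show ?thesis unfolding jump_def
    by (rule X.hols_diff[OF X.hols_add[OF hols0_hols[OF side_hol(1)[OF H]] g] hols0_hols[OF side_hol(1)[OF H]]])
qed

lemma relator_cases:
  assumes R: "R \<in> gog_relators \<G> (\<Lambda>\<lparr>arcs := A\<rparr>)" and A: "A \<subseteq> planes"
  obtains (edge) H g where "H \<in> planes" "g \<in> carrier (RB k (\<Delta> (label H)) (Vertex ` rest H))"
      "[VLetter (side True H) (mono True H g)] \<in> FP.words" "[VLetter (side False H) (mono False H g)] \<in> FP.words"
      "R = FP.cls (FP.inv_word [ELetter H True] @ [VLetter (side True H) (mono True H g)] @ [ELetter H True] @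
          FP.inv_word [VLetter (side False H) (mono False H g)])"
    | (tree) H where "H \<in> A" "R = FP.cls [ELetter H True]"
proof -
  from R consider
      (1) H g where "H \<in> arcs \<Lambda>" "g \<in> carrier (edge_group \<G> H)"
        "R = inv\<^bsub>FP.F\<^esub> (gog_edge_elem \<G> H) \<otimes>\<^bsub>FP.F\<^esub> gog_vertex_elem \<G> (tail \<Lambda> H) (mono_minus \<G> H g) \<otimes>\<^bsub>FP.F\<^esub> gog_edge_elem \<G> H
          \<otimes>\<^bsub>FP.F\<^esub> inv\<^bsub>FP.F\<^esub> (gog_vertex_elem \<G> (head \<Lambda> H) (mono_plus \<G> H g))"
    | (2) H where "H \<in> A" "R = gog_edge_elem \<G> H"
    unfolding gog_relators_def Let_def gog_F by auto
  then show ?thesis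
  proof cases
    case 1
    have H: "H \<in> planes" using 1(1) arcs_base by simp
    have g: "g \<in> carrier (RB k (\<Delta> (label H)) (Vertex ` rest H))" using 1(2) edge_group[OF H] by simp
    let ?V = "\<lambda>s. [VLetter (side s H) (mono s H g)]" and ?E = "[ELetter H True]"
    have w: "?V s \<in> FP.words" for s
      unfolding FP.words_letter(1) using side_hol(2)[OF H g, of s] side_component[OF H, of s]
      by (intro conjI FP.words_Nil) (simp_all add: verts_base vertex_group)
    have E: "?E \<in> FP.words" by (rule E_words[OF H])
    have "R = inv\<^bsub>FP.F\<^esub> (FP.cls ?E) \<otimes>\<^bsub>FP.F\<^esub> FP.cls (?V True) \<otimes>\<^bsub>FP.F\<^esub> FP.cls ?E \<otimes>\<^bsub>FP.F\<^esub> inv\<^bsub>FP.F\<^esub> (FP.cls (?V False))"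
      unfolding 1(3) gog_edge_elem_def gog_vertex_elem_def tail_base[OF H] head_base[OF H] by (simp add: mono_def)
    also have "\<dots> = FP.cls (((FP.inv_word ?E @ ?V True) @ ?E) @ FP.inv_word (?V False))"
      using w[of True] w[of False] E FP.inv_word_words[OF E] FP.inv_word_words[OF w[of False]]
      by (simp only: FP.F_inv FP.F_mult FP.words_append)
    finally show ?thesis using edge[OF H g w w] by simp
  next
    case 2
    then show ?thesis using tree[of H] by (simp add: gog_edge_elem_def)
  qed
qed

lemma relators_carrier:
  assumes "A \<subseteq> planes" shows "gog_relators \<G> (\<Lambda>\<lparr>arcs := A\<rparr>) \<subseteq> carrier FP.F"
proof
  fix R assume "R \<in> gog_relators \<G> (\<Lambda>\<lparr>arcs := A\<rparr>)"
  from this assms show "R \<in> carrier FP.F"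
  proof (cases rule: relator_cases)
    case (edge H g)
    note E = E_words[OF edge(1), of True]
    show ?thesis unfolding edge(5) FP.F_simps
      by (rule imageI) (simp only: FP.words_append E edge(3,4) FP.inv_word_words simp_thms)
  next
    case (tree H)
    then have "H \<in> planes" using assms by blast
    from imageI[OF E_words[OF this]] show ?thesis unfolding tree(2) FP.F_simps .
  qed
qed

end

text \<open>\<open>c K\<close> is the holonomy of a path from \<open>S\<close> to the base point of
  \<open>K\<close>. By \<open>c_word\<close> it is represented by an edge path whose word is trivial
  modulo \<open>N\<close>, and \<open>z\<close> translates between loops at \<open>S\<close> and
  loops at \<open>base K0\<close>.\<close>

locale potential_splitting = quotient_splitting \<Gamma> n k cuts v S sK sH \<G> N A
  for \<Gamma> :: "('v, 'e) pre_digraph" and n k cuts v S sK sH \<G> N A +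
  fixes c :: "('v, 'e) gpoint set set \<Rightarrow> ('e \<times> bool) list set bijection" and K0 and z
  assumes K0: "K0 \<in> comps" and z: "z = c K0 + base_hol (base K0)"
    and c_hols: "\<And>K. K \<in> comps \<Longrightarrow> c K \<in> X.hols S (sK K)"
    and c_word: "\<And>K. K \<in> comps \<Longrightarrow> \<exists>u. legal \<Gamma> (base K0) u \<and> dest \<Gamma> (base K0) u = base K \<and>
      arc_eval \<Gamma> u = - z + c K + base_hol (base K) \<and> path_word (base K0) u \<approx> []"
    and c_tree: "\<And>H. H \<in> A \<Longrightarrow> c (side False H) = c (side True H) + jump True H"
    and N_least: "\<And>M. M \<lhd> FP.F \<Longrightarrow> gog_relators \<G> (\<Lambda>\<lparr>arcs := A\<rparr>) \<subseteq> M \<Longrightarrow> N \<subseteq> M"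
begin

text \<open>Each letter becomes a loop at \<open>S\<close> by going out and back along the
  potentials; the letter of a tree edge gets the value 0 by \<open>c_tree\<close>.\<close>

fun letter_value where
  "letter_value (VLetter K a) = c K + X0.hol_class a - c K"
| "letter_value (ELetter H s) = c (side s H) + jump s H - c (side (\<not> s) H)"

definition word_value where "word_value w = sum_list (map letter_value w)"

lemma word_value_simps [simp]:
  "word_value [] = 0" "word_value (x # w) = letter_value x + word_value w" "word_value (u @ w) = word_value u + word_value w"
  by (simp_all add: word_value_def)

lemma value_V: "g \<in> hK K \<Longrightarrow> word_value (V K g) = c K + g - c K"
  by (simp add: V_def X0.class_of_hol(2))

lemma value_letter_word:
  assumes T: "vertex_config n \<Gamma> T" "can_move \<Gamma> T a"
  shows "word_value (letter_word T a) = c (comp T) + base_hol T + gen a - base_hol (move \<Gamma> T a) - c (comp (move \<Gamma> T a))"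
proof (cases "fst a \<in> cuts")
  case False
  note f = letter_word_free[OF T False]
  show ?thesis unfolding f(1) value_V[OF f(3)] comp_move(1)[OF T False]
    by (simp add: group_add_nf del: add_uminus_conv_diff)
next
  case True
  obtain f s where a: "a = (f, s)" by (cases a)
  have f: "f \<in> cuts" using True a by simp
  note w = letter_word_cut[OF T(1) T(2)[unfolded a] f]
  let ?U = "T - {arc_start \<Gamma> (f, s)}"
  \<comment> \<open>The detour to the resting position is made before the crossing and undone after
    it; as it commutes with the generator of \<open>f\<close>, it drops out.\<close>
  have "rest_hol f ?U + (gen (f, s) + (- rest_hol f ?U + x)) = gen (f, s) + x" for x
  proof -
    have "rest_hol f ?U + (gen (f, s) + (- rest_hol f ?U + x)) = (rest_hol f ?U + gen (f, s)) + (- rest_hol f ?U + x)" by (simp only: add.assoc)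
    also have "\<dots> = gen (f, s) + x" unfolding rest_hol(3)[OF f w(8), of s, symmetric] by (simp add: add.assoc)
    finally show ?thesis .
  qed
  then show ?thesis
    unfolding a w(1) word_value_simps value_V[OF w(6)] value_V[OF w(7)] letter_value.simps jump_def w(3,4,5)
    by (simp add: group_add_nf del: add_uminus_conv_diff)
qed

lemma value_path_word:
  "vertex_config n \<Gamma> T \<Longrightarrow> legal \<Gamma> T u \<Longrightarrow>
    word_value (path_word T u) = c (comp T) + base_hol T + arc_eval \<Gamma> u - base_hol (dest \<Gamma> T u) - c (comp (dest \<Gamma> T u))"
proof (induction u arbitrary: T)
  case Nil
  then show ?case by (simp add: group_add_nf del: add_uminus_conv_diff)
next
  case (Cons a u)
  have a: "can_move \<Gamma> T a" "legal \<Gamma> (move \<Gamma> T a) u" using Cons.prems(2) by auto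
  note T' = vertex_config_move[OF wf Cons.prems(1) a(1)]
  show ?case using Cons.IH[OF T' a(2)] value_letter_word[OF Cons.prems(1) a(1)]
    by (simp add: group_add_nf del: add_uminus_conv_diff)
qed

lemma value_step:
  assumes "FP.step u w" shows "word_value u = word_value w"
  using assms
proof cases
  case (fp_mult K g g' xs ys)
  have K: "K \<in> comps" using fp_mult(3) verts_base by simp
  have "X0.hol_class (g \<otimes>\<^bsub>vertex_group \<G> K\<^esub> g') = X0.hol_class g + X0.hol_class g'"
    using fp_mult(4,5) unfolding vertex_group[OF K] by (rule X0.hol_class_mult)
  then show ?thesis unfolding fp_mult(1,2) by (simp add: group_add_nf del: add_uminus_conv_diff)
next
  case (fp_one K xs ys)
  have K: "K \<in> comps" using fp_one(3) verts_base by simp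
  have "X0.hol_class \<one>\<^bsub>vertex_group \<G> K\<^esub> = 0"
    unfolding vertex_group[OF K] X0.class_of_hol_zero[OF sK_top[OF K], symmetric]
    by (rule X0.class_of_hol(2)[OF X0.hols_zero[OF sK_top[OF K]]])
  then show ?thesis unfolding fp_one(1,2) by simp
next
  case (fp_cancel H xs s ys)
  show ?thesis unfolding fp_cancel(1,2) by (simp add: jump_not group_add_nf del: add_uminus_conv_diff)
qed

lemma value_equiv: "equivclp FP.step u w \<Longrightarrow> word_value u = word_value w"
  by (induction rule: FP.equiv_induct) (auto dest: value_step)

lemma value_inv_word: "w \<in> FP.words \<Longrightarrow> word_value (FP.inv_word w) = - word_value w"
  using value_equiv[OF FP.inv_word_cancel] by (simp add: eq_neg_iff_add_eq_0)

lemma value_hols: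
  "w \<in> FP.words \<Longrightarrow> word_value w \<in> X.hols S S"
proof (induction w)
  case Nil
  show ?case using X.hols_zero[OF S] by simp
next
  case (Cons x w)
  have x: "[x] \<in> FP.words" "w \<in> FP.words" using Cons.prems FP.words_Cons[of x w] by blast+
  have "letter_value x \<in> X.hols S S"
  proof (cases x)
    case (VLetter K a)
    have "K \<in> verts \<Lambda>" "a \<in> carrier (vertex_group \<G> K)" using x(1) unfolding VLetter FP.words_letter(1) by blast+
    then have K: "K \<in> comps" "a \<in> carrier (RB n \<Gamma>' (sK K))" by (simp_all add: verts_base vertex_group)
    show ?thesis unfolding VLetter letter_value.simps
      by (rule X.hols_diff[OF X.hols_add[OF c_hols[OF K(1)] hols0_hols[OF X0.hol_class_in_hols[OF K(2)]]] c_hols[OF K(1)]])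
  next
    case (ELetter H s)
    have "H \<in> arcs \<Lambda>" using x(1) unfolding ELetter FP.words_letter(2) by blast
    then have H: "H \<in> planes" by (simp add: arcs_base)
    show ?thesis unfolding ELetter letter_value.simps
      by (rule X.hols_diff[OF X.hols_add[OF c_hols[OF side_component[OF H]] jump_hols[OF H]] c_hols[OF side_component[OF H]]])
  qed
  from X.hols_add[OF this Cons.IH[OF x(2)]] show ?case by simp
qed

definition evaluation where "evaluation C = word_value (SOME w. w \<in> C)"

lemma evaluation_cls:
  assumes "w \<in> FP.words" shows "evaluation (FP.cls w) = word_value w"
proof -
  have "(SOME u. u \<in> FP.cls w) \<in> FP.cls w" by (rule someI[of "\<lambda>u. u \<in> FP.cls w", OF FP.cls_self[OF assms]])
  then have "equivclp FP.step w (SOME u. u \<in> FP.cls w)" by (simp add: fp_class_def)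
  from value_equiv[OF this] show ?thesis by (simp add: evaluation_def)
qed

lemma evaluation_hom: "evaluation \<in> hom FP.F (additive_group (X.hols S S))"
proof (rule homI)
  fix A assume "A \<in> carrier FP.F"
  then obtain u where u: "u \<in> FP.words" "A = FP.cls u" unfolding FP.F_simps by blast
  then show "evaluation A \<in> carrier (additive_group (X.hols S S))" using evaluation_cls[OF u(1)] value_hols[OF u(1)] by simp
  fix B assume "B \<in> carrier FP.F"
  then obtain w where w: "w \<in> FP.words" "B = FP.cls w" unfolding FP.F_simps by blast
  have uw: "u @ w \<in> FP.words" using u(1) w(1) by (simp only: FP.words_append simp_thms)
  show "evaluation (A \<otimes>\<^bsub>FP.F\<^esub> B) = evaluation A \<otimes>\<^bsub>additive_group (X.hols S S)\<^esub> evaluation B"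
    unfolding u(2) w(2) FP.F_mult[OF u(1) w(1)] evaluation_cls[OF u(1)] evaluation_cls[OF w(1)] evaluation_cls[OF uw] by simp
qed

text \<open>A path between the bases of two components is extended to a loop at
  \<open>base K0\<close> by the edge paths of \<open>c_word\<close>; their words are trivial, so the
  word of the loop is unchanged modulo \<open>N\<close>.\<close>

lemma based_word:
  assumes K: "K \<in> comps" and L: "L \<in> comps" and x: "legal \<Gamma> (base K) x" "dest \<Gamma> (base K) x = base L"
    "arc_eval \<Gamma> x = - base_hol (base K) + g + base_hol (base L)" "path_word (base K) x \<approx> y"
  shows "\<exists>u. legal \<Gamma> (base K0) u \<and> dest \<Gamma> (base K0) u = base K0 \<and>
    arc_eval \<Gamma> u = - z + (c K + g - c L) + z \<and> path_word (base K0) u \<approx> y"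
proof -
  obtain uK where uK: "legal \<Gamma> (base K0) uK" "dest \<Gamma> (base K0) uK = base K"
    "arc_eval \<Gamma> uK = - z + c K + base_hol (base K)" "path_word (base K0) uK \<approx> []" using c_word[OF K] by blast
  obtain uL where uL: "legal \<Gamma> (base K0) uL" "dest \<Gamma> (base K0) uL = base L"
    "arc_eval \<Gamma> uL = - z + c L + base_hol (base L)" "path_word (base K0) uL \<approx> []" using c_word[OF L] by blast
  let ?r = "rev_word uL"
  have r: "legal \<Gamma> (base L) ?r" "dest \<Gamma> (base L) ?r = base K0" using legal_rev_word[OF uL(1)] uL(2) by auto
  note B0 = conjunct1[OF base[OF K0]] and BL = conjunct1[OF base[OF L]]
  \<comment> \<open>Going out and back is congruent to the empty word, so the way back is trivial
    because the way out is.\<close>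
  have "path_word (base K0) (uL @ ?r) \<approx> path_word (base K0) []"
    by (rule path_word_congr[OF B0]) (use uL(1,2) r(1) in \<open>auto simp: arc_eval_rev_word\<close>)
  then have 1: "path_word (base K0) uL @ path_word (base L) ?r \<approx> []" using uL(2) by (simp add: path_word_append)
  have "[] @ path_word (base L) ?r \<approx> path_word (base K0) uL @ path_word (base L) ?r"
    by (rule append_congr[OF FP.congr_sym[OF uL(4)] FP.congr_refl[OF path_word_words[OF BL r(1)]]])
  from FP.congr_trans[OF this 1] have pr: "path_word (base L) ?r \<approx> []" by simp
  let ?u = "uK @ x @ ?r"
  have "path_word (base K0) ?u = path_word (base K0) uK @ path_word (base K) x @ path_word (base L) ?r"
    using uK(2) x(2) by (simp add: path_word_append)
  also have "\<dots> \<approx> [] @ y @ []" by (intro append_congr uK(4) x(4) pr)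
  finally have "path_word (base K0) ?u \<approx> y" by simp
  moreover have "legal \<Gamma> (base K0) ?u" "dest \<Gamma> (base K0) ?u = base K0" using uK(1,2) x(1,2) r by simp_all
  moreover have "arc_eval \<Gamma> ?u = - z + (c K + g - c L) + z"
    using uK(3) x(3) uL(3) by (simp add: arc_eval_rev_word group_add_nf del: add_uminus_conv_diff)
  ultimately show ?thesis by blast
qed

text \<open>The edge loop is controlled: its value is the value of the word, conjugated by
  \<open>z\<close>. Hence a word of value 0 comes from an edge loop that is trivial in the Artin
  group.\<close>

lemma word_realized:
  "w \<in> FP.words \<Longrightarrow> \<exists>u. legal \<Gamma> (base K0) u \<and> dest \<Gamma> (base K0) u = base K0 \<and>
    arc_eval \<Gamma> u = - z + word_value w + z \<and> path_word (base K0) u \<approx> w"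
proof (induction w)
  case Nil
  show ?case by (rule exI[of _ "[]"]) (simp add: FP.congr_refl[OF FP.words_Nil])
next
  case (Cons x w)
  have xw: "[x] \<in> FP.words" "w \<in> FP.words" using Cons.prems FP.words_Cons[of x w] by blast+
  have "\<exists>u. legal \<Gamma> (base K0) u \<and> dest \<Gamma> (base K0) u = base K0 \<and>
    arc_eval \<Gamma> u = - z + letter_value x + z \<and> path_word (base K0) u \<approx> [x]"
  proof (cases x)
    case (VLetter K a)
    have "K \<in> verts \<Lambda>" "a \<in> carrier (vertex_group \<G> K)" using xw(1) unfolding VLetter FP.words_letter(1) by blast+
    then have K: "K \<in> comps" "a \<in> carrier (RB n \<Gamma>' (sK K))" by (simp_all add: verts_base vertex_group)
    let ?g = "X0.hol_class a"
    have V: "V K ?g = [VLetter K a]" unfolding V_def X0.class_of_hol_unique[OF K(2)] ..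
    note B = base[OF K(1)]
    have "- base_hol (base K) + ?g + base_hol (base K) \<in> X0.hols (Vertex ` base K) (Vertex ` base K)"
      by (rule X0.hols_add[OF X0.hols_add[OF X0.hols_uminus[OF base_hol_at_base[OF K(1)]] X0.hol_class_in_hols[OF K(2)]] base_hol_at_base[OF K(1)]])
    then obtain y where y: "legal \<Gamma> (base K) y" "dest \<Gamma> (base K) y = base K" "arc_eval \<Gamma> y = - base_hol (base K) + ?g + base_hol (base K)"
      "path_word (base K) y \<approx> V (comp (base K)) (base_hol (base K) + (- base_hol (base K) + ?g + base_hol (base K)) - base_hol (base K))"
      by (rule free_word_exists[OF conjunct1[OF B]])
    have e: "base_hol (base K) + (- base_hol (base K) + ?g + base_hol (base K)) - base_hol (base K) = ?g"
      by (simp add: group_add_nf del: add_uminus_conv_diff)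
    show ?thesis unfolding VLetter letter_value.simps
      by (rule based_word[OF K(1) K(1) y(1-3) y(4)[unfolded e conjunct2[OF B] V]])
  next
    case (ELetter H s)
    have "H \<in> arcs \<Lambda>" using xw(1) unfolding ELetter FP.words_letter(2) by blast
    then have H: "H \<in> planes" by (simp add: arcs_base)
    obtain y where y: "legal \<Gamma> (base (side s H)) y" "dest \<Gamma> (base (side s H)) y = base (side (\<not> s) H)"
      "arc_eval \<Gamma> y = - base_hol (base (side s H)) + side_hol s H + gen (label H, s) - side_hol (\<not> s) H + base_hol (base (side (\<not> s) H))"
      "path_word (base (side s H)) y \<approx> [ELetter H s]" using cross[OF H, of s] by blast
    have e: "arc_eval \<Gamma> y = - base_hol (base (side s H)) + jump s H + base_hol (base (side (\<not> s) H))"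
      unfolding y(3) jump_def by (simp add: group_add_nf del: add_uminus_conv_diff)
    show ?thesis unfolding ELetter letter_value.simps
      by (rule based_word[OF side_component[OF H] side_component[OF H] y(1,2) e y(4)])
  qed
  then obtain u where u: "legal \<Gamma> (base K0) u" "dest \<Gamma> (base K0) u = base K0"
    "arc_eval \<Gamma> u = - z + letter_value x + z" "path_word (base K0) u \<approx> [x]" by blast
  obtain u' where u': "legal \<Gamma> (base K0) u'" "dest \<Gamma> (base K0) u' = base K0"
    "arc_eval \<Gamma> u' = - z + word_value w + z" "path_word (base K0) u' \<approx> w" using Cons.IH[OF xw(2)] by blast
  show ?case
  proof (intro exI[of _ "u @ u'"] conjI)
    show "legal \<Gamma> (base K0) (u @ u')" "dest \<Gamma> (base K0) (u @ u') = base K0" using u(1,2) u'(1,2) by simp_all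
    show "arc_eval \<Gamma> (u @ u') = - z + word_value (x # w) + z"
      using u(3) u'(3) by (simp add: group_add_nf del: add_uminus_conv_diff)
    show "path_word (base K0) (u @ u') \<approx> x # w" using append_congr[OF u(4) u'(4)] u(2) by (simp add: path_word_append)
  qed
qed

lemma relator_value:
  assumes "R \<in> gog_relators \<G> (\<Lambda>\<lparr>arcs := A\<rparr>)" shows "evaluation R = 0"
  using assms A
proof (cases rule: relator_cases)
  case (edge H g)
  let ?V = "\<lambda>s. [VLetter (side s H) (mono s H g)]" and ?E = "[ELetter H True]" and ?g = "Y.hol_class (label H) g"
  note E = E_words[OF edge(1), of True]
  have w: "FP.inv_word ?E @ ?V True @ ?E @ FP.inv_word (?V False) \<in> FP.words"
    by (simp only: FP.words_append E edge(3,4) FP.inv_word_words simp_thms)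
  \<comment> \<open>The element of the edge group commutes with the crossing, so the two conjugates
    in the relator have the same value.\<close>
  have gq: "gen (label H, True) + ?g = ?g + gen (label H, True)"
    by (rule gen_commute_holsY[OF Y.hol_class_in_hols[OF edge(2)]])
  have "- gen (label H, True) + (?g + (gen (label H, True) + x)) = ?g + x" for x
  proof -
    have "?g + (gen (label H, True) + x) = gen (label H, True) + (?g + x)" by (simp only: add.assoc[symmetric] gq)
    then show ?thesis by simp
  qed
  moreover have "X0.hol_class (mono s H g) = side_hol s H + ?g - side_hol s H" for s using side_hol(2)[OF edge(1,2), of s] by blast
  ultimately show ?thesis
    unfolding edge(5) evaluation_cls[OF w] word_value_simps value_inv_word[OF E] value_inv_word[OF edge(4)] letter_value.simps jump_def
    by (simp add: group_add_nf del: add_uminus_conv_diff)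
next
  case (tree H)
  have H: "H \<in> planes" using A tree(1) by blast
  show ?thesis unfolding tree(2) evaluation_cls[OF E_words[OF H]] using c_tree[OF tree(1)]
    by (simp add: group_add_nf del: add_uminus_conv_diff)
qed

text \<open>A word of value 0 is realised by an edge loop of value 0, whose word is congruent to the
  empty one by \<open>path_word_congr\<close>. The other inclusion holds because the kernel is
  normal and contains the relators.\<close>

lemma kernel_evaluation: "kernel FP.F (additive_group (X.hols S S)) evaluation = N"
proof
  interpret h: group_hom FP.F "additive_group (X.hols S S)" evaluation
    by (intro group_hom.intro FP.group_F X.group_hols[OF S] group_hom_axioms.intro evaluation_hom)
  show "kernel FP.F (additive_group (X.hols S S)) evaluation \<subseteq> N"
  proof
    fix C assume "C \<in> kernel FP.F (additive_group (X.hols S S)) evaluation"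
    then have C: "C \<in> carrier FP.F" "evaluation C = 0" by (simp_all add: kernel_def del: FP.F_simps)
    then obtain w where w: "w \<in> FP.words" "C = FP.cls w" unfolding FP.F_simps by blast
    have 0: "word_value w = 0" using C(2) unfolding w(2) evaluation_cls[OF w(1)] .
    obtain u where u: "legal \<Gamma> (base K0) u" "arc_eval \<Gamma> u = - z + word_value w + z" "path_word (base K0) u \<approx> w"
      using word_realized[OF w(1)] by blast
    have "path_word (base K0) u \<approx> path_word (base K0) []"
      by (rule path_word_congr[OF conjunct1[OF base[OF K0]] u(1)]) (simp_all add: u(2) 0)
    from FP.congr_trans[OF FP.congr_sym[OF u(3)] this] have "w \<approx> []" by simp
    then show "C \<in> N" unfolding w(2) FP.congr_Nil_iff[OF N] by blast
  qed
  show "N \<subseteq> kernel FP.F (additive_group (X.hols S S)) evaluation"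
  proof (rule N_least[OF h.normal_kernel], rule subsetI)
    fix R assume R: "R \<in> gog_relators \<G> (\<Lambda>\<lparr>arcs := A\<rparr>)"
    show "R \<in> kernel FP.F (additive_group (X.hols S S)) evaluation"
      using subsetD[OF relators_carrier[OF A] R] relator_value[OF R] by (simp add: kernel_def del: FP.F_simps)
  qed
qed

lemma z_hols: "z \<in> X.hols S (Vertex ` base K0)"
  unfolding z by (rule X.hols_add[OF c_hols[OF K0] hols0_hols[OF base_hol_at_base[OF K0]]])

text \<open>A loop at \<open>S\<close> is carried to \<open>base K0\<close> by \<open>z\<close> and
  replaced by an edge path, whose word evaluates back to it.\<close>

lemma evaluation_surj: "evaluation ` carrier FP.F = X.hols S S"
proof
  show "evaluation ` carrier FP.F \<subseteq> X.hols S S" using hom_carrier[OF evaluation_hom] by simp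
  show "X.hols S S \<subseteq> evaluation ` carrier FP.F"
  proof
    fix g assume g: "g \<in> X.hols S S"
    note B = base[OF K0]
    have "- z + g + z \<in> X.hols (Vertex ` base K0) (Vertex ` base K0)"
      by (rule X.hols_add[OF X.hols_add[OF X.hols_uminus[OF z_hols] g] z_hols])
    then obtain p where p: "pathin X.X p" "p 0 = Vertex ` base K0" "p 1 = Vertex ` base K0" "- z + g + z = X.holonomy p"
      unfolding X.hols_def by blast
    obtain u where u: "legal \<Gamma> (base K0) u" "dest \<Gamma> (base K0) u = base K0" "- z + g + z = arc_eval \<Gamma> u"
      using X.vertex_path_word[OF p(1-3)] p(4) by auto
    note w = path_word_words[OF conjunct1[OF B] u(1)]
    have "word_value (path_word (base K0) u) = g"
      unfolding value_path_word[OF conjunct1[OF B] u(1)] u(2) u(3)[symmetric] conjunct2[OF B] z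
      by (simp add: group_add_nf del: add_uminus_conv_diff)
    then have "g = evaluation (FP.cls (path_word (base K0) u))" unfolding evaluation_cls[OF w] by simp
    then show "g \<in> evaluation ` carrier FP.F" unfolding FP.F_simps by (rule image_eqI) (rule imageI[OF w])
  qed
qed

lemma RB_iso_quotient: "RB n \<Gamma> S \<cong> FP.F Mod N"
proof -
  interpret h: group_hom FP.F "additive_group (X.hols S S)" evaluation
    by (intro group_hom.intro FP.group_F X.group_hols[OF S] group_hom_axioms.intro evaluation_hom)
  have "FP.F Mod kernel FP.F (additive_group (X.hols S S)) evaluation \<cong> additive_group (X.hols S S)"
    by (rule h.FactGroup_iso) (simp only: evaluation_surj additive_group_simps)
  then have "FP.F Mod N \<cong> additive_group (X.hols S S)" unfolding kernel_evaluation .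
  moreover have "group (FP.F Mod N)" by (rule normal.factorgroup_is_group[OF N])
  ultimately have "additive_group (X.hols S S) \<cong> FP.F Mod N" by (simp add: group.iso_sym)
  then show ?thesis by (rule iso_trans[OF X.RB_iso_hols[OF S]])
qed

end

section \<open>Potentials along a spanning tree\<close>

context quotient_splitting
begin

text \<open>A stable letter of the tree is trivial modulo \<open>N\<close>, so extending the edge
  path across \<open>H\<close> keeps its word trivial.\<close>

lemma potential_step:
  assumes K0: "K0 \<in> comps" and H: "H \<in> A" and x: "x \<in> X.hols S (sK (side s H))"
    and u: "legal \<Gamma> (base K0) u" "dest \<Gamma> (base K0) u = base (side s H)" "arc_eval \<Gamma> u = - z + x + base_hol (base (side s H))"
      "path_word (base K0) u \<approx> []"
  shows "x + jump s H \<in> X.hols S (sK (side (\<not> s) H)) \<and>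
    (\<exists>u. legal \<Gamma> (base K0) u \<and> dest \<Gamma> (base K0) u = base (side (\<not> s) H) \<and>
      arc_eval \<Gamma> u = - z + (x + jump s H) + base_hol (base (side (\<not> s) H)) \<and> path_word (base K0) u \<approx> [])"
proof
  have HP: "H \<in> planes" using A H by blast
  show "x + jump s H \<in> X.hols S (sK (side (\<not> s) H))" by (rule X.hols_add[OF x jump_hols[OF HP]])
  obtain y where y: "legal \<Gamma> (base (side s H)) y" "dest \<Gamma> (base (side s H)) y = base (side (\<not> s) H)"
    "arc_eval \<Gamma> y = - base_hol (base (side s H)) + side_hol s H + gen (label H, s) - side_hol (\<not> s) H + base_hol (base (side (\<not> s) H))"
    "path_word (base (side s H)) y \<approx> [ELetter H s]" using cross[OF HP, of s] by blast
  show "\<exists>u. legal \<Gamma> (base K0) u \<and> dest \<Gamma> (base K0) u = base (side (\<not> s) H) \<and>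
      arc_eval \<Gamma> u = - z + (x + jump s H) + base_hol (base (side (\<not> s) H)) \<and> path_word (base K0) u \<approx> []"
  proof (intro exI[of _ "u @ y"] conjI)
    show "legal \<Gamma> (base K0) (u @ y)" "dest \<Gamma> (base K0) (u @ y) = base (side (\<not> s) H)" using u(1,2) y(1,2) by simp_all
    show "arc_eval \<Gamma> (u @ y) = - z + (x + jump s H) + base_hol (base (side (\<not> s) H))"
      using u(3) y(3) by (simp add: jump_def group_add_nf del: add_uminus_conv_diff)
    show "path_word (base K0) (u @ y) \<approx> []"
      using append_congr[OF u(4) FP.congr_trans[OF y(4) tree_edge[OF H]]] u(2) by (simp add: path_word_append)
  qed
qed

text \<open>Along a tree the potentials can be prescribed arc by arc without a consistency
  condition; the edge paths that realise them are carried in the invariant \<open>P\<close>.\<close>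

lemma potential_exists:
  assumes tree: "grown_tree \<Lambda> K0 (verts \<Lambda>) A" and K0: "K0 \<in> comps"
    and least: "\<And>M. M \<lhd> FP.F \<Longrightarrow> gog_relators \<G> (\<Lambda>\<lparr>arcs := A\<rparr>) \<subseteq> M \<Longrightarrow> N \<subseteq> M"
  shows "\<exists>c z. potential_splitting \<Gamma> n k cuts v S sK sH \<G> N A c K0 z"
proof -
  have "sK K0 \<in> topspace X0.X" by (rule sK_top[OF K0])
  from hols0_hols[OF X0.hols_zero[OF this]] obtain q where "pathin X.X q" "q 0 = sK K0" unfolding X.hols_def by blast
  then have "sK K0 \<in> topspace X.X" using path_start_in_topspace by metis
  \<comment> \<open>Connectedness of \<open>\<Gamma>\<close> provides a path from \<open>S\<close>
    to the base point at the root.\<close>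
  then obtain p where "pathin X.X p" "p 0 = S" "p 1 = sK K0" using X.path_connected_uconf[OF conn S] by blast
  then obtain c0 where c0: "c0 \<in> X.hols S (sK K0)" unfolding X.hols_def by blast
  define z where "z = c0 + base_hol (base K0)"
  define P where "P K x \<longleftrightarrow> x \<in> X.hols S (sK K) \<and>
    (\<exists>u. legal \<Gamma> (base K0) u \<and> dest \<Gamma> (base K0) u = base K \<and>
      arc_eval \<Gamma> u = - z + x + base_hol (base K) \<and> path_word (base K0) u \<approx> [])" for K x
  have step: "P (side (\<not> s) H) (x + jump s H)" if "H \<in> A" "P (side s H) x" for H s x
    using that(2) potential_step[OF K0 that(1), of x s _ z] unfolding P_def by blast
  have "\<exists>c. c K0 = c0 \<and> (\<forall>K\<in>verts \<Lambda>. P K (c K)) \<and> (\<forall>H\<in>A. c (head \<Lambda> H) = c (tail \<Lambda> H) + jump True H)"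
  proof (rule grown_tree_potential[OF tree wf_base])
    have "legal \<Gamma> (base K0) [] \<and> dest \<Gamma> (base K0) [] = base K0 \<and> arc_eval \<Gamma> [] = - z + c0 + base_hol (base K0) \<and> path_word (base K0) [] \<approx> []"
      using FP.congr_refl[OF FP.words_Nil] by (simp add: z_def group_add_nf del: add_uminus_conv_diff)
    then show "P K0 c0" unfolding P_def using c0 by blast
  next
    fix H x assume H: "H \<in> A" and x: "P (tail \<Lambda> H) x"
    have HP: "H \<in> planes" using A H by blast
    show "P (head \<Lambda> H) (x + jump True H)"
      using step[OF H, of True x] x unfolding tail_base[OF HP] head_base[OF HP] by simp
  next
    fix H x assume H: "H \<in> A" and x: "P (head \<Lambda> H) x"
    have HP: "H \<in> planes" using A H by blast
    show "P (tail \<Lambda> H) (x - jump True H)"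
      using step[OF H, of False x] x jump_not[of True H] unfolding tail_base[OF HP] head_base[OF HP] by simp
  qed
  then obtain c where c: "c K0 = c0" "\<forall>K\<in>comps. P K (c K)" "\<forall>H\<in>A. c (head \<Lambda> H) = c (tail \<Lambda> H) + jump True H"
    unfolding verts_base by blast
  have "potential_splitting \<Gamma> n k cuts v S sK sH \<G> N A c K0 z"
  proof unfold_locales
    show "K0 \<in> comps" "z = c K0 + base_hol (base K0)" using K0 c(1) z_def by simp_all
    fix K assume K: "K \<in> comps"
    show "c K \<in> X.hols S (sK K)" using bspec[OF c(2) K] unfolding P_def by blast
    show "\<exists>u. legal \<Gamma> (base K0) u \<and> dest \<Gamma> (base K0) u = base K \<and>
      arc_eval \<Gamma> u = - z + c K + base_hol (base K) \<and> path_word (base K0) u \<approx> []" using bspec[OF c(2) K] unfolding P_def by blast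
  next
    fix H assume H: "H \<in> A"
    have HP: "H \<in> planes" using A H by blast
    show "c (side False H) = c (side True H) + jump True H" using bspec[OF c(3) H] unfolding tail_base[OF HP] head_base[OF HP] .
  next
    fix M assume "M \<lhd> FP.F" "gog_relators \<G> (\<Lambda>\<lparr>arcs := A\<rparr>) \<subseteq> M"
    then show "N \<subseteq> M" by (rule least)
  qed
  then show ?thesis by blast
qed

end

lemma (in splitting) decomposes: "decomposes_as (RB n \<Gamma> S) \<G>"
proof -
  have "verts \<Lambda> \<noteq> {}" using base_connected unfolding connected_conv by blast
  then obtain K0 where K0: "K0 \<in> verts \<Lambda>" by blast
  then obtain A where tree: "grown_tree \<Lambda> K0 (verts \<Lambda>) A"
    using grown_tree_exists[OF wf_base _ base_connected] base_finite unfolding verts_base by blast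
  have AP: "A \<subseteq> planes" using grown_tree_subset[OF tree wf_base] arcs_base by simp
  let ?N = "normal_closure FP.F (gog_relators \<G> (\<Lambda>\<lparr>arcs := A\<rparr>))"
  note closure = group.normal_closure[OF FP.group_F relators_carrier[OF AP]]
  interpret quotient_splitting \<Gamma> n k cuts v S sK sH \<G> ?N A
    by (intro quotient_splitting.intro splitting_axioms quotient_splitting_axioms.intro closure(1,2) AP)
  obtain c z where "potential_splitting \<Gamma> n k cuts v S sK sH \<G> ?N A c K0 z"
    using potential_exists[OF tree K0[unfolded verts_base] closure(3)] by blast
  then have "RB n \<Gamma> S \<cong> gog_fundamental_group \<G> (\<Lambda>\<lparr>arcs := A\<rparr>)"
    unfolding gog_fundamental_group_def gog_F by (rule potential_splitting.RB_iso_quotient)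
  then show ?thesis unfolding decomposes_as_def
    using is_graph_of_groups grown_tree_spanning[OF tree wf_base] by blast
qed

theorem theorem3p5:
  fixes \<Gamma> :: "('v, 'e) pre_digraph"
    and n m :: nat
    and e :: "nat \<Rightarrow> 'e"
    and v :: 'v
    and S :: "('v, 'e) gpoint set"
    and sK :: "('v, 'e) gpoint set set \<Rightarrow> ('v, 'e) gpoint set"
    and sH :: "('e \<times> 'v set) set \<Rightarrow> ('v, 'e) gpoint set"
  assumes "fin_digraph \<Gamma>" and "Digraph_Component.connected \<Gamma>"
    and "n \<ge> 2" and "m \<ge> 1"
    and "inj_on e {1..m}"
    and "\<And>i. i \<in> {1..m} \<Longrightarrow> e i \<in> arcs \<Gamma> \<and> v \<in> {tail \<Gamma> (e i), head \<Gamma> (e i)}"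
    and "S \<in> topspace (uconf_space n \<Gamma>)"
    and "\<And>K. K \<in> connected_components_of (uconf_space n (remove_open_edges \<Gamma> (e ` {1..m}))) \<Longrightarrow>
           sK K \<in> K"
    and "\<And>i H. i \<in> {1..m} \<Longrightarrow> H \<in> hyperplanes_labelled n \<Gamma> (e i) \<Longrightarrow>
           sH H \<in> comb_hyperplane_minus n \<Gamma> (e i) H \<union> comb_hyperplane_plus n \<Gamma> (e i) H \<and>
           sH H \<subseteq> range Vertex"
  shows "(\<exists>\<G>. hyperplane_splitting \<Gamma> n m e sK sH \<G>) \<and>
         (\<forall>\<G>. hyperplane_splitting \<Gamma> n m e sK sH \<G> \<longrightarrow> decomposes_as (RB n \<Gamma> S) \<G>)"
proof -
  interpret cutting \<Gamma> n "n - 1" "e ` {1..m}" v S sK sH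
  proof (rule cutting.intro)
    show "n = Suc (n - 1)" using assms(3) by simp
    show "f \<in> arcs \<Gamma> \<and> v \<in> {tail \<Gamma> f, head \<Gamma> f}" if "f \<in> e ` {1..m}" for f using that assms(6) by blast
    show "sH H \<in> comb_hyperplane_minus n \<Gamma> f H \<union> comb_hyperplane_plus n \<Gamma> f H \<and> sH H \<subseteq> range Vertex"
      if "f \<in> e ` {1..m}" "H \<in> hyperplanes_labelled n \<Gamma> f" for f H using that assms(9) by blast
  qed (rule assms; assumption)+
  have "decomposes_as (RB n \<Gamma> S) \<G>" if "hyperplane_splitting \<Gamma> n m e sK sH \<G>" for \<G>
  proof -
    have "splitting \<Gamma> n (n - 1) (e ` {1..m}) v S sK sH \<G>"
    proof (rule splitting.intro[OF cutting_axioms], rule splitting_axioms.intro)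
      note * = that[unfolded splitting_iff[OF refl] Let_def]
      show "verts (base_graph \<G>) = connected_components_of X0.X" "arcs (base_graph \<G>) = planes" using * by simp_all
      show "vertex_group \<G> K = RB n \<Gamma>' (sK K)" if "K \<in> connected_components_of X0.X" for K using * that by simp
      fix H assume "H \<in> planes"
      then show "tail (base_graph \<G>) H = side True H" "head (base_graph \<G>) H = side False H"
        "edge_group \<G> H = RB (n - 1) (\<Delta> (label H)) (Vertex ` rest H)" "incl True H (mono_minus \<G> H)" "incl False H (mono_plus \<G> H)"
        using * by blast+
    qed
    then show ?thesis by (rule splitting.decomposes)
  qed
  then show ?thesis using splitting_exists[OF refl] by blast
qed

end
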